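(* Let $K$ be a field, let $\mathcal{T}$ and $\mathcal{U}$ be small $K$-categories, let $M:\mathcal{U}\otimes_K\mathcal{T}^{op}\to\mathrm{Mod}(K)$ be a $K$-functor, and let $\Lambda=\left[\begin{smallmatrix}\mathcal{T}&0\\ M&\mathcal{U}\end{smallmatrix}\right]$ be the triangular matrix category. Let $\mathcal{I}$ be the kernel ideal of the functor $\Phi:\Lambda\to\mathcal{U}$. Then there is a long exact sequence $$0\to \mathrm{Hom}_{\mathrm{Mod}(\Lambda^{e})}(\Lambda,\mathcal{I})\to H^{0}(\Lambda)\to H^{0}(\mathcal{U})\to \mathrm{Ext}^{1}_{\mathrm{Mod}(\Lambda^{e})}(\Lambda,\mathcal{I})\to H^{1}(\Lambda)\to H^{1}(\mathcal{U})\to \mathrm{Ext}^{2}_{\mathrm{Mod}(\Lambda^{e})}(\Lambda,\mathcal{I})\to H^{2}(\Lambda)\to H^{2}(\mathcal{U})\to\cdots$$ relating the Hochschild-Mitchell cohomologies of $\Lambda$ and $\mathcal{U}$.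
   Context: A $K$-category is a category whose Hom-sets are $K$-vector spaces with $K$-bilinear composition. $\mathrm{Mod}(\mathcal{C})$ is the abelian category of covariant $K$-linear functors $\mathcal{C}\to\mathrm{Mod}(K)$ ($K$-vector spaces). The tensor product $\mathcal{C}\otimes_K\mathcal{D}$ has objects the pairs $(C,D)$ and morphism spaces $\mathcal{C}(C,C')\otimes_K\mathcal{D}(D,D')$. The enveloping category is $\mathcal{C}^{e}=\mathcal{C}^{op}\otimes_K\mathcal{C}$; the Hom bifunctor $\mathcal{C}(-,-)$ is regarded as an object $\mathcal{C}$ of $\mathrm{Mod}(\mathcal{C}^{e})$. The Hochschild-Mitchell cohomology is $H^{n}(\mathcal{C}):=\mathrm{Ext}^{n}_{\mathrm{Mod}(\mathcal{C}^{e})}(\mathcal{C},\mathcal{C})$. Triangular matrix category $\Lambda$: objects are symbols $\left[\begin{smallmatrix}T&0\\ M&U\end{smallmatrix}\right]$ with $T\in\mathcal{T}$, $U\in\mathcal{U}$ (i.e. pairs $(T,U)$). Morphisms from $\left[\begin{smallmatrix}T&0\\ M&U\end{smallmatrix}\right]$ to $\left[\begin{smallmatrix}T'&0\\ M&U'\end{smallmatrix}\right]$ are matrices $\left[\begin{smallmatrix}t&0\\ m&u\end{smallmatrix}\right]$ with $t\in\mathcal{T}(T,T')$, $m\in M(U',T)$, $u\in\mathcal{U}(U,U')$. Composition: $\left[\begin{smallmatrix}t_2&0\\ m_2&u_2\end{smallmatrix}\right]\circ\left[\begin{smallmatrix}t_1&0\\ m_1&u_1\end{smallmatrix}\right]=\left[\begin{smallmatrix}t_2t_1&0\\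 m_2\bullet t_1+u_2\bullet m_1&u_2u_1\end{smallmatrix}\right]$, where for $t_1\in\mathcal{T}(T,T')$, $m_2\in M(U'',T')$, $u_2\in\mathcal{U}(U',U'')$, $m_1\in M(U',T)$ one sets $m_2\bullet t_1=M(1_{U''}\otimes t_1^{op})(m_2)$ and $u_2\bullet m_1=M(u_2\otimes 1_T)(m_1)$. The functor $\Phi:\Lambda\to\mathcal{U}$ sends $\left[\begin{smallmatrix}T&0\\ M&U\end{smallmatrix}\right]$ to $U$ and $\left[\begin{smallmatrix}t&0\\ m&u\end{smallmatrix}\right]$ to $u$. Its kernel ideal $\mathcal{I}$ is the subfunctor of $\Lambda(-,-)$ (an object of $\mathrm{Mod}(\Lambda^e)$) with $\mathcal{I}\left(\left[\begin{smallmatrix}T'&0\\ M&U'\end{smallmatrix}\right],\left[\begin{smallmatrix}T&0\\ M&U\end{smallmatrix}\right]\right)=\left[\begin{smallmatrix}\mathcal{T}(T',T)&0\\ M(U,T')&0\end{smallmatrix}\right]$.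
   Formalization: The category T is assumed to have at least one object; if T is empty and U is the one-object category K, then Λ is empty, all its terms vanish, and the sequence would force H^0(U)=K to be zero. *)

theory Defs
  imports "HOL-Algebra.Module" "HOL-Algebra.AbelCoset"
begin

text \<open>
  Vector spaces over a field \<open>K\<close> are modules in the sense of HOL-Algebra over a ring record \<open>K\<close>
  with \<open>field K\<close>.  The fields \<open>mult\<close> and \<open>one\<close>, which the module record inherits from the ring
  record, carry no meaning for a module and are left undefined below.
\<close>

section \<open>Linear algebra\<close>

definition linear_map ::
    "'k ring \<Rightarrow> ('k, 'a) module \<Rightarrow> ('k, 'b) module \<Rightarrow> ('a \<Rightarrow> 'b) set" where
  "linear_map K V W =
     {f \<in> carrier V \<rightarrow> carrier W.
        (\<forall>x\<in>carrier V. \<forall>y\<in>carrier V. f (x \<oplus>\<^bsub>V\<^esub> y) = f x \<oplus>\<^bsub>W\<^esub> f y) \<and>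
        (\<forall>a\<in>carrier K. \<forall>x\<in>carrier V. f (a \<odot>\<^bsub>V\<^esub> x) = a \<odot>\<^bsub>W\<^esub> f x)}"

definition bilinear_map ::
    "'k ring \<Rightarrow> ('k, 'a) module \<Rightarrow> ('k, 'b) module \<Rightarrow> ('k, 'c) module \<Rightarrow> ('a \<Rightarrow> 'b \<Rightarrow> 'c) set" where
  "bilinear_map K V W Z =
     {\<beta>. (\<forall>x\<in>carrier V. \<beta> x \<in> linear_map K W Z) \<and>
         (\<forall>y\<in>carrier W. (\<lambda>x. \<beta> x y) \<in> linear_map K V Z)}"

definition exact_at ::
    "('k, 'a) module \<Rightarrow> ('a \<Rightarrow> 'b) \<Rightarrow> ('k, 'b) module \<Rightarrow> ('b \<Rightarrow> 'c) \<Rightarrow> ('k, 'c) module \<Rightarrow> bool" where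
  "exact_at V f W g Z \<longleftrightarrow> f ` carrier V = {y \<in> carrier W. g y = \<zero>\<^bsub>Z\<^esub>}"

definition quotient_module :: "('k, 'a) module \<Rightarrow> 'a set \<Rightarrow> ('k, 'a set) module" where
  "quotient_module V N =
     \<lparr>carrier = a_rcosets\<^bsub>V\<^esub> N, mult = undefined, one = undefined, zero = N, add = set_add V,
      smult = (\<lambda>a X. \<Union>x\<in>X. N +>\<^bsub>V\<^esub> (a \<odot>\<^bsub>V\<^esub> x))\<rparr>"

definition product3_module ::
    "('k, 'a) module \<Rightarrow> ('k, 'b) module \<Rightarrow> ('k, 'c) module \<Rightarrow> ('k, 'a \<times> 'b \<times> 'c) module" where
  "product3_module U V W =
     \<lparr>carrier = carrier U \<times> carrier V \<times> carrier W, mult = undefined, one = undefined,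
      zero = (\<zero>\<^bsub>U\<^esub>, \<zero>\<^bsub>V\<^esub>, \<zero>\<^bsub>W\<^esub>),
      add = (\<lambda>(x, y, z) (x', y', z'). (x \<oplus>\<^bsub>U\<^esub> x', y \<oplus>\<^bsub>V\<^esub> y', z \<oplus>\<^bsub>W\<^esub> z')),
      smult = (\<lambda>a (x, y, z). (a \<odot>\<^bsub>U\<^esub> x, a \<odot>\<^bsub>V\<^esub> y, a \<odot>\<^bsub>W\<^esub> z))\<rparr>"

subsection \<open>Tensor products\<close>

text \<open>
  The tensor product is the free module on \<open>carrier V \<times> carrier W\<close> (finitely supported
  \<open>K\<close>-valued functions) modulo the submodule generated by the bilinearity relations.
\<close>

definition free_module :: "'k ring \<Rightarrow> 'a set \<Rightarrow> ('k, 'a \<Rightarrow> 'k) module" where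
  "free_module K S =
     \<lparr>carrier = {f. (\<forall>p. f p \<in> carrier K) \<and> {p. f p \<noteq> \<zero>\<^bsub>K\<^esub>} \<subseteq> S \<and> finite {p. f p \<noteq> \<zero>\<^bsub>K\<^esub>}},
      mult = undefined, one = undefined, zero = (\<lambda>_. \<zero>\<^bsub>K\<^esub>),
      add = (\<lambda>f g p. f p \<oplus>\<^bsub>K\<^esub> g p), smult = (\<lambda>a f p. a \<otimes>\<^bsub>K\<^esub> f p)\<rparr>"

definition free_gen :: "'k ring \<Rightarrow> 'a \<Rightarrow> 'a \<Rightarrow> 'k" where
  "free_gen K p = (\<lambda>q. if q = p then \<one>\<^bsub>K\<^esub> else \<zero>\<^bsub>K\<^esub>)"

definition tensor_relators ::
    "'k ring \<Rightarrow> ('k, 'a) module \<Rightarrow> ('k, 'b) module \<Rightarrow> ('a \<times> 'b \<Rightarrow> 'k) set" where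
  "tensor_relators K V W =
     (let F = free_module K (carrier V \<times> carrier W); e = (\<lambda>x y. free_gen K (x, y)) in
       {e (x \<oplus>\<^bsub>V\<^esub> x') y \<ominus>\<^bsub>F\<^esub> (e x y \<oplus>\<^bsub>F\<^esub> e x' y) | x x' y.
          x \<in> carrier V \<and> x' \<in> carrier V \<and> y \<in> carrier W} \<union>
       {e x (y \<oplus>\<^bsub>W\<^esub> y') \<ominus>\<^bsub>F\<^esub> (e x y \<oplus>\<^bsub>F\<^esub> e x y') | x y y'.
          x \<in> carrier V \<and> y \<in> carrier W \<and> y' \<in> carrier W} \<union>
       {e (a \<odot>\<^bsub>V\<^esub> x) y \<ominus>\<^bsub>F\<^esub> (a \<odot>\<^bsub>F\<^esub> e x y) | a x y.
          a \<in> carrier K \<and> x \<in> carrier V \<and> y \<in> carrier W} \<union>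
       {e x (a \<odot>\<^bsub>W\<^esub> y) \<ominus>\<^bsub>F\<^esub> (a \<odot>\<^bsub>F\<^esub> e x y) | a x y.
          a \<in> carrier K \<and> x \<in> carrier V \<and> y \<in> carrier W})"

definition tensor_kernel ::
    "'k ring \<Rightarrow> ('k, 'a) module \<Rightarrow> ('k, 'b) module \<Rightarrow> ('a \<times> 'b \<Rightarrow> 'k) set" where
  "tensor_kernel K V W =
     \<Inter>{N. submodule N K (free_module K (carrier V \<times> carrier W)) \<and> tensor_relators K V W \<subseteq> N}"

definition tensor ::
    "'k ring \<Rightarrow> ('k, 'a) module \<Rightarrow> ('k, 'b) module \<Rightarrow> ('k, ('a \<times> 'b \<Rightarrow> 'k) set) module" where
  "tensor K V W =
     quotient_module (free_module K (carrier V \<times> carrier W)) (tensor_kernel K V W)"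

definition pure_tensor ::
    "'k ring \<Rightarrow> ('k, 'a) module \<Rightarrow> ('k, 'b) module \<Rightarrow> 'a \<Rightarrow> 'b \<Rightarrow> ('a \<times> 'b \<Rightarrow> 'k) set" where
  "pure_tensor K V W x y =
     tensor_kernel K V W +>\<^bsub>free_module K (carrier V \<times> carrier W)\<^esub> free_gen K (x, y)"

text \<open>
  The linear map \<open>V \<otimes> W \<rightarrow> Z\<close> induced by a bilinear map \<open>\<beta>\<close>.  All representatives of the coset \<open>X\<close>
  have the same value, so the image is a singleton.
\<close>

definition tensor_lift ::
    "'k ring \<Rightarrow> ('k, 'c) module \<Rightarrow> ('a \<Rightarrow> 'b \<Rightarrow> 'c) \<Rightarrow> ('a \<times> 'b \<Rightarrow> 'k) set \<Rightarrow> 'c" where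
  "tensor_lift K Z \<beta> X =
     the_elem ((\<lambda>f. finsum Z (\<lambda>p. f p \<odot>\<^bsub>Z\<^esub> \<beta> (fst p) (snd p)) {p. f p \<noteq> \<zero>\<^bsub>K\<^esub>}) ` X)"

section \<open>\<open>K\<close>-categories\<close>

text \<open>
  \<open>Comp C a b c g f\<close> is \<open>g \<circ> f\<close> for \<open>f : a \<rightarrow> b\<close> and \<open>g : b \<rightarrow> c\<close>.  The objects are passed
  explicitly, since Hom-sets of different pairs of objects may overlap.
\<close>

record ('k, 'o, 'm) kcat =
  Obj :: "'o set"
  Hom :: "'o \<Rightarrow> 'o \<Rightarrow> ('k, 'm) module"
  Comp :: "'o \<Rightarrow> 'o \<Rightarrow> 'o \<Rightarrow> 'm \<Rightarrow> 'm \<Rightarrow> 'm"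
  Id :: "'o \<Rightarrow> 'm"

definition k_category :: "'k ring \<Rightarrow> ('k, 'o, 'm) kcat \<Rightarrow> bool" where
  "k_category K C \<longleftrightarrow>
     (\<forall>a\<in>Obj C. \<forall>b\<in>Obj C. module K (Hom C a b)) \<and>
     (\<forall>a\<in>Obj C. \<forall>b\<in>Obj C. \<forall>c\<in>Obj C.
        Comp C a b c \<in> bilinear_map K (Hom C b c) (Hom C a b) (Hom C a c)) \<and>
     (\<forall>a\<in>Obj C. \<forall>b\<in>Obj C. \<forall>c\<in>Obj C. \<forall>d\<in>Obj C.
        \<forall>f\<in>carrier (Hom C a b). \<forall>g\<in>carrier (Hom C b c). \<forall>h\<in>carrier (Hom C c d).
        Comp C a b d (Comp C b c d h g) f = Comp C a c d h (Comp C a b c g f)) \<and>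
     (\<forall>a\<in>Obj C. Id C a \<in> carrier (Hom C a a)) \<and>
     (\<forall>a\<in>Obj C. \<forall>b\<in>Obj C. \<forall>f\<in>carrier (Hom C a b).
        Comp C a a b f (Id C a) = f \<and> Comp C a b b (Id C b) f = f)"

definition op_cat :: "('k, 'o, 'm) kcat \<Rightarrow> ('k, 'o, 'm) kcat" where
  "op_cat C =
     \<lparr>Obj = Obj C, Hom = (\<lambda>a b. Hom C b a), Comp = (\<lambda>a b c g f. Comp C c b a f g), Id = Id C\<rparr>"

definition tensor_cat :: "'k ring \<Rightarrow> ('k, 'o, 'm) kcat \<Rightarrow> ('k, 'p, 'n) kcat \<Rightarrow>
    ('k, 'o \<times> 'p, ('m \<times> 'n \<Rightarrow> 'k) set) kcat" where
  "tensor_cat K C D =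
     \<lparr>Obj = Obj C \<times> Obj D,
      Hom = (\<lambda>(c, d) (c', d'). tensor K (Hom C c c') (Hom D d d')),
      Comp = (\<lambda>(c, d) (c', d') (c'', d'') Y X.
        let Z = tensor K (Hom C c c'') (Hom D d d'') in
        tensor_lift K Z (\<lambda>f' g'.
          tensor_lift K Z (\<lambda>f g.
            pure_tensor K (Hom C c c'') (Hom D d d'') (Comp C c c' c'' f' f) (Comp D d d' d'' g' g))
          X) Y),
      Id = (\<lambda>(c, d). pure_tensor K (Hom C c c) (Hom D d d) (Id C c) (Id D d))\<rparr>"

definition env_cat ::
    "'k ring \<Rightarrow> ('k, 'o, 'm) kcat \<Rightarrow> ('k, 'o \<times> 'o, ('m \<times> 'm \<Rightarrow> 'k) set) kcat" where
  "env_cat K C = tensor_cat K (op_cat C) C"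

section \<open>\<open>Mod(C)\<close>\<close>

text \<open>\<open>Act F a b f\<close> is the map \<open>F(f) : F(a) \<rightarrow> F(b)\<close> for \<open>f : a \<rightarrow> b\<close>.\<close>

record ('k, 'o, 'm, 'v) kfun =
  Val :: "'o \<Rightarrow> ('k, 'v) module"
  Act :: "'o \<Rightarrow> 'o \<Rightarrow> 'm \<Rightarrow> 'v \<Rightarrow> 'v"

definition k_functor :: "'k ring \<Rightarrow> ('k, 'o, 'm) kcat \<Rightarrow> ('k, 'o, 'm, 'v) kfun \<Rightarrow> bool" where
  "k_functor K C F \<longleftrightarrow>
     (\<forall>a\<in>Obj C. module K (Val F a)) \<and>
     (\<forall>a\<in>Obj C. \<forall>b\<in>Obj C. Act F a b \<in> bilinear_map K (Hom C a b) (Val F a) (Val F b)) \<and>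
     (\<forall>a\<in>Obj C. \<forall>x\<in>carrier (Val F a). Act F a a (Id C a) x = x) \<and>
     (\<forall>a\<in>Obj C. \<forall>b\<in>Obj C. \<forall>c\<in>Obj C.
        \<forall>f\<in>carrier (Hom C a b). \<forall>g\<in>carrier (Hom C b c). \<forall>x\<in>carrier (Val F a).
        Act F a c (Comp C a b c g f) x = Act F b c g (Act F a b f x))"

text \<open>
  Natural transformations are extensional (\<open>undefined\<close> outside the objects and carriers), so that
  they are equal as soon as their components agree as maps.
\<close>

definition nat_trans :: "'k ring \<Rightarrow> ('k, 'o, 'm) kcat \<Rightarrow> ('k, 'o, 'm, 'v) kfun \<Rightarrow>
    ('k, 'o, 'm, 'w) kfun \<Rightarrow> ('o \<Rightarrow> 'v \<Rightarrow> 'w) set" where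
  "nat_trans K C F G =
     {\<eta> \<in> (\<Pi>\<^sub>E a\<in>Obj C. linear_map K (Val F a) (Val G a) \<inter> extensional (carrier (Val F a))).
        \<forall>a\<in>Obj C. \<forall>b\<in>Obj C. \<forall>f\<in>carrier (Hom C a b). \<forall>x\<in>carrier (Val F a).
          \<eta> b (Act F a b f x) = Act G a b f (\<eta> a x)}"

definition nat_comp :: "('k, 'o, 'm) kcat \<Rightarrow> ('k, 'o, 'm, 'v) kfun \<Rightarrow>
    ('o \<Rightarrow> 'w \<Rightarrow> 'z) \<Rightarrow> ('o \<Rightarrow> 'v \<Rightarrow> 'w) \<Rightarrow> 'o \<Rightarrow> 'v \<Rightarrow> 'z" where
  "nat_comp C F \<theta> \<eta> = (\<lambda>a\<in>Obj C. \<lambda>x\<in>carrier (Val F a). \<theta> a (\<eta> a x))"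

definition nat_space :: "'k ring \<Rightarrow> ('k, 'o, 'm) kcat \<Rightarrow> ('k, 'o, 'm, 'v) kfun \<Rightarrow>
    ('k, 'o, 'm, 'w) kfun \<Rightarrow> ('k, 'o \<Rightarrow> 'v \<Rightarrow> 'w) module" where
  "nat_space K C F G =
     \<lparr>carrier = nat_trans K C F G, mult = undefined, one = undefined,
      zero = (\<lambda>a\<in>Obj C. \<lambda>x\<in>carrier (Val F a). \<zero>\<^bsub>Val G a\<^esub>),
      add = (\<lambda>\<eta> \<theta>. \<lambda>a\<in>Obj C. \<lambda>x\<in>carrier (Val F a). \<eta> a x \<oplus>\<^bsub>Val G a\<^esub> \<theta> a x),
      smult = (\<lambda>r \<eta>. \<lambda>a\<in>Obj C. \<lambda>x\<in>carrier (Val F a). r \<odot>\<^bsub>Val G a\<^esub> \<eta> a x)\<rparr>"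

section \<open>Ext\<close>

text \<open>Epimorphisms and exactness in \<open>Mod(C)\<close> are tested objectwise.\<close>

definition objectwise_surj :: "('k, 'o, 'm) kcat \<Rightarrow> ('k, 'o, 'm, 'v) kfun \<Rightarrow>
    ('k, 'o, 'm, 'w) kfun \<Rightarrow> ('o \<Rightarrow> 'v \<Rightarrow> 'w) \<Rightarrow> bool" where
  "objectwise_surj C F G \<eta> \<longleftrightarrow> (\<forall>a\<in>Obj C. \<eta> a ` carrier (Val F a) = carrier (Val G a))"

text \<open>
  The functors \<open>E\<close>, \<open>B\<close> range over all \<open>K\<close>-functors whose values have underlying sets in the same
  type \<open>'v\<close> as those of \<open>P\<close>.
\<close>

definition projective ::
    "'k ring \<Rightarrow> ('k, 'o, 'm) kcat \<Rightarrow> ('k, 'o, 'm, 'v) kfun \<Rightarrow> bool" where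
  "projective K C P \<longleftrightarrow> k_functor K C P \<and>
     (\<forall>(E :: ('k, 'o, 'm, 'v) kfun) (B :: ('k, 'o, 'm, 'v) kfun).
        k_functor K C E \<longrightarrow> k_functor K C B \<longrightarrow>
        (\<forall>\<pi>\<in>nat_trans K C E B. \<forall>\<phi>\<in>nat_trans K C P B.
           objectwise_surj C E B \<pi> \<longrightarrow> (\<exists>\<psi>\<in>nat_trans K C P E. nat_comp C P \<pi> \<psi> = \<phi>)))"

text \<open>The exact complex \<open>\<dots> \<rightarrow> P 2 \<rightarrow> P 1 \<rightarrow> P 0 \<rightarrow> F \<rightarrow> 0\<close> with \<open>d n : P (n + 1) \<rightarrow> P n\<close>.\<close>

definition proj_resolution :: "'k ring \<Rightarrow> ('k, 'o, 'm) kcat \<Rightarrow> ('k, 'o, 'm, 'w) kfun \<Rightarrow>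
    (nat \<Rightarrow> ('k, 'o, 'm, 'v) kfun) \<Rightarrow> (nat \<Rightarrow> 'o \<Rightarrow> 'v \<Rightarrow> 'v) \<Rightarrow> ('o \<Rightarrow> 'v \<Rightarrow> 'w) \<Rightarrow> bool" where
  "proj_resolution K C F P d \<epsilon> \<longleftrightarrow>
     (\<forall>n. projective K C (P n)) \<and>
     (\<forall>n. d n \<in> nat_trans K C (P (Suc n)) (P n)) \<and>
     \<epsilon> \<in> nat_trans K C (P 0) F \<and>
     objectwise_surj C (P 0) F \<epsilon> \<and>
     (\<forall>a\<in>Obj C. exact_at (Val (P 1) a) (d 0 a) (Val (P 0) a) (\<epsilon> a) (Val F a)) \<and>
     (\<forall>n. \<forall>a\<in>Obj C.
        exact_at (Val (P (Suc (Suc n))) a) (d (Suc n) a) (Val (P (Suc n)) a) (d n a) (Val (P n) a))"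

text \<open>Cohomology of the complex \<open>Hom(P 0, G) \<rightarrow> Hom(P 1, G) \<rightarrow> Hom(P 2, G) \<rightarrow> \<dots>\<close>.\<close>

definition cocycles :: "'k ring \<Rightarrow> ('k, 'o, 'm) kcat \<Rightarrow> (nat \<Rightarrow> ('k, 'o, 'm, 'v) kfun) \<Rightarrow>
    (nat \<Rightarrow> 'o \<Rightarrow> 'v \<Rightarrow> 'v) \<Rightarrow> ('k, 'o, 'm, 'z) kfun \<Rightarrow> nat \<Rightarrow> ('o \<Rightarrow> 'v \<Rightarrow> 'z) set" where
  "cocycles K C P d G n =
     {\<eta> \<in> nat_trans K C (P n) G.
        nat_comp C (P (Suc n)) \<eta> (d n) = \<zero>\<^bsub>nat_space K C (P (Suc n)) G\<^esub>}"

fun coboundaries :: "'k ring \<Rightarrow> ('k, 'o, 'm) kcat \<Rightarrow> (nat \<Rightarrow> ('k, 'o, 'm, 'v) kfun) \<Rightarrow>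
    (nat \<Rightarrow> 'o \<Rightarrow> 'v \<Rightarrow> 'v) \<Rightarrow> ('k, 'o, 'm, 'z) kfun \<Rightarrow> nat \<Rightarrow> ('o \<Rightarrow> 'v \<Rightarrow> 'z) set" where
  "coboundaries K C P d G 0 = {\<zero>\<^bsub>nat_space K C (P 0) G\<^esub>}"
| "coboundaries K C P d G (Suc n) =
     (\<lambda>\<eta>. nat_comp C (P (Suc n)) \<eta> (d n)) ` nat_trans K C (P n) G"

definition hom_cohomology :: "'k ring \<Rightarrow> ('k, 'o, 'm) kcat \<Rightarrow> (nat \<Rightarrow> ('k, 'o, 'm, 'v) kfun) \<Rightarrow>
    (nat \<Rightarrow> 'o \<Rightarrow> 'v \<Rightarrow> 'v) \<Rightarrow> ('k, 'o, 'm, 'z) kfun \<Rightarrow> nat \<Rightarrow>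
    ('k, ('o \<Rightarrow> 'v \<Rightarrow> 'z) set) module" where
  "hom_cohomology K C P d G n =
     quotient_module ((nat_space K C (P n) G)\<lparr>carrier := cocycles K C P d G n\<rparr>)
       (coboundaries K C P d G n)"

text \<open>
  \<open>Ext\<close> is computed from a chosen projective resolution of \<open>F\<close>.  HOL has no type of all vector
  spaces, so the resolution lives in a fixed type \<open>univ\<close>.  This type is infinite and at least as
  large as the types of objects and morphisms of \<open>C\<close>, of scalars and of elements of the values
  of \<open>F\<close>.  Hence, up to isomorphism, it contains the values of the free cover of \<open>F\<close> (the
  coproduct of representables indexed by the elements of \<open>F\<close>) and, iterating, a free resolution
  of \<open>F\<close>, and also the free cover of every functor with values in \<open>univ\<close>.  So a resolution
  exists, and a functor that is projective relative to \<open>univ\<close> is a retract of a coproduct of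
  representables, hence projective with respect to functors of arbitrary size.
\<close>

type_synonym ('k, 'o, 'm, 'w) univ = "('k + 'o + 'm + 'w) list"

definition chosen_resolution :: "'k ring \<Rightarrow> ('k, 'o, 'm) kcat \<Rightarrow> ('k, 'o, 'm, 'w) kfun \<Rightarrow>
    (nat \<Rightarrow> ('k, 'o, 'm, ('k, 'o, 'm, 'w) univ) kfun) \<times>
    (nat \<Rightarrow> 'o \<Rightarrow> ('k, 'o, 'm, 'w) univ \<Rightarrow> ('k, 'o, 'm, 'w) univ)" where
  "chosen_resolution K C F = (SOME (P, d). \<exists>\<epsilon>. proj_resolution K C F P d \<epsilon>)"

definition Ext :: "'k ring \<Rightarrow> ('k, 'o, 'm) kcat \<Rightarrow> nat \<Rightarrow> ('k, 'o, 'm, 'w) kfun \<Rightarrow>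
    ('k, 'o, 'm, 'z) kfun \<Rightarrow> ('k, ('o \<Rightarrow> ('k, 'o, 'm, 'w) univ \<Rightarrow> 'z) set) module" where
  "Ext K C n F G = (case chosen_resolution K C F of (P, d) \<Rightarrow> hom_cohomology K C P d G n)"

section \<open>Hochschild-Mitchell cohomology\<close>

text \<open>
  The bifunctor \<open>C(-,-)\<close> as an object of \<open>Mod(C\<^sup>e)\<close>: for \<open>f : A' \<rightarrow> A\<close> and \<open>g : B \<rightarrow> B'\<close> in \<open>C\<close>,
  \<open>f\<^sup>o\<^sup>p \<otimes> g\<close> sends \<open>h : A \<rightarrow> B\<close> to \<open>g \<circ> h \<circ> f : A' \<rightarrow> B'\<close>.
\<close>

definition hom_bimodule ::
    "'k ring \<Rightarrow> ('k, 'o, 'm) kcat \<Rightarrow> ('k, 'o \<times> 'o, ('m \<times> 'm \<Rightarrow> 'k) set, 'm) kfun" where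
  "hom_bimodule K C =
     \<lparr>Val = (\<lambda>(A, B). Hom C A B),
      Act = (\<lambda>(A, B) (A', B') X h.
        tensor_lift K (Hom C A' B') (\<lambda>f g. Comp C A' B B' g (Comp C A' A B h f)) X)\<rparr>"

definition HM_cohomology :: "'k ring \<Rightarrow> nat \<Rightarrow> ('k, 'o, 'm) kcat \<Rightarrow>
    ('k, ('o \<times> 'o \<Rightarrow> ('k, 'o \<times> 'o, ('m \<times> 'm \<Rightarrow> 'k) set, 'm) univ \<Rightarrow> 'm) set) module" where
  "HM_cohomology K n C = Ext K (env_cat K C) n (hom_bimodule K C) (hom_bimodule K C)"

section \<open>The triangular matrix category\<close>

text \<open>
  The matrix with rows \<open>(t, 0)\<close> and \<open>(m, u)\<close> is the triple \<open>(t, m, u)\<close>; the object with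
  diagonal \<open>T\<close>, \<open>U\<close> is the pair \<open>(T, U)\<close>.
\<close>

definition right_act :: "'k ring \<Rightarrow> ('k, 'a, 'b) kcat \<Rightarrow> ('k, 'c, 'd) kcat \<Rightarrow>
    ('k, 'c \<times> 'a, ('d \<times> 'b \<Rightarrow> 'k) set, 'e) kfun \<Rightarrow> 'c \<Rightarrow> 'a \<Rightarrow> 'a \<Rightarrow> 'e \<Rightarrow> 'b \<Rightarrow> 'e" where
  \<comment> \<open>\<open>m \<bullet> t\<close> for \<open>m \<in> M(U, T')\<close> and \<open>t : T \<rightarrow> T'\<close>\<close>
  "right_act K \<T> \<U> M U T T' m t =
     Act M (U, T') (U, T) (pure_tensor K (Hom \<U> U U) (Hom (op_cat \<T>) T' T) (Id \<U> U) t) m"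

definition left_act :: "'k ring \<Rightarrow> ('k, 'a, 'b) kcat \<Rightarrow> ('k, 'c, 'd) kcat \<Rightarrow>
    ('k, 'c \<times> 'a, ('d \<times> 'b \<Rightarrow> 'k) set, 'e) kfun \<Rightarrow> 'c \<Rightarrow> 'c \<Rightarrow> 'a \<Rightarrow> 'd \<Rightarrow> 'e \<Rightarrow> 'e" where
  \<comment> \<open>\<open>u \<bullet> m\<close> for \<open>m \<in> M(U, T)\<close> and \<open>u : U \<rightarrow> U'\<close>\<close>
  "left_act K \<T> \<U> M U U' T u m =
     Act M (U, T) (U', T) (pure_tensor K (Hom \<U> U U') (Hom (op_cat \<T>) T T) u (Id \<T> T)) m"

definition tri_cat :: "'k ring \<Rightarrow> ('k, 'a, 'b) kcat \<Rightarrow> ('k, 'c, 'd) kcat \<Rightarrow>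
    ('k, 'c \<times> 'a, ('d \<times> 'b \<Rightarrow> 'k) set, 'e) kfun \<Rightarrow> ('k, 'a \<times> 'c, 'b \<times> 'e \<times> 'd) kcat" where
  "tri_cat K \<T> \<U> M =
     \<lparr>Obj = Obj \<T> \<times> Obj \<U>,
      Hom = (\<lambda>(T, U) (T', U'). product3_module (Hom \<T> T T') (Val M (U', T)) (Hom \<U> U U')),
      Comp = (\<lambda>(T, U) (T', U') (T'', U'') (t2, m2, u2) (t1, m1, u1).
        (Comp \<T> T T' T'' t2 t1,
         right_act K \<T> \<U> M U'' T T' m2 t1 \<oplus>\<^bsub>Val M (U'', T)\<^esub> left_act K \<T> \<U> M U' U'' T u2 m1,
         Comp \<U> U U' U'' u2 u1)),
      Id = (\<lambda>(T, U). (Id \<T> T, \<zero>\<^bsub>Val M (U, T)\<^esub>, Id \<U> U))\<rparr>"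

text \<open>
  The kernel ideal of a \<open>K\<close>-functor \<open>C \<rightarrow> D\<close> with object map \<open>\<Phi>o\<close> and morphism map \<open>\<Phi>m\<close>, as a
  subfunctor of \<open>C(-,-)\<close>.
\<close>

definition kernel_ideal :: "'k ring \<Rightarrow> ('k, 'o, 'm) kcat \<Rightarrow> ('k, 'p, 'n) kcat \<Rightarrow>
    ('o \<Rightarrow> 'p) \<Rightarrow> ('o \<Rightarrow> 'o \<Rightarrow> 'm \<Rightarrow> 'n) \<Rightarrow>
    ('k, 'o \<times> 'o, ('m \<times> 'm \<Rightarrow> 'k) set, 'm) kfun" where
  "kernel_ideal K C D \<Phi>o \<Phi>m =
     \<lparr>Val = (\<lambda>(A, B). (Hom C A B)
        \<lparr>carrier := {f \<in> carrier (Hom C A B). \<Phi>m A B f = \<zero>\<^bsub>Hom D (\<Phi>o A) (\<Phi>o B)\<^esub>}\<rparr>),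
      Act = Act (hom_bimodule K C)\<rparr>"

definition tri_proj_obj :: "'a \<times> 'c \<Rightarrow> 'c" where
  "tri_proj_obj = (\<lambda>(T, U). U)"

definition tri_proj_mor :: "'a \<times> 'c \<Rightarrow> 'a \<times> 'c \<Rightarrow> 'b \<times> 'e \<times> 'd \<Rightarrow> 'd" where
  "tri_proj_mor X Y = (\<lambda>(t, m, u). u)"

definition tri_ideal :: "'k ring \<Rightarrow> ('k, 'a, 'b) kcat \<Rightarrow> ('k, 'c, 'd) kcat \<Rightarrow>
    ('k, 'c \<times> 'a, ('d \<times> 'b \<Rightarrow> 'k) set, 'e) kfun \<Rightarrow>
    ('k, ('a \<times> 'c) \<times> ('a \<times> 'c), (('b \<times> 'e \<times> 'd) \<times> ('b \<times> 'e \<times> 'd) \<Rightarrow> 'k) set,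
     'b \<times> 'e \<times> 'd) kfun" where
  "tri_ideal K \<T> \<U> M = kernel_ideal K (tri_cat K \<T> \<U> M) \<U> tri_proj_obj tri_proj_mor"

lemma tri_ideal_carrier:
  assumes "module K (Hom \<U> U' U)"
  shows "carrier (Val (tri_ideal K \<T> \<U> M) ((T', U'), (T, U))) =
    carrier (Hom \<T> T' T) \<times> carrier (Val M (U, T')) \<times> {\<zero>\<^bsub>Hom \<U> U' U\<^esub>}"
proof -
  interpret module K "Hom \<U> U' U" by fact
  show ?thesis
    by (auto simp: tri_ideal_def kernel_ideal_def tri_cat_def product3_module_def
        tri_proj_obj_def tri_proj_mor_def)
qed

end

theory Submission
  imports Defs
begin

text \<open>
  Write \<open>R\<close> for restriction along \<open>\<Lambda>\<^sup>e \<rightarrow> \<U>\<^sup>e\<close>.  The sequence \<open>0 \<rightarrow> \<I> \<rightarrow> \<Lambda> \<rightarrow> R \<U> \<rightarrow> 0\<close> in \<open>Mod(\<Lambda>\<^sup>e)\<close>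
  gives a long exact sequence of \<open>Ext(\<Lambda>, -)\<close>, so the point is that \<open>Ext\<^sup>n(\<Lambda>, R \<U>)\<close> is \<open>H\<^sup>n(\<U>)\<close>.

  Fix an object of \<open>\<T>\<close> and let \<open>e\<close> be the idempotent with diagonal \<open>(0, 1)\<close>.  Since
  \<open>\<Lambda>e = e\<Lambda>e = \<U>\<close>, restriction in the contravariant variable has the exact left adjoint \<open>X \<mapsto> Xe\<close>,
  and restriction in the covariant variable has the exact right adjoint \<open>X \<mapsto> eX\<close>.  For projective
  resolutions \<open>P\<close> of \<open>\<Lambda>\<close> over \<open>\<Lambda>\<^sup>e\<close> and \<open>Q\<close> of \<open>\<U>\<close> over \<open>\<U>\<^sup>e\<close>, both \<open>Pe\<close> and the restriction
  \<open>Q'\<close> of \<open>Q\<close> are therefore projective resolutions of \<open>\<Lambda>e\<close> over \<open>\<U>\<^sup>o\<^sup>p \<otimes> \<Lambda>\<close>, hence homotopy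
  equivalent, and \<open>Hom(P, R \<U>) = Hom(Pe, \<Lambda>e) \<simeq> Hom(Q', \<Lambda>e) = Hom(Q, \<U>)\<close>.

  A functor that is projective relative to the type \<open>univ\<close> is a retract of its free cover, because
  the free cover can be encoded in \<open>univ\<close>; being such a retract gives the lifting property for
  values in arbitrary types, which the comparison of resolutions needs.
\<close>

section \<open>Linear algebra\<close>

text \<open>Two features of \<Lambda> shape the argument. \<T> need not have a zero object, so the
  section of \<Phi> cannot be a functor: it sends an identity of \<U> to the idempotent. The
  adjoints are therefore built from the action of idempotents on values instead of from restriction
  along a functor. Moreover the corner is one-sided: right multiplication by the idempotent kills
  both \<open>t\<close> and \<open>m\<close>, left multiplication kills only \<open>t\<close>. The
  two adjunctions thus point in opposite directions and do not compose to a single one, which forces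
  the stop at the category that is contravariant in \<U> and covariant in \<Lambda>. The object of
  \<T> is just a place for the idempotent to live. Some object must exist, however: for empty \<T>
  the category \<Lambda> is empty and all terms formed over it vanish, while the degree 0 cohomology
  of \<U> can be nonzero, as for the one-object category with endomorphisms
  \<open>K\<close>.\<close>

lemma linear_mapI:
  assumes "\<And>x. x \<in> carrier V \<Longrightarrow> f x \<in> carrier W"
    and "\<And>x y. x \<in> carrier V \<Longrightarrow> y \<in> carrier V \<Longrightarrow> f (x \<oplus>\<^bsub>V\<^esub> y) = f x \<oplus>\<^bsub>W\<^esub> f y"
    and "\<And>a x. a \<in> carrier K \<Longrightarrow> x \<in> carrier V \<Longrightarrow> f (a \<odot>\<^bsub>V\<^esub> x) = a \<odot>\<^bsub>W\<^esub> f x"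
  shows "f \<in> linear_map K V W"
  using assms by (auto simp: linear_map_def)

lemma linear_map_closed: "f \<in> linear_map K V W \<Longrightarrow> x \<in> carrier V \<Longrightarrow> f x \<in> carrier W"
  by (auto simp: linear_map_def)

lemma linear_map_add:
  "f \<in> linear_map K V W \<Longrightarrow> x \<in> carrier V \<Longrightarrow> y \<in> carrier V \<Longrightarrow> f (x \<oplus>\<^bsub>V\<^esub> y) = f x \<oplus>\<^bsub>W\<^esub> f y"
  by (auto simp: linear_map_def)

lemma linear_map_smult:
  "f \<in> linear_map K V W \<Longrightarrow> a \<in> carrier K \<Longrightarrow> x \<in> carrier V \<Longrightarrow> f (a \<odot>\<^bsub>V\<^esub> x) = a \<odot>\<^bsub>W\<^esub> f x"
  by (auto simp: linear_map_def)

lemma bilinear_mapI: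
  assumes "\<And>x. x \<in> carrier V \<Longrightarrow> \<beta> x \<in> linear_map K W Z"
    and "\<And>y. y \<in> carrier W \<Longrightarrow> (\<lambda>x. \<beta> x y) \<in> linear_map K V Z"
  shows "\<beta> \<in> bilinear_map K V W Z"
  using assms by (auto simp: bilinear_map_def)

lemma bilinear_mapD1: "\<beta> \<in> bilinear_map K V W Z \<Longrightarrow> x \<in> carrier V \<Longrightarrow> \<beta> x \<in> linear_map K W Z"
  and bilinear_mapD2: "\<beta> \<in> bilinear_map K V W Z \<Longrightarrow> y \<in> carrier W \<Longrightarrow> (\<lambda>x. \<beta> x y) \<in> linear_map K V Z"
  by (auto simp: bilinear_map_def)

lemma bilinear_map_closed:
  "\<beta> \<in> bilinear_map K V W Z \<Longrightarrow> x \<in> carrier V \<Longrightarrow> y \<in> carrier W \<Longrightarrow> \<beta> x y \<in> carrier Z"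
  using bilinear_mapD1 linear_map_closed by metis

section \<open>Subspaces and module axioms\<close>

text \<open>Closure under negation follows from scaling by \<open>-1\<close>, so kernels, images and
  coboundaries need only the evident checks. The tensor kernel is phrased with
  \<open>submodule\<close>; \<open>submodule_iff_subspace\<close> connects the two.\<close>

definition subspace :: "'k ring \<Rightarrow> ('k, 'a) module \<Rightarrow> 'a set \<Rightarrow> bool" where
  "subspace K V N \<longleftrightarrow> N \<subseteq> carrier V \<and> \<zero>\<^bsub>V\<^esub> \<in> N \<and>
     (\<forall>x\<in>N. \<forall>y\<in>N. x \<oplus>\<^bsub>V\<^esub> y \<in> N) \<and> (\<forall>a\<in>carrier K. \<forall>x\<in>N. a \<odot>\<^bsub>V\<^esub> x \<in> N)"

lemma subspaceI:
  assumes "N \<subseteq> carrier V" "\<zero>\<^bsub>V\<^esub> \<in> N" "\<And>x y. x \<in> N \<Longrightarrow> y \<in> N \<Longrightarrow> x \<oplus>\<^bsub>V\<^esub> y \<in> N"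
    "\<And>a x. a \<in> carrier K \<Longrightarrow> x \<in> N \<Longrightarrow> a \<odot>\<^bsub>V\<^esub> x \<in> N"
  shows "subspace K V N"
  using assms by (auto simp: subspace_def)

locale ground =
  fixes K :: "'k ring"
  assumes cring_K: "cring K"
begin

sublocale K: cring K by (rule cring_K)

lemma add_closed: "module K V \<Longrightarrow> x \<in> carrier V \<Longrightarrow> y \<in> carrier V \<Longrightarrow> x \<oplus>\<^bsub>V\<^esub> y \<in> carrier V"
  and zero_closed: "module K V \<Longrightarrow> \<zero>\<^bsub>V\<^esub> \<in> carrier V"
  and neg_closed: "module K V \<Longrightarrow> x \<in> carrier V \<Longrightarrow> \<ominus>\<^bsub>V\<^esub> x \<in> carrier V"
  and minus_closed: "module K V \<Longrightarrow> x \<in> carrier V \<Longrightarrow> y \<in> carrier V \<Longrightarrow> x \<ominus>\<^bsub>V\<^esub> y \<in> carrier V"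
  and smult_closed: "module K V \<Longrightarrow> a \<in> carrier K \<Longrightarrow> x \<in> carrier V \<Longrightarrow> a \<odot>\<^bsub>V\<^esub> x \<in> carrier V"
  and add_zero: "module K V \<Longrightarrow> x \<in> carrier V \<Longrightarrow> x \<oplus>\<^bsub>V\<^esub> \<zero>\<^bsub>V\<^esub> = x"
  and zero_add: "module K V \<Longrightarrow> x \<in> carrier V \<Longrightarrow> \<zero>\<^bsub>V\<^esub> \<oplus>\<^bsub>V\<^esub> x = x"
  and smult_zero: "module K V \<Longrightarrow> a \<in> carrier K \<Longrightarrow> a \<odot>\<^bsub>V\<^esub> \<zero>\<^bsub>V\<^esub> = \<zero>\<^bsub>V\<^esub>"
  and zero_smult: "module K V \<Longrightarrow> x \<in> carrier V \<Longrightarrow> \<zero>\<^bsub>K\<^esub> \<odot>\<^bsub>V\<^esub> x = \<zero>\<^bsub>V\<^esub>"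
  and one_smult: "module K V \<Longrightarrow> x \<in> carrier V \<Longrightarrow> \<one>\<^bsub>K\<^esub> \<odot>\<^bsub>V\<^esub> x = x"
  and neg_eq_smult: "module K V \<Longrightarrow> x \<in> carrier V \<Longrightarrow> \<ominus>\<^bsub>V\<^esub> x = (\<ominus>\<^bsub>K\<^esub> \<one>\<^bsub>K\<^esub>) \<odot>\<^bsub>V\<^esub> x"
proof -
  assume V: "module K V"
  then interpret V: module K V .
  show "x \<in> carrier V \<Longrightarrow> y \<in> carrier V \<Longrightarrow> x \<oplus>\<^bsub>V\<^esub> y \<in> carrier V"
    "\<zero>\<^bsub>V\<^esub> \<in> carrier V" "x \<in> carrier V \<Longrightarrow> \<ominus>\<^bsub>V\<^esub> x \<in> carrier V"
    "x \<in> carrier V \<Longrightarrow> y \<in> carrier V \<Longrightarrow> x \<ominus>\<^bsub>V\<^esub> y \<in> carrier V"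
    "a \<in> carrier K \<Longrightarrow> x \<in> carrier V \<Longrightarrow> a \<odot>\<^bsub>V\<^esub> x \<in> carrier V"
    "x \<in> carrier V \<Longrightarrow> x \<oplus>\<^bsub>V\<^esub> \<zero>\<^bsub>V\<^esub> = x" "x \<in> carrier V \<Longrightarrow> \<zero>\<^bsub>V\<^esub> \<oplus>\<^bsub>V\<^esub> x = x"
    "a \<in> carrier K \<Longrightarrow> a \<odot>\<^bsub>V\<^esub> \<zero>\<^bsub>V\<^esub> = \<zero>\<^bsub>V\<^esub>" "x \<in> carrier V \<Longrightarrow> \<zero>\<^bsub>K\<^esub> \<odot>\<^bsub>V\<^esub> x = \<zero>\<^bsub>V\<^esub>"
    "x \<in> carrier V \<Longrightarrow> \<one>\<^bsub>K\<^esub> \<odot>\<^bsub>V\<^esub> x = x"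
    "x \<in> carrier V \<Longrightarrow> \<ominus>\<^bsub>V\<^esub> x = (\<ominus>\<^bsub>K\<^esub> \<one>\<^bsub>K\<^esub>) \<odot>\<^bsub>V\<^esub> x"
    by (auto simp: V.smult_l_minus)
qed

lemmas mod_simps = add_closed zero_closed neg_closed minus_closed smult_closed add_zero zero_add
  smult_zero zero_smult one_smult

text \<open>Inverses are traded for the law that zero scales everything to zero: then
  \<open>(-1) x\<close> is the inverse of \<open>x\<close>. For function spaces this is easier to
  supply than a description of negatives.\<close>

lemma moduleI_zero_smult:
  assumes "\<And>x y. x \<in> carrier V \<Longrightarrow> y \<in> carrier V \<Longrightarrow> x \<oplus>\<^bsub>V\<^esub> y \<in> carrier V"
    and "\<zero>\<^bsub>V\<^esub> \<in> carrier V"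
    and "\<And>a x. a \<in> carrier K \<Longrightarrow> x \<in> carrier V \<Longrightarrow> a \<odot>\<^bsub>V\<^esub> x \<in> carrier V"
    and "\<And>x y z. x \<in> carrier V \<Longrightarrow> y \<in> carrier V \<Longrightarrow> z \<in> carrier V \<Longrightarrow>
      (x \<oplus>\<^bsub>V\<^esub> y) \<oplus>\<^bsub>V\<^esub> z = x \<oplus>\<^bsub>V\<^esub> (y \<oplus>\<^bsub>V\<^esub> z)"
    and "\<And>x y. x \<in> carrier V \<Longrightarrow> y \<in> carrier V \<Longrightarrow> x \<oplus>\<^bsub>V\<^esub> y = y \<oplus>\<^bsub>V\<^esub> x"
    and "\<And>x. x \<in> carrier V \<Longrightarrow> \<zero>\<^bsub>V\<^esub> \<oplus>\<^bsub>V\<^esub> x = x"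
    and "\<And>a b x. a \<in> carrier K \<Longrightarrow> b \<in> carrier K \<Longrightarrow> x \<in> carrier V \<Longrightarrow>
      (a \<oplus>\<^bsub>K\<^esub> b) \<odot>\<^bsub>V\<^esub> x = a \<odot>\<^bsub>V\<^esub> x \<oplus>\<^bsub>V\<^esub> b \<odot>\<^bsub>V\<^esub> x"
    and "\<And>a x y. a \<in> carrier K \<Longrightarrow> x \<in> carrier V \<Longrightarrow> y \<in> carrier V \<Longrightarrow>
      a \<odot>\<^bsub>V\<^esub> (x \<oplus>\<^bsub>V\<^esub> y) = a \<odot>\<^bsub>V\<^esub> x \<oplus>\<^bsub>V\<^esub> a \<odot>\<^bsub>V\<^esub> y"
    and "\<And>a b x. a \<in> carrier K \<Longrightarrow> b \<in> carrier K \<Longrightarrow> x \<in> carrier V \<Longrightarrow>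
      (a \<otimes>\<^bsub>K\<^esub> b) \<odot>\<^bsub>V\<^esub> x = a \<odot>\<^bsub>V\<^esub> (b \<odot>\<^bsub>V\<^esub> x)"
    and "\<And>x. x \<in> carrier V \<Longrightarrow> \<one>\<^bsub>K\<^esub> \<odot>\<^bsub>V\<^esub> x = x"
    and "\<And>x. x \<in> carrier V \<Longrightarrow> \<zero>\<^bsub>K\<^esub> \<odot>\<^bsub>V\<^esub> x = \<zero>\<^bsub>V\<^esub>"
  shows "module K V"
proof (rule moduleI)
  show "cring K" by (rule cring_K)
  show "abelian_group V"
  proof (rule abelian_groupI)
    fix x assume x: "x \<in> carrier V"
    have "(\<ominus>\<^bsub>K\<^esub> \<one>\<^bsub>K\<^esub>) \<odot>\<^bsub>V\<^esub> x \<oplus>\<^bsub>V\<^esub> x = (\<ominus>\<^bsub>K\<^esub> \<one>\<^bsub>K\<^esub> \<oplus>\<^bsub>K\<^esub> \<one>\<^bsub>K\<^esub>) \<odot>\<^bsub>V\<^esub> x"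
      using assms(7,10) x by simp
    then show "\<exists>y\<in>carrier V. y \<oplus>\<^bsub>V\<^esub> x = \<zero>\<^bsub>V\<^esub>"
      using assms(3,11) x by (auto simp: K.l_neg)
  qed (use assms in auto)
qed (use assms in auto)

text \<open>The module laws are equations and pass along a surjection compatible with the
  operations. Nothing is assumed about \<open>W\<close> beforehand, which suits quotients and
  transported structures.\<close>

lemma module_surj_image:
  assumes V: "module K V" and im: "carrier W = h ` carrier V"
    and add: "\<And>x y. x \<in> carrier V \<Longrightarrow> y \<in> carrier V \<Longrightarrow> h x \<oplus>\<^bsub>W\<^esub> h y = h (x \<oplus>\<^bsub>V\<^esub> y)"
    and smult: "\<And>a x. a \<in> carrier K \<Longrightarrow> x \<in> carrier V \<Longrightarrow> a \<odot>\<^bsub>W\<^esub> h x = h (a \<odot>\<^bsub>V\<^esub> x)"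
    and zero: "\<zero>\<^bsub>W\<^esub> = h \<zero>\<^bsub>V\<^esub>"
  shows "module K W"
proof -
  interpret V: module K V by (rule V)
  show ?thesis
    by (rule moduleI_zero_smult)
      (auto simp: im add smult zero V.a_ac V.smult_l_distr V.smult_r_distr V.smult_assoc1)
qed

lemma module_subspace:
  assumes V: "module K V" and N: "subspace K V N"
  shows "module K (V\<lparr>carrier := N\<rparr>)"
proof -
  interpret V: module K V by (rule V)
  have c: "x \<in> carrier V" if "x \<in> N" for x using N that by (auto simp: subspace_def)
  show ?thesis
    by (rule moduleI_zero_smult)
      (use N c in \<open>auto simp: subspace_def V.a_ac V.smult_l_distr V.smult_r_distr V.smult_assoc1\<close>)
qed

lemma subspace_neg: "module K V \<Longrightarrow> subspace K V N \<Longrightarrow> x \<in> N \<Longrightarrow> \<ominus>\<^bsub>V\<^esub> x \<in> N"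
  using neg_eq_smult[of V x] by (auto simp: subspace_def subset_iff)

lemma submodule_iff_subspace:
  assumes V: "module K V"
  shows "submodule N K V \<longleftrightarrow> subspace K V N"
proof
  assume s: "submodule N K V"
  interpret V: module K V by (rule V)
  from s show "subspace K V N"
    using V.submoduleE[OF s] subgroup.one_closed[OF submodule.axioms(1)[OF s]]
    by (auto simp: subspace_def)
next
  assume "subspace K V N"
  with subspace_neg[OF V this] show "submodule N K V"
    by (intro module.submoduleI[OF V]) (auto simp: subspace_def)
qed

section \<open>Linear maps, kernels and images\<close>

lemma linear_map_zero:
  assumes "module K V" "module K W" "f \<in> linear_map K V W"
  shows "f \<zero>\<^bsub>V\<^esub> = \<zero>\<^bsub>W\<^esub>"
  using linear_map_smult[OF assms(3), of "\<zero>\<^bsub>K\<^esub>" "\<zero>\<^bsub>V\<^esub>"] assms linear_map_closed[OF assms(3)]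
  by (simp add: mod_simps)

lemma linear_map_neg:
  assumes "module K V" "module K W" "f \<in> linear_map K V W" "x \<in> carrier V"
  shows "f (\<ominus>\<^bsub>V\<^esub> x) = \<ominus>\<^bsub>W\<^esub> f x"
  using assms linear_map_closed[OF assms(3)]
  by (simp add: neg_eq_smult linear_map_smult)

lemma linear_map_minus:
  assumes "module K V" "module K W" "f \<in> linear_map K V W" "x \<in> carrier V" "y \<in> carrier V"
  shows "f (x \<ominus>\<^bsub>V\<^esub> y) = f x \<ominus>\<^bsub>W\<^esub> f y"
  using assms by (simp add: a_minus_def linear_map_add linear_map_neg neg_closed)

lemma linear_map_comp:
  "f \<in> linear_map K V W \<Longrightarrow> g \<in> linear_map K W Z \<Longrightarrow> (\<lambda>x. g (f x)) \<in> linear_map K V Z"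
  by (auto simp: linear_map_def Pi_def)

lemma linear_map_cong:
  assumes "module K V" "f \<in> linear_map K V W" "\<And>x. x \<in> carrier V \<Longrightarrow> g x = f x"
  shows "g \<in> linear_map K V W"
  using assms by (auto simp: linear_map_def mod_simps Pi_def)

text \<open>Components of natural transformations are restricted functions, so linearity must ignore
  values off the carrier.\<close>

lemma linear_map_restrict:
  "module K V \<Longrightarrow> restrict f (carrier V) \<in> linear_map K V W \<longleftrightarrow> f \<in> linear_map K V W"
  using linear_map_cong[of V f W "restrict f (carrier V)"]
    linear_map_cong[of V "restrict f (carrier V)" W f] by auto

lemma linear_map_const_zero: "module K W \<Longrightarrow> (\<lambda>x. \<zero>\<^bsub>W\<^esub>) \<in> linear_map K V W"
  by (auto intro!: linear_mapI simp: mod_simps)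

lemma linear_map_plus:
  assumes "module K V" and W: "module K W" and f: "f \<in> linear_map K V W" and g: "g \<in> linear_map K V W"
  shows "(\<lambda>x. f x \<oplus>\<^bsub>W\<^esub> g x) \<in> linear_map K V W"
proof -
  interpret W: module K W by (rule W)
  show ?thesis
    using linear_map_closed[OF f] linear_map_closed[OF g]
    by (intro linear_mapI)
      (auto simp: linear_map_add[OF f] linear_map_add[OF g] linear_map_smult[OF f] linear_map_smult[OF g]
        W.a_ac W.smult_r_distr)
qed

lemma linear_map_scale:
  assumes W: "module K W" and f: "f \<in> linear_map K V W" and a: "a \<in> carrier K"
  shows "(\<lambda>x. a \<odot>\<^bsub>W\<^esub> f x) \<in> linear_map K V W"
proof -
  interpret W: module K W by (rule W)
  show ?thesis
    using linear_map_closed[OF f] a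
    by (intro linear_mapI)
      (auto simp: linear_map_add[OF f] linear_map_smult[OF f] W.smult_r_distr K.m_comm simp flip: W.smult_assoc1)
qed

lemma subspace_kernel:
  assumes "module K V" "module K W" "f \<in> linear_map K V W"
  shows "subspace K V {x \<in> carrier V. f x = \<zero>\<^bsub>W\<^esub>}"
  using assms by (auto intro!: subspaceI simp: mod_simps linear_map_add linear_map_smult linear_map_zero)

lemma subspace_image:
  assumes "module K V" "module K W" and f: "f \<in> linear_map K V W"
  shows "subspace K W (f ` carrier V)"
  using linear_map_zero[OF assms] assms linear_map_closed[OF f]
  by (auto intro!: subspaceI simp: mod_simps image_iff linear_map_add[OF f, symmetric]
      linear_map_smult[OF f, symmetric]) (metis mod_simps)+

subsection \<open>Quotients\<close>

lemma coset_eq_image: "N +>\<^bsub>V\<^esub> x = (\<lambda>n. n \<oplus>\<^bsub>V\<^esub> x) ` N"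
  by (auto simp: a_r_coset_def')

text \<open>A coset involves addition only. Cohomology is a quotient of a module whose carrier has
  been cut down to the cocycles, and this removes the cut from the cosets.\<close>

lemma coset_restrict: "N +>\<^bsub>V\<lparr>carrier := Z\<rparr>\<^esub> x = N +>\<^bsub>V\<^esub> x"
  by (simp add: coset_eq_image)

context
  fixes V :: "('k, 'a) module" and N
  assumes V: "module K V" and N: "subspace K V N"
begin

interpretation V: module K V by (rule V)

lemma subspace_mem_carrier: "n \<in> N \<Longrightarrow> n \<in> carrier V"
  using N by (auto simp: subspace_def)

lemma coset_eqI:
  assumes "x \<in> carrier V" "n \<in> N"
  shows "N +>\<^bsub>V\<^esub> (x \<oplus>\<^bsub>V\<^esub> n) = N +>\<^bsub>V\<^esub> x"
proof -
  have "m \<oplus>\<^bsub>V\<^esub> (x \<oplus>\<^bsub>V\<^esub> n) = (m \<oplus>\<^bsub>V\<^esub> n) \<oplus>\<^bsub>V\<^esub> x" if "m \<in> N" for m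
    using that assms subspace_mem_carrier by (simp add: V.a_ac)
  moreover have "m \<oplus>\<^bsub>V\<^esub> x = (m \<ominus>\<^bsub>V\<^esub> n) \<oplus>\<^bsub>V\<^esub> (x \<oplus>\<^bsub>V\<^esub> n)" if "m \<in> N" for m
  proof -
    have "(m \<ominus>\<^bsub>V\<^esub> n) \<oplus>\<^bsub>V\<^esub> (x \<oplus>\<^bsub>V\<^esub> n) = m \<oplus>\<^bsub>V\<^esub> x \<oplus>\<^bsub>V\<^esub> (n \<ominus>\<^bsub>V\<^esub> n)"
      using that assms subspace_mem_carrier[of m] subspace_mem_carrier[of n] by (simp add: V.a_ac V.minus_eq)
    then show ?thesis using that assms subspace_mem_carrier[of m] subspace_mem_carrier[of n] by (simp add: V.minus_eq V.r_neg)
  qed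
  moreover have "m \<oplus>\<^bsub>V\<^esub> n \<in> N" "m \<ominus>\<^bsub>V\<^esub> n \<in> N" if "m \<in> N" for m
    using that assms N subspace_neg[OF V N] by (auto simp: subspace_def V.minus_eq)
  ultimately show ?thesis
    unfolding coset_eq_image image_def by blast
qed

lemma coset_eq_iff:
  assumes "x \<in> carrier V" "y \<in> carrier V"
  shows "N +>\<^bsub>V\<^esub> x = N +>\<^bsub>V\<^esub> y \<longleftrightarrow> (\<exists>n\<in>N. x = y \<oplus>\<^bsub>V\<^esub> n)"
proof
  assume e: "N +>\<^bsub>V\<^esub> x = N +>\<^bsub>V\<^esub> y"
  have "\<zero>\<^bsub>V\<^esub> \<oplus>\<^bsub>V\<^esub> x \<in> N +>\<^bsub>V\<^esub> x"
    using N by (auto simp: coset_eq_image subspace_def)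
  then obtain n where n: "n \<in> N" "x = n \<oplus>\<^bsub>V\<^esub> y"
    using assms unfolding e by (auto simp: coset_eq_image)
  then show "\<exists>n\<in>N. x = y \<oplus>\<^bsub>V\<^esub> n"
    using assms subspace_mem_carrier V.a_comm by auto
qed (use assms coset_eqI in auto)

lemma coset_eq_zero_iff:
  assumes "x \<in> carrier V"
  shows "N +>\<^bsub>V\<^esub> x = N \<longleftrightarrow> x \<in> N"
proof -
  have "N +>\<^bsub>V\<^esub> \<zero>\<^bsub>V\<^esub> = N"
    using subspace_mem_carrier by (force simp: coset_eq_image)
  then show ?thesis
    using coset_eq_iff[OF assms V.zero_closed] subspace_mem_carrier by auto
qed

lemma carrier_quotient: "carrier (quotient_module V N) = (\<lambda>x. N +>\<^bsub>V\<^esub> x) ` carrier V"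
  by (auto simp: quotient_module_def A_RCOSETS_def')

lemma zero_quotient: "\<zero>\<^bsub>quotient_module V N\<^esub> = N"
  by (simp add: quotient_module_def)

lemma add_quotient:
  assumes "x \<in> carrier V" "y \<in> carrier V"
  shows "(N +>\<^bsub>V\<^esub> x) \<oplus>\<^bsub>quotient_module V N\<^esub> (N +>\<^bsub>V\<^esub> y) = N +>\<^bsub>V\<^esub> (x \<oplus>\<^bsub>V\<^esub> y)"
proof -
  have 1: "(m \<oplus>\<^bsub>V\<^esub> x) \<oplus>\<^bsub>V\<^esub> (n \<oplus>\<^bsub>V\<^esub> y) = (m \<oplus>\<^bsub>V\<^esub> n) \<oplus>\<^bsub>V\<^esub> (x \<oplus>\<^bsub>V\<^esub> y)" if "m \<in> N" "n \<in> N" for m n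
    using that assms subspace_mem_carrier by (simp add: V.a_ac)
  have 2: "m \<oplus>\<^bsub>V\<^esub> (x \<oplus>\<^bsub>V\<^esub> y) = (m \<oplus>\<^bsub>V\<^esub> x) \<oplus>\<^bsub>V\<^esub> (\<zero>\<^bsub>V\<^esub> \<oplus>\<^bsub>V\<^esub> y)" if "m \<in> N" for m
    using that assms subspace_mem_carrier by (simp add: V.a_ac)
  have 3: "\<zero>\<^bsub>V\<^esub> \<in> N" using N by (auto simp: subspace_def)
  have 4: "m \<oplus>\<^bsub>V\<^esub> n \<in> N" if "m \<in> N" "n \<in> N" for m n
    using that N by (auto simp: subspace_def)
  have "(\<Union>h\<in>(\<lambda>n. n \<oplus>\<^bsub>V\<^esub> x) ` N. \<Union>k\<in>(\<lambda>n. n \<oplus>\<^bsub>V\<^esub> y) ` N. {h \<oplus>\<^bsub>V\<^esub> k}) = (\<lambda>n. n \<oplus>\<^bsub>V\<^esub> (x \<oplus>\<^bsub>V\<^esub> y)) ` N"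
    (is "?L = ?R")
  proof (intro equalityI subsetI)
    fix z assume "z \<in> ?L"
    then obtain m n where "m \<in> N" "n \<in> N" "z = (m \<oplus>\<^bsub>V\<^esub> x) \<oplus>\<^bsub>V\<^esub> (n \<oplus>\<^bsub>V\<^esub> y)" by auto
    then show "z \<in> ?R" using 1 4 by (metis imageI)
  next
    fix z assume "z \<in> ?R"
    then obtain m where "m \<in> N" "z = m \<oplus>\<^bsub>V\<^esub> (x \<oplus>\<^bsub>V\<^esub> y)" by auto
    then show "z \<in> ?L" using 2[of m] 3 by blast
  qed
  then show ?thesis by (simp add: quotient_module_def set_add_def' coset_eq_image)
qed

text \<open>The scalar multiple of a coset is a union over its representatives; since
  \<open>N\<close> is stable under scaling, all sets in the union are one and the same
  coset.\<close>

lemma smult_quotient: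
  assumes "a \<in> carrier K" "x \<in> carrier V"
  shows "a \<odot>\<^bsub>quotient_module V N\<^esub> (N +>\<^bsub>V\<^esub> x) = N +>\<^bsub>V\<^esub> (a \<odot>\<^bsub>V\<^esub> x)"
proof -
  have "N +>\<^bsub>V\<^esub> (a \<odot>\<^bsub>V\<^esub> (n \<oplus>\<^bsub>V\<^esub> x)) = N +>\<^bsub>V\<^esub> (a \<odot>\<^bsub>V\<^esub> x)" if "n \<in> N" for n
  proof -
    have "a \<odot>\<^bsub>V\<^esub> (n \<oplus>\<^bsub>V\<^esub> x) = a \<odot>\<^bsub>V\<^esub> x \<oplus>\<^bsub>V\<^esub> a \<odot>\<^bsub>V\<^esub> n"
      using that assms subspace_mem_carrier by (simp add: V.smult_r_distr V.a_comm)
    moreover have "a \<odot>\<^bsub>V\<^esub> n \<in> N" using that assms N by (auto simp: subspace_def)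
    ultimately show ?thesis using coset_eqI[of "a \<odot>\<^bsub>V\<^esub> x" "a \<odot>\<^bsub>V\<^esub> n"] assms by simp
  qed
  moreover have "N \<noteq> {}" using N by (auto simp: subspace_def)
  ultimately show ?thesis
    by (auto simp: quotient_module_def coset_eq_image[of V N x])
qed

lemma module_quotient: "module K (quotient_module V N)"
  by (rule module_surj_image[OF V carrier_quotient])
    (auto simp: add_quotient smult_quotient zero_quotient coset_eq_zero_iff N[unfolded subspace_def])

lemma linear_map_coset: "(\<lambda>x. N +>\<^bsub>V\<^esub> x) \<in> linear_map K V (quotient_module V N)"
  by (rule linear_mapI) (auto simp: carrier_quotient add_quotient smult_quotient)

end

text \<open>A linear relation that is total and compatible with the submodules induces a map of quotients;
  the connecting homomorphism is of this form.\<close>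

lemma quotient_map_exists:
  assumes V: "module K V" and N: "subspace K V N" and W: "module K W" and N': "subspace K W N'"
    and total: "\<And>x. x \<in> carrier V \<Longrightarrow> \<exists>y\<in>carrier W. R x y"
    and add: "\<And>x x' y y'. x \<in> carrier V \<Longrightarrow> x' \<in> carrier V \<Longrightarrow> y \<in> carrier W \<Longrightarrow> y' \<in> carrier W \<Longrightarrow>
       R x y \<Longrightarrow> R x' y' \<Longrightarrow> R (x \<oplus>\<^bsub>V\<^esub> x') (y \<oplus>\<^bsub>W\<^esub> y')"
    and smult: "\<And>a x y. a \<in> carrier K \<Longrightarrow> x \<in> carrier V \<Longrightarrow> y \<in> carrier W \<Longrightarrow>
       R x y \<Longrightarrow> R (a \<odot>\<^bsub>V\<^esub> x) (a \<odot>\<^bsub>W\<^esub> y)"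
    and zero: "\<And>x y. x \<in> N \<Longrightarrow> y \<in> carrier W \<Longrightarrow> R x y \<Longrightarrow> y \<in> N'"
  shows "\<exists>f\<in>linear_map K (quotient_module V N) (quotient_module W N').
    \<forall>x\<in>carrier V. \<forall>y\<in>carrier W. R x y \<longrightarrow> f (N +>\<^bsub>V\<^esub> x) = N' +>\<^bsub>W\<^esub> y"
proof -
  interpret V: module K V by (rule V)
  interpret W: module K W by (rule W)
  have uniq: "N' +>\<^bsub>W\<^esub> y = N' +>\<^bsub>W\<^esub> y'"
    if c: "x \<in> carrier V" "x' \<in> carrier V" "y \<in> carrier W" "y' \<in> carrier W"
      and r: "R x y" "R x' y'" and e: "N +>\<^bsub>V\<^esub> x = N +>\<^bsub>V\<^esub> x'" for x x' y y'
  proof -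
    \<comment> \<open>Scaling by \<open>-1\<close> stands in for subtraction, for which
      \<open>R\<close> has no hypothesis.\<close>
    have neg: "R (\<ominus>\<^bsub>V\<^esub> x') (\<ominus>\<^bsub>W\<^esub> y')"
      using smult[of "\<ominus>\<^bsub>K\<^esub> \<one>\<^bsub>K\<^esub>" x' y'] c r V W by (simp add: neg_eq_smult)
    have 1: "R (x \<oplus>\<^bsub>V\<^esub> \<ominus>\<^bsub>V\<^esub> x') (y \<oplus>\<^bsub>W\<^esub> \<ominus>\<^bsub>W\<^esub> y')"
      by (rule add[OF _ _ _ _ r(1) neg]) (use c in auto)
    obtain n where n: "n \<in> N" "x = x' \<oplus>\<^bsub>V\<^esub> n"
      using coset_eq_iff[OF V N c(1,2)] e by auto
    then have "x \<oplus>\<^bsub>V\<^esub> \<ominus>\<^bsub>V\<^esub> x' = n"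
      using c(1,2) subspace_mem_carrier[OF V N n(1)] V.a_comm V.a_assoc V.r_neg2 by (metis V.a_inv_closed)
    \<comment> \<open>The difference of the two values is related to an element of \<open>N\<close>,
      so \<open>zero\<close> puts it into \<open>N'\<close>.\<close>
    with n 1 have d: "y \<oplus>\<^bsub>W\<^esub> \<ominus>\<^bsub>W\<^esub> y' \<in> N'" using zero c by auto
    have "y = y' \<oplus>\<^bsub>W\<^esub> (y \<oplus>\<^bsub>W\<^esub> \<ominus>\<^bsub>W\<^esub> y')"
      using c(3,4) by (metis W.a_comm W.a_assoc W.a_inv_closed W.r_neg W.r_zero)
    then show ?thesis using coset_eq_iff[OF W N' c(3,4)] d by blast
  qed
  \<comment> \<open>\<open>R\<close> determines \<open>y\<close> only up to \<open>N'\<close>; the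
    choice is therefore of a coset and not of an element.\<close>
  define f where "f X = (SOME Y. \<exists>x\<in>carrier V. \<exists>y\<in>carrier W. R x y \<and> X = N +>\<^bsub>V\<^esub> x \<and> Y = N' +>\<^bsub>W\<^esub> y)" for X
  have f: "f (N +>\<^bsub>V\<^esub> x) = N' +>\<^bsub>W\<^esub> y" if "x \<in> carrier V" "y \<in> carrier W" "R x y" for x y
  proof -
    have "\<exists>Y. \<exists>x'\<in>carrier V. \<exists>y\<in>carrier W. R x' y \<and> N +>\<^bsub>V\<^esub> x = N +>\<^bsub>V\<^esub> x' \<and> Y = N' +>\<^bsub>W\<^esub> y"
      using that by blast
    from someI_ex[OF this, folded f_def] obtain x' y' where
      "x' \<in> carrier V" "y' \<in> carrier W" "R x' y'" "N +>\<^bsub>V\<^esub> x = N +>\<^bsub>V\<^esub> x'" "f (N +>\<^bsub>V\<^esub> x) = N' +>\<^bsub>W\<^esub> y'"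
      by blast
    then show ?thesis using uniq[of x x' y y'] that by simp
  qed
  have "f \<in> linear_map K (quotient_module V N) (quotient_module W N')"
  proof (rule linear_mapI)
    fix X assume "X \<in> carrier (quotient_module V N)"
    then obtain x where x: "x \<in> carrier V" "X = N +>\<^bsub>V\<^esub> x"
      by (auto simp: carrier_quotient[OF V N])
    with total obtain y where y: "y \<in> carrier W" "R x y" by blast
    then show "f X \<in> carrier (quotient_module W N')"
      using x f by (auto simp: carrier_quotient[OF W N'])
    fix a assume a: "a \<in> carrier K"
    then show "f (a \<odot>\<^bsub>quotient_module V N\<^esub> X) = a \<odot>\<^bsub>quotient_module W N'\<^esub> f X"
      using x y f[OF x(1) y] f[OF _ _ smult[OF a x(1) y]]
      by (simp add: smult_quotient[OF V N] smult_quotient[OF W N'])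
  next
    fix X X' assume "X \<in> carrier (quotient_module V N)" "X' \<in> carrier (quotient_module V N)"
    then obtain x x' where x: "x \<in> carrier V" "X = N +>\<^bsub>V\<^esub> x" "x' \<in> carrier V" "X' = N +>\<^bsub>V\<^esub> x'"
      by (auto simp: carrier_quotient[OF V N])
    with total obtain y y' where y: "y \<in> carrier W" "R x y" "y' \<in> carrier W" "R x' y'" by meson
    show "f (X \<oplus>\<^bsub>quotient_module V N\<^esub> X') = f X \<oplus>\<^bsub>quotient_module W N'\<^esub> f X'"
      using x y f[OF x(1) y(1,2)] f[OF x(3) y(3,4)] f[OF _ _ add[OF x(1,3) y(1,3,2,4)]]
      by (simp add: add_quotient[OF V N] add_quotient[OF W N'])
  qed
  with f show ?thesis by blast
qed

lemma coset_eqI_minus: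
  assumes V: "module K V" and N: "subspace K V N" and "x \<in> carrier V" "y \<in> carrier V" "x \<ominus>\<^bsub>V\<^esub> y \<in> N"
  shows "N +>\<^bsub>V\<^esub> x = N +>\<^bsub>V\<^esub> y"
proof -
  interpret V: module K V by (rule V)
  have "x = y \<oplus>\<^bsub>V\<^esub> (x \<ominus>\<^bsub>V\<^esub> y)"
    using assms(3,4) by (simp add: V.minus_eq V.a_lcomm[of y x] V.r_neg)
  then show ?thesis using coset_eq_iff[OF V N assms(3,4)] assms(5) by blast
qed

subsection \<open>Free modules\<close>

lemma free_module_simps:
  "f \<in> carrier (free_module K S) \<longleftrightarrow>
     (\<forall>p. f p \<in> carrier K) \<and> {p. f p \<noteq> \<zero>\<^bsub>K\<^esub>} \<subseteq> S \<and> finite {p. f p \<noteq> \<zero>\<^bsub>K\<^esub>}"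
  "\<zero>\<^bsub>free_module K S\<^esub> = (\<lambda>_. \<zero>\<^bsub>K\<^esub>)"
  "f \<oplus>\<^bsub>free_module K S\<^esub> g = (\<lambda>p. f p \<oplus>\<^bsub>K\<^esub> g p)"
  "a \<odot>\<^bsub>free_module K S\<^esub> f = (\<lambda>p. a \<otimes>\<^bsub>K\<^esub> f p)"
  by (auto simp: free_module_def)

lemma module_free: "module K (free_module K S)"
proof (rule moduleI_zero_smult)
  fix f g assume "f \<in> carrier (free_module K S)" "g \<in> carrier (free_module K S)"
  moreover have "{p. f p \<oplus>\<^bsub>K\<^esub> g p \<noteq> \<zero>\<^bsub>K\<^esub>} \<subseteq> {p. f p \<noteq> \<zero>\<^bsub>K\<^esub>} \<union> {p. g p \<noteq> \<zero>\<^bsub>K\<^esub>}" by auto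
  ultimately show "f \<oplus>\<^bsub>free_module K S\<^esub> g \<in> carrier (free_module K S)"
    by (auto simp: free_module_simps elim: finite_subset)
next
  fix a f assume "a \<in> carrier K" "f \<in> carrier (free_module K S)"
  moreover from this have "{p. a \<otimes>\<^bsub>K\<^esub> f p \<noteq> \<zero>\<^bsub>K\<^esub>} \<subseteq> {p. f p \<noteq> \<zero>\<^bsub>K\<^esub>}" by auto
  ultimately show "a \<odot>\<^bsub>free_module K S\<^esub> f \<in> carrier (free_module K S)"
    by (auto simp: free_module_simps elim: finite_subset)
qed (auto simp: free_module_simps K.a_ac K.l_distr K.r_distr K.m_assoc)

lemma free_gen_closed: "p \<in> S \<Longrightarrow> free_gen K p \<in> carrier (free_module K S)"
proof -
  have "{q. free_gen K p q \<noteq> \<zero>\<^bsub>K\<^esub>} \<subseteq> {p}" by (auto simp: free_gen_def)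
  then show "p \<in> S \<Longrightarrow> ?thesis"
    by (auto simp: free_module_simps elim: finite_subset) (auto simp: free_gen_def)
qed

text \<open>Induction on the size of the support: clearing one coordinate leaves a smaller support
  and splits off a multiple of one generator.\<close>

lemma free_module_induct [consumes 1, case_names zero add]:
  assumes "f \<in> carrier (free_module K S)"
    and zero: "P \<zero>\<^bsub>free_module K S\<^esub>"
    and add: "\<And>a p f. a \<in> carrier K \<Longrightarrow> p \<in> S \<Longrightarrow> f \<in> carrier (free_module K S) \<Longrightarrow> P f \<Longrightarrow>
      P (a \<odot>\<^bsub>free_module K S\<^esub> free_gen K p \<oplus>\<^bsub>free_module K S\<^esub> f)"
  shows "P f"
  using assms(1)
proof (induction "card {p. f p \<noteq> \<zero>\<^bsub>K\<^esub>}" arbitrary: f)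
  case 0
  then have "f = (\<lambda>_. \<zero>\<^bsub>K\<^esub>)" by (auto simp: free_module_simps)
  then show ?case using zero by (simp add: free_module_simps)
next
  case (Suc n)
  then obtain p where p: "f p \<noteq> \<zero>\<^bsub>K\<^esub>" by (metis (mono_tags, lifting) Collect_empty_eq card.empty nat.simps(3))
  define g where "g = f(p := \<zero>\<^bsub>K\<^esub>)"
  have s: "{q. g q \<noteq> \<zero>\<^bsub>K\<^esub>} = {q. f q \<noteq> \<zero>\<^bsub>K\<^esub>} - {p}" by (auto simp: g_def)
  have g: "g \<in> carrier (free_module K S)"
    using Suc(3) unfolding free_module_simps s by (auto simp: g_def)
  have "P g"
    using Suc(2) p Suc(3) by (intro Suc(1) g) (simp add: s free_module_simps)
  moreover have "f = f p \<odot>\<^bsub>free_module K S\<^esub> free_gen K p \<oplus>\<^bsub>free_module K S\<^esub> g"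
    using Suc(3) by (auto simp: free_module_simps g_def free_gen_def)
  ultimately show ?case
    using add[of "f p" p g] g p Suc(3) by (auto simp: free_module_simps(1))
qed

text \<open>The linear extension of a family \<open>b\<close> from the generators to the free
  module.\<close>

definition free_eval :: "('k, 'z) module \<Rightarrow> ('i \<Rightarrow> 'z) \<Rightarrow> ('i \<Rightarrow> 'k) \<Rightarrow> 'z" where
  "free_eval Z b f = finsum Z (\<lambda>p. f p \<odot>\<^bsub>Z\<^esub> b p) {p. f p \<noteq> \<zero>\<^bsub>K\<^esub>}"

text \<open>Supports can shrink under addition and scaling, so linearity is proved by writing all
  sums over one common finite index set.\<close>

lemma free_eval_superset:
  assumes Z: "module K Z" and f: "f \<in> carrier (free_module K S)" and b: "\<And>p. p \<in> S \<Longrightarrow> b p \<in> carrier Z"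
    and A: "finite A" "{p. f p \<noteq> \<zero>\<^bsub>K\<^esub>} \<subseteq> A" "A \<subseteq> S"
  shows "free_eval Z b f = finsum Z (\<lambda>p. f p \<odot>\<^bsub>Z\<^esub> b p) A"
proof -
  interpret Z: module K Z by (rule Z)
  show ?thesis unfolding free_eval_def
    using f A b by (intro Z.add.finprod_mono_neutral_cong_left)
      (auto simp: free_module_simps Pi_def subset_iff)
qed

lemma linear_map_free_eval:
  assumes Z: "module K Z" and b: "\<And>p. p \<in> S \<Longrightarrow> b p \<in> carrier Z"
  shows "free_eval Z b \<in> linear_map K (free_module K S) Z"
proof (rule linear_mapI)
  interpret Z: module K Z by (rule Z)
  fix f assume f: "f \<in> carrier (free_module K S)"
  then show "free_eval Z b f \<in> carrier Z"
    using b unfolding free_eval_def by (intro Z.finsum_closed) (auto simp: free_module_simps)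
  let ?F = "{p. f p \<noteq> \<zero>\<^bsub>K\<^esub>}"
  have fK: "f p \<in> carrier K" for p using f by (auto simp: free_module_simps)
  have bF: "p \<in> S" if "f p \<noteq> \<zero>\<^bsub>K\<^esub>" for p using f that by (auto simp: free_module_simps)
  fix a assume a: "a \<in> carrier K"
  have "free_eval Z b (a \<odot>\<^bsub>free_module K S\<^esub> f) = finsum Z (\<lambda>p. (a \<otimes>\<^bsub>K\<^esub> f p) \<odot>\<^bsub>Z\<^esub> b p) ?F"
    using f a smult_closed[OF module_free a f]
    by (subst free_eval_superset[OF Z _ b, where A = ?F and S = S]) (auto simp: free_module_simps)
  also have "\<dots> = finsum Z (\<lambda>p. a \<odot>\<^bsub>Z\<^esub> (f p \<odot>\<^bsub>Z\<^esub> b p)) ?F"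
    using a fK b bF by (intro Z.finsum_cong') (auto simp: Z.smult_assoc1)
  also have "\<dots> = a \<odot>\<^bsub>Z\<^esub> free_eval Z b f"
    unfolding free_eval_def using a fK b bF f
    by (intro Z.finsum_smult_ldistr[symmetric]) (auto simp: free_module_simps(1))
  finally show "free_eval Z b (a \<odot>\<^bsub>free_module K S\<^esub> f) = a \<odot>\<^bsub>Z\<^esub> free_eval Z b f" .
next
  interpret Z: module K Z by (rule Z)
  fix f g assume f: "f \<in> carrier (free_module K S)" and g: "g \<in> carrier (free_module K S)"
  let ?A = "{p. f p \<noteq> \<zero>\<^bsub>K\<^esub>} \<union> {p. g p \<noteq> \<zero>\<^bsub>K\<^esub>}"
  have A: "finite ?A" "?A \<subseteq> S" using f g by (auto simp: free_module_simps)
  have fg: "f p \<in> carrier K" "g p \<in> carrier K" for p using f g by (auto simp: free_module_simps)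
  have "free_eval Z b (f \<oplus>\<^bsub>free_module K S\<^esub> g) = finsum Z (\<lambda>p. (f p \<oplus>\<^bsub>K\<^esub> g p) \<odot>\<^bsub>Z\<^esub> b p) ?A"
    using add_closed[OF module_free f g] A fg
    by (subst free_eval_superset[OF Z _ b, where A = ?A and S = S]) (auto simp: free_module_simps(3))
  also have "\<dots> = finsum Z (\<lambda>p. f p \<odot>\<^bsub>Z\<^esub> b p \<oplus>\<^bsub>Z\<^esub> g p \<odot>\<^bsub>Z\<^esub> b p) ?A"
    using fg b A(2) by (intro Z.finsum_cong') (auto simp: Z.smult_l_distr subset_iff)
  also have "\<dots> = finsum Z (\<lambda>p. f p \<odot>\<^bsub>Z\<^esub> b p) ?A \<oplus>\<^bsub>Z\<^esub> finsum Z (\<lambda>p. g p \<odot>\<^bsub>Z\<^esub> b p) ?A"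
    using fg b A(2) by (intro Z.finsum_addf) (auto simp: subset_iff)
  also have "\<dots> = free_eval Z b f \<oplus>\<^bsub>Z\<^esub> free_eval Z b g"
    using f g A by (subst (1 2) free_eval_superset[OF Z _ b, where A = ?A and S = S]) auto
  finally show "free_eval Z b (f \<oplus>\<^bsub>free_module K S\<^esub> g) = free_eval Z b f \<oplus>\<^bsub>Z\<^esub> free_eval Z b g" .
qed

lemma free_eval_gen:
  assumes Z: "module K Z" and b: "\<And>p. p \<in> S \<Longrightarrow> b p \<in> carrier Z" and p: "p \<in> S"
  shows "free_eval Z b (free_gen K p) = b p"
proof -
  interpret Z: module K Z by (rule Z)
  show ?thesis
    using p b[OF p]
    by (subst free_eval_superset[OF Z free_gen_closed[OF p] b, where A = "{p}"])
      (auto simp: free_gen_def)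
qed

subsection \<open>Tensor products\<close>

context
  fixes V :: "('k, 'a) module" and W :: "('k, 'b) module"
  assumes V: "module K V" and W: "module K W"
begin

interpretation V: module K V by (rule V)
interpretation W: module K W by (rule W)
private abbreviation "F \<equiv> free_module K (carrier V \<times> carrier W)"
private abbreviation "N \<equiv> tensor_kernel K V W"
interpretation F: module K F by (rule module_free)

lemma free_gen_pair: "x \<in> carrier V \<Longrightarrow> y \<in> carrier W \<Longrightarrow> free_gen K (x, y) \<in> carrier F"
  by (rule free_gen_closed) auto

lemma tensor_relators_carrier: "tensor_relators K V W \<subseteq> carrier F"
  unfolding tensor_relators_def Let_def
  by (auto intro!: F.minus_closed F.add.m_closed F.smult_closed free_gen_pair)

text \<open>The whole free module belongs to the family being intersected, so the intersection stays
  inside it.\<close>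

lemma subspace_tensor_kernel: "subspace K F N"
proof -
  have "submodule (carrier F) K F" by (rule F.carrier_is_submodule)
  with tensor_relators_carrier show ?thesis
    unfolding tensor_kernel_def submodule_iff_subspace[OF module_free]
    by (intro subspaceI) (auto simp: subspace_def)
qed

lemma tensor_relators_subset: "tensor_relators K V W \<subseteq> N"
  by (auto simp: tensor_kernel_def)

lemma module_tensor: "module K (tensor K V W)"
  unfolding tensor_def by (rule module_quotient[OF module_free subspace_tensor_kernel])

lemma pure_tensor_closed:
  "x \<in> carrier V \<Longrightarrow> y \<in> carrier W \<Longrightarrow> pure_tensor K V W x y \<in> carrier (tensor K V W)"
  by (auto simp: pure_tensor_def tensor_def carrier_quotient[OF module_free subspace_tensor_kernel] free_gen_pair)

text \<open>Each of the four families of relators is one of the four laws of bilinearity.\<close>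

lemma bilinear_map_pure_tensor: "pure_tensor K V W \<in> bilinear_map K V W (tensor K V W)"
proof -
  note Q = module_free[of "carrier V \<times> carrier W"] subspace_tensor_kernel
  note eq = coset_eqI_minus[OF Q] add_quotient[OF Q] smult_quotient[OF Q]
  note defs = tensor_relators_def Let_def
  note rel = subsetD[OF tensor_relators_subset]
  have "pure_tensor K V W (x \<oplus>\<^bsub>V\<^esub> x') y = pure_tensor K V W x y \<oplus>\<^bsub>tensor K V W\<^esub> pure_tensor K V W x' y"
    if xy: "x \<in> carrier V" "x' \<in> carrier V" "y \<in> carrier W" for x x' y
  proof -
    have "free_gen K (x \<oplus>\<^bsub>V\<^esub> x', y) \<ominus>\<^bsub>F\<^esub> (free_gen K (x, y) \<oplus>\<^bsub>F\<^esub> free_gen K (x', y)) \<in> N"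
      by (rule rel) (unfold defs, use xy in blast)
    then show ?thesis
      using xy unfolding pure_tensor_def tensor_def by (simp add: eq free_gen_pair)
  qed
  moreover have "pure_tensor K V W x (y \<oplus>\<^bsub>W\<^esub> y') = pure_tensor K V W x y \<oplus>\<^bsub>tensor K V W\<^esub> pure_tensor K V W x y'"
    if xy: "x \<in> carrier V" "y \<in> carrier W" "y' \<in> carrier W" for x y y'
  proof -
    have "free_gen K (x, y \<oplus>\<^bsub>W\<^esub> y') \<ominus>\<^bsub>F\<^esub> (free_gen K (x, y) \<oplus>\<^bsub>F\<^esub> free_gen K (x, y')) \<in> N"
      by (rule rel) (unfold defs, use xy in blast)
    then show ?thesis
      using xy unfolding pure_tensor_def tensor_def by (simp add: eq free_gen_pair)
  qed
  moreover have "pure_tensor K V W (a \<odot>\<^bsub>V\<^esub> x) y = a \<odot>\<^bsub>tensor K V W\<^esub> pure_tensor K V W x y"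
    if xy: "a \<in> carrier K" "x \<in> carrier V" "y \<in> carrier W" for a x y
  proof -
    have "free_gen K (a \<odot>\<^bsub>V\<^esub> x, y) \<ominus>\<^bsub>F\<^esub> (a \<odot>\<^bsub>F\<^esub> free_gen K (x, y)) \<in> N"
      by (rule rel) (unfold defs, use xy in blast)
    then show ?thesis
      using xy unfolding pure_tensor_def tensor_def by (simp add: eq free_gen_pair)
  qed
  moreover have "pure_tensor K V W x (a \<odot>\<^bsub>W\<^esub> y) = a \<odot>\<^bsub>tensor K V W\<^esub> pure_tensor K V W x y"
    if xy: "a \<in> carrier K" "x \<in> carrier V" "y \<in> carrier W" for a x y
  proof -
    have "free_gen K (x, a \<odot>\<^bsub>W\<^esub> y) \<ominus>\<^bsub>F\<^esub> (a \<odot>\<^bsub>F\<^esub> free_gen K (x, y)) \<in> N"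
      by (rule rel) (unfold defs, use xy in blast)
    then show ?thesis
      using xy unfolding pure_tensor_def tensor_def by (simp add: eq free_gen_pair)
  qed
  ultimately show ?thesis
    by (auto intro!: bilinear_mapI linear_mapI pure_tensor_closed)
qed

text \<open>Scalars are absorbed by \<open>a (x \<otimes> y) = (a x) \<otimes> y\<close>, so sums of
  pure tensors exhaust the tensor product and the induction step carries no scalar.\<close>

lemma tensor_induct [consumes 1, case_names zero add]:
  assumes X: "X \<in> carrier (tensor K V W)"
    and zero: "P \<zero>\<^bsub>tensor K V W\<^esub>"
    and add: "\<And>x y X. x \<in> carrier V \<Longrightarrow> y \<in> carrier W \<Longrightarrow> X \<in> carrier (tensor K V W) \<Longrightarrow> P X \<Longrightarrow>
      P (pure_tensor K V W x y \<oplus>\<^bsub>tensor K V W\<^esub> X)"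
  shows "P X"
proof -
  note Q = module_free[of "carrier V \<times> carrier W"] subspace_tensor_kernel
  obtain f where f: "f \<in> carrier F" "X = N +>\<^bsub>F\<^esub> f"
    using X by (auto simp: tensor_def carrier_quotient[OF Q])
  have "P (N +>\<^bsub>F\<^esub> f)" using f(1)
  proof (induction f rule: free_module_induct)
    case zero
    have "N +>\<^bsub>F\<^esub> \<zero>\<^bsub>F\<^esub> = N"
      using subspace_tensor_kernel by (auto simp: coset_eq_zero_iff[OF Q] subspace_def)
    then show ?case using assms(2) by (simp add: tensor_def zero_quotient[OF Q])
  next
    case (add a p f)
    obtain x y where p: "p = (x, y)" "x \<in> carrier V" "y \<in> carrier W" using add by auto
    have "a \<odot>\<^bsub>tensor K V W\<^esub> pure_tensor K V W x y = pure_tensor K V W (a \<odot>\<^bsub>V\<^esub> x) y"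
      using linear_map_smult[OF bilinear_mapD2[OF bilinear_map_pure_tensor p(3)] add(1) p(2)] by simp
    moreover have "a \<odot>\<^bsub>tensor K V W\<^esub> pure_tensor K V W x y = N +>\<^bsub>F\<^esub> (a \<odot>\<^bsub>F\<^esub> free_gen K p)"
      using p add(1) by (simp add: pure_tensor_def tensor_def smult_quotient[OF Q] free_gen_pair)
    moreover have "N +>\<^bsub>F\<^esub> f \<in> carrier (tensor K V W)"
      using add by (auto simp: tensor_def carrier_quotient[OF Q])
    moreover have "N +>\<^bsub>F\<^esub> (a \<odot>\<^bsub>F\<^esub> free_gen K p \<oplus>\<^bsub>F\<^esub> f)
        = (N +>\<^bsub>F\<^esub> (a \<odot>\<^bsub>F\<^esub> free_gen K p)) \<oplus>\<^bsub>tensor K V W\<^esub> (N +>\<^bsub>F\<^esub> f)"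
      using p add by (simp add: tensor_def add_quotient[OF Q] free_gen_pair)
    ultimately show ?case
      using assms(3)[of "a \<odot>\<^bsub>V\<^esub> x" y "N +>\<^bsub>F\<^esub> f"] add p by simp
  qed
  with f show ?thesis by simp
qed

lemma tensor_linear_eqI:
  assumes Z: "module K Z" and f: "f \<in> linear_map K (tensor K V W) Z" and g: "g \<in> linear_map K (tensor K V W) Z"
    and eq: "\<And>x y. x \<in> carrier V \<Longrightarrow> y \<in> carrier W \<Longrightarrow> f (pure_tensor K V W x y) = g (pure_tensor K V W x y)"
    and X: "X \<in> carrier (tensor K V W)"
  shows "f X = g X"
  using X
proof (induction X rule: tensor_induct)
  case zero
  show ?case using linear_map_zero[OF module_tensor Z f] linear_map_zero[OF module_tensor Z g] by simp
next
  case (add x y X)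
  then show ?case
    using linear_map_add[OF f] linear_map_add[OF g] eq by (simp add: pure_tensor_closed)
qed

context
  fixes Z :: "('k, 'z) module" and \<beta>
  assumes Z: "module K Z" and \<beta>: "\<beta> \<in> bilinear_map K V W Z"
begin

interpretation Z: module K Z by (rule Z)
private abbreviation "L \<equiv> free_eval Z (\<lambda>p. \<beta> (fst p) (snd p))"

lemma tensor_family_closed: "p \<in> carrier V \<times> carrier W \<Longrightarrow> \<beta> (fst p) (snd p) \<in> carrier Z"
  using bilinear_map_closed[OF \<beta>] by auto

lemma linear_map_free_lift: "L \<in> linear_map K F Z"
  by (rule linear_map_free_eval[OF Z tensor_family_closed])

lemma free_lift_gen: "x \<in> carrier V \<Longrightarrow> y \<in> carrier W \<Longrightarrow> L (free_gen K (x, y)) = \<beta> x y"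
  using free_eval_gen[OF Z tensor_family_closed, where p = "(x, y)"] by simp

text \<open>The kernel of the extended map is a submodule containing all relators, and the tensor
  kernel is the least such submodule.\<close>

lemma free_lift_tensor_kernel: "f \<in> N \<Longrightarrow> L f = \<zero>\<^bsub>Z\<^esub>"
proof -
  note L = linear_map_minus[OF module_free Z linear_map_free_lift] linear_map_add[OF linear_map_free_lift]
    linear_map_smult[OF linear_map_free_lift]
  have *: "u \<ominus>\<^bsub>Z\<^esub> u = \<zero>\<^bsub>Z\<^esub>" if "u \<in> carrier Z" for u using that by (simp add: Z.minus_eq Z.r_neg)
  note cl = bilinear_map_closed[OF \<beta>]
  have "tensor_relators K V W \<subseteq> {f \<in> carrier F. L f = \<zero>\<^bsub>Z\<^esub>}" (is "_ \<subseteq> ?N")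
    unfolding tensor_relators_def Let_def
    by (auto simp: F.minus_closed free_gen_pair L free_lift_gen linear_map_add[OF bilinear_mapD1[OF \<beta>]]
        linear_map_add[OF bilinear_mapD2[OF \<beta>]] linear_map_smult[OF bilinear_mapD1[OF \<beta>]]
        linear_map_smult[OF bilinear_mapD2[OF \<beta>]] cl *)
  moreover have "submodule ?N K F"
    unfolding submodule_iff_subspace[OF module_free] by (rule subspace_kernel[OF module_free Z linear_map_free_lift])
  ultimately show "f \<in> N \<Longrightarrow> ?thesis"
    by (auto simp: tensor_kernel_def)
qed

text \<open>Constancy on a coset makes the set of values a singleton, which is what
  \<open>the_elem\<close> in \<open>tensor_lift\<close> requires.\<close>

lemma tensor_lift_coset: "f \<in> carrier F \<Longrightarrow> tensor_lift K Z \<beta> (N +>\<^bsub>F\<^esub> f) = L f"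
proof -
  assume f: "f \<in> carrier F"
  have N: "n \<in> carrier F" if "n \<in> N" for n using that subspace_tensor_kernel by (auto simp: subspace_def)
  have "L (n \<oplus>\<^bsub>F\<^esub> f) = L f" if "n \<in> N" for n
    using f that free_lift_tensor_kernel[OF that] N
    by (simp add: linear_map_add[OF linear_map_free_lift] linear_map_closed[OF linear_map_free_lift])
  moreover have "N \<noteq> {}" using subspace_tensor_kernel by (auto simp: subspace_def)
  ultimately have "L ` (N +>\<^bsub>F\<^esub> f) = {L f}"
    unfolding coset_eq_image by (auto simp: image_iff)
  then show ?thesis
    by (simp add: tensor_lift_def free_eval_def)
qed

lemma tensor_lift_pure:
  "x \<in> carrier V \<Longrightarrow> y \<in> carrier W \<Longrightarrow> tensor_lift K Z \<beta> (pure_tensor K V W x y) = \<beta> x y"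
  by (simp add: pure_tensor_def tensor_lift_coset free_gen_pair free_lift_gen)

lemma linear_map_tensor_lift: "tensor_lift K Z \<beta> \<in> linear_map K (tensor K V W) Z"
proof -
  note Q = module_free[of "carrier V \<times> carrier W"] subspace_tensor_kernel
  show ?thesis
    by (rule linear_mapI)
      (auto simp: tensor_def carrier_quotient[OF Q] add_quotient[OF Q] smult_quotient[OF Q]
        tensor_lift_coset linear_map_closed[OF linear_map_free_lift] linear_map_add[OF linear_map_free_lift]
        linear_map_smult[OF linear_map_free_lift])
qed

end

end

subsection \<open>Direct sums\<close>

text \<open>The summands may vary with the index, as they must for a coproduct of representables.
  Elements are extensional, so that equal coordinates force equality.\<close>

definition dsum :: "'i set \<Rightarrow> ('i \<Rightarrow> ('k, 'v) module) \<Rightarrow> ('k, 'i \<Rightarrow> 'v) module" where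
  "dsum S V =
     \<lparr>carrier = {f \<in> (\<Pi>\<^sub>E i\<in>S. carrier (V i)). finite {i \<in> S. f i \<noteq> \<zero>\<^bsub>V i\<^esub>}},
      mult = undefined, one = undefined, zero = (\<lambda>i\<in>S. \<zero>\<^bsub>V i\<^esub>),
      add = (\<lambda>f g. \<lambda>i\<in>S. f i \<oplus>\<^bsub>V i\<^esub> g i), smult = (\<lambda>a f. \<lambda>i\<in>S. a \<odot>\<^bsub>V i\<^esub> f i)\<rparr>"

definition dsum_inj :: "'i set \<Rightarrow> ('i \<Rightarrow> ('k, 'v) module) \<Rightarrow> 'i \<Rightarrow> 'v \<Rightarrow> 'i \<Rightarrow> 'v" where
  "dsum_inj S V i x = (\<lambda>j\<in>S. if j = i then x else \<zero>\<^bsub>V j\<^esub>)"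

text \<open>The map out of the coproduct that the universal property attaches to the maps
  \<open>b i\<close>.\<close>

definition dsum_eval :: "'i set \<Rightarrow> ('i \<Rightarrow> ('k, 'v) module) \<Rightarrow> ('k, 'z) module \<Rightarrow> ('i \<Rightarrow> 'v \<Rightarrow> 'z) \<Rightarrow> ('i \<Rightarrow> 'v) \<Rightarrow> 'z" where
  "dsum_eval S V Z b f = finsum Z (\<lambda>i. b i (f i)) {i \<in> S. f i \<noteq> \<zero>\<^bsub>V i\<^esub>}"

lemma dsum_simps:
  "f \<in> carrier (dsum S V) \<longleftrightarrow> f \<in> (\<Pi>\<^sub>E i\<in>S. carrier (V i)) \<and> finite {i \<in> S. f i \<noteq> \<zero>\<^bsub>V i\<^esub>}"
  "\<zero>\<^bsub>dsum S V\<^esub> = (\<lambda>i\<in>S. \<zero>\<^bsub>V i\<^esub>)"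
  "f \<oplus>\<^bsub>dsum S V\<^esub> g = (\<lambda>i\<in>S. f i \<oplus>\<^bsub>V i\<^esub> g i)"
  "a \<odot>\<^bsub>dsum S V\<^esub> f = (\<lambda>i\<in>S. a \<odot>\<^bsub>V i\<^esub> f i)"
  by (auto simp: dsum_def)

lemma dsum_mem: "f \<in> carrier (dsum S V) \<Longrightarrow> i \<in> S \<Longrightarrow> f i \<in> carrier (V i)"
  by (auto simp: dsum_simps)

lemma dsum_restrict: "f \<in> carrier (dsum S V) \<Longrightarrow> restrict f S = f"
  by (auto simp: dsum_simps PiE_restrict)

lemma dsum_eqI:
  assumes "f \<in> carrier (dsum S V)" "g \<in> carrier (dsum S V)" "\<And>i. i \<in> S \<Longrightarrow> f i = g i"
  shows "f = g"
  using assms by (intro PiE_ext[of f S _ g]) (auto simp: dsum_simps)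

context
  fixes S and V :: "'i \<Rightarrow> ('k, 'v) module"
  assumes V: "\<And>i. i \<in> S \<Longrightarrow> module K (V i)"
begin

lemma module_dsum: "module K (dsum S V)"
proof (rule moduleI_zero_smult)
  fix f g assume f: "f \<in> carrier (dsum S V)" and g: "g \<in> carrier (dsum S V)"
  have "{i \<in> S. f i \<oplus>\<^bsub>V i\<^esub> g i \<noteq> \<zero>\<^bsub>V i\<^esub>} \<subseteq> {i \<in> S. f i \<noteq> \<zero>\<^bsub>V i\<^esub>} \<union> {i \<in> S. g i \<noteq> \<zero>\<^bsub>V i\<^esub>}"
    using V by (auto simp: mod_simps)
  from finite_subset[OF this] f g show "f \<oplus>\<^bsub>dsum S V\<^esub> g \<in> carrier (dsum S V)"
    using V dsum_mem[OF f] dsum_mem[OF g] by (auto simp: dsum_simps mod_simps cong: conj_cong)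
next
  fix a f assume a: "a \<in> carrier K" and f: "f \<in> carrier (dsum S V)"
  have "{i \<in> S. a \<odot>\<^bsub>V i\<^esub> f i \<noteq> \<zero>\<^bsub>V i\<^esub>} \<subseteq> {i \<in> S. f i \<noteq> \<zero>\<^bsub>V i\<^esub>}"
    using V a by (auto simp: mod_simps)
  from finite_subset[OF this] a f show "a \<odot>\<^bsub>dsum S V\<^esub> f \<in> carrier (dsum S V)"
    using V dsum_mem[OF f] by (auto simp: dsum_simps mod_simps cong: conj_cong)
next
  show "\<zero>\<^bsub>dsum S V\<^esub> \<in> carrier (dsum S V)"
    using V by (auto simp: dsum_simps mod_simps)
qed (use V dsum_mem[of _ S V] in \<open>auto simp: dsum_simps(2-4) mod_simps dsum_restrict cong: restrict_cong
      intro!: restrict_ext abelian_monoid.a_assoc[OF abelian_group.axioms(1)[OF module.axioms(2)]]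
      abelian_monoid.a_comm[OF abelian_group.axioms(1)[OF module.axioms(2)]]
      module.smult_l_distr module.smult_r_distr module.smult_assoc1\<close>)

lemma dsum_inj_closed: "i \<in> S \<Longrightarrow> x \<in> carrier (V i) \<Longrightarrow> dsum_inj S V i x \<in> carrier (dsum S V)"
proof -
  have "{j \<in> S. dsum_inj S V i x j \<noteq> \<zero>\<^bsub>V j\<^esub>} \<subseteq> {i}" by (auto simp: dsum_inj_def)
  from finite_subset[OF this] show "i \<in> S \<Longrightarrow> x \<in> carrier (V i) \<Longrightarrow> ?thesis"
    using V by (auto simp: dsum_simps) (auto simp: dsum_inj_def mod_simps)
qed

lemma dsum_induct [consumes 1, case_names zero add]:
  assumes "f \<in> carrier (dsum S V)"
    and zero: "P \<zero>\<^bsub>dsum S V\<^esub>"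
    and add: "\<And>i x f. i \<in> S \<Longrightarrow> x \<in> carrier (V i) \<Longrightarrow> f \<in> carrier (dsum S V) \<Longrightarrow> P f \<Longrightarrow>
      P (dsum_inj S V i x \<oplus>\<^bsub>dsum S V\<^esub> f)"
  shows "P f"
  using assms(1)
proof (induction "card {i \<in> S. f i \<noteq> \<zero>\<^bsub>V i\<^esub>}" arbitrary: f)
  case 0
  then have "{i \<in> S. f i \<noteq> \<zero>\<^bsub>V i\<^esub>} = {}" by (simp add: dsum_simps)
  then have "f = \<zero>\<^bsub>dsum S V\<^esub>"
    by (intro dsum_eqI[OF 0(2) zero_closed[OF module_dsum]]) (auto simp: dsum_simps)
  then show ?case using zero by simp
next
  case (Suc n)
  then have "{i \<in> S. f i \<noteq> \<zero>\<^bsub>V i\<^esub>} \<noteq> {}" by (metis card.empty nat.simps(3))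
  then obtain p where p: "p \<in> S" "f p \<noteq> \<zero>\<^bsub>V p\<^esub>" by auto
  define g where "g = f(p := \<zero>\<^bsub>V p\<^esub>)"
  have s: "{i \<in> S. g i \<noteq> \<zero>\<^bsub>V i\<^esub>} = {i \<in> S. f i \<noteq> \<zero>\<^bsub>V i\<^esub>} - {p}" by (auto simp: g_def)
  have f: "f i \<in> carrier (V i)" if "i \<in> S" for i using Suc(3) that by (auto simp: dsum_simps)
  have g: "g \<in> carrier (dsum S V)"
    using Suc(3) p V[OF p(1)] unfolding dsum_simps s by (auto simp: g_def PiE_def extensional_def mod_simps)
  have "P g"
    using Suc(2) p Suc(3) by (intro Suc(1) g) (simp add: s dsum_simps)
  moreover have "f = dsum_inj S V p (f p) \<oplus>\<^bsub>dsum S V\<^esub> g"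
    using V f p by (intro dsum_eqI[OF Suc(3) add_closed[OF module_dsum dsum_inj_closed g]])
      (auto simp: dsum_simps g_def dsum_inj_def mod_simps)
  ultimately show ?case
    using add[of p "f p" g] g p f by simp
qed

context
  fixes Z :: "('k, 'z) module" and b
  assumes Z: "module K Z" and b: "\<And>i. i \<in> S \<Longrightarrow> b i \<in> linear_map K (V i) Z"
begin

interpretation Z: module K Z by (rule Z)

lemma dsum_eval_superset:
  assumes f: "f \<in> carrier (dsum S V)" and A: "finite A" "{i \<in> S. f i \<noteq> \<zero>\<^bsub>V i\<^esub>} \<subseteq> A" "A \<subseteq> S"
  shows "dsum_eval S V Z b f = finsum Z (\<lambda>i. b i (f i)) A"
proof -
  have "f i \<in> carrier (V i)" if "i \<in> S" for i using f that by (auto simp: dsum_simps)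
  then show ?thesis unfolding dsum_eval_def
    using A linear_map_zero[OF V Z b] linear_map_closed[OF b]
    by (intro Z.add.finprod_mono_neutral_cong_left) (auto simp: Pi_def subset_iff)
qed

lemma linear_map_dsum_eval: "dsum_eval S V Z b \<in> linear_map K (dsum S V) Z"
proof (rule linear_mapI)
  fix f assume f: "f \<in> carrier (dsum S V)"
  have fV: "f i \<in> carrier (V i)" if "i \<in> S" for i using f that by (auto simp: dsum_simps)
  then show "dsum_eval S V Z b f \<in> carrier Z"
    using linear_map_closed[OF b] unfolding dsum_eval_def by (intro Z.finsum_closed) auto
  let ?F = "{i \<in> S. f i \<noteq> \<zero>\<^bsub>V i\<^esub>}"
  fix a assume a: "a \<in> carrier K"
  have "{i \<in> S. (a \<odot>\<^bsub>dsum S V\<^esub> f) i \<noteq> \<zero>\<^bsub>V i\<^esub>} \<subseteq> ?F"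
    using a V by (auto simp: dsum_simps smult_zero)
  then have "dsum_eval S V Z b (a \<odot>\<^bsub>dsum S V\<^esub> f) = finsum Z (\<lambda>i. b i ((a \<odot>\<^bsub>dsum S V\<^esub> f) i)) ?F"
    using f by (intro dsum_eval_superset smult_closed[OF module_dsum a f]) (auto simp: dsum_simps(1))
  also have "\<dots> = finsum Z (\<lambda>i. a \<odot>\<^bsub>Z\<^esub> b i (f i)) ?F"
    using a fV by (intro Z.finsum_cong') (auto simp: dsum_simps linear_map_smult[OF b] linear_map_closed[OF b])
  also have "\<dots> = a \<odot>\<^bsub>Z\<^esub> dsum_eval S V Z b f"
    unfolding dsum_eval_def using a fV f linear_map_closed[OF b]
    by (intro Z.finsum_smult_ldistr[symmetric]) (auto simp: dsum_simps(1))
  finally show "dsum_eval S V Z b (a \<odot>\<^bsub>dsum S V\<^esub> f) = a \<odot>\<^bsub>Z\<^esub> dsum_eval S V Z b f" .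
next
  fix f g assume f: "f \<in> carrier (dsum S V)" and g: "g \<in> carrier (dsum S V)"
  let ?A = "{i \<in> S. f i \<noteq> \<zero>\<^bsub>V i\<^esub>} \<union> {i \<in> S. g i \<noteq> \<zero>\<^bsub>V i\<^esub>}"
  have A: "finite ?A" "?A \<subseteq> S" using f g by (auto simp: dsum_simps)
  have fg: "f i \<in> carrier (V i)" "g i \<in> carrier (V i)" if "i \<in> S" for i using f g that by (auto simp: dsum_simps)
  have "{i \<in> S. (f \<oplus>\<^bsub>dsum S V\<^esub> g) i \<noteq> \<zero>\<^bsub>V i\<^esub>} \<subseteq> ?A"
    using V by (auto simp: dsum_simps mod_simps)
  then have "dsum_eval S V Z b (f \<oplus>\<^bsub>dsum S V\<^esub> g) = finsum Z (\<lambda>i. b i ((f \<oplus>\<^bsub>dsum S V\<^esub> g) i)) ?A"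
    using A by (intro dsum_eval_superset add_closed[OF module_dsum f g])
  also have "\<dots> = finsum Z (\<lambda>i. b i (f i) \<oplus>\<^bsub>Z\<^esub> b i (g i)) ?A"
    using fg by (intro Z.finsum_cong') (auto simp: dsum_simps linear_map_add[OF b] linear_map_closed[OF b])
  also have "\<dots> = finsum Z (\<lambda>i. b i (f i)) ?A \<oplus>\<^bsub>Z\<^esub> finsum Z (\<lambda>i. b i (g i)) ?A"
    using fg by (intro Z.finsum_addf) (auto simp: linear_map_closed[OF b])
  also have "\<dots> = dsum_eval S V Z b f \<oplus>\<^bsub>Z\<^esub> dsum_eval S V Z b g"
    using f g A by (subst (1 2) dsum_eval_superset[where A = ?A]) auto
  finally show "dsum_eval S V Z b (f \<oplus>\<^bsub>dsum S V\<^esub> g) = dsum_eval S V Z b f \<oplus>\<^bsub>Z\<^esub> dsum_eval S V Z b g" .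
qed

lemma dsum_eval_inj:
  assumes i: "i \<in> S" "x \<in> carrier (V i)"
  shows "dsum_eval S V Z b (dsum_inj S V i x) = b i x"
  using i linear_map_closed[OF b]
  by (subst dsum_eval_superset[OF dsum_inj_closed[OF i], where A = "{i}"]) (auto simp: dsum_inj_def)

end

lemma dsum_linear_eqI:
  assumes Z: "module K Z" and f: "f \<in> linear_map K (dsum S V) Z" and g: "g \<in> linear_map K (dsum S V) Z"
    and eq: "\<And>i x. i \<in> S \<Longrightarrow> x \<in> carrier (V i) \<Longrightarrow> f (dsum_inj S V i x) = g (dsum_inj S V i x)"
    and X: "X \<in> carrier (dsum S V)"
  shows "f X = g X"
  using X
proof (induction X rule: dsum_induct)
  case zero
  show ?case using linear_map_zero[OF module_dsum Z f] linear_map_zero[OF module_dsum Z g] by simp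
next
  case (add i x X)
  then show ?case
    using linear_map_add[OF f] linear_map_add[OF g] eq by (simp add: dsum_inj_closed)
qed

end

end

section \<open>Functors and natural transformations\<close>

lemma
  assumes "k_category K C"
  shows kcat_module: "a \<in> Obj C \<Longrightarrow> b \<in> Obj C \<Longrightarrow> module K (Hom C a b)"
    and kcat_bilinear: "a \<in> Obj C \<Longrightarrow> b \<in> Obj C \<Longrightarrow> c \<in> Obj C \<Longrightarrow>
      Comp C a b c \<in> bilinear_map K (Hom C b c) (Hom C a b) (Hom C a c)"
    and kcat_assoc: "a \<in> Obj C \<Longrightarrow> b \<in> Obj C \<Longrightarrow> c \<in> Obj C \<Longrightarrow> d \<in> Obj C \<Longrightarrow>
      f \<in> carrier (Hom C a b) \<Longrightarrow> g \<in> carrier (Hom C b c) \<Longrightarrow> h \<in> carrier (Hom C c d) \<Longrightarrow>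
      Comp C a b d (Comp C b c d h g) f = Comp C a c d h (Comp C a b c g f)"
    and kcat_Id: "a \<in> Obj C \<Longrightarrow> Id C a \<in> carrier (Hom C a a)"
    and kcat_Id_right: "a \<in> Obj C \<Longrightarrow> b \<in> Obj C \<Longrightarrow> f \<in> carrier (Hom C a b) \<Longrightarrow> Comp C a a b f (Id C a) = f"
    and kcat_Id_left: "a \<in> Obj C \<Longrightarrow> b \<in> Obj C \<Longrightarrow> f \<in> carrier (Hom C a b) \<Longrightarrow> Comp C a b b (Id C b) f = f"
  using assms by (auto simp: k_category_def)

lemma kcat_comp_closed:
  "k_category K C \<Longrightarrow> a \<in> Obj C \<Longrightarrow> b \<in> Obj C \<Longrightarrow> c \<in> Obj C \<Longrightarrow>
   g \<in> carrier (Hom C b c) \<Longrightarrow> f \<in> carrier (Hom C a b) \<Longrightarrow> Comp C a b c g f \<in> carrier (Hom C a c)"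
  using kcat_bilinear bilinear_map_closed by metis

lemma
  assumes "k_functor K C F"
  shows kfun_module: "a \<in> Obj C \<Longrightarrow> module K (Val F a)"
    and kfun_bilinear: "a \<in> Obj C \<Longrightarrow> b \<in> Obj C \<Longrightarrow> Act F a b \<in> bilinear_map K (Hom C a b) (Val F a) (Val F b)"
    and kfun_Id: "a \<in> Obj C \<Longrightarrow> x \<in> carrier (Val F a) \<Longrightarrow> Act F a a (Id C a) x = x"
    and kfun_comp: "a \<in> Obj C \<Longrightarrow> b \<in> Obj C \<Longrightarrow> c \<in> Obj C \<Longrightarrow> f \<in> carrier (Hom C a b) \<Longrightarrow>
      g \<in> carrier (Hom C b c) \<Longrightarrow> x \<in> carrier (Val F a) \<Longrightarrow>
      Act F a c (Comp C a b c g f) x = Act F b c g (Act F a b f x)"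
  using assms by (auto simp: k_functor_def)

lemma kfun_closed:
  "k_functor K C F \<Longrightarrow> a \<in> Obj C \<Longrightarrow> b \<in> Obj C \<Longrightarrow> f \<in> carrier (Hom C a b) \<Longrightarrow> x \<in> carrier (Val F a) \<Longrightarrow>
   Act F a b f x \<in> carrier (Val F b)"
  using kfun_bilinear bilinear_map_closed by metis

lemma kfun_linear:
  "k_functor K C F \<Longrightarrow> a \<in> Obj C \<Longrightarrow> b \<in> Obj C \<Longrightarrow> f \<in> carrier (Hom C a b) \<Longrightarrow>
   Act F a b f \<in> linear_map K (Val F a) (Val F b)"
  by (rule bilinear_mapD1[OF kfun_bilinear])

lemma kfun_linear2:
  "k_functor K C F \<Longrightarrow> a \<in> Obj C \<Longrightarrow> b \<in> Obj C \<Longrightarrow> x \<in> carrier (Val F a) \<Longrightarrow>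
   (\<lambda>f. Act F a b f x) \<in> linear_map K (Hom C a b) (Val F b)"
  by (rule bilinear_mapD2[OF kfun_bilinear])

text \<open>The extensional normal form demanded by \<open>nat_trans\<close>; it allows
  transformations to be given by formulas that also have values off the carriers.\<close>

definition nat_of :: "('k, 'o, 'm) kcat \<Rightarrow> ('k, 'o, 'm, 'v) kfun \<Rightarrow> ('o \<Rightarrow> 'v \<Rightarrow> 'w) \<Rightarrow> 'o \<Rightarrow> 'v \<Rightarrow> 'w" where
  "nat_of C F \<phi> = (\<lambda>a\<in>Obj C. \<lambda>x\<in>carrier (Val F a). \<phi> a x)"

definition nat_id :: "('k, 'o, 'm) kcat \<Rightarrow> ('k, 'o, 'm, 'v) kfun \<Rightarrow> 'o \<Rightarrow> 'v \<Rightarrow> 'v" where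
  "nat_id C F = nat_of C F (\<lambda>a x. x)"

lemma nat_of_apply [simp]: "a \<in> Obj C \<Longrightarrow> x \<in> carrier (Val F a) \<Longrightarrow> nat_of C F \<phi> a x = \<phi> a x"
  by (simp add: nat_of_def)

lemma nat_id_apply [simp]: "a \<in> Obj C \<Longrightarrow> x \<in> carrier (Val F a) \<Longrightarrow> nat_id C F a x = x"
  by (simp add: nat_id_def)

lemma nat_comp_apply [simp]:
  "a \<in> Obj C \<Longrightarrow> x \<in> carrier (Val F a) \<Longrightarrow> nat_comp C F \<theta> \<eta> a x = \<theta> a (\<eta> a x)"
  by (simp add: nat_comp_def)

lemma nat_of_cong:
  "(\<And>a x. a \<in> Obj C \<Longrightarrow> x \<in> carrier (Val F a) \<Longrightarrow> \<phi> a x = \<psi> a x) \<Longrightarrow> nat_of C F \<phi> = nat_of C F \<psi>"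
  by (auto simp: nat_of_def intro!: restrict_ext)

lemma nat_linear: "\<eta> \<in> nat_trans K C F G \<Longrightarrow> a \<in> Obj C \<Longrightarrow> \<eta> a \<in> linear_map K (Val F a) (Val G a)"
  by (auto simp: nat_trans_def)

lemma nat_natural:
  "\<eta> \<in> nat_trans K C F G \<Longrightarrow> a \<in> Obj C \<Longrightarrow> b \<in> Obj C \<Longrightarrow> f \<in> carrier (Hom C a b) \<Longrightarrow> x \<in> carrier (Val F a) \<Longrightarrow>
   \<eta> b (Act F a b f x) = Act G a b f (\<eta> a x)"
  by (auto simp: nat_trans_def)

lemma nat_closed: "\<eta> \<in> nat_trans K C F G \<Longrightarrow> a \<in> Obj C \<Longrightarrow> x \<in> carrier (Val F a) \<Longrightarrow> \<eta> a x \<in> carrier (Val G a)"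
  using nat_linear linear_map_closed by metis

lemma nat_eqI:
  assumes "\<eta> \<in> nat_trans K C F G" "\<theta> \<in> nat_trans K C F G'"
    and "\<And>a x. a \<in> Obj C \<Longrightarrow> x \<in> carrier (Val F a) \<Longrightarrow> \<eta> a x = \<theta> a x"
  shows "\<eta> = \<theta>"
proof -
  have "\<eta> a = \<theta> a" if a: "a \<in> Obj C" for a
    using assms a by (intro extensionalityI[of _ "carrier (Val F a)"]) (auto simp: nat_trans_def PiE_mem)
  then show ?thesis
    using assms(1,2) by (intro extensionalityI[of _ "Obj C"]) (auto simp: nat_trans_def PiE_def)
qed

lemma nat_space_simps:
  "carrier (nat_space K C F G) = nat_trans K C F G"
  "\<zero>\<^bsub>nat_space K C F G\<^esub> = nat_of C F (\<lambda>a x. \<zero>\<^bsub>Val G a\<^esub>)"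
  "\<eta> \<oplus>\<^bsub>nat_space K C F G\<^esub> \<theta> = nat_of C F (\<lambda>a x. \<eta> a x \<oplus>\<^bsub>Val G a\<^esub> \<theta> a x)"
  "r \<odot>\<^bsub>nat_space K C F G\<^esub> \<eta> = nat_of C F (\<lambda>a x. r \<odot>\<^bsub>Val G a\<^esub> \<eta> a x)"
  by (auto simp: nat_space_def nat_of_def)

lemma nat_comp_alt: "nat_comp C F \<theta> \<eta> = nat_of C F (\<lambda>a x. \<theta> a (\<eta> a x))"
  by (simp add: nat_comp_def nat_of_def)

context ground
begin

lemma nat_ofI:
  assumes F: "k_functor K C F"
    and "\<And>a. a \<in> Obj C \<Longrightarrow> \<phi> a \<in> linear_map K (Val F a) (Val G a)"
    and "\<And>a b f x. a \<in> Obj C \<Longrightarrow> b \<in> Obj C \<Longrightarrow> f \<in> carrier (Hom C a b) \<Longrightarrow> x \<in> carrier (Val F a) \<Longrightarrow>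
      \<phi> b (Act F a b f x) = Act G a b f (\<phi> a x)"
  shows "nat_of C F \<phi> \<in> nat_trans K C F G"
  unfolding nat_trans_def nat_of_def
  using assms kfun_closed[OF F] by (auto simp: linear_map_restrict[OF kfun_module[OF F]])

lemma nat_id_closed: "k_functor K C F \<Longrightarrow> nat_id C F \<in> nat_trans K C F F"
  unfolding nat_id_def by (rule nat_ofI) (auto intro: linear_mapI)

lemma nat_comp_closed:
  assumes "k_functor K C F" "\<eta> \<in> nat_trans K C F G" "\<theta> \<in> nat_trans K C G H"
  shows "nat_comp C F \<theta> \<eta> \<in> nat_trans K C F H"
  unfolding nat_comp_alt
  by (rule nat_ofI[OF assms(1)])
    (use assms in \<open>auto intro: linear_map_comp nat_linear simp: nat_natural[OF assms(2)]
      nat_natural[OF assms(3)] nat_closed\<close>)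

lemma nat_comp_assoc:
  assumes "k_functor K C F" "\<eta> \<in> nat_trans K C F G" "\<theta> \<in> nat_trans K C G H" "\<zeta> \<in> nat_trans K C H J"
    and "k_functor K C G"
  shows "nat_comp C F (nat_comp C G \<zeta> \<theta>) \<eta> = nat_comp C F \<zeta> (nat_comp C F \<theta> \<eta>)"
  using assms by (intro nat_eqI[OF nat_comp_closed nat_comp_closed]) (auto intro: nat_comp_closed simp: nat_closed)

lemma nat_comp_id_right:
  assumes "k_functor K C F" "\<eta> \<in> nat_trans K C F G"
  shows "nat_comp C F \<eta> (nat_id C F) = \<eta>"
  using assms by (intro nat_eqI[OF nat_comp_closed assms(2)]) (auto intro: nat_id_closed)

lemma module_nat_space:
  assumes F: "k_functor K C F" and G: "k_functor K C G"
  shows "module K (nat_space K C F G)"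
proof -
  note FM = kfun_module[OF F] and GM = kfun_module[OF G]
  have add: "nat_of C F (\<lambda>a x. \<eta> a x \<oplus>\<^bsub>Val G a\<^esub> \<theta> a x) \<in> nat_trans K C F G"
    if "\<eta> \<in> nat_trans K C F G" "\<theta> \<in> nat_trans K C F G" for \<eta> \<theta>
    using that linear_map_plus[OF FM GM nat_linear[OF that(1)] nat_linear[OF that(2)]] by (intro nat_ofI[OF F])
      (auto simp: nat_natural[OF that(1)] nat_natural[OF that(2)]
        linear_map_add[OF kfun_linear[OF G]] nat_closed[of _ K C F G])
  have smult: "nat_of C F (\<lambda>a x. r \<odot>\<^bsub>Val G a\<^esub> \<eta> a x) \<in> nat_trans K C F G"
    if "\<eta> \<in> nat_trans K C F G" "r \<in> carrier K" for \<eta> r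
    using that linear_map_scale[OF GM nat_linear[OF that(1)] that(2)] by (intro nat_ofI[OF F])
      (auto simp: nat_natural[OF that(1)]
        linear_map_smult[OF kfun_linear[OF G]] nat_closed[of _ K C F G])
  have zero: "nat_of C F (\<lambda>a x. \<zero>\<^bsub>Val G a\<^esub>) \<in> nat_trans K C F G"
    by (intro nat_ofI[OF F])
      (auto intro!: linear_map_const_zero GM simp: linear_map_zero[OF GM GM kfun_linear[OF G]])
  show ?thesis
    by (rule moduleI_zero_smult; unfold nat_space_simps)
      (auto intro!: add smult zero nat_eqI[of _ K C F G _ G]
         abelian_monoid.a_assoc[OF abelian_group.axioms(1)[OF module.axioms(2)[OF GM]]]
         abelian_monoid.a_comm[OF abelian_group.axioms(1)[OF module.axioms(2)[OF GM]]]
         module.smult_l_distr[OF GM] module.smult_r_distr[OF GM] module.smult_assoc1[OF GM]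
         simp: nat_closed[of _ K C F G] mod_simps(1-3)[OF GM] add_zero[OF GM] zero_add[OF GM]
         one_smult[OF GM] zero_smult[OF GM])
qed

lemma linear_map_nat_comp_right:
  assumes F: "k_functor K C F" and G: "k_functor K C G" and H: "k_functor K C H"
    and \<eta>: "\<eta> \<in> nat_trans K C F G"
  shows "(\<lambda>\<theta>. nat_comp C F \<theta> \<eta>) \<in> linear_map K (nat_space K C G H) (nat_space K C F H)"
proof (rule linear_mapI)
  note cl = nat_comp_closed[OF F \<eta>]
  show "nat_comp C F \<theta> \<eta> \<in> carrier (nat_space K C F H)" if "\<theta> \<in> carrier (nat_space K C G H)" for \<theta>
    using that cl by (simp add: nat_space_simps)
  show "nat_comp C F (\<theta> \<oplus>\<^bsub>nat_space K C G H\<^esub> \<theta>') \<eta> =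
      nat_comp C F \<theta> \<eta> \<oplus>\<^bsub>nat_space K C F H\<^esub> nat_comp C F \<theta>' \<eta>"
    if "\<theta> \<in> carrier (nat_space K C G H)" "\<theta>' \<in> carrier (nat_space K C G H)" for \<theta> \<theta>'
    by (rule nat_eqI[of _ K C F H _ H])
      (use that cl[of \<theta> H] cl[of \<theta>' H] nat_closed[OF \<eta>] add_closed[OF module_nat_space[OF G H] that]
          add_closed[OF module_nat_space[OF F H], of "nat_comp C F \<theta> \<eta>" "nat_comp C F \<theta>' \<eta>"]
        in \<open>auto simp: nat_space_simps intro!: cl\<close>)
  show "nat_comp C F (r \<odot>\<^bsub>nat_space K C G H\<^esub> \<theta>) \<eta> = r \<odot>\<^bsub>nat_space K C F H\<^esub> nat_comp C F \<theta> \<eta>"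
    if "r \<in> carrier K" "\<theta> \<in> carrier (nat_space K C G H)" for r \<theta>
    by (rule nat_eqI[of _ K C F H _ H])
      (use that cl[of \<theta> H] nat_closed[OF \<eta>] smult_closed[OF module_nat_space[OF G H] that]
          smult_closed[OF module_nat_space[OF F H], of r "nat_comp C F \<theta> \<eta>"]
        in \<open>auto simp: nat_space_simps intro!: cl\<close>)
qed

lemma linear_map_nat_comp_left:
  assumes F: "k_functor K C F" and G: "k_functor K C G" and H: "k_functor K C H"
    and \<theta>: "\<theta> \<in> nat_trans K C G H"
  shows "(\<lambda>\<eta>. nat_comp C F \<theta> \<eta>) \<in> linear_map K (nat_space K C F G) (nat_space K C F H)"
proof (rule linear_mapI)
  note cl = nat_comp_closed[OF F _ \<theta>]
  show "nat_comp C F \<theta> \<eta> \<in> carrier (nat_space K C F H)" if "\<eta> \<in> carrier (nat_space K C F G)" for \<eta>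
    using that cl by (simp add: nat_space_simps)
  show "nat_comp C F \<theta> (\<eta> \<oplus>\<^bsub>nat_space K C F G\<^esub> \<eta>') =
      nat_comp C F \<theta> \<eta> \<oplus>\<^bsub>nat_space K C F H\<^esub> nat_comp C F \<theta> \<eta>'"
    if "\<eta> \<in> carrier (nat_space K C F G)" "\<eta>' \<in> carrier (nat_space K C F G)" for \<eta> \<eta>'
    by (rule nat_eqI[of _ K C F H _ H])
      (use that cl[of \<eta>] cl[of \<eta>'] add_closed[OF module_nat_space[OF F G] that]
          add_closed[OF module_nat_space[OF F H], of "nat_comp C F \<theta> \<eta>" "nat_comp C F \<theta> \<eta>'"]
        in \<open>auto simp: nat_space_simps linear_map_add[OF nat_linear[OF \<theta>]] nat_closed[of _ K C F G] intro!: cl\<close>)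
  show "nat_comp C F \<theta> (r \<odot>\<^bsub>nat_space K C F G\<^esub> \<eta>) = r \<odot>\<^bsub>nat_space K C F H\<^esub> nat_comp C F \<theta> \<eta>"
    if "r \<in> carrier K" "\<eta> \<in> carrier (nat_space K C F G)" for r \<eta>
    by (rule nat_eqI[of _ K C F H _ H])
      (use that cl[of \<eta>] smult_closed[OF module_nat_space[OF F G] that]
          smult_closed[OF module_nat_space[OF F H], of r "nat_comp C F \<theta> \<eta>"]
        in \<open>auto simp: nat_space_simps linear_map_smult[OF nat_linear[OF \<theta>]] nat_closed[of _ K C F G] intro!: cl\<close>)
qed

subsection \<open>Free functors\<close>

definition free_index :: "('k, 'o, 'm) kcat \<Rightarrow> ('k, 'o, 'm, 'v) kfun \<Rightarrow> ('o \<times> 'v) set" where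
  "free_index C F = (SIGMA b:Obj C. carrier (Val F b))"

text \<open>The coproduct of the representables \<open>C(b, -)\<close>, one for every object
  \<open>b\<close> and every element \<open>x\<close> of \<open>F(b)\<close>.\<close>

definition free_fun :: "('k, 'o, 'm) kcat \<Rightarrow> ('k, 'o, 'm, 'v) kfun \<Rightarrow> ('k, 'o, 'm, 'o \<times> 'v \<Rightarrow> 'm) kfun" where
  "free_fun C F =
     \<lparr>Val = (\<lambda>a. dsum (free_index C F) (\<lambda>i. Hom C (fst i) a)),
      Act = (\<lambda>a b m f. \<lambda>i\<in>free_index C F. Comp C (fst i) a b m (f i))\<rparr>"

text \<open>The universal element that Yoneda assigns to the summand with index
  \<open>(b, x)\<close>.\<close>

definition free_fun_gen :: "('k, 'o, 'm) kcat \<Rightarrow> ('k, 'o, 'm, 'v) kfun \<Rightarrow> 'o \<Rightarrow> 'v \<Rightarrow> 'o \<times> 'v \<Rightarrow> 'm" where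
  "free_fun_gen C F b x = dsum_inj (free_index C F) (\<lambda>i. Hom C (fst i) b) (b, x) (Id C b)"

text \<open>The transformation that Yoneda attaches to a choice of elements \<open>e b x\<close> of
  \<open>G(b)\<close>: it takes \<open>m : b \<rightarrow> a\<close> in the summand
  \<open>(b, x)\<close> to \<open>G(m)(e b x)\<close>.\<close>

definition free_map :: "('k, 'o, 'm) kcat \<Rightarrow> ('k, 'o, 'm, 'v) kfun \<Rightarrow> ('k, 'o, 'm, 'w) kfun \<Rightarrow>
    ('o \<Rightarrow> 'v \<Rightarrow> 'w) \<Rightarrow> 'o \<Rightarrow> ('o \<times> 'v \<Rightarrow> 'm) \<Rightarrow> 'w" where
  "free_map C F G e = nat_of C (free_fun C F) (\<lambda>a. dsum_eval (free_index C F) (\<lambda>i. Hom C (fst i) a) (Val G a)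
     (\<lambda>i m. Act G (fst i) a m (e (fst i) (snd i))))"

context
  fixes C :: "('k, 'o, 'm) kcat" and F :: "('k, 'o, 'm, 'v) kfun"
  assumes C: "k_category K C"
begin

private abbreviation "S \<equiv> free_index C F"
private abbreviation "H a \<equiv> (\<lambda>i. Hom C (fst i) a)"

lemma free_index_fst: "i \<in> S \<Longrightarrow> fst i \<in> Obj C"
  by (auto simp: free_index_def)

lemma free_index_Hom_module: "a \<in> Obj C \<Longrightarrow> i \<in> S \<Longrightarrow> module K (H a i)"
  by (rule kcat_module[OF C free_index_fst])

lemma Act_free: "Act (free_fun C F) a b m f = (\<lambda>i\<in>S. Comp C (fst i) a b m (f i))"
  by (simp add: free_fun_def)

lemma Val_free: "Val (free_fun C F) a = dsum S (H a)"
  by (simp add: free_fun_def)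

text \<open>Composition with \<open>m\<close> sends zero to zero, so the support can only
  shrink.\<close>

lemma Act_free_closed:
  assumes "a \<in> Obj C" "b \<in> Obj C" "m \<in> carrier (Hom C a b)" "f \<in> carrier (dsum S (H a))"
  shows "(\<lambda>i\<in>S. Comp C (fst i) a b m (f i)) \<in> carrier (dsum S (H b))"
proof -
  have "{i \<in> S. Comp C (fst i) a b m (f i) \<noteq> \<zero>\<^bsub>H b i\<^esub>} \<subseteq> {i \<in> S. f i \<noteq> \<zero>\<^bsub>H a i\<^esub>}"
    using assms linear_map_zero[OF free_index_Hom_module free_index_Hom_module bilinear_mapD1[OF kcat_bilinear[OF C free_index_fst]]] by force
  from finite_subset[OF this] show ?thesis
    using assms dsum_mem[OF assms(4)] free_index_fst by (auto simp: dsum_simps kcat_comp_closed[OF C] cong: conj_cong)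
qed

lemma Act_dsum_inj:
  assumes "a \<in> Obj C" "b \<in> Obj C" "m \<in> carrier (Hom C a b)" "i \<in> S" "x \<in> carrier (H a i)"
  shows "Act (free_fun C F) a b m (dsum_inj S (H a) i x) = dsum_inj S (H b) i (Comp C (fst i) a b m x)"
  unfolding Act_free using assms
  by (intro dsum_eqI[OF Act_free_closed dsum_inj_closed] free_index_Hom_module dsum_inj_closed kcat_comp_closed[OF C] free_index_fst)
    (auto simp: dsum_inj_def linear_map_zero[OF free_index_Hom_module free_index_Hom_module bilinear_mapD1[OF kcat_bilinear[OF C free_index_fst]]])

lemma k_functor_free: "k_functor K C (free_fun C F)"
proof -
  note bil = kcat_bilinear[OF C free_index_fst]
  have "(\<lambda>m f. \<lambda>i\<in>S. Comp C (fst i) a b m (f i)) \<in> bilinear_map K (Hom C a b) (dsum S (H a)) (dsum S (H b))"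
    if ab: "a \<in> Obj C" "b \<in> Obj C" for a b
    using ab dsum_mem[of _ S "H a"]
    by (intro bilinear_mapI linear_mapI Act_free_closed)
      (simp_all add: dsum_simps(2-4) linear_map_add[OF bilinear_mapD1[OF bil]] linear_map_smult[OF bilinear_mapD1[OF bil]]
        linear_map_add[OF bilinear_mapD2[OF bil]] linear_map_smult[OF bilinear_mapD2[OF bil]] cong: restrict_cong)
  then show ?thesis
    unfolding k_functor_def
    by (intro conjI ballI)
      (simp_all add: free_fun_def module_dsum free_index_Hom_module free_index_fst dsum_mem[of _ S "H _"] kcat_Id_left[OF C] kcat_assoc[OF C]
        dsum_restrict cong: restrict_cong)
qed

lemma free_fun_gen_closed: "b \<in> Obj C \<Longrightarrow> x \<in> carrier (Val F b) \<Longrightarrow> free_fun_gen C F b x \<in> carrier (Val (free_fun C F) b)"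
  unfolding free_fun_gen_def Val_free
  by (rule dsum_inj_closed) (auto simp: free_index_Hom_module free_index_def kcat_Id[OF C])

text \<open>Composing \<open>m\<close> with an identity returns \<open>m\<close>; hence the
  universal elements generate the functor.\<close>

lemma Act_free_gen:
  assumes "a \<in> Obj C" "b \<in> Obj C" "m \<in> carrier (Hom C b a)" "x \<in> carrier (Val F b)"
  shows "Act (free_fun C F) b a m (free_fun_gen C F b x) = dsum_inj S (H a) (b, x) m"
  unfolding free_fun_gen_def using assms
  by (subst Act_dsum_inj) (auto simp: kcat_Id[OF C] kcat_Id_right[OF C] free_index_def)

context
  fixes G :: "('k, 'o, 'm, 'w) kfun"
  assumes G: "k_functor K C G"
begin

text \<open>The uniqueness half of Yoneda: naturality propagates agreement from the universal
  elements to all elements of single summands, and these span.\<close>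

lemma free_nat_eqI:
  assumes \<eta>: "\<eta> \<in> nat_trans K C (free_fun C F) G" and \<theta>: "\<theta> \<in> nat_trans K C (free_fun C F) G"
    and eq: "\<And>b x. b \<in> Obj C \<Longrightarrow> x \<in> carrier (Val F b) \<Longrightarrow> \<eta> b (free_fun_gen C F b x) = \<theta> b (free_fun_gen C F b x)"
  shows "\<eta> = \<theta>"
proof (rule nat_eqI[OF \<eta> \<theta>])
  fix a f assume a: "a \<in> Obj C" and f: "f \<in> carrier (Val (free_fun C F) a)"
  show "\<eta> a f = \<theta> a f"
  proof (rule dsum_linear_eqI[OF free_index_Hom_module[OF a] kfun_module[OF G a], where f = "\<eta> a" and g = "\<theta> a" and X = f])
    show "\<eta> a \<in> linear_map K (dsum S (H a)) (Val G a)" "\<theta> a \<in> linear_map K (dsum S (H a)) (Val G a)"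
      using nat_linear[OF \<eta> a] nat_linear[OF \<theta> a] by (simp_all add: Val_free)
    show "f \<in> carrier (dsum S (H a))" using f by (simp add: Val_free)
    fix i m assume "i \<in> S" and m: "m \<in> carrier (H a i)"
    then obtain b x where i: "i = (b, x)" "b \<in> Obj C" "x \<in> carrier (Val F b)" by (auto simp: free_index_def)
    have "\<zeta> a (dsum_inj S (H a) i m) = Act G b a m (\<zeta> b (free_fun_gen C F b x))"
      if \<zeta>: "\<zeta> \<in> nat_trans K C (free_fun C F) G" for \<zeta>
      using nat_natural[OF \<zeta> i(2) a _ free_fun_gen_closed[OF i(2,3)], of m] m i
      by (simp add: Act_free_gen[OF a])
    from this[OF \<eta>] this[OF \<theta>] show "\<eta> a (dsum_inj S (H a) i m) = \<theta> a (dsum_inj S (H a) i m)"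
      using eq[OF i(2,3)] by simp
  qed simp
qed

context
  fixes e
  assumes e: "\<And>b x. b \<in> Obj C \<Longrightarrow> x \<in> carrier (Val F b) \<Longrightarrow> e b x \<in> carrier (Val G b)"
begin

lemma Act_family_linear: "a \<in> Obj C \<Longrightarrow> i \<in> S \<Longrightarrow> (\<lambda>m. Act G (fst i) a m (e (fst i) (snd i))) \<in> linear_map K (H a i) (Val G a)"
  by (rule kfun_linear2[OF G]) (auto simp: free_index_def e)

lemma free_map_closed: "free_map C F G e \<in> nat_trans K C (free_fun C F) G"
  unfolding free_map_def
proof (rule nat_ofI[OF k_functor_free])
  let ?L = "\<lambda>a. dsum_eval S (H a) (Val G a) (\<lambda>i m. Act G (fst i) a m (e (fst i) (snd i)))"
  have L: "?L a \<in> linear_map K (dsum S (H a)) (Val G a)" if "a \<in> Obj C" for a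
    by (rule linear_map_dsum_eval[OF free_index_Hom_module kfun_module[OF G] Act_family_linear]) (use that in auto)
  then show "?L a \<in> linear_map K (Val (free_fun C F) a) (Val G a)" if "a \<in> Obj C" for a
    using that by (simp add: Val_free)
  fix a b m f assume ab: "a \<in> Obj C" "b \<in> Obj C" and m: "m \<in> carrier (Hom C a b)" and f: "f \<in> carrier (Val (free_fun C F) a)"
  show "?L b (Act (free_fun C F) a b m f) = Act G a b m (?L a f)"
  proof (rule dsum_linear_eqI[OF free_index_Hom_module[OF ab(1)] kfun_module[OF G ab(2)], where X = f
      and f = "\<lambda>f. ?L b (Act (free_fun C F) a b m f)" and g = "\<lambda>f. Act G a b m (?L a f)"])
    show "f \<in> carrier (dsum S (H a))" using f by (simp add: Val_free)
    show "(\<lambda>f. Act G a b m (?L a f)) \<in> linear_map K (dsum S (H a)) (Val G b)"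
      by (rule linear_map_comp[OF L kfun_linear[OF G]]) (use ab m in auto)
    show "(\<lambda>f. ?L b (Act (free_fun C F) a b m f)) \<in> linear_map K (dsum S (H a)) (Val G b)"
      using linear_map_comp[OF kfun_linear[OF k_functor_free ab m] ] L[OF ab(2)] by (simp add: Val_free)
    fix i x assume i: "i \<in> S" and x: "x \<in> carrier (H a i)"
    have "snd i \<in> carrier (Val F (fst i))" using i by (auto simp: free_index_def)
    then show "?L b (Act (free_fun C F) a b m (dsum_inj S (H a) i x)) = Act G a b m (?L a (dsum_inj S (H a) i x))"
      using ab m i x e kfun_comp[OF G free_index_fst[OF i] ab x m]
      by (simp add: Act_dsum_inj kcat_comp_closed[OF C] free_index_fst
          dsum_eval_inj[OF free_index_Hom_module kfun_module[OF G] Act_family_linear])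
  qed simp
qed

lemma free_map_gen:
  assumes "b \<in> Obj C" "x \<in> carrier (Val F b)"
  shows "free_map C F G e b (free_fun_gen C F b x) = e b x"
proof -
  have "(b, x) \<in> S" using assms by (simp add: free_index_def)
  then have "dsum_eval S (H b) (Val G b) (\<lambda>i m. Act G (fst i) b m (e (fst i) (snd i))) (free_fun_gen C F b x) = e b x"
    unfolding free_fun_gen_def
    using assms e by (subst dsum_eval_inj[OF free_index_Hom_module kfun_module[OF G] Act_family_linear]) (auto simp: kcat_Id[OF C] kfun_Id[OF G])
  then show ?thesis
    using assms by (simp add: free_map_def free_fun_gen_closed)
qed

end

end

text \<open>A preimage is chosen for each universal element separately, and freeness assembles the
  choices into a transformation. The value types of \<open>E\<close> and \<open>B\<close> are
  arbitrary.\<close>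

lemma free_lift:
  fixes E :: "('k, 'o, 'm, 'x) kfun" and B :: "('k, 'o, 'm, 'y) kfun"
  assumes E: "k_functor K C E" and B: "k_functor K C B" and \<pi>: "\<pi> \<in> nat_trans K C E B"
    and \<phi>: "\<phi> \<in> nat_trans K C (free_fun C F) B" and surj: "objectwise_surj C E B \<pi>"
  shows "\<exists>\<psi>\<in>nat_trans K C (free_fun C F) E. nat_comp C (free_fun C F) \<pi> \<psi> = \<phi>"
proof -
  have "\<exists>y\<in>carrier (Val E b). \<pi> b y = \<phi> b (free_fun_gen C F b x)" if "b \<in> Obj C" "x \<in> carrier (Val F b)" for b x
    using surj nat_closed[OF \<phi> that(1) free_fun_gen_closed[OF that]] that
    unfolding objectwise_surj_def by (metis imageE)
  then obtain e where e: "\<And>b x. b \<in> Obj C \<Longrightarrow> x \<in> carrier (Val F b) \<Longrightarrow>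
      e b x \<in> carrier (Val E b) \<and> \<pi> b (e b x) = \<phi> b (free_fun_gen C F b x)"
    by metis
  have cl: "free_map C F E e \<in> nat_trans K C (free_fun C F) E"
    using e by (intro free_map_closed[OF E]) auto
  have "nat_comp C (free_fun C F) \<pi> (free_map C F E e) = \<phi>"
    by (rule free_nat_eqI[OF B nat_comp_closed[OF k_functor_free cl \<pi>] \<phi>])
      (use e in \<open>simp add: free_fun_gen_closed free_map_gen[OF E]\<close>)
  with cl show ?thesis by blast
qed

text \<open>An element \<open>x\<close> of \<open>F(a)\<close> is hit by the universal element of
  the summand \<open>(a, x)\<close>.\<close>

lemma free_counit:
  assumes "k_functor K C F"
  shows "free_map C F F (\<lambda>b x. x) \<in> nat_trans K C (free_fun C F) F"
    and "objectwise_surj C (free_fun C F) F (free_map C F F (\<lambda>b x. x))"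
proof -
  show 1: "free_map C F F (\<lambda>b x. x) \<in> nat_trans K C (free_fun C F) F"
    by (rule free_map_closed[OF assms])
  show "objectwise_surj C (free_fun C F) F (free_map C F F (\<lambda>b x. x))"
    unfolding objectwise_surj_def
    using nat_closed[OF 1] free_fun_gen_closed free_map_gen[OF assms, of "\<lambda>b x. x"]
    by (auto simp: image_iff) metis
qed

end

text \<open>Projectivity as a retract condition, which mentions no other value types and hence yields
  the lifting property for functors with values in arbitrary types.\<close>

definition split_projective :: "('k, 'o, 'm) kcat \<Rightarrow> ('k, 'o, 'm, 'v) kfun \<Rightarrow> bool" where
  "split_projective C P \<longleftrightarrow> k_functor K C P \<and>
     (\<exists>s\<in>nat_trans K C P (free_fun C P). nat_comp C P (free_map C P P (\<lambda>b x. x)) s = nat_id C P)"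

text \<open>Composed with the counit, \<phi> lifts from the free functor; precomposing that lift
  with the section \<open>s\<close> gives a lift of \<phi>.\<close>

lemma split_projective_lift:
  fixes E :: "('k, 'o, 'm, 'x) kfun" and B :: "('k, 'o, 'm, 'y) kfun"
  assumes C: "k_category K C" and P: "split_projective C P"
    and E: "k_functor K C E" and B: "k_functor K C B" and \<pi>: "\<pi> \<in> nat_trans K C E B"
    and \<phi>: "\<phi> \<in> nat_trans K C P B" and surj: "objectwise_surj C E B \<pi>"
  shows "\<exists>\<psi>\<in>nat_trans K C P E. nat_comp C P \<pi> \<psi> = \<phi>"
proof -
  let ?c = "free_map C P P (\<lambda>b x. x)"
  from P obtain s where s: "s \<in> nat_trans K C P (free_fun C P)" "nat_comp C P ?c s = nat_id C P" and P': "k_functor K C P"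
    by (auto simp: split_projective_def)
  note c = free_counit(1)[OF C P'] and free = k_functor_free[OF C, of P]
  obtain \<chi> where \<chi>: "\<chi> \<in> nat_trans K C (free_fun C P) E"
      "nat_comp C (free_fun C P) \<pi> \<chi> = nat_comp C (free_fun C P) \<phi> ?c"
    using free_lift[OF C E B \<pi> nat_comp_closed[OF free c \<phi>] surj] by blast
  have "nat_comp C P \<pi> (nat_comp C P \<chi> s) = nat_comp C P (nat_comp C (free_fun C P) \<pi> \<chi>) s"
    by (rule nat_comp_assoc[OF P' s(1) \<chi>(1) \<pi> free, symmetric])
  also have "\<dots> = nat_comp C P \<phi> (nat_comp C P ?c s)"
    unfolding \<chi>(2) by (rule nat_comp_assoc[OF P' s(1) c \<phi> free])
  also have "\<dots> = \<phi>" unfolding s(2) by (rule nat_comp_id_right[OF P' \<phi>])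
  finally show ?thesis using nat_comp_closed[OF P' s(1) \<chi>(1)] by blast
qed

lemma split_projectiveI:
  assumes C: "k_category K C" and P: "k_functor K C P"
    and "\<exists>s\<in>nat_trans K C P (free_fun C P). nat_comp C P (free_map C P P (\<lambda>b x. x)) s = nat_id C P"
  shows "split_projective C P"
  using assms by (simp add: split_projective_def)

end

subsection \<open>Subfunctors and exactness\<close>

definition sub_fun :: "('k, 'o, 'm, 'v) kfun \<Rightarrow> ('o \<Rightarrow> 'v set) \<Rightarrow> ('k, 'o, 'm, 'v) kfun" where
  "sub_fun F N = \<lparr>Val = (\<lambda>a. (Val F a)\<lparr>carrier := N a\<rparr>), Act = Act F\<rparr>"

definition ker_fun :: "('k, 'o, 'm, 'v) kfun \<Rightarrow> ('k, 'o, 'm, 'w) kfun \<Rightarrow> ('o \<Rightarrow> 'v \<Rightarrow> 'w) \<Rightarrow> ('k, 'o, 'm, 'v) kfun" where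
  "ker_fun F G \<eta> = sub_fun F (\<lambda>a. {x \<in> carrier (Val F a). \<eta> a x = \<zero>\<^bsub>Val G a\<^esub>})"

lemma sub_fun_simps [simp]:
  "carrier (Val (sub_fun F N) a) = N a" "\<zero>\<^bsub>Val (sub_fun F N) a\<^esub> = \<zero>\<^bsub>Val F a\<^esub>"
  "x \<oplus>\<^bsub>Val (sub_fun F N) a\<^esub> y = x \<oplus>\<^bsub>Val F a\<^esub> y" "r \<odot>\<^bsub>Val (sub_fun F N) a\<^esub> x = r \<odot>\<^bsub>Val F a\<^esub> x"
  "Act (sub_fun F N) = Act F"
  by (simp_all add: sub_fun_def)

lemma ker_fun_simps [simp]:
  "carrier (Val (ker_fun F G \<eta>) a) = {x \<in> carrier (Val F a). \<eta> a x = \<zero>\<^bsub>Val G a\<^esub>}"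
  "\<zero>\<^bsub>Val (ker_fun F G \<eta>) a\<^esub> = \<zero>\<^bsub>Val F a\<^esub>" "Act (ker_fun F G \<eta>) = Act F"
  by (simp_all add: ker_fun_def)

text \<open>Extensionality of a transformation concerns its source only, so passing to a subfunctor
  of the target changes nothing about the function. Inclusions of subfunctors thus act as identities
  on transformations.\<close>

lemma nat_trans_into_sub:
  assumes "\<eta> \<in> nat_trans K C P F" "\<And>a x. a \<in> Obj C \<Longrightarrow> x \<in> carrier (Val P a) \<Longrightarrow> \<eta> a x \<in> N a"
  shows "\<eta> \<in> nat_trans K C P (sub_fun F N)"
  using assms by (auto simp: nat_trans_def linear_map_def PiE_def Pi_def)

lemma nat_trans_from_sub:
  assumes "\<eta> \<in> nat_trans K C P (sub_fun F N)" "\<And>a. a \<in> Obj C \<Longrightarrow> N a \<subseteq> carrier (Val F a)"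
  shows "\<eta> \<in> nat_trans K C P F"
  using assms by (fastforce simp: nat_trans_def linear_map_def PiE_def Pi_def)

context ground
begin

lemma k_functor_sub:
  assumes F: "k_functor K C F"
    and N: "\<And>a. a \<in> Obj C \<Longrightarrow> subspace K (Val F a) (N a)"
    and stable: "\<And>a b f x. a \<in> Obj C \<Longrightarrow> b \<in> Obj C \<Longrightarrow> f \<in> carrier (Hom C a b) \<Longrightarrow> x \<in> N a \<Longrightarrow> Act F a b f x \<in> N b"
  shows "k_functor K C (sub_fun F N)"
proof -
  have sub: "x \<in> carrier (Val F a)" if "x \<in> N a" "a \<in> Obj C" for a x
    using N[OF that(2)] that(1) by (auto simp: subspace_def)
  have "module K (Val (sub_fun F N) a)" if "a \<in> Obj C" for a
    unfolding sub_fun_def using module_subspace[OF kfun_module[OF F that] N[OF that]] by simp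
  moreover have "Act F a b \<in> bilinear_map K (Hom C a b) (Val (sub_fun F N) a) (Val (sub_fun F N) b)"
    if "a \<in> Obj C" "b \<in> Obj C" for a b
    using that stable sub kfun_bilinear[OF F that]
    by (intro bilinear_mapI linear_mapI)
      (auto simp: linear_map_add[OF kfun_linear[OF F]] linear_map_smult[OF kfun_linear[OF F]]
        linear_map_add[OF kfun_linear2[OF F]] linear_map_smult[OF kfun_linear2[OF F]])
  ultimately show ?thesis
    unfolding k_functor_def using sub by (auto simp: kfun_Id[OF F] kfun_comp[OF F])
qed

lemma k_functor_ker:
  assumes F: "k_functor K C F" and G: "k_functor K C G" and \<eta>: "\<eta> \<in> nat_trans K C F G"
  shows "k_functor K C (ker_fun F G \<eta>)"
  unfolding ker_fun_def
  using assms
  by (intro k_functor_sub[OF F] subspace_kernel kfun_module[OF F] kfun_module[OF G] nat_linear[OF \<eta>])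
    (auto simp: kfun_closed[OF F] nat_natural[OF \<eta>]
      linear_map_zero[OF kfun_module[OF G] kfun_module[OF G] kfun_linear[OF G]])

text \<open>By naturality the image of \<xi> is a subfunctor of \<open>Y\<close>, and
  \<open>X\<close> surjects onto it. This is the form in which exactness of a complex supplies
  lifts.\<close>

lemma split_projective_lift_image:
  fixes X :: "('k, 'o, 'm, 'x) kfun" and Y :: "('k, 'o, 'm, 'y) kfun"
  assumes C: "k_category K C" and P: "split_projective C P"
    and X: "k_functor K C X" and Y: "k_functor K C Y"
    and \<xi>: "\<xi> \<in> nat_trans K C X Y" and \<alpha>: "\<alpha> \<in> nat_trans K C P Y"
    and im: "\<And>a x. a \<in> Obj C \<Longrightarrow> x \<in> carrier (Val P a) \<Longrightarrow> \<alpha> a x \<in> \<xi> a ` carrier (Val X a)"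
  shows "\<exists>\<psi>\<in>nat_trans K C P X. nat_comp C P \<xi> \<psi> = \<alpha>"
proof -
  let ?B = "sub_fun Y (\<lambda>a. \<xi> a ` carrier (Val X a))"
  have "Act Y a b f (\<xi> a x) \<in> \<xi> b ` carrier (Val X b)"
    if "a \<in> Obj C" "b \<in> Obj C" "f \<in> carrier (Hom C a b)" "x \<in> carrier (Val X a)" for a b f x
    using nat_natural[OF \<xi> that] kfun_closed[OF X that] by (metis imageI)
  then have "k_functor K C ?B"
    by (intro k_functor_sub[OF Y] subspace_image kfun_module[OF X] kfun_module[OF Y] nat_linear[OF \<xi>]) auto
  then show ?thesis
    by (rule split_projective_lift[OF C P X])
      (auto intro!: nat_trans_into_sub \<xi> \<alpha> im simp: objectwise_surj_def)
qed

subsection \<open>Transport along injections\<close>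

definition image_module :: "('k, 'v) module \<Rightarrow> ('v \<Rightarrow> 'w) \<Rightarrow> ('k, 'w) module" where
  "image_module V h = (let g = inv_into (carrier V) h in
     \<lparr>carrier = h ` carrier V, mult = undefined, one = undefined, zero = h \<zero>\<^bsub>V\<^esub>,
      add = (\<lambda>x y. h (g x \<oplus>\<^bsub>V\<^esub> g y)), smult = (\<lambda>a x. h (a \<odot>\<^bsub>V\<^esub> g x))\<rparr>)"

definition image_fun :: "('k, 'o, 'm, 'v) kfun \<Rightarrow> ('o \<Rightarrow> 'v \<Rightarrow> 'w) \<Rightarrow> ('k, 'o, 'm, 'w) kfun" where
  "image_fun F h = \<lparr>Val = (\<lambda>a. image_module (Val F a) (h a)),
     Act = (\<lambda>a b f y. h b (Act F a b f (inv_into (carrier (Val F a)) (h a) y)))\<rparr>"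

lemma image_module_simps:
  "carrier (image_module V h) = h ` carrier V" "\<zero>\<^bsub>image_module V h\<^esub> = h \<zero>\<^bsub>V\<^esub>"
  "x \<oplus>\<^bsub>image_module V h\<^esub> y = h (inv_into (carrier V) h x \<oplus>\<^bsub>V\<^esub> inv_into (carrier V) h y)"
  "a \<odot>\<^bsub>image_module V h\<^esub> x = h (a \<odot>\<^bsub>V\<^esub> inv_into (carrier V) h x)"
  by (simp_all add: image_module_def Let_def)

lemma
  assumes V: "module K V" and h: "inj_on h (carrier V)"
  shows module_image_module: "module K (image_module V h)"
    and linear_map_image_module: "h \<in> linear_map K V (image_module V h)"
    and linear_map_inv_image_module: "inv_into (carrier V) h \<in> linear_map K (image_module V h) V"
proof -
  note inv = inv_into_f_f[OF h]
  show "module K (image_module V h)"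
    by (rule module_surj_image[OF V, of _ h]) (simp_all add: image_module_simps inv)
  show "h \<in> linear_map K V (image_module V h)"
    by (rule linear_mapI) (simp_all add: image_module_simps inv)
  show "inv_into (carrier V) h \<in> linear_map K (image_module V h) V"
    by (rule linear_mapI) (auto simp: image_module_simps inv mod_simps[OF V])
qed

lemma image_fun_simps:
  "Val (image_fun F h) a = image_module (Val F a) (h a)"
  "Act (image_fun F h) a b f y = h b (Act F a b f (inv_into (carrier (Val F a)) (h a) y))"
  by (simp_all add: image_fun_def)

context
  fixes C :: "('k, 'o, 'm) kcat" and F :: "('k, 'o, 'm, 'v) kfun" and h :: "'o \<Rightarrow> 'v \<Rightarrow> 'w"
  assumes F: "k_functor K C F" and h: "\<And>a. a \<in> Obj C \<Longrightarrow> inj_on (h a) (carrier (Val F a))"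
begin

lemma k_functor_image: "k_functor K C (image_fun F h)"
proof -
  note inv = linear_map_inv_image_module[OF kfun_module[OF F] h]
  note lin = linear_map_image_module[OF kfun_module[OF F] h]
  have "(\<lambda>f y. h b (Act F a b f (inv_into (carrier (Val F a)) (h a) y)))
      \<in> bilinear_map K (Hom C a b) (image_module (Val F a) (h a)) (image_module (Val F b) (h b))"
    if "a \<in> Obj C" "b \<in> Obj C" for a b
    using that
    by (intro bilinear_mapI linear_map_comp[OF inv linear_map_comp[OF kfun_linear[OF F] lin]]
        linear_map_comp[OF kfun_linear2[OF F] lin] linear_map_closed[OF inv])
  then show ?thesis
    using h unfolding k_functor_def
    by (auto simp: image_fun_def module_image_module[OF kfun_module[OF F]] image_module_simps
        kfun_Id[OF F] kfun_comp[OF F] kfun_closed[OF F])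
qed

lemma nat_image: "nat_of C F h \<in> nat_trans K C F (image_fun F h)"
  by (rule nat_ofI[OF F])
    (auto simp: image_fun_simps linear_map_image_module[OF kfun_module[OF F]] h)

lemma nat_image_inv:
  "nat_of C (image_fun F h) (\<lambda>a. inv_into (carrier (Val F a)) (h a)) \<in> nat_trans K C (image_fun F h) F"
  by (rule nat_ofI[OF k_functor_image])
    (auto simp: image_fun_simps image_module_simps linear_map_inv_image_module[OF kfun_module[OF F]] h kfun_closed[OF F])

end

text \<open>The copy is isomorphic to a free functor, but freeness applies to the original: a lift
  is found for the encoding map and is turned into a section by composing with the decoding
  map.\<close>

lemma image_free_fun_split_projective:
  assumes C: "k_category K C" and h: "\<And>a. a \<in> Obj C \<Longrightarrow> inj_on (h a) (carrier (Val (free_fun C G) a))"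
  shows "split_projective C (image_fun (free_fun C G) h)"
proof -
  let ?F = "free_fun C G"
  let ?P = "image_fun ?F h"
  let ?to = "nat_of C ?F h" and ?from = "nat_of C ?P (\<lambda>a. inv_into (carrier (Val ?F a)) (h a))"
  let ?c = "free_map C ?P ?P (\<lambda>b x. x)"
  note F = k_functor_free[OF C, of G]
  have P: "k_functor K C ?P" by (rule k_functor_image[OF F h])
  have to: "?to \<in> nat_trans K C ?F ?P" by (rule nat_image[OF F h])
  have from_cl: "?from \<in> nat_trans K C ?P ?F" by (rule nat_image_inv[OF F h])
  note c = free_counit[OF C P] and fr = k_functor_free[OF C, of ?P]
  obtain \<chi> where \<chi>: "\<chi> \<in> nat_trans K C ?F (free_fun C ?P)" "nat_comp C ?F ?c \<chi> = ?to"
    using free_lift[OF C fr P c(1) to c(2)] by blast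
  have "nat_comp C ?P ?c (nat_comp C ?P \<chi> ?from) = nat_comp C ?P ?to ?from"
    using nat_comp_assoc[OF P from_cl \<chi>(1) c(1) F] \<chi>(2) by simp
  also have "\<dots> = nat_id C ?P"
    by (rule nat_eqI[OF nat_comp_closed[OF P from_cl to] nat_id_closed[OF P]])
      (use h in \<open>auto simp: image_fun_simps image_module_simps\<close>)
  finally show ?thesis
    using nat_comp_closed[OF P from_cl \<chi>(1)] by (intro split_projectiveI[OF C P]) blast
qed

end

subsection \<open>Encoding into lists\<close>

text \<open>
  Each entry is preceded by \<open>c\<close> and the end is marked by \<open>c'\<close>, so a concatenation of codes can be
  split again.  This keeps finitely supported functions on lists inside the type of lists.
\<close>

fun escape_list :: "'t \<Rightarrow> 't \<Rightarrow> 't list \<Rightarrow> 't list \<Rightarrow> 't list" where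
  "escape_list c c' [] r = c' # r"
| "escape_list c c' (x # l) r = c # x # escape_list c c' l r"

lemma escape_list_inj:
  "c \<noteq> c' \<Longrightarrow> escape_list c c' l r = escape_list c c' l' r' \<Longrightarrow> l = l' \<and> r = r'"
proof (induction l arbitrary: l')
  case Nil
  then show ?case by (cases l') auto
next
  case (Cons x l)
  then show ?case by (cases l') auto
qed

lemma foldr_escape_list_inj:
  assumes "c \<noteq> c'"
  shows "foldr (escape_list c c') ls [] = foldr (escape_list c c') ls' [] \<Longrightarrow> ls = ls'"
proof (induction ls arbitrary: ls')
  case Nil
  have "escape_list c c' l r \<noteq> []" for l r by (cases l) auto
  with Nil show ?case by (cases ls') (auto, metis)
next
  case (Cons l ls)
  have "escape_list c c' l r \<noteq> []" for l r by (cases l) auto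
  with Cons show ?case by (cases ls') (auto dest!: escape_list_inj[OF assms])
qed

context ground
begin

text \<open>Indices are listed together with their values, so decoding does not depend on knowing
  which enumeration of the support was chosen.\<close>

definition dsum_code :: "('i \<times> 'v \<Rightarrow> 't list) \<Rightarrow> 't \<Rightarrow> 't \<Rightarrow> 'i set \<Rightarrow> ('i \<Rightarrow> ('k, 'v) module) \<Rightarrow> ('i \<Rightarrow> 'v) \<Rightarrow> 't list" where
  "dsum_code code c c' S V f =
     foldr (escape_list c c') (map (\<lambda>i. code (i, f i)) (SOME l. set l = {i \<in> S. f i \<noteq> \<zero>\<^bsub>V i\<^esub>})) []"

text \<open>From the list of pairs, first components recover the enumeration of the support and
  second components the values on it; off the support both elements vanish.\<close>

lemma inj_on_dsum_code:
  assumes code: "inj code" and c: "c \<noteq> c'"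
  shows "inj_on (dsum_code code c c' S V) (carrier (dsum S V))"
proof (rule inj_onI)
  fix f g assume f: "f \<in> carrier (dsum S V)" and g: "g \<in> carrier (dsum S V)"
    and eq: "dsum_code code c c' S V f = dsum_code code c c' S V g"
  define l where "l f = (SOME l. set l = {i \<in> S. f i \<noteq> \<zero>\<^bsub>V i\<^esub>})" for f
  have l: "set (l f) = {i \<in> S. f i \<noteq> \<zero>\<^bsub>V i\<^esub>}" if "f \<in> carrier (dsum S V)" for f
    unfolding l_def using that by (intro someI_ex[of "\<lambda>l. set l = _"] finite_list) (auto simp: dsum_def)
  have m: "map (\<lambda>i. (i, f i)) (l f) = map (\<lambda>i. (i, g i)) (l g)"
    using foldr_escape_list_inj[OF c eq[unfolded dsum_code_def, folded l_def]] code
    by (intro map_injective[of code]) (auto simp: comp_def)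
  have lfg: "l f = l g"
    using arg_cong[OF m, of "map fst"] by (simp add: comp_def)
  then have "f i = g i" if "i \<in> set (l f)" for i
    using m that by auto
  moreover have "f i = g i" if "i \<in> S" "i \<notin> set (l f)" for i
  proof -
    have "i \<notin> {i \<in> S. f i \<noteq> \<zero>\<^bsub>V i\<^esub>}" "i \<notin> {i \<in> S. g i \<noteq> \<zero>\<^bsub>V i\<^esub>}"
      using that(2) lfg unfolding l[OF f, symmetric] l[OF g, symmetric] by simp_all
    then show ?thesis using that(1) by simp
  qed
  ultimately have "f i = g i" if "i \<in> S" for i using that by blast
  then show "f = g"
    using f g by (intro PiE_ext[of f S "\<lambda>i. carrier (V i)" g]) (auto simp: dsum_def)
qed

subsection \<open>Projective resolutions\<close>

text \<open>The result lies again in \<open>univ\<close>, so that free covers can be iterated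
  without leaving the type.\<close>

definition univ_code :: "('o \<times> ('k, 'o, 'm, 'w) univ) \<times> 'm \<Rightarrow> ('k, 'o, 'm, 'w) univ" where
  "univ_code = (\<lambda>((b, x), m). Inr (Inl b) # Inr (Inr (Inl m)) # x)"

text \<open>Any two distinct letters can serve as markers; taking them from different summands of
  the letter type makes them distinct. They may also occur as ordinary entries, since the code is
  read from the left.\<close>

definition free_cover_code :: "('k, 'o, 'm) kcat \<Rightarrow> ('k, 'o, 'm, ('k, 'o, 'm, 'w) univ) kfun \<Rightarrow>
    'o \<Rightarrow> ('o \<times> ('k, 'o, 'm, 'w) univ \<Rightarrow> 'm) \<Rightarrow> ('k, 'o, 'm, 'w) univ" where
  "free_cover_code C G a =
     dsum_code univ_code (Inl undefined) (Inr (Inl undefined)) (free_index C G) (\<lambda>i. Hom C (fst i) a)"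

definition free_cover :: "('k, 'o, 'm) kcat \<Rightarrow> ('k, 'o, 'm, ('k, 'o, 'm, 'w) univ) kfun \<Rightarrow>
    ('k, 'o, 'm, ('k, 'o, 'm, 'w) univ) kfun" where
  "free_cover C G = image_fun (free_fun C G) (free_cover_code C G)"

definition free_cover_map :: "('k, 'o, 'm) kcat \<Rightarrow> ('k, 'o, 'm, ('k, 'o, 'm, 'w) univ) kfun \<Rightarrow>
    'o \<Rightarrow> ('k, 'o, 'm, 'w) univ \<Rightarrow> ('k, 'o, 'm, 'w) univ" where
  "free_cover_map C G = nat_comp C (free_cover C G) (free_map C G G (\<lambda>b x. x))
     (nat_of C (free_cover C G) (\<lambda>a. inv_into (carrier (Val (free_fun C G) a)) (free_cover_code C G a)))"

lemma inj_on_free_cover_code: "inj_on (free_cover_code C G a) (carrier (Val (free_fun C G) a))"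
  unfolding free_cover_code_def free_fun_def
  by (simp, rule inj_on_dsum_code) (auto simp: inj_def univ_code_def)

text \<open>The conditions of \<open>proj_resolution\<close> with the intrinsic notion of
  projectivity. The value type is free, which admits complexes obtained by restriction or by cutting
  with an idempotent.\<close>

definition split_resolution :: "('k, 'o, 'm) kcat \<Rightarrow> ('k, 'o, 'm, 'w) kfun \<Rightarrow>
    (nat \<Rightarrow> ('k, 'o, 'm, 'v) kfun) \<Rightarrow> (nat \<Rightarrow> 'o \<Rightarrow> 'v \<Rightarrow> 'v) \<Rightarrow> ('o \<Rightarrow> 'v \<Rightarrow> 'w) \<Rightarrow> bool" where
  "split_resolution C F P d \<epsilon> \<longleftrightarrow>
     (\<forall>n. split_projective C (P n)) \<and>
     (\<forall>n. d n \<in> nat_trans K C (P (Suc n)) (P n)) \<and>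
     \<epsilon> \<in> nat_trans K C (P 0) F \<and>
     objectwise_surj C (P 0) F \<epsilon> \<and>
     (\<forall>a\<in>Obj C. exact_at (Val (P 1) a) (d 0 a) (Val (P 0) a) (\<epsilon> a) (Val F a)) \<and>
     (\<forall>n. \<forall>a\<in>Obj C.
        exact_at (Val (P (Suc (Suc n))) a) (d (Suc n) a) (Val (P (Suc n)) a) (d n a) (Val (P n) a))"

context
  fixes C :: "('k, 'o, 'm) kcat"
  assumes C: "k_category K C"
begin

lemma split_projective_imp_projective: "split_projective C P \<Longrightarrow> projective K C P"
  unfolding projective_def using split_projective_lift[OF C, of P] by (auto simp: split_projective_def)

context
  fixes G :: "('k, 'o, 'm, ('k, 'o, 'm, 'w) univ) kfun"
  assumes G: "k_functor K C G"
begin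

lemma split_projective_free_cover: "split_projective C (free_cover C G)"
  unfolding free_cover_def
  by (rule image_free_fun_split_projective[OF C inj_on_free_cover_code])

lemma k_functor_free_cover: "k_functor K C (free_cover C G)"
  using split_projective_free_cover by (simp add: split_projective_def)

lemma free_cover_inv: "nat_of C (free_cover C G) (\<lambda>a. inv_into (carrier (Val (free_fun C G) a)) (free_cover_code C G a))
    \<in> nat_trans K C (free_cover C G) (free_fun C G)"
  unfolding free_cover_def by (rule nat_image_inv[OF k_functor_free[OF C] inj_on_free_cover_code])

lemma free_cover_map_closed: "free_cover_map C G \<in> nat_trans K C (free_cover C G) G"
  unfolding free_cover_map_def
  by (rule nat_comp_closed[OF k_functor_free_cover free_cover_inv free_counit(1)[OF C G]])

lemma free_cover_map_surj: "objectwise_surj C (free_cover C G) G (free_cover_map C G)"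
  unfolding objectwise_surj_def
proof
  fix a assume a: "a \<in> Obj C"
  have "x \<in> free_cover_map C G a ` carrier (Val (free_cover C G) a)" if x: "x \<in> carrier (Val G a)" for x
  proof -
    obtain y where y: "y \<in> carrier (Val (free_fun C G) a)" "x = free_map C G G (\<lambda>b x. x) a y"
      using free_counit(2)[OF C G] a x by (auto simp: objectwise_surj_def)
    have c: "free_cover_code C G a y \<in> carrier (Val (free_cover C G) a)"
      using y by (simp add: free_cover_def image_fun_simps image_module_simps)
    have "free_cover_map C G a (free_cover_code C G a y) = x"
      using y c a inv_into_f_f[OF inj_on_free_cover_code y(1)] by (simp add: free_cover_map_def)
    with c show ?thesis by blast
  qed
  then show "free_cover_map C G a ` carrier (Val (free_cover C G) a) = carrier (Val G a)"
    using nat_closed[OF free_cover_map_closed a] by auto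
qed

text \<open>The free cover of \<open>G\<close> has values in the type of \<open>G\<close>, so the
  lifting property may be applied to it and splits it. Here projectivity relative to one type
  becomes intrinsic.\<close>

lemma projective_imp_split_projective:
  assumes "projective K C G"
  shows "split_projective C G"
proof -
  obtain s where s: "s \<in> nat_trans K C G (free_cover C G)" "nat_comp C G (free_cover_map C G) s = nat_id C G"
    using assms k_functor_free_cover free_cover_map_closed free_cover_map_surj nat_id_closed[OF G] G
    unfolding projective_def by blast
  let ?inv = "nat_of C (free_cover C G) (\<lambda>a. inv_into (carrier (Val (free_fun C G) a)) (free_cover_code C G a))"
  have "nat_comp C G (free_map C G G (\<lambda>b x. x)) (nat_comp C G ?inv s) = nat_id C G"
    using nat_comp_assoc[OF G s(1) free_cover_inv free_counit(1)[OF C G] k_functor_free_cover] s(2)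
    by (simp add: free_cover_map_def)
  then show ?thesis
    using nat_comp_closed[OF G s(1) free_cover_inv] by (intro split_projectiveI[OF C G]) blast
qed

end

section \<open>Existence of resolutions\<close>

text \<open>The syzygies are covered one after the other. A differential is the cover of the next
  syzygy followed by its inclusion, and as a function the inclusion is invisible.\<close>

lemma proj_resolution_exists:
  fixes F :: "('k, 'o, 'm, 'w) kfun"
  assumes F: "k_functor K C F"
  shows "\<exists>(P :: nat \<Rightarrow> ('k, 'o, 'm, ('k, 'o, 'm, 'w) univ) kfun) d \<epsilon>. proj_resolution K C F P d \<epsilon>"
proof -
  \<comment> \<open>Elements of \<open>F\<close> become one-letter words; this moves
    \<open>F\<close> itself into \<open>univ\<close> before the iteration starts.\<close>
  define h where "h = (\<lambda>(a :: 'o) x. [Inr (Inr (Inr x))] :: ('k, 'o, 'm, 'w) univ)"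
  have h: "inj_on (h a) (carrier (Val F a))" for a by (auto simp: h_def inj_on_def)
  \<comment> \<open>\<open>N n\<close> is the \<open>n\<close>-th syzygy: the encoded
    \<open>F\<close>, then successively the kernels of free covers.\<close>
  define N where "N = rec_nat (image_fun F h) (\<lambda>n G. ker_fun (free_cover C G) G (free_cover_map C G))"
  define P where "P n = free_cover C (N n)" for n
  define d where "d n = free_cover_map C (N (Suc n))" for n
  let ?inv = "nat_of C (image_fun F h) (\<lambda>a. inv_into (carrier (Val F a)) (h a))"
  define \<epsilon> where "\<epsilon> = nat_comp C (P 0) ?inv (free_cover_map C (N 0))"
  have N0: "N 0 = image_fun F h" and NS: "N (Suc n) = ker_fun (P n) (N n) (free_cover_map C (N n))" for n
    by (simp_all add: N_def P_def)
  have N: "k_functor K C (N n)" for n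
  proof (induction n)
    case 0 then show ?case unfolding N0 by (rule k_functor_image[OF F h])
  next
    case (Suc n) then show ?case
      unfolding NS P_def by (intro k_functor_ker k_functor_free_cover free_cover_map_closed)
  qed
  have P: "k_functor K C (P n)" for n unfolding P_def by (rule k_functor_free_cover[OF N])
  have m: "free_cover_map C (N n) \<in> nat_trans K C (P n) (N n)" for n
    unfolding P_def by (rule free_cover_map_closed[OF N])
  have surj: "free_cover_map C (N n) a ` carrier (Val (P n) a) = carrier (Val (N n) a)" if "a \<in> Obj C" for n a
    using free_cover_map_surj[OF N] that unfolding P_def objectwise_surj_def by blast
  have inv: "?inv \<in> nat_trans K C (N 0) F" unfolding N0 by (rule nat_image_inv[OF F h])
  have inv0: "?inv a x = \<zero>\<^bsub>Val F a\<^esub> \<longleftrightarrow> x = \<zero>\<^bsub>Val (N 0) a\<^esub>" if "a \<in> Obj C" "x \<in> carrier (Val (N 0) a)" for a x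
    using that h zero_closed[OF kfun_module[OF F]] inv_into_f_f[OF h]
    by (auto simp: N0 image_fun_simps image_module_simps)
  have "d n \<in> nat_trans K C (P (Suc n)) (P n)" for n
    using m[of "Suc n"] unfolding d_def NS ker_fun_def by (rule nat_trans_from_sub) auto
  moreover have "\<epsilon> \<in> nat_trans K C (P 0) F"
    unfolding \<epsilon>_def by (rule nat_comp_closed[OF P m inv])
  moreover have "objectwise_surj C (P 0) F \<epsilon>"
    unfolding objectwise_surj_def
  proof
    fix a assume a: "a \<in> Obj C"
    have "\<epsilon> a ` carrier (Val (P 0) a) = ?inv a ` free_cover_map C (N 0) a ` carrier (Val (P 0) a)"
      using a by (auto simp: \<epsilon>_def image_iff)
    also have "\<dots> = ?inv a ` carrier (Val (N 0) a)" using surj[OF a] by simp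
    also have "\<dots> = carrier (Val F a)"
      using a nat_closed[OF inv a] inv_into_f_f[OF h]
      by (force simp: N0 image_fun_simps image_module_simps image_iff)
    finally show "\<epsilon> a ` carrier (Val (P 0) a) = carrier (Val F a)" .
  qed
  moreover have "exact_at (Val (P 1) a) (d 0 a) (Val (P 0) a) (\<epsilon> a) (Val F a)" if a: "a \<in> Obj C" for a
    using surj[OF a, of 1] inv0[OF a nat_closed[OF m a]] a
      linear_map_zero[OF kfun_module[OF N a] kfun_module[OF F a] nat_linear[OF inv a]]
    by (auto simp del: nat_of_apply simp: exact_at_def d_def \<epsilon>_def NS[of 0, simplified])
  moreover have "exact_at (Val (P (Suc (Suc n))) a) (d (Suc n) a) (Val (P (Suc n)) a) (d n a) (Val (P n) a)"
    if a: "a \<in> Obj C" for n a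
    using surj[OF a, of "Suc (Suc n)"] by (simp add: exact_at_def d_def NS)
  moreover have "projective K C (P n)" for n
    unfolding P_def by (intro split_projective_imp_projective split_projective_free_cover N)
  ultimately show ?thesis unfolding proj_resolution_def by blast
qed

text \<open>Whatever resolution the choice operator delivers, its terms are projective relative to
  \<open>univ\<close> and hence split; the rest of the proof works with split resolutions.\<close>

lemma chosen_resolution_split:
  fixes F :: "('k, 'o, 'm, 'w) kfun"
  assumes F: "k_functor K C F"
  obtains P d \<epsilon> where "chosen_resolution K C F = (P, d)" "split_resolution C F P d \<epsilon>"
proof -
  obtain P d where Pd: "chosen_resolution K C F = (P, d)" by fastforce
  have "case chosen_resolution K C F of (P, d) \<Rightarrow> \<exists>\<epsilon>. proj_resolution K C F P d \<epsilon>"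
    unfolding chosen_resolution_def using proj_resolution_exists[OF F]
    by (intro someI_ex[of "\<lambda>(P, d). \<exists>\<epsilon>. proj_resolution K C F P d \<epsilon>"]) auto
  then obtain \<epsilon> where "proj_resolution K C F P d \<epsilon>" using Pd by auto
  then have "split_resolution C F P d \<epsilon>"
    using projective_imp_split_projective[of "P _"]
    unfolding proj_resolution_def split_resolution_def by (auto simp: projective_def[of K C "P _"])
  with Pd that show ?thesis by blast
qed

end

end

section \<open>Cohomology of cochain complexes\<close>

context ground
begin

definition cocomplex :: "(nat \<Rightarrow> ('k, 'x) module) \<Rightarrow> (nat \<Rightarrow> 'x \<Rightarrow> 'x) \<Rightarrow> bool" where
  "cocomplex X D \<longleftrightarrow> (\<forall>n. module K (X n)) \<and> (\<forall>n. D n \<in> linear_map K (X n) (X (Suc n))) \<and>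
     (\<forall>n. \<forall>x\<in>carrier (X n). D (Suc n) (D n x) = \<zero>\<^bsub>X (Suc (Suc n))\<^esub>)"

definition cocyc :: "(nat \<Rightarrow> ('k, 'x) module) \<Rightarrow> (nat \<Rightarrow> 'x \<Rightarrow> 'x) \<Rightarrow> nat \<Rightarrow> 'x set" where
  "cocyc X D n = {x \<in> carrier (X n). D n x = \<zero>\<^bsub>X (Suc n)\<^esub>}"

text \<open>In degree 0 the incoming differential counts as zero, in agreement with
  \<open>coboundaries\<close>.\<close>

definition cobd :: "(nat \<Rightarrow> ('k, 'x) module) \<Rightarrow> (nat \<Rightarrow> 'x \<Rightarrow> 'x) \<Rightarrow> nat \<Rightarrow> 'x set" where
  "cobd X D n = (case n of 0 \<Rightarrow> {\<zero>\<^bsub>X 0\<^esub>} | Suc m \<Rightarrow> D m ` carrier (X m))"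

definition coh :: "(nat \<Rightarrow> ('k, 'x) module) \<Rightarrow> (nat \<Rightarrow> 'x \<Rightarrow> 'x) \<Rightarrow> nat \<Rightarrow> ('k, 'x set) module" where
  "coh X D n = quotient_module ((X n)\<lparr>carrier := cocyc X D n\<rparr>) (cobd X D n)"

definition coh_class :: "(nat \<Rightarrow> ('k, 'x) module) \<Rightarrow> (nat \<Rightarrow> 'x \<Rightarrow> 'x) \<Rightarrow> nat \<Rightarrow> 'x \<Rightarrow> 'x set" where
  "coh_class X D n x = cobd X D n +>\<^bsub>X n\<^esub> x"

definition cochain_map :: "(nat \<Rightarrow> ('k, 'x) module) \<Rightarrow> (nat \<Rightarrow> 'x \<Rightarrow> 'x) \<Rightarrow> (nat \<Rightarrow> ('k, 'y) module) \<Rightarrow>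
    (nat \<Rightarrow> 'y \<Rightarrow> 'y) \<Rightarrow> (nat \<Rightarrow> 'x \<Rightarrow> 'y) \<Rightarrow> bool" where
  "cochain_map X D Y E f \<longleftrightarrow> (\<forall>n. f n \<in> linear_map K (X n) (Y n)) \<and>
     (\<forall>n. \<forall>x\<in>carrier (X n). f (Suc n) (D n x) = E n (f n x))"

lemma cocycD: "x \<in> cocyc X D n \<Longrightarrow> x \<in> carrier (X n)" "x \<in> cocyc X D n \<Longrightarrow> D n x = \<zero>\<^bsub>X (Suc n)\<^esub>"
  by (auto simp: cocyc_def)

context
  fixes X :: "nat \<Rightarrow> ('k, 'x) module" and D
  assumes X: "cocomplex X D"
begin

lemma cocomplex_module: "module K (X n)"
  and cocomplex_linear: "D n \<in> linear_map K (X n) (X (Suc n))"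
  and cocomplex_square: "x \<in> carrier (X n) \<Longrightarrow> D (Suc n) (D n x) = \<zero>\<^bsub>X (Suc (Suc n))\<^esub>"
  using X by (auto simp: cocomplex_def)

lemma subspace_cocyc: "subspace K (X n) (cocyc X D n)"
  unfolding cocyc_def by (rule subspace_kernel[OF cocomplex_module cocomplex_module cocomplex_linear])

lemma module_cocyc: "module K ((X n)\<lparr>carrier := cocyc X D n\<rparr>)"
  by (rule module_subspace[OF cocomplex_module subspace_cocyc])

lemma cobd_cocyc: "x \<in> cobd X D n \<Longrightarrow> x \<in> cocyc X D n"
  using cocomplex_square linear_map_closed[OF cocomplex_linear] zero_closed[OF cocomplex_module]
    linear_map_zero[OF cocomplex_module cocomplex_module cocomplex_linear]
  by (auto simp: cobd_def cocyc_def split: nat.splits)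

lemma subspace_cobd: "subspace K ((X n)\<lparr>carrier := cocyc X D n\<rparr>) (cobd X D n)"
proof -
  have "subspace K (X n) (cobd X D n)"
  proof (cases n)
    case 0
    then show ?thesis
      using zero_closed[OF cocomplex_module, of n] by (auto simp: cobd_def subspace_def mod_simps cocomplex_module)
  next
    case (Suc m)
    then show ?thesis
      by (simp add: cobd_def subspace_image[OF cocomplex_module cocomplex_module cocomplex_linear])
  qed
  then show ?thesis using cobd_cocyc by (auto simp: subspace_def)
qed

lemma module_coh: "module K (coh X D n)"
  unfolding coh_def by (rule module_quotient[OF module_cocyc subspace_cobd])

lemma carrier_coh: "carrier (coh X D n) = coh_class X D n ` cocyc X D n"
  unfolding coh_def carrier_quotient[OF module_cocyc subspace_cobd] coh_class_def by (simp add: coset_restrict)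

lemma coh_class_closed: "x \<in> cocyc X D n \<Longrightarrow> coh_class X D n x \<in> carrier (coh X D n)"
  by (simp add: carrier_coh)

lemma coh_class_eq_iff:
  "x \<in> cocyc X D n \<Longrightarrow> y \<in> cocyc X D n \<Longrightarrow>
   coh_class X D n x = coh_class X D n y \<longleftrightarrow> (\<exists>b\<in>cobd X D n. x = y \<oplus>\<^bsub>X n\<^esub> b)"
  using coset_eq_iff[OF module_cocyc subspace_cobd, of x n y] by (simp add: coh_class_def coset_restrict)

lemma coh_class_zero_iff:
  "x \<in> cocyc X D n \<Longrightarrow> coh_class X D n x = \<zero>\<^bsub>coh X D n\<^esub> \<longleftrightarrow> x \<in> cobd X D n"
  using coset_eq_zero_iff[OF module_cocyc subspace_cobd, of x n]
  by (simp add: coh_class_def coset_restrict coh_def zero_quotient[OF module_cocyc subspace_cobd])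

lemma linear_map_coh_class: "coh_class X D n \<in> linear_map K ((X n)\<lparr>carrier := cocyc X D n\<rparr>) (coh X D n)"
  using linear_map_coset[OF module_cocyc subspace_cobd, of n]
  by (simp add: coh_class_def[abs_def] coset_restrict coh_def)

end

text \<open>The relation and the independent degrees \<open>n\<close> and \<open>m\<close> let this
  cover the maps induced by cochain maps as well as the connecting map.\<close>

lemma coh_map_exists:
  assumes X: "cocomplex X D" and Y: "cocomplex Y E"
    and total: "\<And>x. x \<in> cocyc X D n \<Longrightarrow> \<exists>y\<in>cocyc Y E m. R x y"
    and add: "\<And>x x' y y'. x \<in> cocyc X D n \<Longrightarrow> x' \<in> cocyc X D n \<Longrightarrow> y \<in> cocyc Y E m \<Longrightarrow> y' \<in> cocyc Y E m \<Longrightarrow>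
       R x y \<Longrightarrow> R x' y' \<Longrightarrow> R (x \<oplus>\<^bsub>X n\<^esub> x') (y \<oplus>\<^bsub>Y m\<^esub> y')"
    and smult: "\<And>a x y. a \<in> carrier K \<Longrightarrow> x \<in> cocyc X D n \<Longrightarrow> y \<in> cocyc Y E m \<Longrightarrow>
       R x y \<Longrightarrow> R (a \<odot>\<^bsub>X n\<^esub> x) (a \<odot>\<^bsub>Y m\<^esub> y)"
    and zero: "\<And>x y. x \<in> cobd X D n \<Longrightarrow> y \<in> cocyc Y E m \<Longrightarrow> R x y \<Longrightarrow> y \<in> cobd Y E m"
  shows "\<exists>f\<in>linear_map K (coh X D n) (coh Y E m).
    \<forall>x\<in>cocyc X D n. \<forall>y\<in>cocyc Y E m. R x y \<longrightarrow> f (coh_class X D n x) = coh_class Y E m y"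
  using quotient_map_exists[OF module_cocyc[OF X] subspace_cobd[OF X] module_cocyc[OF Y] subspace_cobd[OF Y],
      of n m R] total add smult zero
  unfolding coh_def[symmetric] by (simp add: coset_restrict coh_class_def)

context
  fixes X :: "nat \<Rightarrow> ('k, 'x) module" and D and Y :: "nat \<Rightarrow> ('k, 'y) module" and E and f
  assumes X: "cocomplex X D" and Y: "cocomplex Y E" and f: "cochain_map X D Y E f"
begin

lemma cochain_map_linear: "f n \<in> linear_map K (X n) (Y n)"
  and cochain_map_comm: "x \<in> carrier (X n) \<Longrightarrow> f (Suc n) (D n x) = E n (f n x)"
  using f by (auto simp: cochain_map_def)

lemma cochain_map_cocyc: "x \<in> cocyc X D n \<Longrightarrow> f n x \<in> cocyc Y E n"
  using linear_map_zero[OF cocomplex_module[OF X] cocomplex_module[OF Y] cochain_map_linear]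
  by (simp add: cocyc_def linear_map_closed[OF cochain_map_linear] flip: cochain_map_comm)

lemma cochain_map_cobd: "x \<in> cobd X D n \<Longrightarrow> f n x \<in> cobd Y E n"
  using linear_map_zero[OF cocomplex_module[OF X] cocomplex_module[OF Y] cochain_map_linear]
    linear_map_closed[OF cochain_map_linear]
  by (auto simp: cobd_def cochain_map_comm split: nat.splits)

lemma coh_cochain_map_exists:
  "\<exists>g\<in>linear_map K (coh X D n) (coh Y E n). \<forall>x\<in>cocyc X D n. g (coh_class X D n x) = coh_class Y E n (f n x)"
  using coh_map_exists[OF X Y, of n n "\<lambda>x y. y = f n x"] cochain_map_cocyc cochain_map_cobd
  by (force simp: linear_map_add[OF cochain_map_linear] linear_map_smult[OF cochain_map_linear] cocycD)

end

text \<open>Of a homotopy equivalence only the effect on cocycles matters: both composites change a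
  cocycle by a coboundary.\<close>

lemma coh_iso:
  assumes X: "cocomplex X D" and Y: "cocomplex Y E"
    and f: "cochain_map X D Y E f" and g: "cochain_map Y E X D g"
    and gf: "\<And>n x. x \<in> cocyc X D n \<Longrightarrow> \<exists>b\<in>cobd X D n. g n (f n x) = x \<oplus>\<^bsub>X n\<^esub> b"
    and fg: "\<And>n y. y \<in> cocyc Y E n \<Longrightarrow> \<exists>b\<in>cobd Y E n. f n (g n y) = y \<oplus>\<^bsub>Y n\<^esub> b"
  shows "\<exists>\<theta>\<in>linear_map K (coh X D n) (coh Y E n). bij_betw \<theta> (carrier (coh X D n)) (carrier (coh Y E n))"
proof -
  obtain \<theta> where \<theta>: "\<theta> \<in> linear_map K (coh X D n) (coh Y E n)"
      "\<And>x. x \<in> cocyc X D n \<Longrightarrow> \<theta> (coh_class X D n x) = coh_class Y E n (f n x)"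
    using coh_cochain_map_exists[OF X Y f, of n] by (elim bexE) (rule that, auto)
  obtain \<theta>' where \<theta>': "\<theta>' \<in> linear_map K (coh Y E n) (coh X D n)"
      "\<And>x. x \<in> cocyc Y E n \<Longrightarrow> \<theta>' (coh_class Y E n x) = coh_class X D n (g n x)"
    using coh_cochain_map_exists[OF Y X g, of n] by (elim bexE) (rule that, auto)
  have "bij_betw \<theta> (carrier (coh X D n)) (carrier (coh Y E n))"
  proof (rule bij_betw_byWitness[where f' = \<theta>'])
    show "\<forall>u\<in>carrier (coh X D n). \<theta>' (\<theta> u) = u"
    proof
      fix u assume "u \<in> carrier (coh X D n)"
      then obtain x where x: "x \<in> cocyc X D n" "u = coh_class X D n x" by (auto simp: carrier_coh[OF X])
      note fx = cochain_map_cocyc[OF X Y f x(1)]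
      have "\<theta>' (\<theta> u) = coh_class X D n (g n (f n x))" using x fx by (simp add: \<theta>(2) \<theta>'(2))
      then show "\<theta>' (\<theta> u) = u"
        using coh_class_eq_iff[OF X cochain_map_cocyc[OF Y X g fx] x(1)] gf[OF x(1)] x(2) by simp
    qed
    show "\<forall>u\<in>carrier (coh Y E n). \<theta> (\<theta>' u) = u"
    proof
      fix u assume "u \<in> carrier (coh Y E n)"
      then obtain y where y: "y \<in> cocyc Y E n" "u = coh_class Y E n y" by (auto simp: carrier_coh[OF Y])
      note gy = cochain_map_cocyc[OF Y X g y(1)]
      have "\<theta> (\<theta>' u) = coh_class Y E n (f n (g n y))" using y gy by (simp add: \<theta>(2) \<theta>'(2))
      then show "\<theta> (\<theta>' u) = u"
        using coh_class_eq_iff[OF Y cochain_map_cocyc[OF X Y f gy] y(1)] fg[OF y(1)] y(2) by simp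
    qed
    show "\<theta> ` carrier (coh X D n) \<subseteq> carrier (coh Y E n)" "\<theta>' ` carrier (coh Y E n) \<subseteq> carrier (coh X D n)"
      using linear_map_closed[OF \<theta>(1)] linear_map_closed[OF \<theta>'(1)] by auto
  qed
  with \<theta>(1) show ?thesis by blast
qed

subsection \<open>The long exact sequence\<close>

text \<open>Every class has a representing cocycle, so exactness becomes a condition on cocycles of
  the middle complex.\<close>

lemma exact_at_coh_iff:
  assumes X: "cocomplex X D" and Y: "cocomplex Y E" and Z: "cocomplex Z F"
    and "\<And>y. y \<in> cocyc Y E m \<Longrightarrow> g (coh_class Y E m y) = \<zero>\<^bsub>coh Z F l\<^esub> \<longleftrightarrow>
      (\<exists>x\<in>cocyc X D n. f (coh_class X D n x) = coh_class Y E m y)"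
    and f: "f \<in> linear_map K (coh X D n) (coh Y E m)"
  shows "exact_at (coh X D n) f (coh Y E m) g (coh Z F l)"
proof -
  have 1: "f (coh_class X D n x) \<in> carrier (coh Y E m)" if "x \<in> cocyc X D n" for x
    using linear_map_closed[OF f] coh_class_closed[OF X that] .
  show ?thesis unfolding exact_at_def
  proof (intro equalityI subsetI)
    fix v assume v: "v \<in> f ` carrier (coh X D n)"
    then obtain x where x: "x \<in> cocyc X D n" "v = f (coh_class X D n x)" by (auto simp: carrier_coh[OF X])
    with 1 obtain y where y: "y \<in> cocyc Y E m" "v = coh_class Y E m y" by (fastforce simp: carrier_coh[OF Y])
    then have "g v = \<zero>\<^bsub>coh Z F l\<^esub>" using assms(4)[OF y(1)] x by metis
    with v x y 1 show "v \<in> {y \<in> carrier (coh Y E m). g y = \<zero>\<^bsub>coh Z F l\<^esub>}" by simp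
  next
    fix v assume v: "v \<in> {y \<in> carrier (coh Y E m). g y = \<zero>\<^bsub>coh Z F l\<^esub>}"
    then obtain y where y: "y \<in> cocyc Y E m" "v = coh_class Y E m y" by (auto simp: carrier_coh[OF Y])
    with v assms(4)[OF y(1)] obtain x where "x \<in> cocyc X D n" "f (coh_class X D n x) = v" by auto
    then show "v \<in> f ` carrier (coh X D n)" using coh_class_closed[OF X] by blast
  qed
qed

text \<open>The value of \<open>i\<close> on classes is kept among the conclusions because the
  degree 0 source of \<open>i\<close> is later exchanged for a space of transformations.\<close>

theorem long_exact_sequence:
  fixes A :: "nat \<Rightarrow> ('k, 'x) module" and B :: "nat \<Rightarrow> ('k, 'y) module" and C :: "nat \<Rightarrow> ('k, 'z) module"
  assumes A: "cocomplex A DA" and B: "cocomplex B DB" and C: "cocomplex C DC"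
    and f: "cochain_map A DA B DB f" and g: "cochain_map B DB C DC g"
    and inj: "\<And>n. inj_on (f n) (carrier (A n))"
    and ex: "\<And>n. exact_at (A n) (f n) (B n) (g n) (C n)"
    and surj: "\<And>n. g n ` carrier (B n) = carrier (C n)"
  obtains i p \<delta> where
    "\<And>n. i n \<in> linear_map K (coh A DA n) (coh B DB n)"
    "\<And>n. p n \<in> linear_map K (coh B DB n) (coh C DC n)"
    "\<And>n. \<delta> n \<in> linear_map K (coh C DC n) (coh A DA (Suc n))"
    "\<And>n x. x \<in> cocyc A DA n \<Longrightarrow> i n (coh_class A DA n x) = coh_class B DB n (f n x)"
    "inj_on (i 0) (carrier (coh A DA 0))"
    "\<And>n. exact_at (coh A DA n) (i n) (coh B DB n) (p n) (coh C DC n)"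
    "\<And>n. exact_at (coh B DB n) (p n) (coh C DC n) (\<delta> n) (coh A DA (Suc n))"
    "\<And>n. exact_at (coh C DC n) (\<delta> n) (coh A DA (Suc n)) (i (Suc n)) (coh B DB (Suc n))"
proof -
  note lf = cochain_map_linear[OF A B f] and lg = cochain_map_linear[OF B C g]
  note cf = cochain_map_comm[OF A B f] and cg = cochain_map_comm[OF B C g]
  note mA = cocomplex_module[OF A] and mB = cocomplex_module[OF B] and mC = cocomplex_module[OF C]
  note dA = cocomplex_linear[OF A] and dB = cocomplex_linear[OF B] and dC = cocomplex_linear[OF C]
  have gf: "g n (f n a) = \<zero>\<^bsub>C n\<^esub>" if "a \<in> carrier (A n)" for n a
    using ex[of n] that by (auto simp: exact_at_def)
  have ker: "\<exists>a\<in>carrier (A n). f n a = b" if "b \<in> carrier (B n)" "g n b = \<zero>\<^bsub>C n\<^esub>" for n b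
  proof -
    have "b \<in> f n ` carrier (A n)" using ex[of n] that unfolding exact_at_def by simp
    then show ?thesis by blast
  qed
  \<comment> \<open>Two lifts of one element of \<open>C n\<close> differ by an element from
    \<open>A n\<close>; this controls the choice of lifts below.\<close>
  have ker': "\<exists>a\<in>carrier (A n). b' = b \<oplus>\<^bsub>B n\<^esub> f n a"
    if b: "b \<in> carrier (B n)" "b' \<in> carrier (B n)" "g n b = g n b'" for n b b'
  proof -
    interpret B: module K "B n" by (rule mB)
    interpret C: module K "C n" by (rule mC)
    have "g n (b' \<ominus>\<^bsub>B n\<^esub> b) = \<zero>\<^bsub>C n\<^esub>"
      using b linear_map_closed[OF lg] by (simp add: linear_map_minus[OF mB mC lg] C.minus_eq C.r_neg)
    with ker[of "b' \<ominus>\<^bsub>B n\<^esub> b"] b obtain a where "a \<in> carrier (A n)" "f n a = b' \<ominus>\<^bsub>B n\<^esub> b" by auto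
    then show ?thesis
      using b by (intro bexI[of _ a]) (simp_all add: B.minus_eq B.a_lcomm[of b b'] B.r_neg)
  qed
  \<comment> \<open>Injectivity of \<open>f\<close> allows the cocycle condition to be tested in
    \<open>B\<close>.\<close>
  have cocA: "a \<in> cocyc A DA n" if "a \<in> carrier (A n)" "f n a \<in> cocyc B DB n" for a n
  proof -
    have "f (Suc n) (DA n a) = f (Suc n) \<zero>\<^bsub>A (Suc n)\<^esub>"
      using that by (simp add: cf cocycD linear_map_zero[OF mA mB lf])
    with inj_onD[OF inj this] that linear_map_closed[OF dA] zero_closed[OF mA]
    show ?thesis by (simp add: cocyc_def)
  qed
  have surj': "\<exists>b\<in>carrier (B n). g n b = c" if "c \<in> carrier (C n)" for n c
    using that unfolding surj[of n, symmetric] by blast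
  \<comment> \<open>Lift a primitive and differentiate; in degree 0 zero lifts to zero.\<close>
  have lift_cobd: "\<exists>b\<in>cobd B DB n. g n b = c" if "c \<in> cobd C DC n" for c n
  proof (cases n)
    case 0
    with that show ?thesis by (simp add: cobd_def linear_map_zero[OF mB mC lg])
  next
    case (Suc m)
    with that obtain c' where c': "c' \<in> carrier (C m)" "c = DC m c'" by (auto simp: cobd_def)
    then obtain b' where "b' \<in> carrier (B m)" "g m b' = c'" using surj' by blast
    then show ?thesis using Suc c' by (intro bexI[of _ "DB m b'"]) (auto simp: cobd_def cg)
  qed
  \<comment> \<open>The zigzag of the snake lemma: lift \<open>c\<close> to \<open>b\<close>,
    differentiate, pull back along \<open>f\<close>. Since \<open>b\<close> is quantified, no lift
    has to be chosen compatibly with sums and scalars.\<close>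
  define R where "R n c a \<longleftrightarrow> (\<exists>b\<in>carrier (B n). g n b = c \<and> f (Suc n) a = DB n b)" for n c a
  have "\<exists>i\<in>linear_map K (coh A DA n) (coh B DB n). \<forall>x\<in>cocyc A DA n. i (coh_class A DA n x) = coh_class B DB n (f n x)" for n
    by (rule coh_cochain_map_exists[OF A B f])
  then obtain i where i: "\<And>n. i n \<in> linear_map K (coh A DA n) (coh B DB n)"
      "\<And>n x. x \<in> cocyc A DA n \<Longrightarrow> i n (coh_class A DA n x) = coh_class B DB n (f n x)" by metis
  have "\<exists>p\<in>linear_map K (coh B DB n) (coh C DC n). \<forall>x\<in>cocyc B DB n. p (coh_class B DB n x) = coh_class C DC n (g n x)" for n
    by (rule coh_cochain_map_exists[OF B C g])
  then obtain p where p: "\<And>n. p n \<in> linear_map K (coh B DB n) (coh C DC n)"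
      "\<And>n x. x \<in> cocyc B DB n \<Longrightarrow> p n (coh_class B DB n x) = coh_class C DC n (g n x)" by metis
  have total: "\<exists>a\<in>cocyc A DA (Suc n). f (Suc n) a = DB n b" if b: "b \<in> carrier (B n)" "g n b \<in> cocyc C DC n" for n b
  proof -
    have "g (Suc n) (DB n b) = \<zero>\<^bsub>C (Suc n)\<^esub>" using b by (simp add: cg cocycD)
    then obtain a where "a \<in> carrier (A (Suc n))" "f (Suc n) a = DB n b"
      using ker linear_map_closed[OF dB b(1)] by blast
    moreover have "DB n b \<in> cocyc B DB (Suc n)"
      using b(1) by (simp add: cocyc_def linear_map_closed[OF dB] cocomplex_square[OF B])
    ultimately show ?thesis using cocA by metis
  qed
  \<comment> \<open>For a coboundary \<open>c\<close> the lift \<open>b\<close> is compared with a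
    lift \<open>b0\<close> that is itself a coboundary. The differential kills \<open>b0\<close>,
    and what remains of \<open>DB n b\<close> is the image of \<open>DA n a'\<close>.\<close>
  have Rzero: "a \<in> cobd A DA (Suc n)" if c: "c \<in> cobd C DC n" and a: "a \<in> cocyc A DA (Suc n)" and R: "R n c a" for n c a
  proof -
    obtain b where b: "b \<in> carrier (B n)" "g n b = c" "f (Suc n) a = DB n b" using R by (auto simp: R_def)
    obtain b0 where b0: "b0 \<in> cobd B DB n" "g n b0 = c" using lift_cobd[OF c] by blast
    note b0' = cocycD[OF cobd_cocyc[OF B b0(1)]]
    obtain a' where a': "a' \<in> carrier (A n)" "b = b0 \<oplus>\<^bsub>B n\<^esub> f n a'"
      using ker'[OF b0'(1) b(1)] b b0 by auto
    then have "f (Suc n) a = f (Suc n) (DA n a')"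
      using b b0' linear_map_closed[OF lf] linear_map_closed[OF dB]
      by (simp add: linear_map_add[OF dB] cf zero_add[OF mB])
    then have "a = DA n a'"
      using inj_onD[OF inj] cocycD[OF a] a' linear_map_closed[OF dA] by blast
    then show ?thesis using a' by (auto simp: cobd_def)
  qed
  have "\<exists>\<delta>\<in>linear_map K (coh C DC n) (coh A DA (Suc n)). \<forall>x\<in>cocyc C DC n. \<forall>y\<in>cocyc A DA (Suc n).
      R n x y \<longrightarrow> \<delta> (coh_class C DC n x) = coh_class A DA (Suc n) y" for n
  proof (rule coh_map_exists[OF C A])
    fix c assume c: "c \<in> cocyc C DC n"
    then obtain b where "b \<in> carrier (B n)" "g n b = c" using surj'[OF cocycD(1)[OF c]] by blast
    with total[of b n] c show "\<exists>y\<in>cocyc A DA (Suc n). R n c y" by (auto simp: R_def)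
  next
    fix x x' y y' assume c: "x \<in> cocyc C DC n" "x' \<in> cocyc C DC n" "y \<in> cocyc A DA (Suc n)" "y' \<in> cocyc A DA (Suc n)"
      and "R n x y" "R n x' y'"
    then obtain b b' where "b \<in> carrier (B n)" "g n b = x" "f (Suc n) y = DB n b"
      "b' \<in> carrier (B n)" "g n b' = x'" "f (Suc n) y' = DB n b'" by (auto simp: R_def)
    then show "R n (x \<oplus>\<^bsub>C n\<^esub> x') (y \<oplus>\<^bsub>A (Suc n)\<^esub> y')"
      unfolding R_def using c
      by (intro bexI[of _ "b \<oplus>\<^bsub>B n\<^esub> b'"])
        (auto simp: linear_map_add[OF lg] linear_map_add[OF lf] linear_map_add[OF dB] add_closed[OF mB] cocycD)
  next
    fix r x y assume c: "r \<in> carrier K" "x \<in> cocyc C DC n" "y \<in> cocyc A DA (Suc n)" and "R n x y"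
    then obtain b where "b \<in> carrier (B n)" "g n b = x" "f (Suc n) y = DB n b" by (auto simp: R_def)
    then show "R n (r \<odot>\<^bsub>C n\<^esub> x) (r \<odot>\<^bsub>A (Suc n)\<^esub> y)"
      unfolding R_def using c
      by (intro bexI[of _ "r \<odot>\<^bsub>B n\<^esub> b"])
        (auto simp: linear_map_smult[OF lg] linear_map_smult[OF lf] linear_map_smult[OF dB] smult_closed[OF mB] cocycD)
  qed (rule Rzero)
  then obtain \<delta> where \<delta>: "\<And>n. \<delta> n \<in> linear_map K (coh C DC n) (coh A DA (Suc n))"
      "\<And>n x y. x \<in> cocyc C DC n \<Longrightarrow> y \<in> cocyc A DA (Suc n) \<Longrightarrow> R n x y \<Longrightarrow>
        \<delta> n (coh_class C DC n x) = coh_class A DA (Suc n) y" by metis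
  show ?thesis
  proof (rule that[OF i(1) p(1) \<delta>(1) i(2)])
    show "inj_on (i 0) (carrier (coh A DA 0))"
    proof (rule inj_onI)
      fix u v assume u: "u \<in> carrier (coh A DA 0)" and v: "v \<in> carrier (coh A DA 0)" and "i 0 u = i 0 v"
      then obtain x y where x: "x \<in> cocyc A DA 0" "u = coh_class A DA 0 x" and y: "y \<in> cocyc A DA 0" "v = coh_class A DA 0 y"
          and e: "coh_class B DB 0 (f 0 x) = coh_class B DB 0 (f 0 y)"
        by (auto simp: carrier_coh[OF A] i(2))
      then obtain b where "b \<in> cobd B DB 0" "f 0 x = f 0 y \<oplus>\<^bsub>B 0\<^esub> b"
        using coh_class_eq_iff[OF B cochain_map_cocyc[OF A B f x(1)] cochain_map_cocyc[OF A B f y(1)]] by auto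
      \<comment> \<open>In degree 0 the only coboundary is zero.\<close>
      then have "f 0 x = f 0 y"
        using linear_map_closed[OF lf cocycD(1)[OF y(1)]] by (simp add: cobd_def add_zero[OF mB])
      then show "u = v" using inj_onD[OF inj] cocycD(1) x y by metis
    qed
  next
    fix n
    show "exact_at (coh A DA n) (i n) (coh B DB n) (p n) (coh C DC n)"
    proof (rule exact_at_coh_iff[OF A B C _ i(1)])
      fix y assume y: "y \<in> cocyc B DB n"
      note y' = cocycD[OF y]
      show "p n (coh_class B DB n y) = \<zero>\<^bsub>coh C DC n\<^esub> \<longleftrightarrow> (\<exists>x\<in>cocyc A DA n. i n (coh_class A DA n x) = coh_class B DB n y)"
      proof
        assume "p n (coh_class B DB n y) = \<zero>\<^bsub>coh C DC n\<^esub>"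
        then have "g n y \<in> cobd C DC n"
          using y by (simp add: p(2) coh_class_zero_iff[OF C] cochain_map_cocyc[OF B C g])
        then obtain b0 where b0: "b0 \<in> cobd B DB n" "g n b0 = g n y" using lift_cobd by blast
        note b0' = cobd_cocyc[OF B b0(1)]
        obtain a where a: "a \<in> carrier (A n)" "b0 = y \<oplus>\<^bsub>B n\<^esub> f n a"
          using ker'[OF y'(1) cocycD(1)[OF b0']] b0(2) by auto
        interpret B: module K "B n" by (rule mB)
        note fa = linear_map_closed[OF lf a(1)]
        \<comment> \<open>\<open>b0\<close> is a coboundary with the same image as \<open>y\<close>,
          so \<open>y - b0\<close> represents the class of \<open>y\<close> and comes from
          \<open>A\<close>; the element there is \<open>-a\<close>.\<close>
        have e: "y \<oplus>\<^bsub>B n\<^esub> (\<ominus>\<^bsub>B n\<^esub> b0) = \<ominus>\<^bsub>B n\<^esub> f n a"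
          using a fa y' by (simp add: B.minus_add B.r_neg2)
        have sub: "\<ominus>\<^bsub>B n\<^esub> b0 \<in> cobd B DB n"
          using subspace_neg[OF mB _ b0(1)] subspace_cobd[OF B, of n] cobd_cocyc[OF B] cocycD(1)[of _ B DB n]
          by (auto simp: subspace_def subset_iff)
        define x where "x = \<ominus>\<^bsub>A n\<^esub> a"
        have x: "x \<in> carrier (A n)" "f n x = y \<oplus>\<^bsub>B n\<^esub> (\<ominus>\<^bsub>B n\<^esub> b0)"
          using a(1) by (simp_all only: x_def e neg_closed[OF mA] linear_map_neg[OF mA mB lf])
        have "f n x \<in> cocyc B DB n"
          using subspace_cocyc[OF B, of n] y cobd_cocyc[OF B sub] x(2) by (auto simp: subspace_def)
        then have "x \<in> cocyc A DA n" using cocA x by blast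
        moreover have "coh_class B DB n (f n x) = coh_class B DB n y"
          using coh_class_eq_iff[OF B \<open>f n x \<in> cocyc B DB n\<close> y] x(2) sub by blast
        ultimately show "\<exists>x\<in>cocyc A DA n. i n (coh_class A DA n x) = coh_class B DB n y"
          using i(2) by auto
      next
        assume "\<exists>x\<in>cocyc A DA n. i n (coh_class A DA n x) = coh_class B DB n y"
        then obtain x where x: "x \<in> cocyc A DA n" "coh_class B DB n (f n x) = coh_class B DB n y" by (auto simp: i(2))
        then have "p n (coh_class B DB n y) = p n (coh_class B DB n (f n x))" by simp
        also have "\<dots> = coh_class C DC n \<zero>\<^bsub>C n\<^esub>"
          using x(1) by (simp add: p(2) cochain_map_cocyc[OF A B f] gf cocycD)
        also have "\<dots> = \<zero>\<^bsub>coh C DC n\<^esub>"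
          using subspace_cobd[OF C, of n] by (subst coh_class_zero_iff[OF C]) (auto simp: subspace_def)
        finally show "p n (coh_class B DB n y) = \<zero>\<^bsub>coh C DC n\<^esub>" .
      qed
    qed
    show "exact_at (coh B DB n) (p n) (coh C DC n) (\<delta> n) (coh A DA (Suc n))"
    proof (rule exact_at_coh_iff[OF B C A _ p(1)])
      fix c assume c: "c \<in> cocyc C DC n"
      then obtain b where b: "b \<in> carrier (B n)" "g n b = c" using surj'[OF cocycD(1)[OF c]] by blast
      then obtain a where a: "a \<in> cocyc A DA (Suc n)" "f (Suc n) a = DB n b" using total c by blast
      have \<delta>c: "\<delta> n (coh_class C DC n c) = coh_class A DA (Suc n) a"
        using a b c by (intro \<delta>(2)) (auto simp: R_def)
      interpret B: module K "B n" by (rule mB)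
      interpret B': module K "B (Suc n)" by (rule mB)
      show "\<delta> n (coh_class C DC n c) = \<zero>\<^bsub>coh A DA (Suc n)\<^esub> \<longleftrightarrow> (\<exists>x\<in>cocyc B DB n. p n (coh_class B DB n x) = coh_class C DC n c)"
      proof
        assume "\<delta> n (coh_class C DC n c) = \<zero>\<^bsub>coh A DA (Suc n)\<^esub>"
        then have "a \<in> cobd A DA (Suc n)" using a by (simp add: \<delta>c coh_class_zero_iff[OF A])
        then obtain a' where a': "a' \<in> carrier (A n)" "a = DA n a'" by (auto simp: cobd_def)
        note fa = linear_map_closed[OF lf a'(1)]
        \<comment> \<open>\<open>DB n b\<close> is the differential of \<open>f n a'\<close>, so
          subtracting \<open>f n a'\<close> makes the lift closed and leaves its image
          \<open>c\<close> unchanged.\<close>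
        define x where "x = b \<ominus>\<^bsub>B n\<^esub> f n a'"
        have x: "x \<in> carrier (B n)" using b fa by (simp add: x_def)
        have "DB n x = \<zero>\<^bsub>B (Suc n)\<^esub>"
          using a a' b fa linear_map_closed[OF dB b(1)]
          by (simp add: x_def linear_map_minus[OF mB mB dB] B'.minus_eq B'.r_neg flip: cf)
        with x have xc: "x \<in> cocyc B DB n" by (simp add: cocyc_def)
        interpret C: module K "C n" by (rule mC)
        have "g n x = c"
          using b a' fa cocycD(1)[OF c] by (simp add: x_def linear_map_minus[OF mB mC lg] gf C.minus_eq)
        with xc show "\<exists>x\<in>cocyc B DB n. p n (coh_class B DB n x) = coh_class C DC n c" using p(2) by auto
      next
        assume "\<exists>x\<in>cocyc B DB n. p n (coh_class B DB n x) = coh_class C DC n c"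
        then obtain x where x: "x \<in> cocyc B DB n" "coh_class C DC n (g n x) = coh_class C DC n c" by (auto simp: p(2))
        have z: "\<zero>\<^bsub>A (Suc n)\<^esub> \<in> cobd A DA (Suc n)" using subspace_cobd[OF A, of "Suc n"] by (auto simp: subspace_def)
        \<comment> \<open>A cocycle \<open>x\<close> of \<open>B\<close> is a lift of
          \<open>g n x\<close> with zero differential, so \<open>R\<close> pairs
          \<open>g n x\<close> with zero.\<close>
        have "\<delta> n (coh_class C DC n (g n x)) = coh_class A DA (Suc n) \<zero>\<^bsub>A (Suc n)\<^esub>"
          using x(1) cobd_cocyc[OF A z]
          by (intro \<delta>(2) cochain_map_cocyc[OF B C g]) (auto simp: R_def linear_map_zero[OF mA mB lf] cocycD)
        then show "\<delta> n (coh_class C DC n c) = \<zero>\<^bsub>coh A DA (Suc n)\<^esub>"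
          using x(2) z coh_class_zero_iff[OF A cobd_cocyc[OF A z]] by simp
      qed
    qed
    show "exact_at (coh C DC n) (\<delta> n) (coh A DA (Suc n)) (i (Suc n)) (coh B DB (Suc n))"
    proof (rule exact_at_coh_iff[OF C A B _ \<delta>(1)])
      fix a assume a: "a \<in> cocyc A DA (Suc n)"
      have "i (Suc n) (coh_class A DA (Suc n) a) = \<zero>\<^bsub>coh B DB (Suc n)\<^esub> \<longleftrightarrow> f (Suc n) a \<in> cobd B DB (Suc n)"
        using a by (simp add: i(2) coh_class_zero_iff[OF B] cochain_map_cocyc[OF A B f])
      also have "\<dots> \<longleftrightarrow> (\<exists>c\<in>cocyc C DC n. \<delta> n (coh_class C DC n c) = coh_class A DA (Suc n) a)"
      proof
        assume "f (Suc n) a \<in> cobd B DB (Suc n)"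
        then obtain b where b: "b \<in> carrier (B n)" "f (Suc n) a = DB n b" by (auto simp: cobd_def)
        \<comment> \<open>The image of the primitive \<open>b\<close> is closed because
          \<open>g\<close> kills the image of \<open>f\<close>; by construction \<delta> sends its
          class to that of \<open>a\<close>.\<close>
        have gb: "g n b \<in> cocyc C DC n"
          using b gf[of a "Suc n"] cocycD[OF a] linear_map_closed[OF lg b(1)] by (simp add: cocyc_def flip: cg)
        show "\<exists>c\<in>cocyc C DC n. \<delta> n (coh_class C DC n c) = coh_class A DA (Suc n) a"
          using gb b a by (intro bexI[of _ "g n b"] \<delta>(2)) (auto simp: R_def)
      next
        assume "\<exists>c\<in>cocyc C DC n. \<delta> n (coh_class C DC n c) = coh_class A DA (Suc n) a"
        then obtain c where c: "c \<in> cocyc C DC n" "\<delta> n (coh_class C DC n c) = coh_class A DA (Suc n) a" by blast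
        obtain b where b: "b \<in> carrier (B n)" "g n b = c" using surj'[OF cocycD(1)[OF c(1)]] by blast
        then obtain a' where a': "a' \<in> cocyc A DA (Suc n)" "f (Suc n) a' = DB n b" using total c by blast
        have "coh_class A DA (Suc n) a = coh_class A DA (Suc n) a'"
          using a' b c by (subst c(2)[symmetric], intro \<delta>(2)) (auto simp: R_def)
        then obtain e where e: "e \<in> cobd A DA (Suc n)" "a = a' \<oplus>\<^bsub>A (Suc n)\<^esub> e"
          using coh_class_eq_iff[OF A a a'(1)] by auto
        have "f (Suc n) a = DB n b \<oplus>\<^bsub>B (Suc n)\<^esub> f (Suc n) e"
          using e a' cocycD[OF cobd_cocyc[OF A e(1)]] cocycD[OF a'(1)] by (simp add: linear_map_add[OF lf])
        moreover have "DB n b \<in> cobd B DB (Suc n)" using b by (auto simp: cobd_def)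
        ultimately show "f (Suc n) a \<in> cobd B DB (Suc n)"
          using cochain_map_cobd[OF A B f e(1)] subspace_cobd[OF B, of "Suc n"] by (auto simp: subspace_def)
      qed
      finally show "i (Suc n) (coh_class A DA (Suc n) a) = \<zero>\<^bsub>coh B DB (Suc n)\<^esub> \<longleftrightarrow>
        (\<exists>c\<in>cocyc C DC n. \<delta> n (coh_class C DC n c) = coh_class A DA (Suc n) a)" .
    qed
  qed
qed

end

section \<open>Independence of the resolution\<close>

context ground
begin

definition hom_cx :: "('k, 'o, 'm) kcat \<Rightarrow> (nat \<Rightarrow> ('k, 'o, 'm, 'v) kfun) \<Rightarrow> ('k, 'o, 'm, 'z) kfun \<Rightarrow>
    nat \<Rightarrow> ('k, 'o \<Rightarrow> 'v \<Rightarrow> 'z) module" where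
  "hom_cx C P G n = nat_space K C (P n) G"

definition hom_d :: "('k, 'o, 'm) kcat \<Rightarrow> (nat \<Rightarrow> ('k, 'o, 'm, 'v) kfun) \<Rightarrow> (nat \<Rightarrow> 'o \<Rightarrow> 'v \<Rightarrow> 'v) \<Rightarrow>
    nat \<Rightarrow> ('o \<Rightarrow> 'v \<Rightarrow> 'z) \<Rightarrow> 'o \<Rightarrow> 'v \<Rightarrow> 'z" where
  "hom_d C P d n \<eta> = nat_comp C (P (Suc n)) \<eta> (d n)"

lemma hom_cohomology_eq_coh: "hom_cohomology K C P d G n = coh (hom_cx C P G) (hom_d C P d) n"
proof -
  have "cocycles K C P d G n = cocyc (hom_cx C P G) (hom_d C P d) n"
    by (simp add: cocycles_def cocyc_def hom_cx_def hom_d_def nat_space_simps(1))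
  moreover have "coboundaries K C P d G n = cobd (hom_cx C P G) (hom_d C P d) n"
    by (cases n) (simp_all add: cobd_def hom_cx_def hom_d_def nat_space_simps(1))
  ultimately show ?thesis by (simp add: hom_cohomology_def coh_def hom_cx_def)
qed

lemma linear_map_nat_eval:
  "a \<in> Obj C \<Longrightarrow> x \<in> carrier (Val F a) \<Longrightarrow> (\<lambda>\<eta>. \<eta> a x) \<in> linear_map K (nat_space K C F G) (Val G a)"
  by (intro linear_mapI) (auto simp: nat_space_simps nat_closed)

lemma nat_space_minus_apply:
  assumes "k_functor K C F" "k_functor K C G" "\<eta> \<in> nat_trans K C F G" "\<theta> \<in> nat_trans K C F G"
    and "a \<in> Obj C" "x \<in> carrier (Val F a)"
  shows "(\<eta> \<ominus>\<^bsub>nat_space K C F G\<^esub> \<theta>) a x = \<eta> a x \<ominus>\<^bsub>Val G a\<^esub> \<theta> a x"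
  using linear_map_minus[OF module_nat_space[OF assms(1,2)] kfun_module[OF assms(2,5)]
      linear_map_nat_eval[of a C x F G, OF assms(5,6)], of \<eta> \<theta>] assms(3,4)
  by (simp add: nat_space_simps(1))

lemma nat_space_minus_closed:
  assumes "k_functor K C F" "k_functor K C G" "\<eta> \<in> nat_trans K C F G" "\<theta> \<in> nat_trans K C F G"
  shows "\<eta> \<ominus>\<^bsub>nat_space K C F G\<^esub> \<theta> \<in> nat_trans K C F G"
  using minus_closed[OF module_nat_space[OF assms(1,2)], of \<eta> \<theta>] assms by (simp add: nat_space_simps(1))

context
  fixes C :: "('k, 'o, 'm) kcat" and F :: "('k, 'o, 'm, 'w) kfun" and P :: "nat \<Rightarrow> ('k, 'o, 'm, 'v) kfun" and d \<epsilon>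
  assumes C: "k_category K C" and F: "k_functor K C F" and res: "split_resolution C F P d \<epsilon>"
begin

lemma res_split: "split_projective C (P n)"
  and res_functor: "k_functor K C (P n)"
  and res_d: "d n \<in> nat_trans K C (P (Suc n)) (P n)"
  and res_eps: "\<epsilon> \<in> nat_trans K C (P 0) F"
  and res_surj: "a \<in> Obj C \<Longrightarrow> \<epsilon> a ` carrier (Val (P 0) a) = carrier (Val F a)"
  and res_exact0: "a \<in> Obj C \<Longrightarrow> d 0 a ` carrier (Val (P (Suc 0)) a) = {y \<in> carrier (Val (P 0) a). \<epsilon> a y = \<zero>\<^bsub>Val F a\<^esub>}"
  and res_exact: "a \<in> Obj C \<Longrightarrow> d (Suc n) a ` carrier (Val (P (Suc (Suc n))) a) =
     {y \<in> carrier (Val (P (Suc n)) a). d n a y = \<zero>\<^bsub>Val (P n) a\<^esub>}"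
  using res by (auto simp: split_resolution_def split_projective_def exact_at_def objectwise_surj_def)

lemma res_eps_d: "a \<in> Obj C \<Longrightarrow> x \<in> carrier (Val (P (Suc 0)) a) \<Longrightarrow> \<epsilon> a (d 0 a x) = \<zero>\<^bsub>Val F a\<^esub>"
  using res_exact0 by blast

lemma res_dd: "a \<in> Obj C \<Longrightarrow> x \<in> carrier (Val (P (Suc (Suc n))) a) \<Longrightarrow> d n a (d (Suc n) a x) = \<zero>\<^bsub>Val (P n) a\<^esub>"
  using res_exact by blast

lemma cocomplex_hom:
  assumes G: "k_functor K C G"
  shows "cocomplex (hom_cx C P G) (hom_d C P d)"
  unfolding cocomplex_def hom_cx_def hom_d_def[abs_def]
proof (intro conjI allI ballI module_nat_space linear_map_nat_comp_right res_functor G res_d)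
  fix n \<eta> assume "\<eta> \<in> carrier (nat_space K C (P n) G)"
  then have \<eta>: "\<eta> \<in> nat_trans K C (P n) G" by (simp add: nat_space_simps)
  note z = zero_closed[OF module_nat_space[OF res_functor G], unfolded nat_space_simps(1)]
  show "nat_comp C (P (Suc (Suc n))) (nat_comp C (P (Suc n)) \<eta> (d n)) (d (Suc n)) =
      \<zero>\<^bsub>nat_space K C (P (Suc (Suc n))) G\<^esub>"
    by (rule nat_eqI[OF nat_comp_closed[OF res_functor res_d nat_comp_closed[OF res_functor res_d \<eta>]] z])
      (simp add: nat_space_simps(2) nat_closed[OF res_d] res_dd
        linear_map_zero[OF kfun_module[OF res_functor] kfun_module[OF G] nat_linear[OF \<eta>]])
qed

text \<open>\<open>F\<close> is the cokernel of \<open>d 0\<close>, so a transformation that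
  vanishes on the image of \<open>d 0\<close> descends to \<open>F\<close>. This is the source of
  the Hom term that opens the sequence.\<close>

lemma zero_cocycle_factors:
  assumes G: "k_functor K C G" and \<eta>: "\<eta> \<in> cocyc (hom_cx C P G) (hom_d C P d) 0"
  shows "\<exists>\<theta>\<in>nat_trans K C F G. nat_comp C (P 0) \<theta> \<epsilon> = \<eta>"
proof -
  have \<eta>': "\<eta> \<in> nat_trans K C (P 0) G"
    and z: "nat_comp C (P (Suc 0)) \<eta> (d 0) = nat_of C (P (Suc 0)) (\<lambda>a x. \<zero>\<^bsub>Val G a\<^esub>)"
    using \<eta> by (auto simp: cocyc_def hom_cx_def hom_d_def nat_space_simps)
  have z': "\<eta> a (d 0 a x) = \<zero>\<^bsub>Val G a\<^esub>" if "a \<in> Obj C" "x \<in> carrier (Val (P (Suc 0)) a)" for a x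
    using fun_cong[OF fun_cong[OF z], of a x] that by simp
  \<comment> \<open>Elements with equal image under \<epsilon> differ by an element of the image of
    \<open>d 0\<close>, where \<eta> vanishes.\<close>
  have wd: "\<eta> a x = \<eta> a y" if a: "a \<in> Obj C" and xy: "x \<in> carrier (Val (P 0) a)" "y \<in> carrier (Val (P 0) a)"
    and e: "\<epsilon> a x = \<epsilon> a y" for a x y
  proof -
    interpret F: module K "Val F a" by (rule kfun_module[OF F a])
    interpret G: module K "Val G a" by (rule kfun_module[OF G a])
    interpret P: module K "Val (P 0) a" by (rule kfun_module[OF res_functor a])
    have "\<epsilon> a (x \<ominus>\<^bsub>Val (P 0) a\<^esub> y) = \<zero>\<^bsub>Val F a\<^esub>"
      using xy e nat_closed[OF res_eps a]
      by (simp add: linear_map_minus[OF P.module_axioms F.module_axioms nat_linear[OF res_eps a]] F.minus_eq F.r_neg)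
    then have "x \<ominus>\<^bsub>Val (P 0) a\<^esub> y \<in> d 0 a ` carrier (Val (P (Suc 0)) a)"
      using xy res_exact0[OF a] by simp
    then have "\<eta> a (x \<ominus>\<^bsub>Val (P 0) a\<^esub> y) = \<zero>\<^bsub>Val G a\<^esub>" using z'[OF a] by auto
    then have z: "\<eta> a x \<ominus>\<^bsub>Val G a\<^esub> \<eta> a y = \<zero>\<^bsub>Val G a\<^esub>"
      using xy by (simp add: linear_map_minus[OF P.module_axioms G.module_axioms nat_linear[OF \<eta>' a]])
    note cl = nat_closed[OF \<eta>' a xy(1)] nat_closed[OF \<eta>' a xy(2)]
    have "\<eta> a x = (\<eta> a x \<ominus>\<^bsub>Val G a\<^esub> \<eta> a y) \<oplus>\<^bsub>Val G a\<^esub> \<eta> a y"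
      using cl by (simp add: G.minus_eq G.a_assoc G.l_neg)
    then show ?thesis using cl by (simp add: z)
  qed
  \<comment> \<open>The value at \<open>y\<close> is read off at an arbitrary preimage under
    \<epsilon>; \<open>wd\<close> makes it independent of the choice.\<close>
  define \<theta>0 where "\<theta>0 a y = \<eta> a (SOME x. x \<in> carrier (Val (P 0) a) \<and> \<epsilon> a x = y)" for a y
  have \<theta>0: "\<theta>0 a (\<epsilon> a x) = \<eta> a x" if a: "a \<in> Obj C" and x: "x \<in> carrier (Val (P 0) a)" for a x
    unfolding \<theta>0_def by (rule someI2[of _ x]) (simp add: x, rule wd[OF a _ x], auto)
  have lin: "\<theta>0 a \<in> linear_map K (Val F a) (Val G a)" if a: "a \<in> Obj C" for a
  proof (rule linear_mapI; unfold res_surj[OF a, symmetric]; elim imageE)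
    show "\<theta>0 a y \<in> carrier (Val G a)" if "y = \<epsilon> a x" "x \<in> carrier (Val (P 0) a)" for x y
      using that a nat_closed[OF \<eta>'] by (simp add: \<theta>0)
    show "\<theta>0 a (y \<oplus>\<^bsub>Val F a\<^esub> y') = \<theta>0 a y \<oplus>\<^bsub>Val G a\<^esub> \<theta>0 a y'"
      if "y = \<epsilon> a x" "x \<in> carrier (Val (P 0) a)" "y' = \<epsilon> a x'" "x' \<in> carrier (Val (P 0) a)" for x x' y y'
      using that a \<theta>0[OF a add_closed[OF kfun_module[OF res_functor a] that(2,4)]]
      by (simp add: \<theta>0 linear_map_add[OF nat_linear[OF res_eps]] linear_map_add[OF nat_linear[OF \<eta>']])
    show "\<theta>0 a (r \<odot>\<^bsub>Val F a\<^esub> y) = r \<odot>\<^bsub>Val G a\<^esub> \<theta>0 a y"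
      if "r \<in> carrier K" "y = \<epsilon> a x" "x \<in> carrier (Val (P 0) a)" for r x y
      using that a \<theta>0[OF a smult_closed[OF kfun_module[OF res_functor a] that(1,3)]]
      by (simp add: \<theta>0 linear_map_smult[OF nat_linear[OF res_eps]] linear_map_smult[OF nat_linear[OF \<eta>']])
  qed
  have nat: "\<theta>0 b (Act F a b f y) = Act G a b f (\<theta>0 a y)"
    if ab: "a \<in> Obj C" "b \<in> Obj C" and f: "f \<in> carrier (Hom C a b)" and y: "y \<in> carrier (Val F a)" for a b f y
  proof -
    obtain x where x: "x \<in> carrier (Val (P 0) a)" "y = \<epsilon> a x" using y res_surj[OF ab(1)] by auto
    show ?thesis
      using ab f x \<theta>0[OF ab(2) kfun_closed[OF res_functor ab f x(1)]]
      by (simp add: \<theta>0 nat_natural[OF \<eta>'] nat_natural[OF res_eps])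
  qed
  have \<theta>: "nat_of C F \<theta>0 \<in> nat_trans K C F G" by (rule nat_ofI[OF F lin nat])
  have "nat_comp C (P 0) (nat_of C F \<theta>0) \<epsilon> = \<eta>"
    by (rule nat_eqI[OF nat_comp_closed[OF res_functor res_eps \<theta>] \<eta>']) (simp add: \<theta>0 nat_closed[OF res_eps])
  with \<theta> show ?thesis by blast
qed

section \<open>Homotopies and their effect on cohomology\<close>

text \<open>The endomorphism \<chi> covers zero on \<open>F\<close>, so each component of the
  homotopy exists as a lift against the next differential.\<close>

lemma res_null_homotopy:
  assumes \<chi>: "\<And>n. \<chi> n \<in> nat_trans K C (P n) (P n)"
    and \<chi>0: "\<And>a x. a \<in> Obj C \<Longrightarrow> x \<in> carrier (Val (P 0) a) \<Longrightarrow> \<epsilon> a (\<chi> 0 a x) = \<zero>\<^bsub>Val F a\<^esub>"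
    and \<chi>d: "\<And>n a x. a \<in> Obj C \<Longrightarrow> x \<in> carrier (Val (P (Suc n)) a) \<Longrightarrow> \<chi> n a (d n a x) = d n a (\<chi> (Suc n) a x)"
  obtains s where "\<And>n. s n \<in> nat_trans K C (P n) (P (Suc n))"
    "\<And>a x. a \<in> Obj C \<Longrightarrow> x \<in> carrier (Val (P 0) a) \<Longrightarrow> \<chi> 0 a x = d 0 a (s 0 a x)"
    "\<And>n a x. a \<in> Obj C \<Longrightarrow> x \<in> carrier (Val (P (Suc n)) a) \<Longrightarrow>
       \<chi> (Suc n) a x = d (Suc n) a (s (Suc n) a x) \<oplus>\<^bsub>Val (P (Suc n)) a\<^esub> s n a (d n a x)"
proof -
  \<comment> \<open>The second condition feeds the next step: it puts the difference of
    \<open>\<chi> (Suc n)\<close> and \<open>\<sigma> d\<close> into the kernel of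
    \<open>d n\<close>, hence into the image of \<open>d (Suc n)\<close>. Degree 0 has no term
    \<open>s d\<close> and is recorded separately.\<close>
  define I where "I n \<sigma> \<longleftrightarrow> \<sigma> \<in> nat_trans K C (P n) (P (Suc n)) \<and>
    (\<forall>a\<in>Obj C. \<forall>x\<in>carrier (Val (P (Suc n)) a). d n a (\<sigma> a (d n a x)) = d n a (\<chi> (Suc n) a x)) \<and>
    (n = 0 \<longrightarrow> (\<forall>a\<in>Obj C. \<forall>x\<in>carrier (Val (P 0) a). \<chi> 0 a x = d 0 a (\<sigma> a x)))" for n \<sigma>
  define R where "R n \<sigma> \<sigma>' \<longleftrightarrow> (\<forall>a\<in>Obj C. \<forall>x\<in>carrier (Val (P (Suc n)) a).
       \<chi> (Suc n) a x = d (Suc n) a (\<sigma>' a x) \<oplus>\<^bsub>Val (P (Suc n)) a\<^esub> \<sigma> a (d n a x))" for n \<sigma> \<sigma>'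
  note md = linear_map_minus[OF kfun_module[OF res_functor] kfun_module[OF res_functor] nat_linear[OF res_d]]
  have "\<exists>s. \<forall>n. I n (s n) \<and> R n (s n) (s (Suc n))"
  proof (rule dependent_nat_choice)
    obtain \<sigma> where \<sigma>: "\<sigma> \<in> nat_trans K C (P 0) (P (Suc 0))" "nat_comp C (P 0) (d 0) \<sigma> = \<chi> 0"
      using split_projective_lift_image[OF C res_split res_functor res_functor res_d \<chi>, of 0]
        res_exact0 \<chi>0 nat_closed[OF \<chi>, of _ _ 0] by blast
    have "\<chi> 0 a x = d 0 a (\<sigma> a x)" if "a \<in> Obj C" "x \<in> carrier (Val (P 0) a)" for a x
      using that by (simp flip: \<sigma>(2))
    then have "I 0 \<sigma>"
      using \<sigma> \<chi>d nat_closed[OF res_d] by (simp add: I_def flip: \<chi>d)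
    then show "\<exists>\<sigma>. I 0 \<sigma>" by blast
  next
    fix \<sigma> n assume I: "I n \<sigma>"
    have \<sigma>: "\<sigma> \<in> nat_trans K C (P n) (P (Suc n))"
      and \<sigma>d: "\<And>a x. a \<in> Obj C \<Longrightarrow> x \<in> carrier (Val (P (Suc n)) a) \<Longrightarrow> d n a (\<sigma> a (d n a x)) = d n a (\<chi> (Suc n) a x)"
      using I by (auto simp: I_def)
    have \<sigma>dn: "nat_comp C (P (Suc n)) \<sigma> (d n) \<in> nat_trans K C (P (Suc n)) (P (Suc n))"
      by (rule nat_comp_closed[OF res_functor res_d \<sigma>])
    \<comment> \<open>The part of \<open>\<chi> (Suc n)\<close> not yet accounted for by the
      homotopy; it is what the next component must lift.\<close>
    define \<alpha> where "\<alpha> = \<chi> (Suc n) \<ominus>\<^bsub>nat_space K C (P (Suc n)) (P (Suc n))\<^esub> nat_comp C (P (Suc n)) \<sigma> (d n)"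
    have \<alpha>: "\<alpha> \<in> nat_trans K C (P (Suc n)) (P (Suc n))"
      unfolding \<alpha>_def by (rule nat_space_minus_closed[OF res_functor res_functor \<chi> \<sigma>dn])
    have \<alpha>x: "\<alpha> a x = \<chi> (Suc n) a x \<ominus>\<^bsub>Val (P (Suc n)) a\<^esub> \<sigma> a (d n a x)"
      if "a \<in> Obj C" "x \<in> carrier (Val (P (Suc n)) a)" for a x
      using nat_space_minus_apply[OF res_functor res_functor \<chi> \<sigma>dn that] that by (simp add: \<alpha>_def)
    have im: "\<alpha> a x \<in> d (Suc n) a ` carrier (Val (P (Suc (Suc n))) a)"
      if a: "a \<in> Obj C" and x: "x \<in> carrier (Val (P (Suc n)) a)" for a x
    proof -
      interpret P: module K "Val (P n) a" by (rule kfun_module[OF res_functor a])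
      show ?thesis
        using a x nat_closed[OF \<alpha> a x] nat_closed[OF \<chi>[of "Suc n"] a x] nat_closed[OF \<sigma> a nat_closed[OF res_d a x]]
          nat_closed[OF res_d a nat_closed[OF \<chi>[of "Suc n"] a x]]
        by (simp add: res_exact \<alpha>x md \<sigma>d P.minus_eq P.r_neg)
    qed
    obtain \<sigma>' where \<sigma>': "\<sigma>' \<in> nat_trans K C (P (Suc n)) (P (Suc (Suc n)))" "nat_comp C (P (Suc n)) (d (Suc n)) \<sigma>' = \<alpha>"
      using split_projective_lift_image[OF C res_split res_functor res_functor res_d \<alpha> im] by blast
    have d\<sigma>': "d (Suc n) a (\<sigma>' a x) = \<chi> (Suc n) a x \<ominus>\<^bsub>Val (P (Suc n)) a\<^esub> \<sigma> a (d n a x)"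
      if "a \<in> Obj C" "x \<in> carrier (Val (P (Suc n)) a)" for a x
      using \<alpha>x[OF that] that by (simp flip: \<sigma>'(2))
    have "d (Suc n) a (\<sigma>' a (d (Suc n) a x)) = d (Suc n) a (\<chi> (Suc (Suc n)) a x)"
      if a: "a \<in> Obj C" and x: "x \<in> carrier (Val (P (Suc (Suc n))) a)" for a x
    proof -
      interpret P: module K "Val (P (Suc n)) a" by (rule kfun_module[OF res_functor a])
      show ?thesis
        using a x nat_closed[OF res_d a x] nat_closed[OF res_d a nat_closed[OF \<chi>[of "Suc (Suc n)"] a x]]
        by (simp add: d\<sigma>' res_dd \<chi>d P.minus_eq
            linear_map_zero[OF kfun_module[OF res_functor] kfun_module[OF res_functor] nat_linear[OF \<sigma>]])
    qed
    then have "I (Suc n) \<sigma>'" using \<sigma>' by (simp add: I_def)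
    moreover have "R n \<sigma> \<sigma>'"
      unfolding R_def
    proof (intro ballI)
      fix a x assume a: "a \<in> Obj C" and x: "x \<in> carrier (Val (P (Suc n)) a)"
      interpret P: module K "Val (P (Suc n)) a" by (rule kfun_module[OF res_functor a])
      show "\<chi> (Suc n) a x = d (Suc n) a (\<sigma>' a x) \<oplus>\<^bsub>Val (P (Suc n)) a\<^esub> \<sigma> a (d n a x)"
        using a x nat_closed[OF \<chi>[of "Suc n"] a x] nat_closed[OF \<sigma> a nat_closed[OF res_d a x]]
        by (simp add: d\<sigma>' P.minus_eq P.a_assoc P.l_neg)
    qed
    ultimately show "\<exists>\<sigma>'. I (Suc n) \<sigma>' \<and> R n \<sigma> \<sigma>'" by blast
  qed
  then obtain s where "\<And>n. I n (s n)" "\<And>n. R n (s n) (s (Suc n))" by blast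
  then show ?thesis by (intro that[of s]) (auto simp: I_def R_def)
qed

text \<open>\<kappa> lifts the identity of \<open>F\<close>, so it differs from the identity by
  \<open>d s + s d\<close>. For a cocycle \<eta> the part \<open>\<eta> d s\<close> vanishes, and
  \<open>\<eta> s d\<close> is the coboundary of \<open>\<eta> s\<close>.\<close>

lemma res_endo_cohomology:
  assumes G: "k_functor K C G"
    and \<kappa>: "\<And>n. \<kappa> n \<in> nat_trans K C (P n) (P n)"
    and \<kappa>0: "\<And>a x. a \<in> Obj C \<Longrightarrow> x \<in> carrier (Val (P 0) a) \<Longrightarrow> \<epsilon> a (\<kappa> 0 a x) = \<epsilon> a x"
    and \<kappa>d: "\<And>n a x. a \<in> Obj C \<Longrightarrow> x \<in> carrier (Val (P (Suc n)) a) \<Longrightarrow> \<kappa> n a (d n a x) = d n a (\<kappa> (Suc n) a x)"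
    and \<eta>: "\<eta> \<in> cocyc (hom_cx C P G) (hom_d C P d) n"
  shows "\<exists>b\<in>cobd (hom_cx C P G) (hom_d C P d) n. nat_comp C (P n) \<eta> (\<kappa> n) = \<eta> \<oplus>\<^bsub>hom_cx C P G n\<^esub> b"
proof -
  define \<chi> where "\<chi> n = \<kappa> n \<ominus>\<^bsub>nat_space K C (P n) (P n)\<^esub> nat_id C (P n)" for n
  note ids = nat_id_closed[OF res_functor]
  have \<chi>: "\<chi> n \<in> nat_trans K C (P n) (P n)" for n
    unfolding \<chi>_def by (rule nat_space_minus_closed[OF res_functor res_functor \<kappa> ids])
  have \<chi>x: "\<chi> n a x = \<kappa> n a x \<ominus>\<^bsub>Val (P n) a\<^esub> x" if "a \<in> Obj C" "x \<in> carrier (Val (P n) a)" for n a x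
    using nat_space_minus_apply[OF res_functor res_functor \<kappa> ids that] that by (simp add: \<chi>_def)
  have \<kappa>x: "\<kappa> n a x = x \<oplus>\<^bsub>Val (P n) a\<^esub> \<chi> n a x" if a: "a \<in> Obj C" and x: "x \<in> carrier (Val (P n) a)" for n a x
  proof -
    interpret P: module K "Val (P n) a" by (rule kfun_module[OF res_functor a])
    show ?thesis using nat_closed[OF \<kappa> a x] x by (simp add: \<chi>x[OF a x] P.minus_eq P.a_lcomm[of x] P.r_neg)
  qed
  note md = linear_map_minus[OF kfun_module[OF res_functor] kfun_module[OF res_functor] nat_linear[OF res_d]]
  obtain s where s: "\<And>n. s n \<in> nat_trans K C (P n) (P (Suc n))"
    "\<And>a x. a \<in> Obj C \<Longrightarrow> x \<in> carrier (Val (P 0) a) \<Longrightarrow> \<chi> 0 a x = d 0 a (s 0 a x)"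
    "\<And>n a x. a \<in> Obj C \<Longrightarrow> x \<in> carrier (Val (P (Suc n)) a) \<Longrightarrow>
       \<chi> (Suc n) a x = d (Suc n) a (s (Suc n) a x) \<oplus>\<^bsub>Val (P (Suc n)) a\<^esub> s n a (d n a x)"
  proof (rule res_null_homotopy[OF \<chi>])
    fix a x assume a: "a \<in> Obj C"
    interpret F: module K "Val F a" by (rule kfun_module[OF F a])
    {
      assume x: "x \<in> carrier (Val (P 0) a)"
      show "\<epsilon> a (\<chi> 0 a x) = \<zero>\<^bsub>Val F a\<^esub>"
        using x nat_closed[OF \<kappa> a x] nat_closed[OF res_eps a x]
        by (simp add: \<chi>x[OF a x] \<kappa>0[OF a x] F.minus_eq F.r_neg
            linear_map_minus[OF kfun_module[OF res_functor a] kfun_module[OF F a] nat_linear[OF res_eps a]])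
    }
    fix n assume x: "x \<in> carrier (Val (P (Suc n)) a)"
    show "\<chi> n a (d n a x) = d n a (\<chi> (Suc n) a x)"
      using a x nat_closed[OF \<kappa> a x] by (simp add: \<chi>x[OF a] nat_closed[OF res_d a] md[OF a] \<kappa>d[OF a])
  qed blast
  have \<eta>': "\<eta> \<in> nat_trans K C (P n) G"
    and z: "nat_comp C (P (Suc n)) \<eta> (d n) = nat_of C (P (Suc n)) (\<lambda>a x. \<zero>\<^bsub>Val G a\<^esub>)"
    using \<eta> by (auto simp: cocyc_def hom_cx_def hom_d_def nat_space_simps)
  have z': "\<eta> a (d n a x) = \<zero>\<^bsub>Val G a\<^esub>" if "a \<in> Obj C" "x \<in> carrier (Val (P (Suc n)) a)" for a x
    using fun_cong[OF fun_cong[OF z], of a x] that by simp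
  note zero = linear_map_zero[OF kfun_module[OF res_functor] kfun_module[OF G] nat_linear[OF \<eta>']]
  note add = linear_map_add[OF nat_linear[OF \<eta>']]
  note mG = module_nat_space[OF res_functor G]
  show ?thesis
  proof (cases n)
    case 0
    \<comment> \<open>In degree 0 the homotopy consists of \<open>d s\<close> alone, so the cocycle
      does not change at all.\<close>
    have "\<eta> a (\<chi> n a x) = \<zero>\<^bsub>Val G a\<^esub>" if "a \<in> Obj C" "x \<in> carrier (Val (P n) a)" for a x
      using that 0 s(2) z' nat_closed[OF s(1)] by simp
    then have "nat_comp C (P n) \<eta> (\<kappa> n) = \<eta>"
      by (intro nat_eqI[OF nat_comp_closed[OF res_functor \<kappa> \<eta>'] \<eta>'])
        (simp add: nat_closed[OF \<eta>'] nat_closed[OF \<chi>] \<kappa>x add add_zero[OF kfun_module[OF G]])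
    then show ?thesis
      using \<eta>' 0 add_zero[OF mG, of \<eta> 0] by (simp add: cobd_def hom_cx_def nat_space_simps(1))
  next
    case (Suc m)
    have \<eta>s: "nat_comp C (P m) \<eta> (s m) \<in> nat_trans K C (P m) G"
      using \<eta>' Suc by (intro nat_comp_closed[OF res_functor s(1)]) simp
    define b where "b = nat_comp C (P n) (nat_comp C (P m) \<eta> (s m)) (d m)"
    have b: "b \<in> nat_trans K C (P n) G"
      unfolding b_def Suc by (rule nat_comp_closed[OF res_functor res_d \<eta>s])
    have "nat_comp C (P n) \<eta> (\<kappa> n) = \<eta> \<oplus>\<^bsub>nat_space K C (P n) G\<^esub> b"
    proof (rule nat_eqI[OF nat_comp_closed[OF res_functor \<kappa> \<eta>']])
      show "\<eta> \<oplus>\<^bsub>nat_space K C (P n) G\<^esub> b \<in> nat_trans K C (P n) G"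
        using add_closed[OF mG] \<eta>' b by (simp add: nat_space_simps(1))
      fix a x assume a: "a \<in> Obj C" and x: "x \<in> carrier (Val (P n) a)"
      have 1: "d n a (s n a x) \<in> carrier (Val (P n) a)" "s m a (d m a x) \<in> carrier (Val (P n) a)"
        using x Suc nat_closed[OF s(1) a] nat_closed[OF res_d a] by auto
      have "\<eta> a (\<chi> n a x) = \<eta> a (s m a (d m a x))"
        using 1 x a s(3)[OF a, of x m] Suc add z' nat_closed[OF s(1)] nat_closed[OF \<eta>']
        by (simp add: zero_add[OF kfun_module[OF G]])
      then show "nat_comp C (P n) \<eta> (\<kappa> n) a x = (\<eta> \<oplus>\<^bsub>nat_space K C (P n) G\<^esub> b) a x"
        using a x nat_closed[OF \<chi> a x] nat_closed[OF res_d a, of x m] Suc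
        by (simp add: nat_space_simps(3) \<kappa>x add[unfolded Suc] b_def)
    qed
    moreover have "b \<in> cobd (hom_cx C P G) (hom_d C P d) n"
      using \<eta>s by (auto simp: Suc cobd_def hom_d_def hom_cx_def nat_space_simps(1) b_def)
    ultimately show ?thesis by (auto simp: hom_cx_def)
  qed
qed

end

section \<open>Comparison of two resolutions\<close>

lemma resolution_chain_map:
  fixes F :: "('k, 'o, 'm, 'w) kfun" and P :: "nat \<Rightarrow> ('k, 'o, 'm, 'v) kfun" and Q :: "nat \<Rightarrow> ('k, 'o, 'm, 'u) kfun"
  assumes C: "k_category K C" and F: "k_functor K C F"
    and P: "split_resolution C F P d \<epsilon>" and Q: "split_resolution C F Q e \<zeta>"
  obtains \<phi> where "\<And>n. \<phi> n \<in> nat_trans K C (P n) (Q n)"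
    "\<And>a x. a \<in> Obj C \<Longrightarrow> x \<in> carrier (Val (P 0) a) \<Longrightarrow> \<zeta> a (\<phi> 0 a x) = \<epsilon> a x"
    "\<And>n a x. a \<in> Obj C \<Longrightarrow> x \<in> carrier (Val (P (Suc n)) a) \<Longrightarrow> \<phi> n a (d n a x) = e n a (\<phi> (Suc n) a x)"
proof -
  note p = res_split[OF C F P] res_functor[OF C F P] res_d[OF C F P] res_eps[OF C F P]
  note q = res_functor[OF C F Q] res_d[OF C F Q] res_eps[OF C F Q]
  \<comment> \<open>Landing in the image of \<open>e n\<close> is exactly what the lift in the next
    degree requires. In degree 0 it follows from compatibility with the augmentations.\<close>
  define I where "I n \<sigma> \<longleftrightarrow> \<sigma> \<in> nat_trans K C (P n) (Q n) \<and>
    (\<forall>a\<in>Obj C. \<forall>x\<in>carrier (Val (P (Suc n)) a). \<sigma> a (d n a x) \<in> e n a ` carrier (Val (Q (Suc n)) a)) \<and>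
    (n = 0 \<longrightarrow> (\<forall>a\<in>Obj C. \<forall>x\<in>carrier (Val (P 0) a). \<zeta> a (\<sigma> a x) = \<epsilon> a x))" for n \<sigma>
  define R where "R n \<sigma> \<sigma>' \<longleftrightarrow> (\<forall>a\<in>Obj C. \<forall>x\<in>carrier (Val (P (Suc n)) a). \<sigma> a (d n a x) = e n a (\<sigma>' a x))" for n \<sigma> \<sigma>'
  have "\<exists>\<phi>. \<forall>n. I n (\<phi> n) \<and> R n (\<phi> n) (\<phi> (Suc n))"
  proof (rule dependent_nat_choice)
    obtain \<sigma> where \<sigma>: "\<sigma> \<in> nat_trans K C (P 0) (Q 0)" "nat_comp C (P 0) \<zeta> \<sigma> = \<epsilon>"
      using split_projective_lift[OF C p(1) q(1) F q(3) p(4)] res_surj[OF C F Q]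
      by (auto simp: objectwise_surj_def)
    have "\<zeta> a (\<sigma> a x) = \<epsilon> a x" if "a \<in> Obj C" "x \<in> carrier (Val (P 0) a)" for a x
      using that by (simp flip: \<sigma>(2))
    then have "I 0 \<sigma>"
      using \<sigma>(1) nat_closed[OF p(3)] nat_closed[OF \<sigma>(1)]
      by (simp add: I_def res_exact0[OF C F Q] res_eps_d[OF C F P])
    then show "\<exists>\<sigma>. I 0 \<sigma>" by blast
  next
    fix \<sigma> n assume I: "I n \<sigma>"
    then have \<sigma>: "\<sigma> \<in> nat_trans K C (P n) (Q n)"
      and im: "\<And>a x. a \<in> Obj C \<Longrightarrow> x \<in> carrier (Val (P (Suc n)) a) \<Longrightarrow>
        nat_comp C (P (Suc n)) \<sigma> (d n) a x \<in> e n a ` carrier (Val (Q (Suc n)) a)"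
      by (auto simp: I_def)
    obtain \<sigma>' where \<sigma>': "\<sigma>' \<in> nat_trans K C (P (Suc n)) (Q (Suc n))"
        "nat_comp C (P (Suc n)) (e n) \<sigma>' = nat_comp C (P (Suc n)) \<sigma> (d n)"
      using split_projective_lift_image[OF C p(1) q(1) q(1) q(2) nat_comp_closed[OF p(2) p(3) \<sigma>] im] by blast
    have R: "\<sigma> a (d n a x) = e n a (\<sigma>' a x)" if "a \<in> Obj C" "x \<in> carrier (Val (P (Suc n)) a)" for a x
      using fun_cong[OF fun_cong[OF \<sigma>'(2)], of a x] that by simp
    have "I (Suc n) \<sigma>'"
      using \<sigma>'(1) nat_closed[OF p(3)] nat_closed[OF \<sigma>'(1)]
        linear_map_zero[OF kfun_module[OF p(2)] kfun_module[OF q(1)] nat_linear[OF \<sigma>]]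
      by (simp add: I_def res_exact[OF C F Q] res_dd[OF C F P] flip: R)
    with R show "\<exists>\<sigma>'. I (Suc n) \<sigma>' \<and> R n \<sigma> \<sigma>'" by (auto simp: R_def)
  qed
  then obtain \<phi> where "\<And>n. I n (\<phi> n)" "\<And>n. R n (\<phi> n) (\<phi> (Suc n))" by blast
  then show ?thesis by (intro that[of \<phi>]) (auto simp: I_def R_def)
qed

text \<open>The composites of comparison maps are endomorphisms of one resolution over the identity
  of \<open>F\<close>, so \<open>res_endo_cohomology\<close> applies to both. The two resolutions
  may have different value types.\<close>

theorem coh_hom_resolution_iso:
  fixes F :: "('k, 'o, 'm, 'w) kfun" and P :: "nat \<Rightarrow> ('k, 'o, 'm, 'v) kfun" and Q :: "nat \<Rightarrow> ('k, 'o, 'm, 'u) kfun"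
  assumes C: "k_category K C" and F: "k_functor K C F" and G: "k_functor K C G"
    and P: "split_resolution C F P d \<epsilon>" and Q: "split_resolution C F Q e \<zeta>"
  shows "\<exists>\<theta>\<in>linear_map K (coh (hom_cx C P G) (hom_d C P d) n) (coh (hom_cx C Q G) (hom_d C Q e) n).
    bij_betw \<theta> (carrier (coh (hom_cx C P G) (hom_d C P d) n)) (carrier (coh (hom_cx C Q G) (hom_d C Q e) n))"
proof -
  note fP = res_functor[OF C F P] and fQ = res_functor[OF C F Q]
  note dP = res_d[OF C F P] and dQ = res_d[OF C F Q]
  obtain \<phi> where \<phi>: "\<And>n. \<phi> n \<in> nat_trans K C (P n) (Q n)"
    "\<And>a x. a \<in> Obj C \<Longrightarrow> x \<in> carrier (Val (P 0) a) \<Longrightarrow> \<zeta> a (\<phi> 0 a x) = \<epsilon> a x"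
    "\<And>n a x. a \<in> Obj C \<Longrightarrow> x \<in> carrier (Val (P (Suc n)) a) \<Longrightarrow> \<phi> n a (d n a x) = e n a (\<phi> (Suc n) a x)"
    by (rule resolution_chain_map[OF C F P Q], rule that)
  obtain \<psi> where \<psi>: "\<And>n. \<psi> n \<in> nat_trans K C (Q n) (P n)"
    "\<And>a x. a \<in> Obj C \<Longrightarrow> x \<in> carrier (Val (Q 0) a) \<Longrightarrow> \<epsilon> a (\<psi> 0 a x) = \<zeta> a x"
    "\<And>n a x. a \<in> Obj C \<Longrightarrow> x \<in> carrier (Val (Q (Suc n)) a) \<Longrightarrow> \<psi> n a (e n a x) = d n a (\<psi> (Suc n) a x)"
    by (rule resolution_chain_map[OF C F Q P], rule that)
  have "cochain_map (hom_cx C P G) (hom_d C P d) (hom_cx C Q G) (hom_d C Q e) (\<lambda>n \<eta>. nat_comp C (Q n) \<eta> (\<psi> n))"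
    unfolding cochain_map_def hom_cx_def hom_d_def nat_space_simps(1)
  proof (intro conjI allI ballI linear_map_nat_comp_right fP fQ G \<psi>(1))
    fix n \<eta> assume \<eta>: "\<eta> \<in> nat_trans K C (P n) G"
    show "nat_comp C (Q (Suc n)) (nat_comp C (P (Suc n)) \<eta> (d n)) (\<psi> (Suc n)) =
        nat_comp C (Q (Suc n)) (nat_comp C (Q n) \<eta> (\<psi> n)) (e n)"
      by (rule nat_eqI[OF nat_comp_closed[OF fQ \<psi>(1) nat_comp_closed[OF fP dP \<eta>]]
            nat_comp_closed[OF fQ dQ nat_comp_closed[OF fQ \<psi>(1) \<eta>]]])
        (simp add: nat_closed[OF \<psi>(1)] nat_closed[OF dQ] \<psi>(3))
  qed
  moreover have "cochain_map (hom_cx C Q G) (hom_d C Q e) (hom_cx C P G) (hom_d C P d) (\<lambda>n \<eta>. nat_comp C (P n) \<eta> (\<phi> n))"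
    unfolding cochain_map_def hom_cx_def hom_d_def nat_space_simps(1)
  proof (intro conjI allI ballI linear_map_nat_comp_right fP fQ G \<phi>(1))
    fix n \<eta> assume \<eta>: "\<eta> \<in> nat_trans K C (Q n) G"
    show "nat_comp C (P (Suc n)) (nat_comp C (Q (Suc n)) \<eta> (e n)) (\<phi> (Suc n)) =
        nat_comp C (P (Suc n)) (nat_comp C (P n) \<eta> (\<phi> n)) (d n)"
      by (rule nat_eqI[OF nat_comp_closed[OF fP \<phi>(1) nat_comp_closed[OF fQ dQ \<eta>]]
            nat_comp_closed[OF fP dP nat_comp_closed[OF fP \<phi>(1) \<eta>]]])
        (simp add: nat_closed[OF \<phi>(1)] nat_closed[OF dP] \<phi>(3))
  qed
  moreover have "\<exists>b\<in>cobd (hom_cx C P G) (hom_d C P d) n.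
      nat_comp C (P n) (nat_comp C (Q n) \<eta> (\<psi> n)) (\<phi> n) = \<eta> \<oplus>\<^bsub>hom_cx C P G n\<^esub> b"
    if \<eta>: "\<eta> \<in> cocyc (hom_cx C P G) (hom_d C P d) n" for n \<eta>
  proof -
    have "\<eta> \<in> nat_trans K C (P n) G" using cocycD(1)[OF \<eta>] by (simp add: hom_cx_def nat_space_simps)
    then have "nat_comp C (P n) (nat_comp C (Q n) \<eta> (\<psi> n)) (\<phi> n) = nat_comp C (P n) \<eta> (nat_comp C (P n) (\<psi> n) (\<phi> n))"
      by (intro nat_comp_assoc[OF fP \<phi>(1) \<psi>(1)] fQ)
    then show ?thesis
      using res_endo_cohomology[OF C F P G _ _ _ \<eta>, of "\<lambda>n. nat_comp C (P n) (\<psi> n) (\<phi> n)"]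
        nat_comp_closed[OF fP \<phi>(1) \<psi>(1)] nat_closed[OF \<phi>(1)] nat_closed[OF dP]
      by (simp add: \<phi>(2,3) \<psi>(2,3))
  qed
  moreover have "\<exists>b\<in>cobd (hom_cx C Q G) (hom_d C Q e) n.
      nat_comp C (Q n) (nat_comp C (P n) \<eta> (\<phi> n)) (\<psi> n) = \<eta> \<oplus>\<^bsub>hom_cx C Q G n\<^esub> b"
    if \<eta>: "\<eta> \<in> cocyc (hom_cx C Q G) (hom_d C Q e) n" for n \<eta>
  proof -
    have "\<eta> \<in> nat_trans K C (Q n) G" using cocycD(1)[OF \<eta>] by (simp add: hom_cx_def nat_space_simps)
    then have "nat_comp C (Q n) (nat_comp C (P n) \<eta> (\<phi> n)) (\<psi> n) = nat_comp C (Q n) \<eta> (nat_comp C (Q n) (\<phi> n) (\<psi> n))"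
      by (intro nat_comp_assoc[OF fQ \<psi>(1) \<phi>(1)] fP)
    then show ?thesis
      using res_endo_cohomology[OF C F Q G _ _ _ \<eta>, of "\<lambda>n. nat_comp C (Q n) (\<phi> n) (\<psi> n)"]
        nat_comp_closed[OF fQ \<psi>(1) \<phi>(1)] nat_closed[OF \<psi>(1)] nat_closed[OF dQ]
      by (simp add: \<phi>(2,3) \<psi>(2,3))
  qed
  ultimately show ?thesis
    by (rule coh_iso[OF cocomplex_hom[OF C F P G] cocomplex_hom[OF C F Q G]])
qed

end

section \<open>Change of categories along a non-unital section\<close>

text \<open>
  A functor \<open>\<Psi> : A \<rightarrow> B\<close> together with a section \<open>\<sigma>\<close> on morphisms that is compatible with
  composition but need not preserve identities; \<open>\<sigma>(1\<^sub>b)\<close> is an idempotent.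
\<close>

locale retract = ground K for K :: "'k ring" +
  fixes A :: "('k, 'p, 'm) kcat" and B :: "('k, 'q, 'n) kcat"
    and \<Psi>o :: "'p \<Rightarrow> 'q" and \<Psi> :: "'p \<Rightarrow> 'p \<Rightarrow> 'm \<Rightarrow> 'n" and so :: "'q \<Rightarrow> 'p" and \<sigma> :: "'p \<Rightarrow> 'p \<Rightarrow> 'n \<Rightarrow> 'm"
  assumes A: "k_category K A" and B: "k_category K B"
    and \<Psi>o: "\<And>a. a \<in> Obj A \<Longrightarrow> \<Psi>o a \<in> Obj B"
    and so: "\<And>b. b \<in> Obj B \<Longrightarrow> so b \<in> Obj A" and \<Psi>o_so: "\<And>b. b \<in> Obj B \<Longrightarrow> \<Psi>o (so b) = b"
    and \<Psi>_linear: "\<And>a a'. a \<in> Obj A \<Longrightarrow> a' \<in> Obj A \<Longrightarrow> \<Psi> a a' \<in> linear_map K (Hom A a a') (Hom B (\<Psi>o a) (\<Psi>o a'))"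
    and \<Psi>_Id: "\<And>a. a \<in> Obj A \<Longrightarrow> \<Psi> a a (Id A a) = Id B (\<Psi>o a)"
    and \<Psi>_comp: "\<And>a b c f g. a \<in> Obj A \<Longrightarrow> b \<in> Obj A \<Longrightarrow> c \<in> Obj A \<Longrightarrow>
      f \<in> carrier (Hom A a b) \<Longrightarrow> g \<in> carrier (Hom A b c) \<Longrightarrow>
      \<Psi> a c (Comp A a b c g f) = Comp B (\<Psi>o a) (\<Psi>o b) (\<Psi>o c) (\<Psi> b c g) (\<Psi> a b f)"
    and \<sigma>_linear: "\<And>a a'. a \<in> Obj A \<Longrightarrow> a' \<in> Obj A \<Longrightarrow> \<sigma> a a' \<in> linear_map K (Hom B (\<Psi>o a) (\<Psi>o a')) (Hom A a a')"
    and \<Psi>_\<sigma>: "\<And>a a' u. a \<in> Obj A \<Longrightarrow> a' \<in> Obj A \<Longrightarrow> u \<in> carrier (Hom B (\<Psi>o a) (\<Psi>o a')) \<Longrightarrow> \<Psi> a a' (\<sigma> a a' u) = u"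
    and \<sigma>_comp: "\<And>a b c u v. a \<in> Obj A \<Longrightarrow> b \<in> Obj A \<Longrightarrow> c \<in> Obj A \<Longrightarrow>
      u \<in> carrier (Hom B (\<Psi>o a) (\<Psi>o b)) \<Longrightarrow> v \<in> carrier (Hom B (\<Psi>o b) (\<Psi>o c)) \<Longrightarrow>
      Comp A a b c (\<sigma> b c v) (\<sigma> a b u) = \<sigma> a c (Comp B (\<Psi>o a) (\<Psi>o b) (\<Psi>o c) v u)"
begin

lemma \<Psi>_closed: "a \<in> Obj A \<Longrightarrow> a' \<in> Obj A \<Longrightarrow> f \<in> carrier (Hom A a a') \<Longrightarrow> \<Psi> a a' f \<in> carrier (Hom B (\<Psi>o a) (\<Psi>o a'))"
  using \<Psi>_linear linear_map_closed by metis

lemma \<sigma>_closed: "a \<in> Obj A \<Longrightarrow> a' \<in> Obj A \<Longrightarrow> u \<in> carrier (Hom B (\<Psi>o a) (\<Psi>o a')) \<Longrightarrow> \<sigma> a a' u \<in> carrier (Hom A a a')"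
  using \<sigma>_linear linear_map_closed by metis

definition res_fun :: "('k, 'q, 'n, 'v) kfun \<Rightarrow> ('k, 'p, 'm, 'v) kfun" where
  "res_fun Y = \<lparr>Val = (\<lambda>a. Val Y (\<Psi>o a)), Act = (\<lambda>a b f. Act Y (\<Psi>o a) (\<Psi>o b) (\<Psi> a b f))\<rparr>"

definition res_nat :: "('k, 'q, 'n, 'v) kfun \<Rightarrow> ('q \<Rightarrow> 'v \<Rightarrow> 'w) \<Rightarrow> 'p \<Rightarrow> 'v \<Rightarrow> 'w" where
  "res_nat Y \<eta> = nat_of A (res_fun Y) (\<lambda>a. \<eta> (\<Psi>o a))"

text \<open>The corner cut out by the idempotents. Since \<sigma> is not unital, the fixed space at
  \<open>so b\<close>, rather than the whole value, is where identities of \<open>B\<close> act as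
  identities.\<close>

definition eig_fun :: "('k, 'p, 'm, 'v) kfun \<Rightarrow> ('k, 'q, 'n, 'v) kfun" where
  "eig_fun X = \<lparr>Val = (\<lambda>b. (Val X (so b))\<lparr>carrier :=
       {x \<in> carrier (Val X (so b)). Act X (so b) (so b) (\<sigma> (so b) (so b) (Id B b)) x = x}\<rparr>),
     Act = (\<lambda>b b' u. Act X (so b) (so b') (\<sigma> (so b) (so b') u))\<rparr>"

definition eig_nat :: "('k, 'p, 'm, 'v) kfun \<Rightarrow> ('p \<Rightarrow> 'v \<Rightarrow> 'w) \<Rightarrow> 'q \<Rightarrow> 'v \<Rightarrow> 'w" where
  "eig_nat X \<eta> = nat_of B (eig_fun X) (\<lambda>b. \<eta> (so b))"

lemma res_fun_simps [simp]:
  "Val (res_fun Y) a = Val Y (\<Psi>o a)" "Act (res_fun Y) a b f = Act Y (\<Psi>o a) (\<Psi>o b) (\<Psi> a b f)"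
  by (simp_all add: res_fun_def)

lemma eig_fun_simps [simp]:
  "carrier (Val (eig_fun X) b) = {x \<in> carrier (Val X (so b)). Act X (so b) (so b) (\<sigma> (so b) (so b) (Id B b)) x = x}"
  "\<zero>\<^bsub>Val (eig_fun X) b\<^esub> = \<zero>\<^bsub>Val X (so b)\<^esub>"
  "x \<oplus>\<^bsub>Val (eig_fun X) b\<^esub> y = x \<oplus>\<^bsub>Val X (so b)\<^esub> y" "r \<odot>\<^bsub>Val (eig_fun X) b\<^esub> x = r \<odot>\<^bsub>Val X (so b)\<^esub> x"
  "Act (eig_fun X) b b' u = Act X (so b) (so b') (\<sigma> (so b) (so b') u)"
  by (simp_all add: eig_fun_def)

lemma k_functor_res:
  assumes Y: "k_functor K B Y"
  shows "k_functor K A (res_fun Y)"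
proof -
  have "(\<lambda>f. Act Y (\<Psi>o a) (\<Psi>o b) (\<Psi> a b f)) \<in> bilinear_map K (Hom A a b) (Val Y (\<Psi>o a)) (Val Y (\<Psi>o b))"
    if "a \<in> Obj A" "b \<in> Obj A" for a b
    using that by (intro bilinear_mapI linear_map_comp[OF \<Psi>_linear kfun_linear2[OF Y]] kfun_linear[OF Y] \<Psi>o \<Psi>_closed)
  then show ?thesis
    unfolding k_functor_def
    by (auto simp: res_fun_def \<Psi>o kfun_module[OF Y] \<Psi>_Id kfun_Id[OF Y] \<Psi>_comp kfun_comp[OF Y] \<Psi>_closed)
qed

lemma res_nat_closed:
  assumes "k_functor K B Y" and \<eta>: "\<eta> \<in> nat_trans K B Y Z"
  shows "res_nat Y \<eta> \<in> nat_trans K A (res_fun Y) (res_fun Z)"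
  unfolding res_nat_def
  by (rule nat_ofI[OF k_functor_res[OF assms(1)]])
    (auto simp: \<Psi>o nat_linear[OF \<eta>] nat_natural[OF \<eta>] \<Psi>_closed)

context
  fixes X :: "('k, 'p, 'm, 'v) kfun"
  assumes X: "k_functor K A X"
begin

lemma Act_\<sigma>_comp:
  assumes "a \<in> Obj A" "b \<in> Obj A" "c \<in> Obj A"
    "u \<in> carrier (Hom B (\<Psi>o a) (\<Psi>o b))" "v \<in> carrier (Hom B (\<Psi>o b) (\<Psi>o c))" "x \<in> carrier (Val X a)"
  shows "Act X b c (\<sigma> b c v) (Act X a b (\<sigma> a b u) x) = Act X a c (\<sigma> a c (Comp B (\<Psi>o a) (\<Psi>o b) (\<Psi>o c) v u)) x"
  using assms by (simp flip: kfun_comp[OF X] \<sigma>_comp add: \<sigma>_closed)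

text \<open>\<sigma> respects composition, so the idempotent fixes every \<sigma>-morphism into
  \<open>so b\<close>; hence all that such a morphism hits is fixed.\<close>

lemma Act_\<sigma>_closed:
  assumes a: "a \<in> Obj A" and b: "b \<in> Obj B" and u: "u \<in> carrier (Hom B (\<Psi>o a) b)" and x: "x \<in> carrier (Val X a)"
  shows "Act X a (so b) (\<sigma> a (so b) u) x \<in> carrier (Val (eig_fun X) b)"
  using assms by (simp add: Act_\<sigma>_comp so \<Psi>o_so \<Psi>o kcat_Id[OF B] kcat_Id_left[OF B] kfun_closed[OF X] \<sigma>_closed)

lemma k_functor_eig: "k_functor K B (eig_fun X)"
proof -
  note lin = kfun_linear[OF X so so \<sigma>_closed[OF so so]]
  have "subspace K (Val X (so b)) (carrier (Val (eig_fun X) b))" if "b \<in> Obj B" for b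
    using that kfun_module[OF X so[OF that]] lin[OF that that that that, of "Id B b"]
    by (auto simp: subspace_def mod_simps linear_map_add[OF lin] linear_map_smult[OF lin]
        linear_map_zero[of "Val X (so b)" "Val X (so b)"] \<Psi>o_so kcat_Id[OF B])
  then have "module K (Val (eig_fun X) b)" if "b \<in> Obj B" for b
    using module_subspace[OF kfun_module[OF X so[OF that]]] that by (simp add: eig_fun_def)
  moreover have "Act (eig_fun X) b b' \<in> bilinear_map K (Hom B b b') (Val (eig_fun X) b) (Val (eig_fun X) b')"
    if b: "b \<in> Obj B" "b' \<in> Obj B" for b b'
  proof -
    have 1: "Act X (so b) (so b') (\<sigma> (so b) (so b') u) \<in> linear_map K (Val X (so b)) (Val X (so b'))"
      if "u \<in> carrier (Hom B b b')" for u
      using b that by (intro lin) (auto simp: \<Psi>o_so)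
    have 2: "(\<lambda>u. Act X (so b) (so b') (\<sigma> (so b) (so b') u) x) \<in> linear_map K (Hom B b b') (Val X (so b'))"
      if "x \<in> carrier (Val X (so b))" for x
      using linear_map_comp[OF \<sigma>_linear[OF so so] kfun_linear2[OF X so so that]] b by (simp add: \<Psi>o_so)
    have 3: "Act X (so b) (so b') (\<sigma> (so b) (so b') u) x \<in> carrier (Val (eig_fun X) b')"
      if "u \<in> carrier (Hom B b b')" "x \<in> carrier (Val X (so b))" for u x
      using that b by (intro Act_\<sigma>_closed) (auto simp: so \<Psi>o_so)
    show ?thesis
      using 3 by (intro bilinear_mapI linear_mapI)
        (auto simp: linear_map_add[OF 1] linear_map_smult[OF 1] linear_map_add[OF 2] linear_map_smult[OF 2])
  qed
  ultimately show ?thesis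
    unfolding k_functor_def by (auto simp: Act_\<sigma>_comp so \<Psi>o_so)
qed

lemma eig_nat_closed:
  assumes \<eta>: "\<eta> \<in> nat_trans K A X X'"
  shows "eig_nat X \<eta> \<in> nat_trans K B (eig_fun X) (eig_fun X')"
  unfolding eig_nat_def
proof (rule nat_ofI[OF k_functor_eig])
  show "\<eta> (so b) \<in> linear_map K (Val (eig_fun X) b) (Val (eig_fun X') b)" if "b \<in> Obj B" for b
    using that so[OF that]
    by (intro linear_mapI) (auto simp: nat_closed[OF \<eta>] linear_map_add[OF nat_linear[OF \<eta>]]
        linear_map_smult[OF nat_linear[OF \<eta>]] \<Psi>o_so kcat_Id[OF B] \<sigma>_closed simp flip: nat_natural[OF \<eta>])
qed (simp add: so \<Psi>o_so \<sigma>_closed nat_natural[OF \<eta>])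

end

text \<open>An arbitrary preimage is projected by the idempotent; naturality shows that its image
  \<open>y\<close>, being fixed, is unaffected.\<close>

lemma eig_nat_surj:
  assumes X: "k_functor K A X" and X': "k_functor K A X'" and \<eta>: "\<eta> \<in> nat_trans K A X X'" and s: "objectwise_surj A X X' \<eta>"
    and b: "b \<in> Obj B" and y: "y \<in> carrier (Val (eig_fun X') b)"
  obtains x where "x \<in> carrier (Val (eig_fun X) b)" "\<eta> (so b) x = y"
proof -
  have "y \<in> \<eta> (so b) ` carrier (Val X (so b))"
    using s y so[OF b] by (simp add: objectwise_surj_def)
  then obtain x where x: "x \<in> carrier (Val X (so b))" "\<eta> (so b) x = y" by blast
  let ?e = "\<sigma> (so b) (so b) (Id B b)"
  have "Act X (so b) (so b) ?e x \<in> carrier (Val (eig_fun X) b)"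
    using x b by (intro Act_\<sigma>_closed[OF X]) (auto simp: so \<Psi>o_so kcat_Id[OF B])
  moreover have "\<eta> (so b) (Act X (so b) (so b) ?e x) = y"
    using x y b by (simp add: nat_natural[OF \<eta>] so \<Psi>o_so kcat_Id[OF B] \<sigma>_closed)
  ultimately show ?thesis by (rule that)
qed

text \<open>Restriction loses no transformations: \<open>res_nat\<close> is inverse to evaluation at
  the objects \<open>so b\<close>. The complexes are thus isomorphic before passing to
  cohomology.\<close>

lemma coh_res_iso:
  assumes Q: "split_resolution B F Q d \<epsilon>" and F: "k_functor K B F" and Y: "k_functor K B Y"
    and RQ: "split_resolution A (res_fun F) (\<lambda>n. res_fun (Q n)) (\<lambda>n. res_nat (Q (Suc n)) (d n)) \<epsilon>'"
  defines "X1 \<equiv> hom_cx B Q Y" and "D1 \<equiv> hom_d B Q d"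
    and "X2 \<equiv> hom_cx A (\<lambda>n. res_fun (Q n)) (res_fun Y)"
    and "D2 \<equiv> hom_d A (\<lambda>n. res_fun (Q n)) (\<lambda>n. res_nat (Q (Suc n)) (d n))"
  shows "\<exists>\<theta>\<in>linear_map K (coh X2 D2 n) (coh X1 D1 n). bij_betw \<theta> (carrier (coh X2 D2 n)) (carrier (coh X1 D1 n))"
proof -
  note fQ = res_functor[OF B F Q] and dQ = res_d[OF B F Q]
  note RF = k_functor_res[OF F] and RY = k_functor_res[OF Y] and fR = k_functor_res[OF fQ]
  note dR = res_nat_closed[OF fQ dQ]
  note c1 = cocomplex_hom[OF B F Q Y] and c2 = cocomplex_hom[OF A RF RQ RY]
  let ?g = "\<lambda>n f. nat_of B (Q n) (\<lambda>b. f (so b))"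
  \<comment> \<open>On restricted functors the \<sigma>-morphism from \<open>so (\<Psi>o a)\<close>
    to \<open>a\<close> over an identity acts as the identity. Naturality along it shows that
    \<open>f a\<close> depends on \<open>\<Psi>o a\<close> only.\<close>
  have f_so: "f a z = f (so (\<Psi>o a)) z"
    if f: "f \<in> nat_trans K A (res_fun (Q n)) (res_fun Y)" and a: "a \<in> Obj A" and z: "z \<in> carrier (Val (Q n) (\<Psi>o a))" for f a z n
    using nat_natural[OF f so[OF \<Psi>o[OF a]] a \<sigma>_closed[OF so[OF \<Psi>o[OF a]] a], of "Id B (\<Psi>o a)" z]
      nat_closed[OF f so[OF \<Psi>o[OF a]], of z] a z
    by (simp add: \<Psi>o_so \<Psi>o \<Psi>_\<sigma> so kcat_Id[OF B] kfun_Id[OF fQ] kfun_Id[OF Y])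
  have g: "?g n f \<in> nat_trans K B (Q n) Y" if f: "f \<in> nat_trans K A (res_fun (Q n)) (res_fun Y)" for n f
  proof (rule nat_ofI[OF fQ])
    show "f (so b) \<in> linear_map K (Val (Q n) b) (Val Y b)" if "b \<in> Obj B" for b
      using nat_linear[OF f so[OF that]] that by (simp add: \<Psi>o_so)
    show "f (so b') (Act (Q n) b b' u x) = Act Y b b' u (f (so b) x)"
      if "b \<in> Obj B" "b' \<in> Obj B" "u \<in> carrier (Hom B b b')" "x \<in> carrier (Val (Q n) b)" for b b' u x
      using nat_natural[OF f so so \<sigma>_closed[OF so so], of b b' u x] that by (simp add: \<Psi>o_so \<Psi>_\<sigma> so)
  qed
  have f_res: "cochain_map X1 D1 X2 D2 (\<lambda>n. res_nat (Q n))"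
    unfolding cochain_map_def X1_def D1_def X2_def D2_def hom_cx_def hom_d_def
  proof (intro conjI allI ballI)
    fix n
    have 1: "res_nat (Q n) \<eta> \<in> nat_trans K A (res_fun (Q n)) (res_fun Y)" if "\<eta> \<in> nat_trans K B (Q n) Y" for \<eta>
      by (rule res_nat_closed[OF fQ that])
    show "res_nat (Q n) \<in> linear_map K (nat_space K B (Q n) Y) (nat_space K A (res_fun (Q n)) (res_fun Y))"
      by (rule linear_mapI) (auto simp: nat_space_simps(1) 1, auto simp: nat_space_simps res_nat_def nat_of_def \<Psi>o fun_eq_iff)
    fix \<eta> assume "\<eta> \<in> carrier (nat_space K B (Q n) Y)"
    then have \<eta>: "\<eta> \<in> nat_trans K B (Q n) Y" by (simp add: nat_space_simps)
    show "res_nat (Q (Suc n)) (nat_comp B (Q (Suc n)) \<eta> (d n)) =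
        nat_comp A (res_fun (Q (Suc n))) (res_nat (Q n) \<eta>) (res_nat (Q (Suc n)) (d n))"
      by (rule nat_eqI[OF res_nat_closed[OF fQ nat_comp_closed[OF fQ dQ \<eta>]] nat_comp_closed[OF fR dR res_nat_closed[OF fQ \<eta>]]])
        (simp add: res_nat_def \<Psi>o nat_closed[OF dQ])
  qed
  have g_res: "cochain_map X2 D2 X1 D1 ?g"
    unfolding cochain_map_def X1_def D1_def X2_def D2_def hom_cx_def hom_d_def
  proof (intro conjI allI ballI)
    fix n
    show "?g n \<in> linear_map K (nat_space K A (res_fun (Q n)) (res_fun Y)) (nat_space K B (Q n) Y)"
      by (rule linear_mapI) (auto simp: nat_space_simps(1) g, auto simp: nat_space_simps nat_of_def so \<Psi>o_so fun_eq_iff)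
    fix f assume "f \<in> carrier (nat_space K A (res_fun (Q n)) (res_fun Y))"
    then have f: "f \<in> nat_trans K A (res_fun (Q n)) (res_fun Y)" by (simp add: nat_space_simps)
    show "?g (Suc n) (nat_comp A (res_fun (Q (Suc n))) f (res_nat (Q (Suc n)) (d n))) =
        nat_comp B (Q (Suc n)) (?g n f) (d n)"
      by (rule nat_eqI[OF g[OF nat_comp_closed[OF fR dR f]] nat_comp_closed[OF fQ dQ g[OF f]]])
        (simp add: res_nat_def so \<Psi>o_so nat_closed[OF dQ])
  qed
  note m1 = cocomplex_module[OF c1, folded X1_def D1_def] and m2 = cocomplex_module[OF c2, folded X2_def D2_def]
  note z1 = subspace_cobd[OF c1, folded X1_def D1_def] and z2 = subspace_cobd[OF c2, folded X2_def D2_def]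
  show ?thesis
  proof (rule coh_iso[OF c2[folded X2_def D2_def] c1[folded X1_def D1_def] g_res f_res])
    fix n f assume f0: "f \<in> cocyc X2 D2 n"
    then have f: "f \<in> nat_trans K A (res_fun (Q n)) (res_fun Y)"
      by (auto simp: cocyc_def X2_def hom_cx_def nat_space_simps)
    have "res_nat (Q n) (?g n f) = f"
      by (rule nat_eqI[OF res_nat_closed[OF fQ g[OF f]] f]) (simp add: res_nat_def \<Psi>o f_so[OF f])
    then show "\<exists>b\<in>cobd X2 D2 n. res_nat (Q n) (?g n f) = f \<oplus>\<^bsub>X2 n\<^esub> b"
      using z2[of n] add_zero[OF m2 cocycD(1)[OF f0]] by (intro bexI[of _ "\<zero>\<^bsub>X2 n\<^esub>"]) (auto simp: subspace_def)
  next
    fix n \<eta> assume \<eta>0: "\<eta> \<in> cocyc X1 D1 n"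
    then have \<eta>: "\<eta> \<in> nat_trans K B (Q n) Y" by (auto simp: cocyc_def X1_def hom_cx_def nat_space_simps)
    have "?g n (res_nat (Q n) \<eta>) = \<eta>"
      by (rule nat_eqI[OF g[OF res_nat_closed[OF fQ \<eta>]] \<eta>]) (simp add: res_nat_def so \<Psi>o_so)
    then show "\<exists>b\<in>cobd X1 D1 n. ?g n (res_nat (Q n) \<eta>) = \<eta> \<oplus>\<^bsub>X1 n\<^esub> b"
      using z1[of n] add_zero[OF m1 cocycD(1)[OF \<eta>0]] by (intro bexI[of _ "\<zero>\<^bsub>X1 n\<^esub>"]) (auto simp: subspace_def)
  qed
qed

end

text \<open>Here \<open>eig_fun\<close> is an exact right adjoint of \<open>res_fun\<close>, so restriction preserves projectives.\<close>

locale retract_left = retract K A B \<Psi>o \<Psi> so \<sigma>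
  for K :: "'k ring" and A :: "('k, 'p, 'm) kcat" and B :: "('k, 'q, 'n) kcat"
    and \<Psi>o :: "'p \<Rightarrow> 'q" and \<Psi> :: "'p \<Rightarrow> 'p \<Rightarrow> 'm \<Rightarrow> 'n" and so :: "'q \<Rightarrow> 'p" and \<sigma> :: "'p \<Rightarrow> 'p \<Rightarrow> 'n \<Rightarrow> 'm" +
  assumes comp_\<sigma>: "\<And>a b c f u. a \<in> Obj A \<Longrightarrow> b \<in> Obj A \<Longrightarrow> c \<in> Obj A \<Longrightarrow>
    u \<in> carrier (Hom B (\<Psi>o a) (\<Psi>o b)) \<Longrightarrow> f \<in> carrier (Hom A b c) \<Longrightarrow>
    Comp A a b c f (\<sigma> a b u) = \<sigma> a c (Comp B (\<Psi>o a) (\<Psi>o b) (\<Psi>o c) (\<Psi> b c f) u)"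
begin

text \<open>A left adjoint preserves projectives when its right adjoint preserves surjections. The
  section of the counit over \<open>res_fun Q\<close> is the transpose of a lift of the
  unit.\<close>

lemma split_projective_res:
  fixes Q :: "('k, 'q, 'n, 'v) kfun"
  assumes Q: "split_projective B Q"
  shows "split_projective A (res_fun Q)"
proof -
  have fQ: "k_functor K B Q" using Q by (simp add: split_projective_def)
  note RQ = k_functor_res[OF fQ] and Fr = k_functor_free[OF A, of "res_fun Q"]
  note E1 = k_functor_eig[OF RQ] and E2 = k_functor_eig[OF Fr]
  let ?c = "free_map A (res_fun Q) (res_fun Q) (\<lambda>b x. x)"
  note c = free_counit[OF A RQ]
  \<comment> \<open>The unit of the adjunction; it is the identity on elements because the
    idempotents act trivially on a restricted functor.\<close>
  let ?u = "nat_of B Q (\<lambda>b x. x)"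
  have u: "?u \<in> nat_trans K B Q (eig_fun (res_fun Q))"
    by (rule nat_ofI[OF fQ]; (rule linear_mapI)?)
      (auto simp: so \<Psi>o_so \<Psi>_\<sigma> kfun_Id[OF fQ] kcat_Id[OF B])
  obtain \<psi> where \<psi>: "\<psi> \<in> nat_trans K B Q (eig_fun (free_fun A (res_fun Q)))"
      "nat_comp B Q (eig_nat (free_fun A (res_fun Q)) ?c) \<psi> = ?u"
  proof -
    have "objectwise_surj B (eig_fun (free_fun A (res_fun Q))) (eig_fun (res_fun Q)) (eig_nat (free_fun A (res_fun Q)) ?c)"
      unfolding objectwise_surj_def
    proof (intro ballI equalityI subsetI)
      fix b y assume b: "b \<in> Obj B"
      {
        assume "y \<in> carrier (Val (eig_fun (res_fun Q)) b)"
        then obtain x where x: "x \<in> carrier (Val (eig_fun (free_fun A (res_fun Q))) b)" "?c (so b) x = y"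
          by (rule eig_nat_surj[OF Fr RQ c b])
        then have "eig_nat (free_fun A (res_fun Q)) ?c b x = y" using b by (simp add: eig_nat_def)
        with x(1) show "y \<in> eig_nat (free_fun A (res_fun Q)) ?c b ` carrier (Val (eig_fun (free_fun A (res_fun Q))) b)"
          by blast
      }
      assume "y \<in> eig_nat (free_fun A (res_fun Q)) ?c b ` carrier (Val (eig_fun (free_fun A (res_fun Q))) b)"
      then show "y \<in> carrier (Val (eig_fun (res_fun Q)) b)"
        using nat_closed[OF eig_nat_closed[OF Fr c(1)] b] by blast
    qed
    from split_projective_lift[OF B Q E2 E1 eig_nat_closed[OF Fr c(1)] u this] that show ?thesis by blast
  qed
  \<comment> \<open>The transpose of \<psi>: its value lives at \<open>so (\<Psi>o a)\<close> and is
    carried to \<open>a\<close> by the \<sigma>-morphism over an identity.\<close>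
  define s0 where "s0 a z = Act (free_fun A (res_fun Q)) (so (\<Psi>o a)) a (\<sigma> (so (\<Psi>o a)) a (Id B (\<Psi>o a))) (\<psi> (\<Psi>o a) z)" for a z
  have \<psi>c: "\<psi> b z \<in> carrier (Val (free_fun A (res_fun Q)) (so b))" if "b \<in> Obj B" "z \<in> carrier (Val Q b)" for b z
    using nat_closed[OF \<psi>(1) that] by simp
  have \<psi>c': "?c (so b) (\<psi> b z) = z" if "b \<in> Obj B" "z \<in> carrier (Val Q b)" for b z
    using fun_cong[OF fun_cong[OF \<psi>(2)], of b z] that nat_closed[OF \<psi>(1) that] by (simp add: eig_nat_def)
  have s: "nat_of A (res_fun Q) s0 \<in> nat_trans K A (res_fun Q) (free_fun A (res_fun Q))"
  proof (rule nat_ofI[OF RQ])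
    fix a assume a: "a \<in> Obj A"
    have "\<psi> (\<Psi>o a) \<in> linear_map K (Val Q (\<Psi>o a)) (Val (free_fun A (res_fun Q)) (so (\<Psi>o a)))"
      using nat_linear[OF \<psi>(1) \<Psi>o[OF a]] by (auto simp: linear_map_def Pi_def)
    then show "s0 a \<in> linear_map K (Val (res_fun Q) a) (Val (free_fun A (res_fun Q)) a)"
      unfolding s0_def[abs_def] res_fun_simps
      by (rule linear_map_comp) (use a in \<open>auto intro!: kfun_linear[OF Fr] \<sigma>_closed simp: so \<Psi>o \<Psi>o_so kcat_Id[OF B]\<close>)
    fix a' f x assume a': "a' \<in> Obj A" and f: "f \<in> carrier (Hom A a a')" and x: "x \<in> carrier (Val (res_fun Q) a)"
    let ?b = "\<Psi>o a" and ?b' = "\<Psi>o a'"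
    let ?F = "free_fun A (res_fun Q)"
    have b: "?b \<in> Obj B" "?b' \<in> Obj B" and s: "so ?b \<in> Obj A" "so ?b' \<in> Obj A" using a a' by (auto simp: \<Psi>o so)
    have x': "x \<in> carrier (Val Q ?b)" using x by simp
    note \<psi>x = \<psi>c[OF b(1) x']
    have \<Psi>f: "\<Psi> a a' f \<in> carrier (Hom B ?b ?b')" using a a' f by (rule \<Psi>_closed)
    have "s0 a' (Act (res_fun Q) a a' f x) =
        Act ?F (so ?b') a' (\<sigma> (so ?b') a' (Id B ?b')) (Act ?F (so ?b) (so ?b') (\<sigma> (so ?b) (so ?b') (\<Psi> a a' f)) (\<psi> ?b x))"
      using nat_natural[OF \<psi>(1) b \<Psi>f x'] by (simp add: s0_def)
    also have "\<dots> = Act ?F (so ?b) a' (\<sigma> (so ?b) a' (\<Psi> a a' f)) (\<psi> ?b x)"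
      using a' s b \<Psi>f \<psi>x by (simp add: Act_\<sigma>_comp[OF Fr] \<Psi>o_so kcat_Id[OF B] kcat_Id_left[OF B])
    \<comment> \<open>Here absorption enters: \<open>f\<close> composed after a \<sigma>-morphism is
      again a \<sigma>-morphism.\<close>
    also have "\<dots> = Act ?F (so ?b) a' (Comp A (so ?b) a a' f (\<sigma> (so ?b) a (Id B ?b))) (\<psi> ?b x)"
      using a a' s b f \<Psi>f by (simp add: comp_\<sigma> \<Psi>o_so kcat_Id[OF B] kcat_Id_right[OF B])
    also have "\<dots> = Act ?F a a' f (s0 a x)"
      using a a' s b f \<psi>x by (simp add: s0_def kfun_comp[OF Fr] \<sigma>_closed \<Psi>o_so kcat_Id[OF B])
    finally show "s0 a' (Act (res_fun Q) a a' f x) = Act ?F a a' f (s0 a x)" .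
  qed
  have "nat_comp A (res_fun Q) ?c (nat_of A (res_fun Q) s0) = nat_id A (res_fun Q)"
  proof (rule nat_eqI[OF nat_comp_closed[OF RQ s c(1)] nat_id_closed[OF RQ]])
    fix a x assume a: "a \<in> Obj A" and x: "x \<in> carrier (Val (res_fun Q) a)"
    have b: "\<Psi>o a \<in> Obj B" "so (\<Psi>o a) \<in> Obj A" using a by (auto simp: \<Psi>o so)
    have "?c a (s0 a x) = x"
      using a b x nat_natural[OF c(1) b(2) a \<sigma>_closed[OF b(2) a], of "Id B (\<Psi>o a)" "\<psi> (\<Psi>o a) x"]
      by (simp add: s0_def \<psi>c \<psi>c' \<Psi>o_so \<Psi>_\<sigma> kcat_Id[OF B] kfun_Id[OF fQ])
    then show "nat_comp A (res_fun Q) ?c (nat_of A (res_fun Q) s0) a x = nat_id A (res_fun Q) a x"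
      using a x by simp
  qed
  with s show ?thesis by (intro split_projectiveI[OF A RQ]) blast
qed

text \<open>Restriction keeps the values, so exactness is inherited objectwise; the adjunction is
  used for projectivity.\<close>

lemma split_resolution_res:
  assumes F: "k_functor K B F" and Q: "split_resolution B F Q d \<epsilon>"
  shows "split_resolution A (res_fun F) (\<lambda>n. res_fun (Q n)) (\<lambda>n. res_nat (Q (Suc n)) (d n)) (res_nat (Q 0) \<epsilon>)"
proof -
  note fQ = res_functor[OF B F Q] and dQ = res_d[OF B F Q] and \<epsilon> = res_eps[OF B F Q]
  have im: "res_nat Y \<eta> a ` carrier (Val Y (\<Psi>o a)) = \<eta> (\<Psi>o a) ` carrier (Val Y (\<Psi>o a))" if "a \<in> Obj A" for a Y \<eta>
    using that by (intro image_cong) (auto simp: res_nat_def)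
  show ?thesis
    unfolding split_resolution_def objectwise_surj_def exact_at_def
    using split_projective_res[OF res_split[OF B F Q]] res_nat_closed[OF fQ dQ] res_nat_closed[OF fQ \<epsilon>]
      res_surj[OF B F Q \<Psi>o] res_exact0[OF B F Q \<Psi>o] res_exact[OF B F Q \<Psi>o]
    by (auto simp: im) (auto simp: res_nat_def)
qed

end

text \<open>Here \<open>eig_fun\<close> is an exact left adjoint of \<open>res_fun\<close>.\<close>

locale retract_right = retract K A B \<Psi>o \<Psi> so \<sigma>
  for K :: "'k ring" and A :: "('k, 'p, 'm) kcat" and B :: "('k, 'q, 'n) kcat"
    and \<Psi>o :: "'p \<Rightarrow> 'q" and \<Psi> :: "'p \<Rightarrow> 'p \<Rightarrow> 'm \<Rightarrow> 'n" and so :: "'q \<Rightarrow> 'p" and \<sigma> :: "'p \<Rightarrow> 'p \<Rightarrow> 'n \<Rightarrow> 'm" +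
  assumes \<sigma>_comp_right: "\<And>a b c f u. a \<in> Obj A \<Longrightarrow> b \<in> Obj A \<Longrightarrow> c \<in> Obj A \<Longrightarrow>
    f \<in> carrier (Hom A a b) \<Longrightarrow> u \<in> carrier (Hom B (\<Psi>o b) (\<Psi>o c)) \<Longrightarrow>
    Comp A a b c (\<sigma> b c u) f = \<sigma> a c (Comp B (\<Psi>o a) (\<Psi>o b) (\<Psi>o c) u (\<Psi> a b f))"
begin

text \<open>The transpose of \<open>f : eig X \<rightarrow> Y\<close>. The inner action, from
  \<open>a\<close> to \<open>so (\<Psi>o a)\<close> over an identity, is the unit from
  \<open>X\<close> to the restriction of its corner.\<close>

definition adj_ext :: "('k, 'p, 'm, 'v) kfun \<Rightarrow> ('q \<Rightarrow> 'v \<Rightarrow> 'w) \<Rightarrow> 'p \<Rightarrow> 'v \<Rightarrow> 'w" where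
  "adj_ext X f = nat_of A X (\<lambda>a x. f (\<Psi>o a) (Act X a (so (\<Psi>o a)) (\<sigma> a (so (\<Psi>o a)) (Id B (\<Psi>o a))) x))"

context
  fixes X :: "('k, 'p, 'm, 'v) kfun" and Y :: "('k, 'q, 'n, 'w) kfun"
  assumes X: "k_functor K A X" and Y: "k_functor K B Y"
begin

lemma Act_unit_closed:
  "a \<in> Obj A \<Longrightarrow> x \<in> carrier (Val X a) \<Longrightarrow>
   Act X a (so (\<Psi>o a)) (\<sigma> a (so (\<Psi>o a)) (Id B (\<Psi>o a))) x \<in> carrier (Val (eig_fun X) (\<Psi>o a))"
  by (intro Act_\<sigma>_closed[OF X]) (auto simp: \<Psi>o kcat_Id[OF B])

lemma adj_ext_closed:
  assumes f: "f \<in> nat_trans K B (eig_fun X) Y"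
  shows "adj_ext X f \<in> nat_trans K A X (res_fun Y)"
  unfolding adj_ext_def
proof (rule nat_ofI[OF X])
  let ?U = "\<lambda>a. Act X a (so (\<Psi>o a)) (\<sigma> a (so (\<Psi>o a)) (Id B (\<Psi>o a)))"
  fix a assume a: "a \<in> Obj A"
  have "?U a \<in> linear_map K (Val X a) (Val X (so (\<Psi>o a)))"
    using a by (intro kfun_linear[OF X] \<sigma>_closed) (auto simp: \<Psi>o so \<Psi>o_so kcat_Id[OF B])
  then have "?U a \<in> linear_map K (Val X a) (Val (eig_fun X) (\<Psi>o a))"
    using Act_unit_closed[OF a] unfolding linear_map_def Pi_def mem_Collect_eq eig_fun_simps(3,4) by blast
  then show "(\<lambda>x. f (\<Psi>o a) (?U a x)) \<in> linear_map K (Val X a) (Val (res_fun Y) a)"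
    unfolding res_fun_simps by (rule linear_map_comp[OF _ nat_linear[OF f \<Psi>o[OF a]]])
  fix a' g x assume a': "a' \<in> Obj A" and g: "g \<in> carrier (Hom A a a')" and x: "x \<in> carrier (Val X a)"
  let ?b = "\<Psi>o a" and ?b' = "\<Psi>o a'"
  have b: "?b \<in> Obj B" "?b' \<in> Obj B" and s: "so ?b \<in> Obj A" "so ?b' \<in> Obj A" using a a' by (auto simp: \<Psi>o so)
  have \<Psi>g: "\<Psi> a a' g \<in> carrier (Hom B ?b ?b')" using a a' g by (rule \<Psi>_closed)
  have "?U a' (Act X a a' g x) = Act X a (so ?b') (Comp A a a' (so ?b') (\<sigma> a' (so ?b') (Id B ?b')) g) x"
    using a a' s b g x by (simp add: kfun_comp[OF X] \<sigma>_closed \<Psi>o_so kcat_Id[OF B])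
  \<comment> \<open>Absorbing the arbitrary morphism \<open>g\<close> into \<sigma> is what makes
    the unit natural.\<close>
  also have "\<dots> = Act X a (so ?b') (\<sigma> a (so ?b') (\<Psi> a a' g)) x"
    using a a' s b g \<Psi>g by (simp add: \<sigma>_comp_right \<Psi>o_so kcat_Id[OF B] kcat_Id_left[OF B])
  also have "\<dots> = Act X (so ?b) (so ?b') (\<sigma> (so ?b) (so ?b') (\<Psi> a a' g)) (?U a x)"
    using a a' s b x \<Psi>g by (simp add: Act_\<sigma>_comp[OF X] \<Psi>o_so kcat_Id[OF B] kcat_Id_right[OF B])
  finally show "f ?b' (?U a' (Act X a a' g x)) = Act (res_fun Y) a a' g (f ?b (?U a x))"
    using nat_natural[OF f b \<Psi>g Act_unit_closed[OF a x]] by simp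
qed

definition adj_restrict :: "('p \<Rightarrow> 'v \<Rightarrow> 'w) \<Rightarrow> 'q \<Rightarrow> 'v \<Rightarrow> 'w" where
  "adj_restrict \<eta> = nat_of B (eig_fun X) (\<lambda>b. \<eta> (so b))"

lemma adj_restrict_closed:
  assumes \<eta>: "\<eta> \<in> nat_trans K A X (res_fun Y)"
  shows "adj_restrict \<eta> \<in> nat_trans K B (eig_fun X) Y"
  unfolding adj_restrict_def
proof (rule nat_ofI[OF k_functor_eig[OF X]])
  show "\<eta> (so b) \<in> linear_map K (Val (eig_fun X) b) (Val Y b)" if "b \<in> Obj B" for b
    using nat_linear[OF \<eta> so[OF that]] that by (auto simp: linear_map_def \<Psi>o_so)
  show "\<eta> (so b') (Act (eig_fun X) b b' u x) = Act Y b b' u (\<eta> (so b) x)"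
    if "b \<in> Obj B" "b' \<in> Obj B" "u \<in> carrier (Hom B b b')" "x \<in> carrier (Val (eig_fun X) b)" for b b' u x
    using that by (simp add: nat_natural[OF \<eta>] so \<Psi>o_so \<sigma>_closed \<Psi>_\<sigma>)
qed

lemma adj_restrict_ext:
  assumes f: "f \<in> nat_trans K B (eig_fun X) Y"
  shows "adj_restrict (adj_ext X f) = f"
  by (rule nat_eqI[OF adj_restrict_closed[OF adj_ext_closed[OF f]] f])
    (simp add: adj_restrict_def adj_ext_def so \<Psi>o_so)

lemma adj_ext_restrict:
  assumes \<eta>: "\<eta> \<in> nat_trans K A X (res_fun Y)"
  shows "adj_ext X (adj_restrict \<eta>) = \<eta>"
proof (rule nat_eqI[OF adj_ext_closed[OF adj_restrict_closed[OF \<eta>]] \<eta>])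
  fix a x assume a: "a \<in> Obj A" and x: "x \<in> carrier (Val X a)"
  show "adj_ext X (adj_restrict \<eta>) a x = \<eta> a x"
    using a x Act_unit_closed[OF a x] nat_closed[OF \<eta> a x]
      nat_natural[OF \<eta> a so[OF \<Psi>o[OF a]] \<sigma>_closed[OF a so[OF \<Psi>o[OF a]]], of "Id B (\<Psi>o a)" x]
    by (simp add: adj_restrict_def adj_ext_def \<Psi>o so \<Psi>o_so kcat_Id[OF B] \<Psi>_\<sigma> kfun_Id[OF Y])
qed

end

text \<open>Restriction preserves surjections, so the unit of \<open>P\<close> lifts against the
  restricted counit; transposing the lift back gives the section.\<close>

lemma split_projective_eig:
  fixes P :: "('k, 'p, 'm, 'v) kfun"
  assumes P: "split_projective A P"
  shows "split_projective B (eig_fun P)"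
proof -
  have fP: "k_functor K A P" using P by (simp add: split_projective_def)
  note EP = k_functor_eig[OF fP] and Fr = k_functor_free[OF B, of "eig_fun P"]
  let ?c = "free_map B (eig_fun P) (eig_fun P) (\<lambda>b x. x)"
  note c = free_counit[OF B EP]
  have "objectwise_surj A (res_fun (free_fun B (eig_fun P))) (res_fun (eig_fun P)) (res_nat (free_fun B (eig_fun P)) ?c)"
    using c(2) \<Psi>o unfolding objectwise_surj_def by (auto simp: res_nat_def image_iff simp del: eig_fun_simps)
  from split_projective_lift[OF A P k_functor_res[OF Fr] k_functor_res[OF EP] res_nat_closed[OF Fr c(1)]
      adj_ext_closed[OF fP EP nat_id_closed[OF EP]] this]
  obtain \<psi> where \<psi>: "\<psi> \<in> nat_trans K A P (res_fun (free_fun B (eig_fun P)))"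
      "nat_comp A P (res_nat (free_fun B (eig_fun P)) ?c) \<psi> = adj_ext P (nat_id B (eig_fun P))" by blast
  note s = adj_restrict_closed[OF fP Fr \<psi>(1)]
  have "nat_comp B (eig_fun P) ?c (adj_restrict P \<psi>) = nat_id B (eig_fun P)"
  proof (rule nat_eqI[OF nat_comp_closed[OF EP s c(1)] nat_id_closed[OF EP]])
    fix b x assume b: "b \<in> Obj B" and x: "x \<in> carrier (Val (eig_fun P) b)"
    have x': "x \<in> carrier (Val P (so b))" using x by simp
    have "?c b (\<psi> (so b) x) = x"
      using fun_cong[OF fun_cong[OF \<psi>(2)], of "so b" x] b x x' nat_closed[OF \<psi>(1) so[OF b] x']
      by (simp add: res_nat_def adj_ext_def so \<Psi>o_so)
    then show "nat_comp B (eig_fun P) ?c (adj_restrict P \<psi>) b x = nat_id B (eig_fun P) b x"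
      using b x by (simp add: adj_restrict_def[OF fP Fr])
  qed
  with s show ?thesis by (intro split_projectiveI[OF B EP]) blast
qed

context
  fixes F :: "('k, 'p, 'm, 'w) kfun" and P :: "nat \<Rightarrow> ('k, 'p, 'm, 'v) kfun" and d \<epsilon>
  assumes F: "k_functor K A F" and P: "split_resolution A F P d \<epsilon>"
begin

text \<open>The augmentation is the transpose of \<eta> after \<epsilon>. Bijectivity of \<eta> is
  asked for on the fixed spaces, which are all that the corner sees.\<close>

lemma split_resolution_eig:
  assumes F': "k_functor K B F'" and \<eta>: "\<eta> \<in> nat_trans K A F (res_fun F')"
    and bij: "\<And>b. b \<in> Obj B \<Longrightarrow> bij_betw (\<eta> (so b)) (carrier (Val (eig_fun F) b)) (carrier (Val F' b))"
  shows "split_resolution B F' (\<lambda>n. eig_fun (P n)) (\<lambda>n. eig_nat (P (Suc n)) (d n))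
    (adj_restrict (P 0) (nat_comp A (P 0) \<eta> \<epsilon>))"
proof -
  note fP = res_functor[OF A F P] and dP = res_d[OF A F P] and \<epsilon> = res_eps[OF A F P]
  let ?e = "\<lambda>b. \<sigma> (so b) (so b) (Id B b)"
  have e: "?e b \<in> carrier (Hom A (so b) (so b))" if "b \<in> Obj B" for b
    using that by (simp add: \<sigma>_closed so \<Psi>o_so kcat_Id[OF B])
  have eigI: "Act X (so b) (so b) (?e b) x \<in> carrier (Val (eig_fun X) b)"
    if "k_functor K A X" "b \<in> Obj B" "x \<in> carrier (Val X (so b))" for X :: "('k, 'p, 'm, 'x) kfun" and b x
    using that by (intro Act_\<sigma>_closed) (auto simp: so \<Psi>o_so kcat_Id[OF B])
  \<comment> \<open>Exactness of taking fixed points: a preimage is projected by the idempotent. The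
    kernel is described by a predicate \<gamma>, so that one argument serves at the augmentation and
    at the differentials.\<close>
  have ex: "eig_nat X \<delta> b ` carrier (Val (eig_fun X) b) = {y \<in> carrier (Val (eig_fun Y) b). \<beta> y = \<zero>\<^bsub>Z\<^esub>}"
    if X: "k_functor K A X" and \<delta>: "\<delta> \<in> nat_trans K A X Y" and b: "b \<in> Obj B"
      and im: "\<delta> (so b) ` carrier (Val X (so b)) = {y \<in> carrier (Val Y (so b)). \<gamma> y}"
      and \<gamma>: "\<And>y. y \<in> carrier (Val (eig_fun Y) b) \<Longrightarrow> \<beta> y = \<zero>\<^bsub>Z\<^esub> \<longleftrightarrow> \<gamma> y"
    for X Y :: "('k, 'p, 'm, 'v) kfun" and \<delta> b \<beta> \<gamma> and Z :: "('k, 'x) module"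
  proof (intro equalityI subsetI)
    fix y assume "y \<in> eig_nat X \<delta> b ` carrier (Val (eig_fun X) b)"
    then obtain x where x: "x \<in> carrier (Val (eig_fun X) b)" "y = eig_nat X \<delta> b x" by blast
    then have y: "y \<in> carrier (Val (eig_fun Y) b)" using nat_closed[OF eig_nat_closed[OF X \<delta>] b x(1)] by simp
    have "y \<in> \<delta> (so b) ` carrier (Val X (so b))" using x b by (auto simp: eig_nat_def)
    with y \<gamma> im show "y \<in> {y \<in> carrier (Val (eig_fun Y) b). \<beta> y = \<zero>\<^bsub>Z\<^esub>}" by blast
  next
    fix y assume "y \<in> {y \<in> carrier (Val (eig_fun Y) b). \<beta> y = \<zero>\<^bsub>Z\<^esub>}"
    then have y: "y \<in> carrier (Val (eig_fun Y) b)" "\<gamma> y" using \<gamma> by auto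
    then have "y \<in> \<delta> (so b) ` carrier (Val X (so b))" unfolding im by simp
    then obtain x where x: "x \<in> carrier (Val X (so b))" "\<delta> (so b) x = y" by blast
    let ?x = "Act X (so b) (so b) (?e b) x"
    note x' = eigI[OF X b x(1)]
    have "eig_nat X \<delta> b ?x = \<delta> (so b) ?x" using b x' by (simp add: eig_nat_def)
    also have "\<dots> = y" using nat_natural[OF \<delta> so[OF b] so[OF b] e[OF b] x(1)] x(2) y(1) by simp
    finally show "y \<in> eig_nat X \<delta> b ` carrier (Val (eig_fun X) b)" using x' by blast
  qed
  have \<epsilon>eig: "\<epsilon> (so b) x \<in> carrier (Val (eig_fun F) b)" if "b \<in> Obj B" "x \<in> carrier (Val (eig_fun (P 0)) b)" for b x
    using nat_closed[OF eig_nat_closed[OF fP \<epsilon>] that] that by (simp add: eig_nat_def)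
  note \<eta>\<epsilon> = nat_comp_closed[OF fP \<epsilon> \<eta>]
  have \<epsilon>': "adj_restrict (P 0) (nat_comp A (P 0) \<eta> \<epsilon>) b x = \<eta> (so b) (\<epsilon> (so b) x)"
    if "b \<in> Obj B" "x \<in> carrier (Val (eig_fun (P 0)) b)" for b x
    using that by (simp add: adj_restrict_def[OF fP F'] so)
  have "adj_restrict (P 0) (nat_comp A (P 0) \<eta> \<epsilon>) b ` carrier (Val (eig_fun (P 0)) b) = carrier (Val F' b)"
    if b: "b \<in> Obj B" for b
  proof (intro equalityI subsetI)
    fix y assume "y \<in> carrier (Val F' b)"
    then obtain z where z: "z \<in> carrier (Val (eig_fun F) b)" "y = \<eta> (so b) z"
      using bij[OF b] unfolding bij_betw_def by blast
    obtain x where "x \<in> carrier (Val (eig_fun (P 0)) b)" "\<epsilon> (so b) x = z"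
      by (rule eig_nat_surj[OF fP F \<epsilon> _ b z(1)]) (use res_surj[OF A F P] in \<open>auto simp: objectwise_surj_def\<close>)
    then show "y \<in> adj_restrict (P 0) (nat_comp A (P 0) \<eta> \<epsilon>) b ` carrier (Val (eig_fun (P 0)) b)"
      using \<epsilon>'[OF b] z by (metis imageI)
  qed (use nat_closed[OF adj_restrict_closed[OF fP F' \<eta>\<epsilon>] b] in blast)
  moreover have "eig_nat (P (Suc 0)) (d 0) b ` carrier (Val (eig_fun (P (Suc 0))) b) =
      {y \<in> carrier (Val (eig_fun (P 0)) b). adj_restrict (P 0) (nat_comp A (P 0) \<eta> \<epsilon>) b y = \<zero>\<^bsub>Val F' b\<^esub>}"
    if b: "b \<in> Obj B" for b
  proof (rule ex[OF fP dP b res_exact0[OF A F P so[OF b]]])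
    fix y assume y: "y \<in> carrier (Val (eig_fun (P 0)) b)"
    have lin: "\<eta> (so b) \<in> linear_map K (Val F (so b)) (Val F' b)"
      using nat_linear[OF \<eta> so[OF b]] b by (simp add: \<Psi>o_so)
    have 0: "\<eta> (so b) \<zero>\<^bsub>Val F (so b)\<^esub> = \<zero>\<^bsub>Val F' b\<^esub>"
      by (rule linear_map_zero[OF kfun_module[OF F so[OF b]] kfun_module[OF F' b] lin])
    have "\<zero>\<^bsub>Val F (so b)\<^esub> \<in> carrier (Val (eig_fun F) b)"
      using zero_closed[OF kfun_module[OF k_functor_eig[OF F] b]] by simp
    \<comment> \<open>Injectivity of \<eta> is available on the fixed space only; zero lies there,
      so composing \<epsilon> with \<eta> does not enlarge the kernel.\<close>
    then show "adj_restrict (P 0) (nat_comp A (P 0) \<eta> \<epsilon>) b y = \<zero>\<^bsub>Val F' b\<^esub> \<longleftrightarrow> \<epsilon> (so b) y = \<zero>\<^bsub>Val F (so b)\<^esub>"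
      using \<epsilon>'[OF b y] \<epsilon>eig[OF b y] 0 bij[OF b] unfolding bij_betw_def by (metis inj_onD)
  qed
  moreover have "eig_nat (P (Suc (Suc n))) (d (Suc n)) b ` carrier (Val (eig_fun (P (Suc (Suc n)))) b) =
      {y \<in> carrier (Val (eig_fun (P (Suc n))) b). eig_nat (P (Suc n)) (d n) b y = \<zero>\<^bsub>Val (eig_fun (P n)) b\<^esub>}"
    if b: "b \<in> Obj B" for n b
    by (rule ex[OF fP dP b res_exact[OF A F P so[OF b]]]) (use b in \<open>simp add: eig_nat_def\<close>)
  ultimately show ?thesis
    unfolding split_resolution_def objectwise_surj_def exact_at_def
    using split_projective_eig[OF res_split[OF A F P]] eig_nat_closed[OF fP dP] adj_restrict_closed[OF fP F' \<eta>\<epsilon>]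
    by (auto simp del: eig_fun_simps)
qed

text \<open>The two transpositions are mutually inverse and commute with the differentials, so the
  complexes are isomorphic on the nose.\<close>

lemma coh_eig_iso:
  assumes Y: "k_functor K B Y" and F': "k_functor K B F'"
    and EP: "split_resolution B F' (\<lambda>n. eig_fun (P n)) (\<lambda>n. eig_nat (P (Suc n)) (d n)) \<epsilon>'"
  defines "X1 \<equiv> hom_cx A P (res_fun Y)" and "D1 \<equiv> hom_d A P d"
    and "X2 \<equiv> hom_cx B (\<lambda>n. eig_fun (P n)) Y"
    and "D2 \<equiv> hom_d B (\<lambda>n. eig_fun (P n)) (\<lambda>n. eig_nat (P (Suc n)) (d n))"
  shows "\<exists>\<theta>\<in>linear_map K (coh X1 D1 n) (coh X2 D2 n). bij_betw \<theta> (carrier (coh X1 D1 n)) (carrier (coh X2 D2 n))"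
proof -
  note fP = res_functor[OF A F P] and dP = res_d[OF A F P]
  note RY = k_functor_res[OF Y] and fE = k_functor_eig[OF fP] and dE = eig_nat_closed[OF fP dP]
  note c1 = cocomplex_hom[OF A F P RY] and c2 = cocomplex_hom[OF B F' EP Y]
  note restr = adj_restrict_closed[OF fP Y] and ext = adj_ext_closed[OF fP Y]
  note rdef = adj_restrict_def[OF fP Y]
  have f: "cochain_map X1 D1 X2 D2 (\<lambda>n. adj_restrict (P n))"
    unfolding cochain_map_def X1_def D1_def X2_def D2_def hom_cx_def hom_d_def
  proof (intro conjI allI ballI)
    fix n
    show "adj_restrict (P n) \<in> linear_map K (nat_space K A (P n) (res_fun Y)) (nat_space K B (eig_fun (P n)) Y)"
      by (rule linear_mapI) (auto simp: nat_space_simps(1) restr, auto simp: nat_space_simps rdef nat_of_def so \<Psi>o_so fun_eq_iff)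
    fix \<eta> assume "\<eta> \<in> carrier (nat_space K A (P n) (res_fun Y))"
    then have \<eta>: "\<eta> \<in> nat_trans K A (P n) (res_fun Y)" by (simp add: nat_space_simps)
    show "adj_restrict (P (Suc n)) (nat_comp A (P (Suc n)) \<eta> (d n)) =
        nat_comp B (eig_fun (P (Suc n))) (adj_restrict (P n) \<eta>) (eig_nat (P (Suc n)) (d n))"
    proof (rule nat_eqI[OF restr[OF nat_comp_closed[OF fP dP \<eta>]] nat_comp_closed[OF fE dE restr[OF \<eta>]]])
      fix b x assume b: "b \<in> Obj B" and x: "x \<in> carrier (Val (eig_fun (P (Suc n))) b)"
      show "adj_restrict (P (Suc n)) (nat_comp A (P (Suc n)) \<eta> (d n)) b x =
          nat_comp B (eig_fun (P (Suc n))) (adj_restrict (P n) \<eta>) (eig_nat (P (Suc n)) (d n)) b x"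
        using b x nat_closed[OF dE b x] by (simp add: rdef eig_nat_def so)
    qed
  qed
  have g: "cochain_map X2 D2 X1 D1 (\<lambda>n. adj_ext (P n))"
    unfolding cochain_map_def X1_def D1_def X2_def D2_def hom_cx_def hom_d_def
  proof (intro conjI allI ballI)
    fix n
    show "adj_ext (P n) \<in> linear_map K (nat_space K B (eig_fun (P n)) Y) (nat_space K A (P n) (res_fun Y))"
    proof (rule linear_mapI)
      fix \<eta> \<eta>' assume "\<eta> \<in> carrier (nat_space K B (eig_fun (P n)) Y)" "\<eta>' \<in> carrier (nat_space K B (eig_fun (P n)) Y)"
      show "adj_ext (P n) (\<eta> \<oplus>\<^bsub>nat_space K B (eig_fun (P n)) Y\<^esub> \<eta>') =
          adj_ext (P n) \<eta> \<oplus>\<^bsub>nat_space K A (P n) (res_fun Y)\<^esub> adj_ext (P n) \<eta>'"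
        unfolding adj_ext_def nat_space_simps
        by (rule nat_of_cong) (simp del: eig_fun_simps add: \<Psi>o Act_unit_closed[OF fP Y])
    next
      fix r \<eta> assume "r \<in> carrier K" "\<eta> \<in> carrier (nat_space K B (eig_fun (P n)) Y)"
      show "adj_ext (P n) (r \<odot>\<^bsub>nat_space K B (eig_fun (P n)) Y\<^esub> \<eta>) = r \<odot>\<^bsub>nat_space K A (P n) (res_fun Y)\<^esub> adj_ext (P n) \<eta>"
        unfolding adj_ext_def nat_space_simps
        by (rule nat_of_cong) (simp del: eig_fun_simps add: \<Psi>o Act_unit_closed[OF fP Y])
    qed (simp add: nat_space_simps(1) ext)
    fix h assume "h \<in> carrier (nat_space K B (eig_fun (P n)) Y)"
    then have h: "h \<in> nat_trans K B (eig_fun (P n)) Y" by (simp add: nat_space_simps)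
    show "adj_ext (P (Suc n)) (nat_comp B (eig_fun (P (Suc n))) h (eig_nat (P (Suc n)) (d n))) =
        nat_comp A (P (Suc n)) (adj_ext (P n) h) (d n)"
    proof (rule nat_eqI[OF ext[OF nat_comp_closed[OF fE dE h]] nat_comp_closed[OF fP dP ext[OF h]]])
      fix a x assume a: "a \<in> Obj A" and x: "x \<in> carrier (Val (P (Suc n)) a)"
      note u = Act_unit_closed[OF fP Y a x]
      have "d n (so (\<Psi>o a)) (Act (P (Suc n)) a (so (\<Psi>o a)) (\<sigma> a (so (\<Psi>o a)) (Id B (\<Psi>o a))) x) =
          Act (P n) a (so (\<Psi>o a)) (\<sigma> a (so (\<Psi>o a)) (Id B (\<Psi>o a))) (d n a x)"
        using a x by (intro nat_natural[OF dP] \<sigma>_closed) (auto simp: \<Psi>o so \<Psi>o_so kcat_Id[OF B])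
      then show "adj_ext (P (Suc n)) (nat_comp B (eig_fun (P (Suc n))) h (eig_nat (P (Suc n)) (d n))) a x =
          nat_comp A (P (Suc n)) (adj_ext (P n) h) (d n) a x"
        using a x u nat_closed[OF dP a x] by (simp add: adj_ext_def eig_nat_def \<Psi>o del: eig_fun_simps)
    qed
  qed
  note m1 = cocomplex_module[OF c1, folded X1_def D1_def] and m2 = cocomplex_module[OF c2, folded X2_def D2_def]
  note z1 = subspace_cobd[OF c1, folded X1_def D1_def] and z2 = subspace_cobd[OF c2, folded X2_def D2_def]
  show ?thesis
  proof (rule coh_iso[OF c1[folded X1_def D1_def] c2[folded X2_def D2_def] f g])
    fix n \<eta> assume \<eta>0: "\<eta> \<in> cocyc X1 D1 n"
    then have "\<eta> \<in> nat_trans K A (P n) (res_fun Y)" by (auto simp: cocyc_def X1_def hom_cx_def nat_space_simps)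
    then show "\<exists>b\<in>cobd X1 D1 n. adj_ext (P n) (adj_restrict (P n) \<eta>) = \<eta> \<oplus>\<^bsub>X1 n\<^esub> b"
      using z1[of n] add_zero[OF m1 cocycD(1)[OF \<eta>0]]
      by (intro bexI[of _ "\<zero>\<^bsub>X1 n\<^esub>"]) (auto simp: subspace_def adj_ext_restrict[OF fP Y])
  next
    fix n h assume h0: "h \<in> cocyc X2 D2 n"
    then have "h \<in> nat_trans K B (eig_fun (P n)) Y" by (auto simp: cocyc_def X2_def hom_cx_def nat_space_simps)
    then show "\<exists>b\<in>cobd X2 D2 n. adj_restrict (P n) (adj_ext (P n) h) = h \<oplus>\<^bsub>X2 n\<^esub> b"
      using z2[of n] add_zero[OF m2 cocycD(1)[OF h0]]
      by (intro bexI[of _ "\<zero>\<^bsub>X2 n\<^esub>"]) (auto simp: subspace_def adj_restrict_ext[OF fP Y])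
  qed
qed

end

end

section \<open>Tensor products of categories\<close>

lemma op_cat_simps [simp]:
  "Obj (op_cat C) = Obj C" "Hom (op_cat C) a b = Hom C b a" "Comp (op_cat C) a b c = (\<lambda>g f. Comp C c b a f g)"
  "Id (op_cat C) = Id C"
  by (simp_all add: op_cat_def)

lemma tensor_cat_simps:
  "Obj (tensor_cat K C D) = Obj C \<times> Obj D"
  "Hom (tensor_cat K C D) p q = tensor K (Hom C (fst p) (fst q)) (Hom D (snd p) (snd q))"
  "Id (tensor_cat K C D) p =
     pure_tensor K (Hom C (fst p) (fst p)) (Hom D (snd p) (snd p)) (Id C (fst p)) (Id D (snd p))"
  "Comp (tensor_cat K C D) p q r Y X =
     (let Z = tensor K (Hom C (fst p) (fst r)) (Hom D (snd p) (snd r)) in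
        tensor_lift K Z (\<lambda>f' g'. tensor_lift K Z (\<lambda>f g.
            pure_tensor K (Hom C (fst p) (fst r)) (Hom D (snd p) (snd r))
              (Comp C (fst p) (fst q) (fst r) f' f) (Comp D (snd p) (snd q) (snd r) g' g)) X) Y)"
  by (simp_all add: tensor_cat_def split_beta)

definition tensor_map :: "'k ring \<Rightarrow> ('k, 'c) module \<Rightarrow> ('k, 'd) module \<Rightarrow> ('a \<Rightarrow> 'c) \<Rightarrow> ('b \<Rightarrow> 'd) \<Rightarrow>
    ('a \<times> 'b \<Rightarrow> 'k) set \<Rightarrow> ('c \<times> 'd \<Rightarrow> 'k) set" where
  "tensor_map K V' W' f g = tensor_lift K (tensor K V' W') (\<lambda>x y. pure_tensor K V' W' (f x) (g y))"

lemma bilinear_map_comp: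
  "\<beta> \<in> bilinear_map K V W Z \<Longrightarrow> f \<in> linear_map K V' V \<Longrightarrow> g \<in> linear_map K W' W \<Longrightarrow>
   (\<lambda>x y. \<beta> (f x) (g y)) \<in> bilinear_map K V' W' Z"
  unfolding bilinear_map_def using linear_map_closed by (fastforce simp: linear_map_def Pi_def)

context ground
begin

lemma k_category_op: "k_category K C \<Longrightarrow> k_category K (op_cat C)"
  unfolding k_category_def by (auto simp: bilinear_map_def)

lemma
  assumes "module K V" "module K W" and V': "module K V'" and W': "module K W'"
    and f: "f \<in> linear_map K V V'" and g: "g \<in> linear_map K W W'"
  shows linear_map_tensor_map: "tensor_map K V' W' f g \<in> linear_map K (tensor K V W) (tensor K V' W')"
    and tensor_map_pure: "x \<in> carrier V \<Longrightarrow> y \<in> carrier W \<Longrightarrow>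
      tensor_map K V' W' f g (pure_tensor K V W x y) = pure_tensor K V' W' (f x) (g y)"
proof -
  have \<beta>: "(\<lambda>x y. pure_tensor K V' W' (f x) (g y)) \<in> bilinear_map K V W (tensor K V' W')"
    by (rule bilinear_map_comp[OF bilinear_map_pure_tensor[OF V' W'] f g])
  note T = module_tensor[OF V' W']
  show "tensor_map K V' W' f g \<in> linear_map K (tensor K V W) (tensor K V' W')"
    unfolding tensor_map_def by (rule linear_map_tensor_lift[OF assms(1,2) T \<beta>])
  show "x \<in> carrier V \<Longrightarrow> y \<in> carrier W \<Longrightarrow>
      tensor_map K V' W' f g (pure_tensor K V W x y) = pure_tensor K V' W' (f x) (g y)"
    unfolding tensor_map_def by (rule tensor_lift_pure[OF assms(1,2) T \<beta>])
qed

text \<open>Linearity in the extra variable \<open>h\<close> is known at pure tensors and is carried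
  through sums by induction on the tensor.\<close>

lemma bilinear_map_tensor_lift:
  assumes V: "module K V" and W: "module K W" and H: "module K H" and Z: "module K Z"
    and \<beta>: "\<And>h. h \<in> carrier H \<Longrightarrow> (\<lambda>x y. \<beta> x y h) \<in> bilinear_map K V W Z"
    and \<beta>': "\<And>x y. x \<in> carrier V \<Longrightarrow> y \<in> carrier W \<Longrightarrow> \<beta> x y \<in> linear_map K H Z"
  shows "(\<lambda>X h. tensor_lift K Z (\<lambda>x y. \<beta> x y h) X) \<in> bilinear_map K (tensor K V W) H Z"
proof (rule bilinear_mapI)
  note T = module_tensor[OF V W]
  note lin = linear_map_tensor_lift[OF V W Z \<beta>]
  show "(\<lambda>X. tensor_lift K Z (\<lambda>x y. \<beta> x y h) X) \<in> linear_map K (tensor K V W) Z" if "h \<in> carrier H" for h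
    by (rule lin[OF that])
  fix X assume "X \<in> carrier (tensor K V W)"
  then show "(\<lambda>h. tensor_lift K Z (\<lambda>x y. \<beta> x y h) X) \<in> linear_map K H Z"
  proof (induction X rule: tensor_induct[OF V W, consumes 1, case_names zero add])
    case zero
    show ?case
      by (rule linear_map_cong[OF H linear_map_const_zero[OF Z]]) (rule linear_map_zero[OF T Z lin])
  next
    case (add x y X)
    show ?case
      by (rule linear_map_cong[OF H linear_map_plus[OF H Z \<beta>'[OF add(1,2)] add(4)]])
        (simp add: linear_map_add[OF lin] pure_tensor_closed[OF V W] add tensor_lift_pure[OF V W Z \<beta>])
  qed
qed

text \<open>Composition in a tensor category lifts twice. The outer lift needs the inner one to be
  bilinear in \<open>x'\<close> and \<open>y'\<close> for every tensor \<open>X\<close>, pure or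
  not.\<close>

lemma
  assumes V: "module K V" and W: "module K W" and V': "module K V'" and W': "module K W'" and Z: "module K Z"
    and \<beta>: "\<And>x' y'. x' \<in> carrier V' \<Longrightarrow> y' \<in> carrier W' \<Longrightarrow> \<beta> x' y' \<in> bilinear_map K V W Z"
    and \<beta>': "\<And>x y. x \<in> carrier V \<Longrightarrow> y \<in> carrier W \<Longrightarrow> (\<lambda>x' y'. \<beta> x' y' x y) \<in> bilinear_map K V' W' Z"
  defines "\<gamma> \<equiv> \<lambda>Y X. tensor_lift K Z (\<lambda>x' y'. tensor_lift K Z (\<beta> x' y') X) Y"
  shows tensor_lift2_bilinear: "\<gamma> \<in> bilinear_map K (tensor K V' W') (tensor K V W) Z"
    and tensor_lift2_pure: "x' \<in> carrier V' \<Longrightarrow> y' \<in> carrier W' \<Longrightarrow> x \<in> carrier V \<Longrightarrow> y \<in> carrier W \<Longrightarrow>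
      \<gamma> (pure_tensor K V' W' x' y') (pure_tensor K V W x y) = \<beta> x' y' x y"
proof -
  note T = module_tensor[OF V W]
  note lin = linear_map_tensor_lift[OF V W Z \<beta>]
  have 1: "(\<lambda>X x'. tensor_lift K Z (\<lambda>x y. \<beta> x' y' x y) X) \<in> bilinear_map K (tensor K V W) V' Z" if "y' \<in> carrier W'" for y'
    using that \<beta> bilinear_mapD2[OF \<beta>']
    by (intro bilinear_map_tensor_lift[OF V W V' Z, where \<beta> = "\<lambda>x y x'. \<beta> x' y' x y"]) auto
  have 2: "(\<lambda>X y'. tensor_lift K Z (\<lambda>x y. \<beta> x' y' x y) X) \<in> bilinear_map K (tensor K V W) W' Z" if "x' \<in> carrier V'" for x'
    using that \<beta> bilinear_mapD1[OF \<beta>']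
    by (intro bilinear_map_tensor_lift[OF V W W' Z, where \<beta> = "\<lambda>x y y'. \<beta> x' y' x y"]) auto
  have 3: "(\<lambda>x' y'. tensor_lift K Z (\<beta> x' y') X) \<in> bilinear_map K V' W' Z" if "X \<in> carrier (tensor K V W)" for X
    using that bilinear_mapD1[OF 1] bilinear_mapD1[OF 2] by (intro bilinear_mapI) auto
  show "\<gamma> \<in> bilinear_map K (tensor K V' W') (tensor K V W) Z"
    unfolding \<gamma>_def
    by (rule bilinear_map_tensor_lift[OF V' W' T Z, where \<beta> = "\<lambda>x' y' X. tensor_lift K Z (\<beta> x' y') X"])
      (simp_all add: 3 lin)
  show "x' \<in> carrier V' \<Longrightarrow> y' \<in> carrier W' \<Longrightarrow> x \<in> carrier V \<Longrightarrow> y \<in> carrier W \<Longrightarrow>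
      \<gamma> (pure_tensor K V' W' x' y') (pure_tensor K V W x y) = \<beta> x' y' x y"
    unfolding \<gamma>_def
    by (simp add: tensor_lift_pure[OF V' W' Z 3] tensor_lift_pure[OF V W Z \<beta>] pure_tensor_closed[OF V W])
qed

context
  fixes C :: "('k, 'o, 'm) kcat" and D :: "('k, 'p, 'n) kcat"
  assumes C: "k_category K C" and D: "k_category K D"
begin

private abbreviation "T \<equiv> tensor_cat K C D"
private abbreviation "pt p q \<equiv> pure_tensor K (Hom C (fst p) (fst q)) (Hom D (snd p) (snd q))"

lemma tensor_cat_module:
  assumes "p \<in> Obj T" "q \<in> Obj T"
  shows "module K (Hom C (fst p) (fst q))" "module K (Hom D (snd p) (snd q))" "module K (Hom T p q)"
  using assms kcat_module[OF C] kcat_module[OF D] by (auto simp: tensor_cat_simps module_tensor)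

lemma tensor_cat_pure_closed:
  "p \<in> Obj T \<Longrightarrow> q \<in> Obj T \<Longrightarrow> f \<in> carrier (Hom C (fst p) (fst q)) \<Longrightarrow> g \<in> carrier (Hom D (snd p) (snd q)) \<Longrightarrow>
   pt p q f g \<in> carrier (Hom T p q)"
  by (simp add: tensor_cat_simps pure_tensor_closed kcat_module[OF C] kcat_module[OF D] mem_Times_iff)

lemma tensor_cat_eqI:
  assumes "p \<in> Obj T" "q \<in> Obj T" "module K Z" "f \<in> linear_map K (Hom T p q) Z" "g \<in> linear_map K (Hom T p q) Z"
    and "\<And>x y. x \<in> carrier (Hom C (fst p) (fst q)) \<Longrightarrow> y \<in> carrier (Hom D (snd p) (snd q)) \<Longrightarrow>
      f (pt p q x y) = g (pt p q x y)"
    and "X \<in> carrier (Hom T p q)"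
  shows "f X = g X"
  using tensor_linear_eqI[OF tensor_cat_module(1,2)[OF assms(1,2)] assms(3), of f g X] assms(4-)
  by (simp add: tensor_cat_simps)

lemma
  assumes p: "p \<in> Obj T" and q: "q \<in> Obj T" and r: "r \<in> Obj T"
  shows tensor_cat_comp_bilinear: "Comp T p q r \<in> bilinear_map K (Hom T q r) (Hom T p q) (Hom T p r)"
    and tensor_cat_comp_pure: "f' \<in> carrier (Hom C (fst q) (fst r)) \<Longrightarrow> g' \<in> carrier (Hom D (snd q) (snd r)) \<Longrightarrow>
      f \<in> carrier (Hom C (fst p) (fst q)) \<Longrightarrow> g \<in> carrier (Hom D (snd p) (snd q)) \<Longrightarrow>
      Comp T p q r (pt q r f' g') (pt p q f g) =
      pt p r (Comp C (fst p) (fst q) (fst r) f' f) (Comp D (snd p) (snd q) (snd r) g' g)"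
proof -
  let ?Z = "tensor K (Hom C (fst p) (fst r)) (Hom D (snd p) (snd r))"
  let ?\<beta> = "\<lambda>f' g' f g. pt p r (Comp C (fst p) (fst q) (fst r) f' f) (Comp D (snd p) (snd q) (snd r) g' g)"
  have o: "fst p \<in> Obj C" "fst q \<in> Obj C" "fst r \<in> Obj C" "snd p \<in> Obj D" "snd q \<in> Obj D" "snd r \<in> Obj D"
    using assms by (auto simp: tensor_cat_simps)
  note bC = kcat_bilinear[OF C o(1-3)] and bD = kcat_bilinear[OF D o(4-6)]
  note m = tensor_cat_module(1,2)[OF p q] tensor_cat_module(1,2)[OF q r] module_tensor[OF tensor_cat_module(1,2)[OF p r]]
  note pb = bilinear_map_pure_tensor[OF tensor_cat_module(1,2)[OF p r]]
  have 1: "?\<beta> f' g' \<in> bilinear_map K (Hom C (fst p) (fst q)) (Hom D (snd p) (snd q)) ?Z"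
    if "f' \<in> carrier (Hom C (fst q) (fst r))" "g' \<in> carrier (Hom D (snd q) (snd r))" for f' g'
    by (rule bilinear_map_comp[OF pb bilinear_mapD1[OF bC that(1)] bilinear_mapD1[OF bD that(2)]])
  have 2: "(\<lambda>f' g'. ?\<beta> f' g' f g) \<in> bilinear_map K (Hom C (fst q) (fst r)) (Hom D (snd q) (snd r)) ?Z"
    if "f \<in> carrier (Hom C (fst p) (fst q))" "g \<in> carrier (Hom D (snd p) (snd q))" for f g
    by (rule bilinear_map_comp[OF pb bilinear_mapD2[OF bC that(1)] bilinear_mapD2[OF bD that(2)]])
  have e: "Comp T p q r = (\<lambda>Y X. tensor_lift K ?Z (\<lambda>f' g'. tensor_lift K ?Z (?\<beta> f' g') X) Y)"
    by (intro ext) (simp add: tensor_cat_simps Let_def)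
  show "Comp T p q r \<in> bilinear_map K (Hom T q r) (Hom T p q) (Hom T p r)"
    unfolding e tensor_cat_simps(2) by (rule tensor_lift2_bilinear[OF m 1 2])
  show "f' \<in> carrier (Hom C (fst q) (fst r)) \<Longrightarrow> g' \<in> carrier (Hom D (snd q) (snd r)) \<Longrightarrow>
      f \<in> carrier (Hom C (fst p) (fst q)) \<Longrightarrow> g \<in> carrier (Hom D (snd p) (snd q)) \<Longrightarrow>
      Comp T p q r (pt q r f' g') (pt p q f g) = ?\<beta> f' g' f g"
    unfolding e by (rule tensor_lift2_pure[OF m 1 2])
qed

text \<open>All laws are multilinear, so they reduce to pure tensors, where they hold factor by
  factor.\<close>

lemma k_category_tensor: "k_category K T"
proof -
  note b = tensor_cat_comp_bilinear and cp = tensor_cat_comp_pure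
  note cl = bilinear_map_closed[OF b] and pc = tensor_cat_pure_closed
  have o: "fst p \<in> Obj C" "snd p \<in> Obj D" if "p \<in> Obj T" for p
    using that by (auto simp: tensor_cat_simps)
  have Id: "Id T p = pt p p (Id C (fst p)) (Id D (snd p))" for p by (simp add: tensor_cat_simps)
  have Idc: "Id T p \<in> carrier (Hom T p p)" if "p \<in> Obj T" for p
    unfolding Id using that by (intro pc) (auto simp: o kcat_Id[OF C] kcat_Id[OF D])
  have idr: "Comp T p p q X (Id T p) = X" if p: "p \<in> Obj T" "q \<in> Obj T" and X: "X \<in> carrier (Hom T p q)" for p q X
  proof (rule tensor_cat_eqI[OF p tensor_cat_module(3)[OF p], where f = "\<lambda>X. Comp T p p q X (Id T p)" and g = "\<lambda>X. X"])
    show "(\<lambda>X. Comp T p p q X (Id T p)) \<in> linear_map K (Hom T p q) (Hom T p q)"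
      by (rule bilinear_mapD2[OF b]) (use p Idc in auto)
  qed (use p X in \<open>auto intro: linear_mapI simp: Id cp o kcat_Id[OF C] kcat_Id[OF D] kcat_Id_right[OF C] kcat_Id_right[OF D]\<close>)
  have idl: "Comp T p q q (Id T q) X = X" if p: "p \<in> Obj T" "q \<in> Obj T" and X: "X \<in> carrier (Hom T p q)" for p q X
  proof (rule tensor_cat_eqI[OF p tensor_cat_module(3)[OF p], where f = "\<lambda>X. Comp T p q q (Id T q) X" and g = "\<lambda>X. X"])
    show "Comp T p q q (Id T q) \<in> linear_map K (Hom T p q) (Hom T p q)"
      by (rule bilinear_mapD1[OF b]) (use p Idc in auto)
  qed (use p X in \<open>auto intro: linear_mapI simp: Id cp o kcat_Id[OF C] kcat_Id[OF D] kcat_Id_left[OF C] kcat_Id_left[OF D]\<close>)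
  have assoc: "Comp T p q s (Comp T q r s Z Y) X = Comp T p r s Z (Comp T p q r Y X)"
    if p: "p \<in> Obj T" "q \<in> Obj T" "r \<in> Obj T" "s \<in> Obj T"
      and XYZ: "X \<in> carrier (Hom T p q)" "Y \<in> carrier (Hom T q r)" "Z \<in> carrier (Hom T r s)" for p q r s X Y Z
  proof -
    note M = tensor_cat_module(3)[OF p(1,4)]
    \<comment> \<open>Associativity is trilinear. The arguments are released one at a time:
      \<open>X\<close> while \<open>Y\<close> and \<open>Z\<close> are pure, then \<open>Y\<close>,
      then \<open>Z\<close>.\<close>
    have 1: "Comp T p q s (Comp T q r s (pt r s z z') (pt q r y y')) X = Comp T p r s (pt r s z z') (Comp T p q r (pt q r y y') X)"
      if z: "z \<in> carrier (Hom C (fst r) (fst s))" "z' \<in> carrier (Hom D (snd r) (snd s))"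
        and y: "y \<in> carrier (Hom C (fst q) (fst r))" "y' \<in> carrier (Hom D (snd q) (snd r))" for y y' z z'
    proof (rule tensor_cat_eqI[OF p(1,2) M, where X = X and f = "\<lambda>X. Comp T p q s (Comp T q r s (pt r s z z') (pt q r y y')) X"])
      show "(\<lambda>X. Comp T p r s (pt r s z z') (Comp T p q r (pt q r y y') X)) \<in> linear_map K (Hom T p q) (Hom T p s)"
        by (rule linear_map_comp[OF bilinear_mapD1[OF b] bilinear_mapD1[OF b]]) (use p y z pc in auto)
      show "Comp T p q s (Comp T q r s (pt r s z z') (pt q r y y')) \<in> linear_map K (Hom T p q) (Hom T p s)"
        by (rule bilinear_mapD1[OF b]) (use p y z pc cl in auto)
    qed (use p y z XYZ in \<open>simp_all add: cp o kcat_comp_closed[OF C] kcat_comp_closed[OF D] kcat_assoc[OF C] kcat_assoc[OF D]\<close>)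
    have 2: "Comp T p q s (Comp T q r s (pt r s z z') Y) X = Comp T p r s (pt r s z z') (Comp T p q r Y X)"
      if z: "z \<in> carrier (Hom C (fst r) (fst s))" "z' \<in> carrier (Hom D (snd r) (snd s))" for z z'
    proof (rule tensor_cat_eqI[OF p(2,3) M, where X = Y and f = "\<lambda>Y. Comp T p q s (Comp T q r s (pt r s z z') Y) X"])
      show "(\<lambda>Y. Comp T p q s (Comp T q r s (pt r s z z') Y) X) \<in> linear_map K (Hom T q r) (Hom T p s)"
        by (rule linear_map_comp[OF bilinear_mapD1[OF b] bilinear_mapD2[OF b]]) (use p z pc XYZ in auto)
      show "(\<lambda>Y. Comp T p r s (pt r s z z') (Comp T p q r Y X)) \<in> linear_map K (Hom T q r) (Hom T p s)"
        by (rule linear_map_comp[OF bilinear_mapD2[OF b] bilinear_mapD1[OF b]]) (use p z pc XYZ in auto)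
    qed (use XYZ 1 z in auto)
    show ?thesis
    proof (rule tensor_cat_eqI[OF p(3,4) M, where X = Z and f = "\<lambda>Z. Comp T p q s (Comp T q r s Z Y) X"])
      show "(\<lambda>Z. Comp T p q s (Comp T q r s Z Y) X) \<in> linear_map K (Hom T r s) (Hom T p s)"
        by (rule linear_map_comp[OF bilinear_mapD2[OF b] bilinear_mapD2[OF b]]) (use p XYZ in auto)
      show "(\<lambda>Z. Comp T p r s Z (Comp T p q r Y X)) \<in> linear_map K (Hom T r s) (Hom T p s)"
        by (rule bilinear_mapD2[OF b]) (use p XYZ cl in auto)
    qed (use XYZ 2 in auto)
  qed
  show ?thesis
    unfolding k_category_def
    by (intro conjI ballI) (simp_all add: tensor_cat_module(3) b assoc Idc idl idr)
qed

end

lemma k_category_env: "k_category K C \<Longrightarrow> k_category K (env_cat K C)"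
  unfolding env_cat_def by (intro k_category_tensor k_category_op)

subsection \<open>The bimodule of morphisms\<close>

lemma hom_bimodule_simps:
  "Val (hom_bimodule K C) p = Hom C (fst p) (snd p)"
  "Act (hom_bimodule K C) p q X h = tensor_lift K (Hom C (fst q) (snd q))
     (\<lambda>f g. Comp C (fst q) (snd p) (snd q) g (Comp C (fst q) (fst p) (snd p) h f)) X"
  by (simp_all add: hom_bimodule_def split_beta)

context
  fixes C :: "('k, 'o, 'm) kcat"
  assumes C: "k_category K C"
begin

lemma
  assumes p: "p \<in> Obj (env_cat K C)" and q: "q \<in> Obj (env_cat K C)"
  shows hom_bimodule_bilinear: "Act (hom_bimodule K C) p q \<in>
      bilinear_map K (Hom (env_cat K C) p q) (Hom C (fst p) (snd p)) (Hom C (fst q) (snd q))"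
    and hom_bimodule_pure: "f \<in> carrier (Hom C (fst q) (fst p)) \<Longrightarrow> g \<in> carrier (Hom C (snd p) (snd q)) \<Longrightarrow>
      h \<in> carrier (Hom C (fst p) (snd p)) \<Longrightarrow>
      Act (hom_bimodule K C) p q (pure_tensor K (Hom C (fst q) (fst p)) (Hom C (snd p) (snd q)) f g) h =
      Comp C (fst q) (snd p) (snd q) g (Comp C (fst q) (fst p) (snd p) h f)"
proof -
  have o: "fst p \<in> Obj C" "snd p \<in> Obj C" "fst q \<in> Obj C" "snd q \<in> Obj C"
    using assms by (auto simp: env_cat_def tensor_cat_simps)
  let ?\<beta> = "\<lambda>f g h. Comp C (fst q) (snd p) (snd q) g (Comp C (fst q) (fst p) (snd p) h f)"
  note m = kcat_module[OF C]
  note b1 = kcat_bilinear[OF C o(3,2,4)] and b2 = kcat_bilinear[OF C o(3,1,2)]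
  have 1: "(\<lambda>f g. ?\<beta> f g h) \<in> bilinear_map K (Hom C (fst q) (fst p)) (Hom C (snd p) (snd q)) (Hom C (fst q) (snd q))"
    if h: "h \<in> carrier (Hom C (fst p) (snd p))" for h
  proof (rule bilinear_mapI)
    show "(\<lambda>g. ?\<beta> f g h) \<in> linear_map K (Hom C (snd p) (snd q)) (Hom C (fst q) (snd q))"
      if "f \<in> carrier (Hom C (fst q) (fst p))" for f
      by (rule bilinear_mapD2[OF b1 bilinear_map_closed[OF b2 h that]])
    show "(\<lambda>f. ?\<beta> f g h) \<in> linear_map K (Hom C (fst q) (fst p)) (Hom C (fst q) (snd q))"
      if "g \<in> carrier (Hom C (snd p) (snd q))" for g
      by (rule linear_map_comp[OF bilinear_mapD1[OF b2 h] bilinear_mapD1[OF b1 that]])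
  qed
  have 2: "?\<beta> f g \<in> linear_map K (Hom C (fst p) (snd p)) (Hom C (fst q) (snd q))"
    if "f \<in> carrier (Hom C (fst q) (fst p))" "g \<in> carrier (Hom C (snd p) (snd q))" for f g
    by (rule linear_map_comp[OF bilinear_mapD2[OF b2 that(1)] bilinear_mapD1[OF b1 that(2)]])
  have e: "Act (hom_bimodule K C) p q = (\<lambda>X h. tensor_lift K (Hom C (fst q) (snd q)) (\<lambda>f g. ?\<beta> f g h) X)"
    by (intro ext) (simp add: hom_bimodule_simps)
  have H: "Hom (env_cat K C) p q = tensor K (Hom C (fst q) (fst p)) (Hom C (snd p) (snd q))"
    by (simp add: env_cat_def tensor_cat_simps)
  show "Act (hom_bimodule K C) p q \<in>
      bilinear_map K (Hom (env_cat K C) p q) (Hom C (fst p) (snd p)) (Hom C (fst q) (snd q))"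
    unfolding e H by (rule bilinear_map_tensor_lift[OF m m m m 1 2]) (use o in auto)
  show "f \<in> carrier (Hom C (fst q) (fst p)) \<Longrightarrow> g \<in> carrier (Hom C (snd p) (snd q)) \<Longrightarrow>
      h \<in> carrier (Hom C (fst p) (snd p)) \<Longrightarrow>
      Act (hom_bimodule K C) p q (pure_tensor K (Hom C (fst q) (fst p)) (Hom C (snd p) (snd q)) f g) h = ?\<beta> f g h"
    unfolding e by (rule tensor_lift_pure[OF m m m 1]) (use o in auto)
qed

lemma env_cat_eqI:
  assumes "p \<in> Obj (env_cat K C)" "q \<in> Obj (env_cat K C)" "module K Z"
    and "f \<in> linear_map K (Hom (env_cat K C) p q) Z" "g \<in> linear_map K (Hom (env_cat K C) p q) Z"
    and "\<And>x y. x \<in> carrier (Hom C (fst q) (fst p)) \<Longrightarrow> y \<in> carrier (Hom C (snd p) (snd q)) \<Longrightarrow>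
      f (pure_tensor K (Hom C (fst q) (fst p)) (Hom C (snd p) (snd q)) x y) =
      g (pure_tensor K (Hom C (fst q) (fst p)) (Hom C (snd p) (snd q)) x y)"
    and "X \<in> carrier (Hom (env_cat K C) p q)"
  shows "f X = g X"
  using tensor_cat_eqI[OF k_category_op[OF C] C, of p q Z f g X] assms unfolding env_cat_def by simp

text \<open>On pure tensors, functoriality of the two-sided action is associativity of composition,
  with the order reversed in the first factor; multilinearity does the rest.\<close>

lemma k_functor_hom_bimodule: "k_functor K (env_cat K C) (hom_bimodule K C)"
proof -
  let ?E = "env_cat K C" and ?H = "hom_bimodule K C"
  let ?pt = "\<lambda>p q. pure_tensor K (Hom C (fst q) (fst p)) (Hom C (snd p) (snd q))"
  note E = k_category_env[OF C]
  note b = hom_bimodule_bilinear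
  have o: "fst p \<in> Obj C" "snd p \<in> Obj C" if "p \<in> Obj ?E" for p
    using that by (auto simp: env_cat_def tensor_cat_simps)
  have Id: "Id ?E p = ?pt p p (Id C (fst p)) (Id C (snd p))" for p by (simp add: env_cat_def tensor_cat_simps)
  have pc: "?pt p q f g \<in> carrier (Hom ?E p q)"
    if "p \<in> Obj ?E" "q \<in> Obj ?E" "f \<in> carrier (Hom C (fst q) (fst p))" "g \<in> carrier (Hom C (snd p) (snd q))" for p q f g
    using tensor_cat_pure_closed[OF k_category_op[OF C] C, of p q f g] that by (simp add: env_cat_def)
  have cp: "Comp ?E p q r (?pt q r f' g') (?pt p q f g) =
      ?pt p r (Comp C (fst r) (fst q) (fst p) f f') (Comp C (snd p) (snd q) (snd r) g' g)"
    if "p \<in> Obj ?E" "q \<in> Obj ?E" "r \<in> Obj ?E" "f \<in> carrier (Hom C (fst q) (fst p))" "g \<in> carrier (Hom C (snd p) (snd q))"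
      "f' \<in> carrier (Hom C (fst r) (fst q))" "g' \<in> carrier (Hom C (snd q) (snd r))" for p q r f g f' g'
    using tensor_cat_comp_pure[OF k_category_op[OF C] C, of p q r f' g' f g] that by (simp add: env_cat_def)
  have comp: "Act ?H p r (Comp ?E p q r Y X) h = Act ?H q r Y (Act ?H p q X h)"
    if p: "p \<in> Obj ?E" "q \<in> Obj ?E" "r \<in> Obj ?E" and X: "X \<in> carrier (Hom ?E p q)" and Y: "Y \<in> carrier (Hom ?E q r)"
      and h: "h \<in> carrier (Hom C (fst p) (snd p))" for p q r X Y h
  proof -
    have M: "module K (Hom C (fst r) (snd r))" using o[OF p(3)] by (rule kcat_module[OF C])
    note o' = o[OF p(1)] o[OF p(2)] o[OF p(3)]
    have 1: "Act ?H p r (Comp ?E p q r (?pt q r f' g') X) h = Act ?H q r (?pt q r f' g') (Act ?H p q X h)"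
      if f': "f' \<in> carrier (Hom C (fst r) (fst q))" and g': "g' \<in> carrier (Hom C (snd q) (snd r))" for f' g'
    proof (rule env_cat_eqI[OF p(1,2) M, where X = X and f = "\<lambda>X. Act ?H p r (Comp ?E p q r (?pt q r f' g') X) h"])
      show "(\<lambda>X. Act ?H p r (Comp ?E p q r (?pt q r f' g') X) h) \<in> linear_map K (Hom ?E p q) (Hom C (fst r) (snd r))"
        by (rule linear_map_comp[OF bilinear_mapD1[OF kcat_bilinear[OF E]] bilinear_mapD2[OF b]]) (use p h pc f' g' in auto)
      show "(\<lambda>X. Act ?H q r (?pt q r f' g') (Act ?H p q X h)) \<in> linear_map K (Hom ?E p q) (Hom C (fst r) (snd r))"
        by (rule linear_map_comp[OF bilinear_mapD2[OF b] bilinear_mapD1[OF b]]) (use p h pc f' g' in auto)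
      show "Act ?H p r (Comp ?E p q r (?pt q r f' g') (?pt p q f g)) h = Act ?H q r (?pt q r f' g') (Act ?H p q (?pt p q f g) h)"
        if f: "f \<in> carrier (Hom C (fst q) (fst p))" and g: "g \<in> carrier (Hom C (snd p) (snd q))" for f g
        using p o' f g f' g' h
        by (simp add: cp hom_bimodule_pure kcat_comp_closed[OF C] kcat_assoc[OF C])
    qed (rule X)
    show ?thesis
    proof (rule env_cat_eqI[OF p(2,3) M, where X = Y and f = "\<lambda>Y. Act ?H p r (Comp ?E p q r Y X) h"])
      show "(\<lambda>Y. Act ?H p r (Comp ?E p q r Y X) h) \<in> linear_map K (Hom ?E q r) (Hom C (fst r) (snd r))"
        by (rule linear_map_comp[OF bilinear_mapD2[OF kcat_bilinear[OF E]] bilinear_mapD2[OF b]]) (use p h X in auto)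
      show "(\<lambda>Y. Act ?H q r Y (Act ?H p q X h)) \<in> linear_map K (Hom ?E q r) (Hom C (fst r) (snd r))"
        by (rule bilinear_mapD2[OF b]) (use p X h bilinear_map_closed[OF b] in auto)
    qed (use 1 Y in auto)
  qed
  show ?thesis
    unfolding k_functor_def
    by (intro conjI ballI)
      (simp_all add: hom_bimodule_simps(1) o kcat_module[OF C] b comp Id hom_bimodule_pure kcat_Id[OF C]
        kcat_Id_left[OF C] kcat_Id_right[OF C])
qed

end

end

subsection \<open>Retracts of tensor products\<close>

text \<open>A variable that is left alone enters the tensor construction as the identity retract,
  which absorbs on both sides.\<close>

lemma (in ground) retract_id:
  assumes "k_category K C"
  shows "retract K C C (\<lambda>a. a) (\<lambda>_ _ f. f) (\<lambda>a. a) (\<lambda>_ _ f. f)"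
  by unfold_locales (use assms in \<open>auto intro: linear_mapI\<close>)

lemma (in ground) retract_left_id:
  assumes "k_category K C"
  shows "retract_left K C C (\<lambda>a. a) (\<lambda>_ _ f. f) (\<lambda>a. a) (\<lambda>_ _ f. f)"
  by (intro retract_left.intro retract_id assms retract_left_axioms.intro) simp

lemma (in ground) retract_right_id:
  assumes "k_category K C"
  shows "retract_right K C C (\<lambda>a. a) (\<lambda>_ _ f. f) (\<lambda>a. a) (\<lambda>_ _ f. f)"
  by (intro retract_right.intro retract_id assms retract_right_axioms.intro) simp

text \<open>Reversing arrows exchanges the side on which \<sigma> absorbs. This is why the same
  corner gives a left adjoint in the contravariant variable and a right adjoint in the covariant
  one.\<close>

lemma (in retract_left) retract_right_op:
  "retract_right K (op_cat A) (op_cat B) \<Psi>o (\<lambda>a b. \<Psi> b a) so (\<lambda>a b. \<sigma> b a)"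
  by unfold_locales
    (auto simp: k_category_op A B \<Psi>o so \<Psi>o_so \<Psi>_linear \<Psi>_Id \<Psi>_comp \<sigma>_linear \<Psi>_\<sigma> \<sigma>_comp comp_\<sigma>)

text \<open>The object maps \<open>u\<close> and \<open>v\<close> locate the targets. For a section
  they are identities, since \<sigma> is indexed by objects of the category into which it
  maps.\<close>

definition tensor_mor :: "'k ring \<Rightarrow> ('k, 'o, 'm) kcat \<Rightarrow> ('k, 'p, 'n) kcat \<Rightarrow> ('x \<Rightarrow> 'o) \<Rightarrow> ('y \<Rightarrow> 'p) \<Rightarrow>
    ('x \<Rightarrow> 'x \<Rightarrow> 'a \<Rightarrow> 'm) \<Rightarrow> ('y \<Rightarrow> 'y \<Rightarrow> 'b \<Rightarrow> 'n) \<Rightarrow> 'x \<times> 'y \<Rightarrow> 'x \<times> 'y \<Rightarrow>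
    ('a \<times> 'b \<Rightarrow> 'k) set \<Rightarrow> ('m \<times> 'n \<Rightarrow> 'k) set" where
  "tensor_mor K C D u v f g p q = tensor_map K (Hom C (u (fst p)) (u (fst q))) (Hom D (v (snd p)) (v (snd q)))
     (f (fst p) (fst q)) (g (snd p) (snd q))"

lemma linear_map_id: "(\<lambda>x. x) \<in> linear_map K V V"
  by (auto intro: linear_mapI)

context ground
begin

lemma bilinear_map_post:
  assumes \<beta>: "\<beta> \<in> bilinear_map K V W Z" and f: "f \<in> linear_map K Z Z'"
  shows "(\<lambda>x y. f (\<beta> x y)) \<in> bilinear_map K V W Z'"
  by (intro bilinear_mapI)
    (rule linear_map_comp[OF bilinear_mapD1[OF \<beta>] f] linear_map_comp[OF bilinear_mapD2[OF \<beta>] f], assumption)+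

text \<open>The laws for tensor products of retracts are equations between bilinear maps in two
  tensors; pairs of pure tensors decide them.\<close>

lemma tensor_bilinear_eqI:
  assumes V: "module K V" and W: "module K W" and V': "module K V'" and W': "module K W'" and Z: "module K Z"
    and \<beta>: "\<beta> \<in> bilinear_map K (tensor K V' W') (tensor K V W) Z"
    and \<gamma>: "\<gamma> \<in> bilinear_map K (tensor K V' W') (tensor K V W) Z"
    and eq: "\<And>x' y' x y. x' \<in> carrier V' \<Longrightarrow> y' \<in> carrier W' \<Longrightarrow> x \<in> carrier V \<Longrightarrow> y \<in> carrier W \<Longrightarrow>
      \<beta> (pure_tensor K V' W' x' y') (pure_tensor K V W x y) = \<gamma> (pure_tensor K V' W' x' y') (pure_tensor K V W x y)"
    and Y: "Y \<in> carrier (tensor K V' W')" and X: "X \<in> carrier (tensor K V W)"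
  shows "\<beta> Y X = \<gamma> Y X"
proof (rule tensor_linear_eqI[OF V' W' Z bilinear_mapD2[OF \<beta> X] bilinear_mapD2[OF \<gamma> X] _ Y])
  fix x' y' assume x': "x' \<in> carrier V'" "y' \<in> carrier W'"
  note p = pure_tensor_closed[OF V' W' x']
  show "\<beta> (pure_tensor K V' W' x' y') X = \<gamma> (pure_tensor K V' W' x' y') X"
    by (rule tensor_linear_eqI[OF V W Z bilinear_mapD1[OF \<beta> p] bilinear_mapD1[OF \<gamma> p] eq[OF x'] X])
qed

context
  fixes A1 :: "('k, 'o1, 'm1) kcat" and B1 :: "('k, 'p1, 'n1) kcat" and u1 \<Psi>1 s1 \<sigma>1
    and A2 :: "('k, 'o2, 'm2) kcat" and B2 :: "('k, 'p2, 'n2) kcat" and u2 \<Psi>2 s2 \<sigma>2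
  assumes R1: "retract K A1 B1 u1 \<Psi>1 s1 \<sigma>1" and R2: "retract K A2 B2 u2 \<Psi>2 s2 \<sigma>2"
begin

interpretation R1: retract K A1 B1 u1 \<Psi>1 s1 \<sigma>1 by (rule R1)
interpretation R2: retract K A2 B2 u2 \<Psi>2 s2 \<sigma>2 by (rule R2)

private abbreviation "A \<equiv> tensor_cat K A1 A2"
private abbreviation "B \<equiv> tensor_cat K B1 B2"
private abbreviation "u \<equiv> map_prod u1 u2"
private abbreviation "s \<equiv> map_prod s1 s2"
private abbreviation "\<Psi> \<equiv> tensor_mor K B1 B2 u1 u2 \<Psi>1 \<Psi>2"
private abbreviation "\<sigma> \<equiv> tensor_mor K A1 A2 (\<lambda>a. a) (\<lambda>a. a) \<sigma>1 \<sigma>2"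
private abbreviation "ptA p q \<equiv> pure_tensor K (Hom A1 (fst p) (fst q)) (Hom A2 (snd p) (snd q))"
private abbreviation "ptu p q \<equiv> pure_tensor K (Hom B1 (u1 (fst p)) (u1 (fst q))) (Hom B2 (u2 (snd p)) (u2 (snd q)))"
private abbreviation "ptB p q \<equiv> pure_tensor K (Hom B1 (fst p) (fst q)) (Hom B2 (snd p) (snd q))"

lemma tensor_retract_obj:
  assumes "p \<in> Obj A"
  shows "fst p \<in> Obj A1" "snd p \<in> Obj A2" "u1 (fst p) \<in> Obj B1" "u2 (snd p) \<in> Obj B2" "u p \<in> Obj B"
  using assms by (auto simp: tensor_cat_simps R1.\<Psi>o R2.\<Psi>o)

lemma
  assumes p: "p \<in> Obj A" and q: "q \<in> Obj A"
  shows tensor_\<Psi>_linear: "\<Psi> p q \<in> linear_map K (Hom A p q) (Hom B (u p) (u q))"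
    and tensor_\<Psi>_pure: "f \<in> carrier (Hom A1 (fst p) (fst q)) \<Longrightarrow> g \<in> carrier (Hom A2 (snd p) (snd q)) \<Longrightarrow>
      \<Psi> p q (ptA p q f g) = ptu p q (\<Psi>1 (fst p) (fst q) f) (\<Psi>2 (snd p) (snd q) g)"
    and tensor_\<sigma>_linear: "\<sigma> p q \<in> linear_map K (Hom B (u p) (u q)) (Hom A p q)"
    and tensor_\<sigma>_pure: "x \<in> carrier (Hom B1 (u1 (fst p)) (u1 (fst q))) \<Longrightarrow> y \<in> carrier (Hom B2 (u2 (snd p)) (u2 (snd q))) \<Longrightarrow>
      \<sigma> p q (ptu p q x y) = ptA p q (\<sigma>1 (fst p) (fst q) x) (\<sigma>2 (snd p) (snd q) y)"
proof -
  note op = tensor_retract_obj[OF p] and oq = tensor_retract_obj[OF q]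
  note m = kcat_module[OF R1.A op(1) oq(1)] kcat_module[OF R2.A op(2) oq(2)]
    kcat_module[OF R1.B op(3) oq(3)] kcat_module[OF R2.B op(4) oq(4)]
  note l = R1.\<Psi>_linear[OF op(1) oq(1)] R2.\<Psi>_linear[OF op(2) oq(2)]
  note l' = R1.\<sigma>_linear[OF op(1) oq(1)] R2.\<sigma>_linear[OF op(2) oq(2)]
  show "\<Psi> p q \<in> linear_map K (Hom A p q) (Hom B (u p) (u q))"
    using linear_map_tensor_map[OF m l] by (simp add: tensor_mor_def tensor_cat_simps)
  show "\<sigma> p q \<in> linear_map K (Hom B (u p) (u q)) (Hom A p q)"
    using linear_map_tensor_map[OF m(3,4) m(1,2) l'] by (simp add: tensor_mor_def tensor_cat_simps)
  show "f \<in> carrier (Hom A1 (fst p) (fst q)) \<Longrightarrow> g \<in> carrier (Hom A2 (snd p) (snd q)) \<Longrightarrow>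
      \<Psi> p q (ptA p q f g) = ptu p q (\<Psi>1 (fst p) (fst q) f) (\<Psi>2 (snd p) (snd q) g)"
    using tensor_map_pure[OF m l] by (simp add: tensor_mor_def)
  show "x \<in> carrier (Hom B1 (u1 (fst p)) (u1 (fst q))) \<Longrightarrow> y \<in> carrier (Hom B2 (u2 (snd p)) (u2 (snd q))) \<Longrightarrow>
      \<sigma> p q (ptu p q x y) = ptA p q (\<sigma>1 (fst p) (fst q) x) (\<sigma>2 (snd p) (snd q) y)"
    using tensor_map_pure[OF m(3,4) m(1,2) l'] by (simp add: tensor_mor_def)
qed

lemma retract_tensor: "retract K A B u \<Psi> s \<sigma>"
proof unfold_locales
  note kA = k_category_tensor[OF R1.A R2.A] and kB = k_category_tensor[OF R1.B R2.B]
  note bA = tensor_cat_comp_bilinear[OF R1.A R2.A] and bB = tensor_cat_comp_bilinear[OF R1.B R2.B]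
  note cA = tensor_cat_comp_pure[OF R1.A R2.A] and cB = tensor_cat_comp_pure[OF R1.B R2.B]
  note o = tensor_retract_obj
  note mA = tensor_cat_module[OF R1.A R2.A] and mB = tensor_cat_module[OF R1.B R2.B]
  show "k_category K A" "k_category K B" by (fact kA, fact kB)
  show "u p \<in> Obj B" if "p \<in> Obj A" for p using that by (rule o)
  show "s b \<in> Obj A" "u (s b) = b" if "b \<in> Obj B" for b
    using that by (auto simp: tensor_cat_simps R1.so R2.so R1.\<Psi>o_so R2.\<Psi>o_so)
  fix p q assume p: "p \<in> Obj A" and q: "q \<in> Obj A"
  show "\<Psi> p q \<in> linear_map K (Hom A p q) (Hom B (u p) (u q))" by (rule tensor_\<Psi>_linear[OF p q])
  show "\<sigma> p q \<in> linear_map K (Hom B (u p) (u q)) (Hom A p q)" by (rule tensor_\<sigma>_linear[OF p q])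
  show "\<Psi> p p (Id A p) = Id B (u p)"
    using tensor_\<Psi>_pure[OF p p] o[OF p] by (simp add: tensor_cat_simps kcat_Id[OF R1.A] kcat_Id[OF R2.A] R1.\<Psi>_Id R2.\<Psi>_Id)
  show "\<Psi> p q (\<sigma> p q X) = X" if X: "X \<in> carrier (Hom B (u p) (u q))" for X
  proof (rule tensor_cat_eqI[OF R1.B R2.B o(5)[OF p] o(5)[OF q] mB(3)[OF o(5)[OF p] o(5)[OF q]], where f = "\<lambda>X. \<Psi> p q (\<sigma> p q X)"])
    show "(\<lambda>X. \<Psi> p q (\<sigma> p q X)) \<in> linear_map K (Hom B (u p) (u q)) (Hom B (u p) (u q))"
      by (rule linear_map_comp[OF tensor_\<sigma>_linear[OF p q] tensor_\<Psi>_linear[OF p q]])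
    show "(\<lambda>x. x) \<in> linear_map K (Hom B (u p) (u q)) (Hom B (u p) (u q))" by (rule linear_map_id)
    show "\<Psi> p q (\<sigma> p q (ptB (u p) (u q) x y)) = ptB (u p) (u q) x y"
      if "x \<in> carrier (Hom B1 (fst (u p)) (fst (u q)))" "y \<in> carrier (Hom B2 (snd (u p)) (snd (u q)))" for x y
      using that o[OF p] o[OF q]
      by (simp add: tensor_\<sigma>_pure[OF p q] tensor_\<Psi>_pure[OF p q] R1.\<sigma>_closed R2.\<sigma>_closed R1.\<Psi>_\<sigma> R2.\<Psi>_\<sigma>)
  qed (rule X)
  fix r assume r: "r \<in> Obj A"
  note o' = o[OF p] o[OF q] o[OF r]
  show "\<Psi> p r (Comp A p q r g f) = Comp B (u p) (u q) (u r) (\<Psi> q r g) (\<Psi> p q f)"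
    if f: "f \<in> carrier (Hom A p q)" and g: "g \<in> carrier (Hom A q r)" for f g
  proof (rule tensor_bilinear_eqI[OF mA(1,2)[OF p q] mA(1,2)[OF q r] mB(3)[OF o(5)[OF p] o(5)[OF r]],
        where \<beta> = "\<lambda>g f. \<Psi> p r (Comp A p q r g f)" and \<gamma> = "\<lambda>g f. Comp B (u p) (u q) (u r) (\<Psi> q r g) (\<Psi> p q f)"];
      (fold tensor_cat_simps(2))?)
    show "(\<lambda>g f. \<Psi> p r (Comp A p q r g f)) \<in> bilinear_map K (Hom A q r) (Hom A p q) (Hom B (u p) (u r))"
      by (rule bilinear_map_post[OF bA[OF p q r] tensor_\<Psi>_linear[OF p r]])
    show "(\<lambda>g f. Comp B (u p) (u q) (u r) (\<Psi> q r g) (\<Psi> p q f)) \<in> bilinear_map K (Hom A q r) (Hom A p q) (Hom B (u p) (u r))"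
      by (rule bilinear_map_comp[OF bB tensor_\<Psi>_linear[OF q r] tensor_\<Psi>_linear[OF p q]]) (use o' in auto)
    fix x' y' x y
    assume "x' \<in> carrier (Hom A1 (fst q) (fst r))" "y' \<in> carrier (Hom A2 (snd q) (snd r))"
      "x \<in> carrier (Hom A1 (fst p) (fst q))" "y \<in> carrier (Hom A2 (snd p) (snd q))"
    then show "\<Psi> p r (Comp A p q r (ptA q r x' y') (ptA p q x y)) =
        Comp B (u p) (u q) (u r) (\<Psi> q r (ptA q r x' y')) (\<Psi> p q (ptA p q x y))"
      using o' by (simp add: cA[OF p q r] cB[OF o'(5,10,15), unfolded fst_map_prod snd_map_prod] tensor_\<Psi>_pure p q r kcat_comp_closed[OF R1.A] kcat_comp_closed[OF R2.A]
          R1.\<Psi>_closed R2.\<Psi>_closed R1.\<Psi>_comp R2.\<Psi>_comp)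
  qed (rule g, rule f)
  show "Comp A p q r (\<sigma> q r g) (\<sigma> p q f) = \<sigma> p r (Comp B (u p) (u q) (u r) g f)"
    if f: "f \<in> carrier (Hom B (u p) (u q))" and g: "g \<in> carrier (Hom B (u q) (u r))" for f g
  proof (rule tensor_bilinear_eqI[OF mB(1,2)[OF o(5)[OF p] o(5)[OF q]] mB(1,2)[OF o(5)[OF q] o(5)[OF r]] mA(3)[OF p r],
        where \<beta> = "\<lambda>g f. Comp A p q r (\<sigma> q r g) (\<sigma> p q f)" and \<gamma> = "\<lambda>g f. \<sigma> p r (Comp B (u p) (u q) (u r) g f)"];
      (fold tensor_cat_simps(2))?)
    show "(\<lambda>g f. \<sigma> p r (Comp B (u p) (u q) (u r) g f)) \<in> bilinear_map K (Hom B (u q) (u r)) (Hom B (u p) (u q)) (Hom A p r)"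
      by (rule bilinear_map_post[OF bB[OF o'(5,10,15)] tensor_\<sigma>_linear[OF p r]])
    show "(\<lambda>g f. Comp A p q r (\<sigma> q r g) (\<sigma> p q f)) \<in> bilinear_map K (Hom B (u q) (u r)) (Hom B (u p) (u q)) (Hom A p r)"
      by (rule bilinear_map_comp[OF bA[OF p q r] tensor_\<sigma>_linear[OF q r] tensor_\<sigma>_linear[OF p q]])
    fix x' y' x y
    assume "x' \<in> carrier (Hom B1 (fst (u q)) (fst (u r)))" "y' \<in> carrier (Hom B2 (snd (u q)) (snd (u r)))"
      "x \<in> carrier (Hom B1 (fst (u p)) (fst (u q)))" "y \<in> carrier (Hom B2 (snd (u p)) (snd (u q)))"
    then show "Comp A p q r (\<sigma> q r (ptB (u q) (u r) x' y')) (\<sigma> p q (ptB (u p) (u q) x y)) =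
        \<sigma> p r (Comp B (u p) (u q) (u r) (ptB (u q) (u r) x' y') (ptB (u p) (u q) x y))"
      using o' by (simp add: cA[OF p q r] cB[OF o'(5,10,15), unfolded fst_map_prod snd_map_prod] tensor_\<sigma>_pure p q r kcat_comp_closed[OF R1.B] kcat_comp_closed[OF R2.B]
          R1.\<sigma>_closed R2.\<sigma>_closed R1.\<sigma>_comp R2.\<sigma>_comp)
  qed (rule g, rule f)
qed

text \<open>Both factors have to absorb on the same side: on pure tensors the law is absorption in
  each factor.\<close>

lemma retract_left_tensor:
  assumes "retract_left K A1 B1 u1 \<Psi>1 s1 \<sigma>1" "retract_left K A2 B2 u2 \<Psi>2 s2 \<sigma>2"
  shows "retract_left K A B u \<Psi> s \<sigma>"
proof (intro retract_left.intro retract_tensor retract_left_axioms.intro)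
  interpret L1: retract_left K A1 B1 u1 \<Psi>1 s1 \<sigma>1 by fact
  interpret L2: retract_left K A2 B2 u2 \<Psi>2 s2 \<sigma>2 by fact
  note bA = tensor_cat_comp_bilinear[OF R1.A R2.A] and bB = tensor_cat_comp_bilinear[OF R1.B R2.B]
  note cA = tensor_cat_comp_pure[OF R1.A R2.A] and cB = tensor_cat_comp_pure[OF R1.B R2.B]
  note mA = tensor_cat_module[OF R1.A R2.A] and mB = tensor_cat_module[OF R1.B R2.B]
  fix p q r f X assume p: "p \<in> Obj A" and q: "q \<in> Obj A" and r: "r \<in> Obj A"
    and X: "X \<in> carrier (Hom B (u p) (u q))" and f: "f \<in> carrier (Hom A q r)"
  note o' = tensor_retract_obj[OF p] tensor_retract_obj[OF q] tensor_retract_obj[OF r]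
  show "Comp A p q r f (\<sigma> p q X) = \<sigma> p r (Comp B (u p) (u q) (u r) (\<Psi> q r f) X)"
  proof (rule tensor_bilinear_eqI[OF mB(1,2)[OF o'(5,10)] mA(1,2)[OF q r] mA(3)[OF p r],
        where \<beta> = "\<lambda>f X. Comp A p q r f (\<sigma> p q X)" and \<gamma> = "\<lambda>f X. \<sigma> p r (Comp B (u p) (u q) (u r) (\<Psi> q r f) X)"];
      (fold tensor_cat_simps(2))?)
    show "(\<lambda>f X. Comp A p q r f (\<sigma> p q X)) \<in> bilinear_map K (Hom A q r) (Hom B (u p) (u q)) (Hom A p r)"
      by (rule bilinear_map_comp[OF bA[OF p q r] linear_map_id tensor_\<sigma>_linear[OF p q]])
    show "(\<lambda>f X. \<sigma> p r (Comp B (u p) (u q) (u r) (\<Psi> q r f) X)) \<in> bilinear_map K (Hom A q r) (Hom B (u p) (u q)) (Hom A p r)"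
      by (rule bilinear_map_post[OF bilinear_map_comp[OF bB[OF o'(5,10,15)] tensor_\<Psi>_linear[OF q r] linear_map_id] tensor_\<sigma>_linear[OF p r]])
    fix x' y' x y
    assume "x' \<in> carrier (Hom A1 (fst q) (fst r))" "y' \<in> carrier (Hom A2 (snd q) (snd r))"
      "x \<in> carrier (Hom B1 (fst (u p)) (fst (u q)))" "y \<in> carrier (Hom B2 (snd (u p)) (snd (u q)))"
    then show "Comp A p q r (ptA q r x' y') (\<sigma> p q (ptB (u p) (u q) x y)) =
        \<sigma> p r (Comp B (u p) (u q) (u r) (\<Psi> q r (ptA q r x' y')) (ptB (u p) (u q) x y))"
      using o' by (simp add: cA[OF p q r] cB[OF o'(5,10,15), unfolded fst_map_prod snd_map_prod] tensor_\<sigma>_pure tensor_\<Psi>_pure p q r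
          kcat_comp_closed[OF R1.B] kcat_comp_closed[OF R2.B] R1.\<Psi>_closed R2.\<Psi>_closed
          R1.\<sigma>_closed R2.\<sigma>_closed L1.comp_\<sigma> L2.comp_\<sigma>)
  qed (rule f, rule X)
qed

lemma retract_right_tensor:
  assumes "retract_right K A1 B1 u1 \<Psi>1 s1 \<sigma>1" "retract_right K A2 B2 u2 \<Psi>2 s2 \<sigma>2"
  shows "retract_right K A B u \<Psi> s \<sigma>"
proof (intro retract_right.intro retract_tensor retract_right_axioms.intro)
  interpret L1: retract_right K A1 B1 u1 \<Psi>1 s1 \<sigma>1 by fact
  interpret L2: retract_right K A2 B2 u2 \<Psi>2 s2 \<sigma>2 by fact
  note bA = tensor_cat_comp_bilinear[OF R1.A R2.A] and bB = tensor_cat_comp_bilinear[OF R1.B R2.B]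
  note cA = tensor_cat_comp_pure[OF R1.A R2.A] and cB = tensor_cat_comp_pure[OF R1.B R2.B]
  note mA = tensor_cat_module[OF R1.A R2.A] and mB = tensor_cat_module[OF R1.B R2.B]
  fix p q r f X assume p: "p \<in> Obj A" and q: "q \<in> Obj A" and r: "r \<in> Obj A"
    and f: "f \<in> carrier (Hom A p q)" and X: "X \<in> carrier (Hom B (u q) (u r))"
  note o' = tensor_retract_obj[OF p] tensor_retract_obj[OF q] tensor_retract_obj[OF r]
  show "Comp A p q r (\<sigma> q r X) f = \<sigma> p r (Comp B (u p) (u q) (u r) X (\<Psi> p q f))"
  proof (rule tensor_bilinear_eqI[OF mA(1,2)[OF p q] mB(1,2)[OF o'(10,15)] mA(3)[OF p r],
        where \<beta> = "\<lambda>X f. Comp A p q r (\<sigma> q r X) f" and \<gamma> = "\<lambda>X f. \<sigma> p r (Comp B (u p) (u q) (u r) X (\<Psi> p q f))"];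
      (fold tensor_cat_simps(2))?)
    show "(\<lambda>X f. Comp A p q r (\<sigma> q r X) f) \<in> bilinear_map K (Hom B (u q) (u r)) (Hom A p q) (Hom A p r)"
      by (rule bilinear_map_comp[OF bA[OF p q r] tensor_\<sigma>_linear[OF q r] linear_map_id])
    show "(\<lambda>X f. \<sigma> p r (Comp B (u p) (u q) (u r) X (\<Psi> p q f))) \<in> bilinear_map K (Hom B (u q) (u r)) (Hom A p q) (Hom A p r)"
      by (rule bilinear_map_post[OF bilinear_map_comp[OF bB[OF o'(5,10,15)] linear_map_id tensor_\<Psi>_linear[OF p q]] tensor_\<sigma>_linear[OF p r]])
    fix x' y' x y
    assume "x' \<in> carrier (Hom B1 (fst (u q)) (fst (u r)))" "y' \<in> carrier (Hom B2 (snd (u q)) (snd (u r)))"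
      "x \<in> carrier (Hom A1 (fst p) (fst q))" "y \<in> carrier (Hom A2 (snd p) (snd q))"
    then show "Comp A p q r (\<sigma> q r (ptB (u q) (u r) x' y')) (ptA p q x y) =
        \<sigma> p r (Comp B (u p) (u q) (u r) (ptB (u q) (u r) x' y') (\<Psi> p q (ptA p q x y)))"
      using o' by (simp add: cA[OF p q r] cB[OF o'(5,10,15), unfolded fst_map_prod snd_map_prod] tensor_\<sigma>_pure tensor_\<Psi>_pure p q r
          kcat_comp_closed[OF R1.B] kcat_comp_closed[OF R2.B] R1.\<Psi>_closed R2.\<Psi>_closed
          R1.\<sigma>_closed R2.\<sigma>_closed L1.\<sigma>_comp_right L2.\<sigma>_comp_right)
  qed (rule X, rule f)
qed

end

end

subsection \<open>The long exact sequence of a subfunctor\<close>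

context ground
begin

text \<open>\<open>N\<close> must agree with the kernel of \<pi> at objects of \<open>C\<close>
  only, so it may be given by any formula. In degree 0, composition with \<epsilon> identifies
  Hom(F, I) with the cocycles.\<close>

lemma hom_long_exact_sequence:
  fixes F :: "('k, 'o, 'm, 'w) kfun" and P :: "nat \<Rightarrow> ('k, 'o, 'm, 'v) kfun"
    and G :: "('k, 'o, 'm, 'y) kfun" and H :: "('k, 'o, 'm, 'z) kfun"
  assumes C: "k_category K C" and F: "k_functor K C F" and P: "split_resolution C F P d \<epsilon>"
    and G: "k_functor K C G" and H: "k_functor K C H" and \<pi>: "\<pi> \<in> nat_trans K C G H"
    and surj: "objectwise_surj C G H \<pi>"
    and N: "\<And>a. a \<in> Obj C \<Longrightarrow> N a = {x \<in> carrier (Val G a). \<pi> a x = \<zero>\<^bsub>Val H a\<^esub>}"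
  defines "I \<equiv> sub_fun G N"
  defines "E \<equiv> \<lambda>n. coh (hom_cx C P I) (hom_d C P d) n"
    and "EG \<equiv> \<lambda>n. coh (hom_cx C P G) (hom_d C P d) n" and "EH \<equiv> \<lambda>n. coh (hom_cx C P H) (hom_d C P d) n"
  obtains j i p \<delta> where
    "j \<in> linear_map K (nat_space K C F I) (EG 0)"
    "\<And>n. i n \<in> linear_map K (E n) (EG n)"
    "\<And>n. p n \<in> linear_map K (EG n) (EH n)"
    "\<And>n. \<delta> n \<in> linear_map K (EH n) (E (Suc n))"
    "inj_on j (carrier (nat_space K C F I))"
    "exact_at (nat_space K C F I) j (EG 0) (p 0) (EH 0)"
    "\<And>n. exact_at (E n) (i n) (EG n) (p n) (EH n)"
    "\<And>n. exact_at (EG n) (p n) (EH n) (\<delta> n) (E (Suc n))"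
    "\<And>n. exact_at (EH n) (\<delta> n) (E (Suc n)) (i (Suc n)) (EG (Suc n))"
proof -
  note fP = res_functor[OF C F P] and dP = res_d[OF C F P] and eP = res_eps[OF C F P]
  have I: "k_functor K C I"
    unfolding I_def
  proof (rule k_functor_sub[OF G])
    show "subspace K (Val G a) (N a)" if "a \<in> Obj C" for a
      unfolding N[OF that] using that by (intro subspace_kernel kfun_module[OF G] kfun_module[OF H] nat_linear[OF \<pi>])
  qed (auto simp: N kfun_closed[OF G] nat_natural[OF \<pi>]
      linear_map_zero[OF kfun_module[OF H] kfun_module[OF H] kfun_linear[OF H]])
  have from_I: "\<eta> \<in> nat_trans K C X G" if "\<eta> \<in> nat_trans K C X I" for X :: "('k, 'o, 'm, 'x) kfun" and \<eta>
    using that unfolding I_def by (rule nat_trans_from_sub) (auto simp: N)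
  note cI = cocomplex_hom[OF C F P I] and cG = cocomplex_hom[OF C F P G] and cH = cocomplex_hom[OF C F P H]
  \<comment> \<open>The inclusion of the subfunctor does not change a transformation as a function,
    so the cochain map is the identity function.\<close>
  have f: "cochain_map (hom_cx C P I) (hom_d C P d) (hom_cx C P G) (hom_d C P d) (\<lambda>n \<eta>. \<eta>)"
    unfolding cochain_map_def hom_cx_def hom_d_def
    by (auto intro!: linear_mapI from_I simp: nat_space_simps I_def)
  have g: "cochain_map (hom_cx C P G) (hom_d C P d) (hom_cx C P H) (hom_d C P d) (\<lambda>n \<eta>. nat_comp C (P n) \<pi> \<eta>)"
    unfolding cochain_map_def hom_cx_def hom_d_def
  proof (intro conjI allI ballI linear_map_nat_comp_left[OF fP G H \<pi>])
    fix n \<eta> assume "\<eta> \<in> carrier (nat_space K C (P n) G)"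
    then have "\<eta> \<in> nat_trans K C (P n) G" by (simp add: nat_space_simps)
    from nat_comp_assoc[OF fP dP this \<pi> fP]
    show "nat_comp C (P (Suc n)) \<pi> (nat_comp C (P (Suc n)) \<eta> (d n)) = nat_comp C (P (Suc n)) (nat_comp C (P n) \<pi> \<eta>) (d n)"
      by simp
  qed
  have ex: "exact_at (hom_cx C P I n) (\<lambda>\<eta>. \<eta>) (hom_cx C P G n) (nat_comp C (P n) \<pi>) (hom_cx C P H n)" for n
    unfolding exact_at_def hom_cx_def nat_space_simps(1,2)
  proof (intro equalityI subsetI)
    fix \<eta> assume "\<eta> \<in> (\<lambda>\<eta>. \<eta>) ` nat_trans K C (P n) I"
    then have \<eta>: "\<eta> \<in> nat_trans K C (P n) I" by simp
    have "\<pi> a (\<eta> a x) = \<zero>\<^bsub>Val H a\<^esub>" if "a \<in> Obj C" "x \<in> carrier (Val (P n) a)" for a x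
      using nat_closed[OF \<eta> that] N[OF that(1)] by (simp add: I_def)
    then show "\<eta> \<in> {y \<in> nat_trans K C (P n) G. nat_comp C (P n) \<pi> y = nat_of C (P n) (\<lambda>a x. \<zero>\<^bsub>Val H a\<^esub>)}"
      using from_I[OF \<eta>] by (auto simp: nat_comp_alt intro!: nat_of_cong)
  next
    fix \<eta> assume "\<eta> \<in> {y \<in> nat_trans K C (P n) G. nat_comp C (P n) \<pi> y = nat_of C (P n) (\<lambda>a x. \<zero>\<^bsub>Val H a\<^esub>)}"
    then have \<eta>: "\<eta> \<in> nat_trans K C (P n) G" and z: "nat_comp C (P n) \<pi> \<eta> = nat_of C (P n) (\<lambda>a x. \<zero>\<^bsub>Val H a\<^esub>)" by auto
    have "\<pi> a (\<eta> a x) = \<zero>\<^bsub>Val H a\<^esub>" if "a \<in> Obj C" "x \<in> carrier (Val (P n) a)" for a x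
      using fun_cong[OF fun_cong[OF z], of a x] that by simp
    then have "\<eta> \<in> nat_trans K C (P n) I"
      unfolding I_def by (intro nat_trans_into_sub[OF \<eta>]) (auto simp: N nat_closed[OF \<eta>])
    then show "\<eta> \<in> (\<lambda>\<eta>. \<eta>) ` nat_trans K C (P n) I" by simp
  qed
  \<comment> \<open>Projectivity of \<open>P n\<close> makes composition with \<pi>
    surjective.\<close>
  have sj: "nat_comp C (P n) \<pi> ` carrier (hom_cx C P G n) = carrier (hom_cx C P H n)" for n
  proof (intro equalityI subsetI)
    fix \<phi> assume "\<phi> \<in> carrier (hom_cx C P H n)"
    then have \<phi>: "\<phi> \<in> nat_trans K C (P n) H" by (simp add: hom_cx_def nat_space_simps)
    from split_projective_lift[OF C res_split[OF C F P] G H \<pi> \<phi> surj]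
    show "\<phi> \<in> nat_comp C (P n) \<pi> ` carrier (hom_cx C P G n)" by (auto simp: hom_cx_def nat_space_simps)
  qed (use nat_comp_closed[OF fP _ \<pi>] in \<open>auto simp: hom_cx_def nat_space_simps(1)\<close>)
  obtain i p \<delta> where LES:
    "\<And>n. i n \<in> linear_map K (E n) (EG n)"
    "\<And>n. p n \<in> linear_map K (EG n) (EH n)"
    "\<And>n. \<delta> n \<in> linear_map K (EH n) (E (Suc n))"
    "\<And>n x. x \<in> cocyc (hom_cx C P I) (hom_d C P d) n \<Longrightarrow>
       i n (coh_class (hom_cx C P I) (hom_d C P d) n x) = coh_class (hom_cx C P G) (hom_d C P d) n x"
    "inj_on (i 0) (carrier (E 0))"
    "\<And>n. exact_at (E n) (i n) (EG n) (p n) (EH n)"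
    "\<And>n. exact_at (EG n) (p n) (EH n) (\<delta> n) (E (Suc n))"
    "\<And>n. exact_at (EH n) (\<delta> n) (E (Suc n)) (i (Suc n)) (EG (Suc n))"
    by (rule long_exact_sequence[OF cI cG cH f g inj_on_id2 ex sj, folded E_def EG_def EH_def], rule that)
  let ?A = "hom_cx C P I" and ?D = "hom_d C P d"
  define c where "c \<theta> = nat_comp C (P 0) \<theta> \<epsilon>" for \<theta> :: "'o \<Rightarrow> 'w \<Rightarrow> 'y"
  \<comment> \<open>\<open>j\<close> is \<open>i 0\<close> read on transformations out of
    \<open>F\<close> instead of on classes of cocycles.\<close>
  define j where "j \<theta> = i 0 (coh_class ?A ?D 0 (c \<theta>))" for \<theta>
  have lin_c: "c \<in> linear_map K (nat_space K C F I) (nat_space K C (P 0) I)"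
    unfolding c_def[abs_def] by (rule linear_map_nat_comp_right[OF fP F I eP])
  have c: "c \<theta> \<in> cocyc ?A ?D 0" if "\<theta> \<in> carrier (nat_space K C F I)" for \<theta>
  proof -
    have \<theta>: "\<theta> \<in> nat_trans K C F I" using that by (simp add: nat_space_simps)
    have "nat_comp C (P (Suc 0)) (c \<theta>) (d 0) = nat_of C (P (Suc 0)) (\<lambda>a x. \<zero>\<^bsub>Val I a\<^esub>)"
      unfolding nat_comp_alt c_def
      by (rule nat_of_cong) (simp add: nat_closed[OF dP] res_eps_d[OF C F P]
          linear_map_zero[OF kfun_module[OF F] kfun_module[OF I] nat_linear[OF \<theta>]])
    then show ?thesis
      using linear_map_closed[OF lin_c that] by (simp add: cocyc_def hom_cx_def hom_d_def nat_space_simps(2))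
  qed
  have "c \<in> linear_map K (nat_space K C F I) ((?A 0)\<lparr>carrier := cocyc ?A ?D 0\<rparr>)"
    using lin_c c by (auto simp: linear_map_def hom_cx_def)
  from linear_map_comp[OF linear_map_comp[OF this linear_map_coh_class[OF cI]]] LES(1)
  have j: "j \<in> linear_map K (nat_space K C F I) (EG 0)" unfolding j_def[abs_def] E_def by blast
  have inj: "inj_on j (carrier (nat_space K C F I))"
  proof (rule inj_onI)
    fix \<theta> \<theta>' assume \<theta>: "\<theta> \<in> carrier (nat_space K C F I)" and \<theta>': "\<theta>' \<in> carrier (nat_space K C F I)" and e: "j \<theta> = j \<theta>'"
    have "coh_class ?A ?D 0 (c \<theta>) = coh_class ?A ?D 0 (c \<theta>')"
      using e c[OF \<theta>] c[OF \<theta>'] inj_onD[OF LES(5)] by (simp add: j_def E_def coh_class_closed[OF cI])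
    then obtain b where "b \<in> cobd ?A ?D 0" "c \<theta> = c \<theta>' \<oplus>\<^bsub>?A 0\<^esub> b"
      using coh_class_eq_iff[OF cI c[OF \<theta>] c[OF \<theta>']] by blast
    then have e: "c \<theta> = c \<theta>'"
      using add_zero[OF cocomplex_module[OF cI] cocycD(1)[OF c[OF \<theta>']]] by (simp add: cobd_def)
    show "\<theta> = \<theta>'"
    proof (rule nat_eqI[of _ K C F I _ I])
      fix a y assume a: "a \<in> Obj C" and y: "y \<in> carrier (Val F a)"
      obtain x where "x \<in> carrier (Val (P 0) a)" "y = \<epsilon> a x" using y res_surj[OF C F P a] by auto
      then show "\<theta> a y = \<theta>' a y" using fun_cong[OF fun_cong[OF e], of a x] a by (simp add: c_def)
    qed (use \<theta> \<theta>' in \<open>auto simp: nat_space_simps\<close>)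
  qed
  \<comment> \<open>Every cocycle of degree 0 factors through \<epsilon>, so \<open>j\<close> and
    \<open>i 0\<close> have the same image and exactness carries over.\<close>
  have "j ` carrier (nat_space K C F I) = i 0 ` carrier (E 0)"
  proof (intro equalityI subsetI)
    fix v assume "v \<in> i 0 ` carrier (E 0)"
    then obtain \<eta> where \<eta>: "\<eta> \<in> cocyc ?A ?D 0" "v = i 0 (coh_class ?A ?D 0 \<eta>)"
      by (auto simp: E_def carrier_coh[OF cI])
    then show "v \<in> j ` carrier (nat_space K C F I)"
      using zero_cocycle_factors[OF C F P I \<eta>(1)] by (auto simp: j_def c_def nat_space_simps)
  qed (use c in \<open>auto simp: j_def E_def coh_class_closed[OF cI]\<close>)
  then have ex0: "exact_at (nat_space K C F I) j (EG 0) (p 0) (EH 0)"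
    using LES(6)[of 0] by (simp add: exact_at_def)
  show ?thesis by (rule that[OF j LES(1-3) inj ex0 LES(6-8)])
qed

section \<open>Exchanging a term of an exact sequence\<close>

lemma linear_map_the_inv:
  assumes V: "module K V" and \<theta>: "\<theta> \<in> linear_map K V W" and b: "bij_betw \<theta> (carrier V) (carrier W)"
  shows "the_inv_into (carrier V) \<theta> \<in> linear_map K W V"
proof -
  have inj: "inj_on \<theta> (carrier V)" and W: "carrier W = \<theta> ` carrier V" using b by (auto simp: bij_betw_def)
  have inv: "the_inv_into (carrier V) \<theta> (\<theta> x) = x" if "x \<in> carrier V" for x
    by (rule the_inv_into_f_f[OF inj that])
  show ?thesis
    by (rule linear_mapI)
      (auto simp: W inv mod_simps[OF V] simp flip: linear_map_add[OF \<theta>] linear_map_smult[OF \<theta>])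
qed

text \<open>An isomorphism preserves kernels and images. The three equivalences treat the exchanged
  term in the last, the middle and the first position.\<close>

lemma exact_at_iso:
  assumes Z: "module K Z" and Z': "module K Z'" and \<theta>: "\<theta> \<in> linear_map K Z Z'"
    and b: "bij_betw \<theta> (carrier Z) (carrier Z')" and g: "g \<in> linear_map K W Z" and h: "h \<in> linear_map K Z Y"
  shows "exact_at V f W (\<lambda>x. \<theta> (g x)) Z' \<longleftrightarrow> exact_at V f W g Z"
    and "exact_at W (\<lambda>x. \<theta> (g x)) Z' (\<lambda>x. h (the_inv_into (carrier Z) \<theta> x)) Y \<longleftrightarrow> exact_at W g Z h Y"
    and "exact_at Z' (\<lambda>x. h (the_inv_into (carrier Z) \<theta> x)) Y k X \<longleftrightarrow> exact_at Z h Y k X"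
proof -
  have inj: "inj_on \<theta> (carrier Z)" and im: "\<theta> ` carrier Z = carrier Z'" using b by (auto simp: bij_betw_def)
  have inv: "the_inv_into (carrier Z) \<theta> (\<theta> x) = x" if "x \<in> carrier Z" for x by (rule the_inv_into_f_f[OF inj that])
  have "\<theta> (g x) = \<zero>\<^bsub>Z'\<^esub> \<longleftrightarrow> g x = \<zero>\<^bsub>Z\<^esub>" if "x \<in> carrier W" for x
    using inj_on_eq_iff[OF inj linear_map_closed[OF g that] zero_closed[OF Z]] linear_map_zero[OF Z Z' \<theta>] by simp
  then show "exact_at V f W (\<lambda>x. \<theta> (g x)) Z' \<longleftrightarrow> exact_at V f W g Z"
    by (simp add: exact_at_def cong: conj_cong)
  have "(\<lambda>x. \<theta> (g x)) ` carrier W = \<theta> ` g ` carrier W" by auto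
  moreover have "{y \<in> carrier Z'. h (the_inv_into (carrier Z) \<theta> y) = \<zero>\<^bsub>Y\<^esub>} = \<theta> ` {y \<in> carrier Z. h y = \<zero>\<^bsub>Y\<^esub>}"
    using im inv by (auto simp flip: im)
  ultimately show "exact_at W (\<lambda>x. \<theta> (g x)) Z' (\<lambda>x. h (the_inv_into (carrier Z) \<theta> x)) Y \<longleftrightarrow> exact_at W g Z h Y"
    using inj_on_image_eq_iff[OF inj, of "g ` carrier W" "{y \<in> carrier Z. h y = \<zero>\<^bsub>Y\<^esub>}"] linear_map_closed[OF g]
    by (auto simp: exact_at_def)
  have "(\<lambda>x. h (the_inv_into (carrier Z) \<theta> x)) ` carrier Z' = h ` carrier Z"
    unfolding im[symmetric] image_image using inv by (intro image_cong) auto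
  then show "exact_at Z' (\<lambda>x. h (the_inv_into (carrier Z) \<theta> x)) Y k X \<longleftrightarrow> exact_at Z h Y k X"
    by (simp add: exact_at_def)
qed

end

section \<open>The triangular matrix category\<close>

lemma product3_simps [simp]:
  "carrier (product3_module U V W) = carrier U \<times> carrier V \<times> carrier W"
  "\<zero>\<^bsub>product3_module U V W\<^esub> = (\<zero>\<^bsub>U\<^esub>, \<zero>\<^bsub>V\<^esub>, \<zero>\<^bsub>W\<^esub>)"
  "x \<oplus>\<^bsub>product3_module U V W\<^esub> y =
     (fst x \<oplus>\<^bsub>U\<^esub> fst y, fst (snd x) \<oplus>\<^bsub>V\<^esub> fst (snd y), snd (snd x) \<oplus>\<^bsub>W\<^esub> snd (snd y))"
  "a \<odot>\<^bsub>product3_module U V W\<^esub> x = (a \<odot>\<^bsub>U\<^esub> fst x, a \<odot>\<^bsub>V\<^esub> fst (snd x), a \<odot>\<^bsub>W\<^esub> snd (snd x))"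
  by (simp_all add: product3_module_def split_beta)

lemma linear_map_product3:
  "f \<in> linear_map K V A \<Longrightarrow> g \<in> linear_map K V B \<Longrightarrow> h \<in> linear_map K V C \<Longrightarrow>
   (\<lambda>x. (f x, g x, h x)) \<in> linear_map K V (product3_module A B C)"
  by (auto simp: linear_map_def)

lemma linear_map_product3_proj:
  "fst \<in> linear_map K (product3_module A B C) A"
  "(\<lambda>x. fst (snd x)) \<in> linear_map K (product3_module A B C) B"
  "(\<lambda>x. snd (snd x)) \<in> linear_map K (product3_module A B C) C"
  by (auto simp: linear_map_def)

lemma (in ground) module_product3:
  assumes "module K A" "module K B" "module K C"
  shows "module K (product3_module A B C)"
proof -
  interpret A: module K A by fact
  interpret B: module K B by fact
  interpret C: module K C by fact
  show ?thesis
    by (rule moduleI_zero_smult)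
      (auto simp: A.a_ac B.a_ac C.a_ac A.smult_l_distr B.smult_l_distr C.smult_l_distr
        A.smult_r_distr B.smult_r_distr C.smult_r_distr A.smult_assoc1 B.smult_assoc1 C.smult_assoc1)
qed

lemma tri_proj_simps [simp]: "tri_proj_obj X = snd X" "tri_proj_mor X Y f = snd (snd f)"
  by (simp_all add: tri_proj_obj_def tri_proj_mor_def split_beta)

lemma tri_cat_simps:
  "Obj (tri_cat K \<T> \<U> M) = Obj \<T> \<times> Obj \<U>"
  "Hom (tri_cat K \<T> \<U> M) X Y =
     product3_module (Hom \<T> (fst X) (fst Y)) (Val M (snd Y, fst X)) (Hom \<U> (snd X) (snd Y))"
  "Comp (tri_cat K \<T> \<U> M) X Y Z = (\<lambda>g f.
     (Comp \<T> (fst X) (fst Y) (fst Z) (fst g) (fst f),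
      right_act K \<T> \<U> M (snd Z) (fst X) (fst Y) (fst (snd g)) (fst f) \<oplus>\<^bsub>Val M (snd Z, fst X)\<^esub>
        left_act K \<T> \<U> M (snd Y) (snd Z) (fst X) (snd (snd g)) (fst (snd f)),
      Comp \<U> (snd X) (snd Y) (snd Z) (snd (snd g)) (snd (snd f))))"
  "Id (tri_cat K \<T> \<U> M) X = (Id \<T> (fst X), \<zero>\<^bsub>Val M (snd X, fst X)\<^esub>, Id \<U> (snd X))"
  by (simp_all add: tri_cat_def split_beta fun_eq_iff)

locale triangular = ground K for K :: "'k ring" +
  fixes \<T> :: "('k, 'a, 'b) kcat" and \<U> :: "('k, 'c, 'd) kcat"
    and M :: "('k, 'c \<times> 'a, ('d \<times> 'b \<Rightarrow> 'k) set, 'e) kfun"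
  assumes T: "k_category K \<T>" and U: "k_category K \<U>"
    and M: "k_functor K (tensor_cat K \<U> (op_cat \<T>)) M"
begin

abbreviation "ra \<equiv> right_act K \<T> \<U> M"
abbreviation "la \<equiv> left_act K \<T> \<U> M"
abbreviation "\<Lambda> \<equiv> tri_cat K \<T> \<U> M"

lemma M_module: "u \<in> Obj \<U> \<Longrightarrow> t \<in> Obj \<T> \<Longrightarrow> module K (Val M (u, t))"
  by (rule kfun_module[OF M]) (simp add: tensor_cat_simps)

lemma M_pure_bilinear:
  assumes "u \<in> Obj \<U>" "u' \<in> Obj \<U>" "t \<in> Obj \<T>" "t' \<in> Obj \<T>" "m \<in> carrier (Val M (u, t'))"
  shows "(\<lambda>v x. Act M (u, t') (u', t) (pure_tensor K (Hom \<U> u u') (Hom \<T> t t') v x) m)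
    \<in> bilinear_map K (Hom \<U> u u') (Hom \<T> t t') (Val M (u', t))"
  using assms kfun_linear2[OF M, of "(u, t')" "(u', t)" m]
  by (intro bilinear_map_post[OF bilinear_map_pure_tensor])
    (auto simp: tensor_cat_simps kcat_module[OF T] kcat_module[OF U])

lemma M_pure_linear:
  assumes "u \<in> Obj \<U>" "u' \<in> Obj \<U>" "t \<in> Obj \<T>" "t' \<in> Obj \<T>" "v \<in> carrier (Hom \<U> u u')" "x \<in> carrier (Hom \<T> t t')"
  shows "Act M (u, t') (u', t) (pure_tensor K (Hom \<U> u u') (Hom \<T> t t') v x) \<in> linear_map K (Val M (u, t')) (Val M (u', t))"
  using assms by (intro kfun_linear[OF M])
    (auto simp: tensor_cat_simps kcat_module[OF T] kcat_module[OF U] pure_tensor_closed)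

text \<open>Composites in the \<T> factor appear in reversed order, because \<open>M\<close> is
  contravariant there.\<close>

lemma M_pure_comp:
  assumes "u \<in> Obj \<U>" "u' \<in> Obj \<U>" "u'' \<in> Obj \<U>" "t \<in> Obj \<T>" "t' \<in> Obj \<T>" "t'' \<in> Obj \<T>"
    "v \<in> carrier (Hom \<U> u u')" "x \<in> carrier (Hom \<T> t' t'')" "v' \<in> carrier (Hom \<U> u' u'')" "x' \<in> carrier (Hom \<T> t t')"
    "m \<in> carrier (Val M (u, t''))"
  shows "Act M (u', t') (u'', t) (pure_tensor K (Hom \<U> u' u'') (Hom \<T> t t') v' x')
      (Act M (u, t'') (u', t') (pure_tensor K (Hom \<U> u u') (Hom \<T> t' t'') v x) m) =
    Act M (u, t'') (u'', t) (pure_tensor K (Hom \<U> u u'') (Hom \<T> t t'') (Comp \<U> u u' u'' v' v) (Comp \<T> t t' t'' x x')) m"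
proof -
  have o: "(u, t'') \<in> Obj (tensor_cat K \<U> (op_cat \<T>))" "(u', t') \<in> Obj (tensor_cat K \<U> (op_cat \<T>))"
    "(u'', t) \<in> Obj (tensor_cat K \<U> (op_cat \<T>))"
    using assms by (auto simp: tensor_cat_simps)
  note opT = k_category_op[OF T]
  show ?thesis
    using kfun_comp[OF M o tensor_cat_pure_closed[OF U opT o(1,2)] tensor_cat_pure_closed[OF U opT o(2,3)], of v x v' x' m]
      tensor_cat_comp_pure[OF U opT o, of v' x' v x] assms by simp
qed

lemma ra_bilinear:
  assumes "u \<in> Obj \<U>" "t \<in> Obj \<T>" "t' \<in> Obj \<T>"
  shows "ra u t t' \<in> bilinear_map K (Val M (u, t')) (Hom \<T> t t') (Val M (u, t))"
  unfolding right_act_def op_cat_simps using assms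
  by (intro bilinear_mapI bilinear_mapD1[OF M_pure_bilinear] M_pure_linear) (auto simp: kcat_Id[OF U])

lemma la_bilinear:
  assumes "u \<in> Obj \<U>" "u' \<in> Obj \<U>" "t \<in> Obj \<T>"
  shows "la u u' t \<in> bilinear_map K (Hom \<U> u u') (Val M (u, t)) (Val M (u', t))"
  unfolding left_act_def op_cat_simps using assms
  by (intro bilinear_mapI bilinear_mapD2[OF M_pure_bilinear] M_pure_linear) (auto simp: kcat_Id[OF T])

lemma ra_Id: "u \<in> Obj \<U> \<Longrightarrow> t \<in> Obj \<T> \<Longrightarrow> m \<in> carrier (Val M (u, t)) \<Longrightarrow> ra u t t m (Id \<T> t) = m"
  and la_Id: "u \<in> Obj \<U> \<Longrightarrow> t \<in> Obj \<T> \<Longrightarrow> m \<in> carrier (Val M (u, t)) \<Longrightarrow> la u u t (Id \<U> u) m = m"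
  using kfun_Id[OF M, of "(u, t)" m] by (simp_all add: right_act_def left_act_def tensor_cat_simps)

lemma ra_comp:
  assumes "u \<in> Obj \<U>" "t \<in> Obj \<T>" "t' \<in> Obj \<T>" "t'' \<in> Obj \<T>"
    "x \<in> carrier (Hom \<T> t t')" "y \<in> carrier (Hom \<T> t' t'')" "m \<in> carrier (Val M (u, t''))"
  shows "ra u t t' (ra u t' t'' m y) x = ra u t t'' m (Comp \<T> t t' t'' y x)"
  using assms by (simp add: right_act_def M_pure_comp kcat_Id[OF U] kcat_Id_left[OF U])

lemma la_comp:
  assumes "u \<in> Obj \<U>" "u' \<in> Obj \<U>" "u'' \<in> Obj \<U>" "t \<in> Obj \<T>"
    "v \<in> carrier (Hom \<U> u u')" "w \<in> carrier (Hom \<U> u' u'')" "m \<in> carrier (Val M (u, t))"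
  shows "la u' u'' t w (la u u' t v m) = la u u'' t (Comp \<U> u u' u'' w v) m"
  using assms by (simp add: left_act_def M_pure_comp kcat_Id[OF T] kcat_Id_left[OF T])

text \<open>Both orders of acting amount to the single action of
  \<open>v \<otimes> x\<close>.\<close>

lemma ra_la:
  assumes "u \<in> Obj \<U>" "u' \<in> Obj \<U>" "t \<in> Obj \<T>" "t' \<in> Obj \<T>"
    "x \<in> carrier (Hom \<T> t t')" "v \<in> carrier (Hom \<U> u u')" "m \<in> carrier (Val M (u, t'))"
  shows "ra u' t t' (la u u' t' v m) x = la u u' t v (ra u t t' m x)"
  using assms by (simp add: left_act_def right_act_def M_pure_comp kcat_Id[OF T] kcat_Id_left[OF T] kcat_Id_right[OF T]
      kcat_Id[OF U] kcat_Id_left[OF U] kcat_Id_right[OF U])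

lemmas ra_closed = bilinear_map_closed[OF ra_bilinear] and la_closed = bilinear_map_closed[OF la_bilinear]

lemma k_category_tri: "k_category K \<Lambda>"
proof -
  have m: "module K (Hom \<Lambda> X Y)" if "X \<in> Obj \<Lambda>" "Y \<in> Obj \<Lambda>" for X Y
    using that unfolding tri_cat_simps by (intro module_product3 kcat_module[OF T] kcat_module[OF U] M_module) auto
  have b: "Comp \<Lambda> X Y Z \<in> bilinear_map K (Hom \<Lambda> Y Z) (Hom \<Lambda> X Y) (Hom \<Lambda> X Z)"
    if XYZ: "X \<in> Obj \<Lambda>" "Y \<in> Obj \<Lambda>" "Z \<in> Obj \<Lambda>" for X Y Z
  proof -
    have o: "fst X \<in> Obj \<T>" "fst Y \<in> Obj \<T>" "fst Z \<in> Obj \<T>" "snd X \<in> Obj \<U>" "snd Y \<in> Obj \<U>" "snd Z \<in> Obj \<U>"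
      using XYZ by (auto simp: tri_cat_simps)
    note bT = kcat_bilinear[OF T o(1-3)] and bU = kcat_bilinear[OF U o(4-6)]
    note bra = ra_bilinear[OF o(6,1,2)] and bla = la_bilinear[OF o(5,6,1)]
    note mM = M_module[OF o(6,1)]
    note pr = linear_map_product3_proj
    show ?thesis
      unfolding tri_cat_simps(2,3)
    proof (intro bilinear_mapI linear_map_product3 linear_map_plus mM)
      fix g assume "g \<in> carrier (product3_module (Hom \<T> (fst Y) (fst Z)) (Val M (snd Z, fst Y)) (Hom \<U> (snd Y) (snd Z)))"
      then have g: "fst g \<in> carrier (Hom \<T> (fst Y) (fst Z))" "fst (snd g) \<in> carrier (Val M (snd Z, fst Y))"
          "snd (snd g) \<in> carrier (Hom \<U> (snd Y) (snd Z))" by auto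
      let ?V = "product3_module (Hom \<T> (fst X) (fst Y)) (Val M (snd Y, fst X)) (Hom \<U> (snd X) (snd Y))"
      show "(\<lambda>f. Comp \<T> (fst X) (fst Y) (fst Z) (fst g) (fst f)) \<in> linear_map K ?V (Hom \<T> (fst X) (fst Z))"
        by (rule linear_map_comp[OF pr(1) bilinear_mapD1[OF bT g(1)]])
      show "(\<lambda>f. ra (snd Z) (fst X) (fst Y) (fst (snd g)) (fst f)) \<in> linear_map K ?V (Val M (snd Z, fst X))"
        by (rule linear_map_comp[OF pr(1) bilinear_mapD1[OF bra g(2)]])
      show "(\<lambda>f. la (snd Y) (snd Z) (fst X) (snd (snd g)) (fst (snd f))) \<in> linear_map K ?V (Val M (snd Z, fst X))"
        by (rule linear_map_comp[OF pr(2) bilinear_mapD1[OF bla g(3)]])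
      show "(\<lambda>f. Comp \<U> (snd X) (snd Y) (snd Z) (snd (snd g)) (snd (snd f))) \<in> linear_map K ?V (Hom \<U> (snd X) (snd Z))"
        by (rule linear_map_comp[OF pr(3) bilinear_mapD1[OF bU g(3)]])
      show "module K ?V" using m[OF XYZ(1,2)] by (simp add: tri_cat_simps)
    next
      fix f assume "f \<in> carrier (product3_module (Hom \<T> (fst X) (fst Y)) (Val M (snd Y, fst X)) (Hom \<U> (snd X) (snd Y)))"
      then have f: "fst f \<in> carrier (Hom \<T> (fst X) (fst Y))" "fst (snd f) \<in> carrier (Val M (snd Y, fst X))"
          "snd (snd f) \<in> carrier (Hom \<U> (snd X) (snd Y))" by auto
      let ?V = "product3_module (Hom \<T> (fst Y) (fst Z)) (Val M (snd Z, fst Y)) (Hom \<U> (snd Y) (snd Z))"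
      show "(\<lambda>g. Comp \<T> (fst X) (fst Y) (fst Z) (fst g) (fst f)) \<in> linear_map K ?V (Hom \<T> (fst X) (fst Z))"
        by (rule linear_map_comp[OF pr(1) bilinear_mapD2[OF bT f(1)]])
      show "(\<lambda>g. ra (snd Z) (fst X) (fst Y) (fst (snd g)) (fst f)) \<in> linear_map K ?V (Val M (snd Z, fst X))"
        by (rule linear_map_comp[OF pr(2) bilinear_mapD2[OF bra f(1)]])
      show "(\<lambda>g. la (snd Y) (snd Z) (fst X) (snd (snd g)) (fst (snd f))) \<in> linear_map K ?V (Val M (snd Z, fst X))"
        by (rule linear_map_comp[OF pr(3) bilinear_mapD2[OF bla f(2)]])
      show "(\<lambda>g. Comp \<U> (snd X) (snd Y) (snd Z) (snd (snd g)) (snd (snd f))) \<in> linear_map K ?V (Hom \<U> (snd X) (snd Z))"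
        by (rule linear_map_comp[OF pr(3) bilinear_mapD2[OF bU f(3)]])
      show "module K ?V" using m[OF XYZ(2,3)] by (simp add: tri_cat_simps)
    qed
  qed
  have Id: "Id \<Lambda> X \<in> carrier (Hom \<Lambda> X X)" if "X \<in> Obj \<Lambda>" for X
    using that by (auto simp: tri_cat_simps kcat_Id[OF T] kcat_Id[OF U] zero_closed M_module)
  have ids: "Comp \<Lambda> X X Y f (Id \<Lambda> X) = f \<and> Comp \<Lambda> X Y Y (Id \<Lambda> Y) f = f"
    if XY: "X \<in> Obj \<Lambda>" "Y \<in> Obj \<Lambda>" and f: "f \<in> carrier (Hom \<Lambda> X Y)" for X Y f
  proof -
    have o: "fst X \<in> Obj \<T>" "fst Y \<in> Obj \<T>" "snd X \<in> Obj \<U>" "snd Y \<in> Obj \<U>"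
      using XY by (auto simp: tri_cat_simps)
    have f': "fst f \<in> carrier (Hom \<T> (fst X) (fst Y))" "fst (snd f) \<in> carrier (Val M (snd Y, fst X))"
      "snd (snd f) \<in> carrier (Hom \<U> (snd X) (snd Y))" using f by (auto simp: tri_cat_simps)
    have "la (snd X) (snd Y) (fst X) (snd (snd f)) \<zero>\<^bsub>Val M (snd X, fst X)\<^esub> = \<zero>\<^bsub>Val M (snd Y, fst X)\<^esub>"
      by (rule linear_map_zero[OF M_module M_module bilinear_mapD1[OF la_bilinear]]) (use o f' in auto)
    moreover have "ra (snd Y) (fst X) (fst Y) \<zero>\<^bsub>Val M (snd Y, fst Y)\<^esub> (fst f) = \<zero>\<^bsub>Val M (snd Y, fst X)\<^esub>"
      by (rule linear_map_zero[OF M_module M_module bilinear_mapD2[OF ra_bilinear]]) (use o f' in auto)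
    ultimately show ?thesis
      using o f' by (simp add: tri_cat_simps kcat_Id_left[OF T] kcat_Id_right[OF T] kcat_Id_left[OF U] kcat_Id_right[OF U]
          ra_Id la_Id add_zero zero_add M_module)
  qed
  have assoc: "Comp \<Lambda> W X Z (Comp \<Lambda> X Y Z h g) f = Comp \<Lambda> W Y Z h (Comp \<Lambda> W X Y g f)"
    if O: "W \<in> Obj \<Lambda>" "X \<in> Obj \<Lambda>" "Y \<in> Obj \<Lambda>" "Z \<in> Obj \<Lambda>"
      and fgh: "f \<in> carrier (Hom \<Lambda> W X)" "g \<in> carrier (Hom \<Lambda> X Y)" "h \<in> carrier (Hom \<Lambda> Y Z)" for W X Y Z f g h
  proof -
    have o: "fst W \<in> Obj \<T>" "fst X \<in> Obj \<T>" "fst Y \<in> Obj \<T>" "fst Z \<in> Obj \<T>"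
      "snd W \<in> Obj \<U>" "snd X \<in> Obj \<U>" "snd Y \<in> Obj \<U>" "snd Z \<in> Obj \<U>"
      using O by (auto simp: tri_cat_simps)
    have c: "fst f \<in> carrier (Hom \<T> (fst W) (fst X))" "fst (snd f) \<in> carrier (Val M (snd X, fst W))" "snd (snd f) \<in> carrier (Hom \<U> (snd W) (snd X))"
      "fst g \<in> carrier (Hom \<T> (fst X) (fst Y))" "fst (snd g) \<in> carrier (Val M (snd Y, fst X))" "snd (snd g) \<in> carrier (Hom \<U> (snd X) (snd Y))"
      "fst h \<in> carrier (Hom \<T> (fst Y) (fst Z))" "fst (snd h) \<in> carrier (Val M (snd Z, fst Y))" "snd (snd h) \<in> carrier (Hom \<U> (snd Y) (snd Z))"
      using fgh by (auto simp: tri_cat_simps)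
    interpret MM: module K "Val M (snd Z, fst W)" by (rule M_module[OF o(8,1)])
    have 1: "ra (snd Z) (fst W) (fst X)
        (ra (snd Z) (fst X) (fst Y) (fst (snd h)) (fst g) \<oplus>\<^bsub>Val M (snd Z, fst X)\<^esub> la (snd Y) (snd Z) (fst X) (snd (snd h)) (fst (snd g))) (fst f) =
      ra (snd Z) (fst W) (fst X) (ra (snd Z) (fst X) (fst Y) (fst (snd h)) (fst g)) (fst f) \<oplus>\<^bsub>Val M (snd Z, fst W)\<^esub>
      ra (snd Z) (fst W) (fst X) (la (snd Y) (snd Z) (fst X) (snd (snd h)) (fst (snd g))) (fst f)"
      by (rule linear_map_add[OF bilinear_mapD2[OF ra_bilinear]]) (use o c in \<open>auto intro: ra_closed la_closed\<close>)
    have 2: "la (snd Y) (snd Z) (fst W) (snd (snd h))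
        (ra (snd Y) (fst W) (fst X) (fst (snd g)) (fst f) \<oplus>\<^bsub>Val M (snd Y, fst W)\<^esub> la (snd X) (snd Y) (fst W) (snd (snd g)) (fst (snd f))) =
      la (snd Y) (snd Z) (fst W) (snd (snd h)) (ra (snd Y) (fst W) (fst X) (fst (snd g)) (fst f)) \<oplus>\<^bsub>Val M (snd Z, fst W)\<^esub>
      la (snd Y) (snd Z) (fst W) (snd (snd h)) (la (snd X) (snd Y) (fst W) (snd (snd g)) (fst (snd f)))"
      by (rule linear_map_add[OF bilinear_mapD1[OF la_bilinear]]) (use o c in \<open>auto intro: ra_closed la_closed\<close>)
    \<comment> \<open>On either side the off-diagonal entry is a sum of three terms; they match by
      \<open>ra_comp\<close>, \<open>ra_la\<close> and \<open>la_comp\<close>.\<close>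
    show ?thesis
      using o c by (simp add: tri_cat_simps kcat_assoc[OF T] kcat_assoc[OF U] 1 2 ra_comp ra_la la_comp MM.a_assoc
          ra_closed la_closed kcat_comp_closed[OF T] kcat_comp_closed[OF U])
  qed
  show ?thesis
    unfolding k_category_def by (intro conjI ballI m b assoc Id ids[THEN conjunct1] ids[THEN conjunct2])
qed

text \<open>The image of \<open>tri_sec\<close> is the corner of \<open>\<Lambda>\<close> at the idempotents with diagonal \<open>(0, 1)\<close>.\<close>

definition tri_sec :: "'a \<times> 'c \<Rightarrow> 'a \<times> 'c \<Rightarrow> 'd \<Rightarrow> 'b \<times> 'e \<times> 'd" where
  "tri_sec X Y u = (\<zero>\<^bsub>Hom \<T> (fst X) (fst Y)\<^esub>, \<zero>\<^bsub>Val M (snd Y, fst X)\<^esub>, u)"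

text \<open>With a corner matrix as right factor, the off-diagonal entry is
  \<open>m \<bullet> 0 + u \<bullet> 0\<close>. As left factor it would leave the term
  \<open>u \<bullet> m\<close>, so the corner absorbs on one side only.\<close>

lemma comp_tri_sec:
  assumes "X \<in> Obj \<Lambda>" "Y \<in> Obj \<Lambda>" "Z \<in> Obj \<Lambda>" "u \<in> carrier (Hom \<U> (snd X) (snd Y))" "f \<in> carrier (Hom \<Lambda> Y Z)"
  shows "Comp \<Lambda> X Y Z f (tri_sec X Y u) = tri_sec X Z (Comp \<U> (snd X) (snd Y) (snd Z) (snd (snd f)) u)"
proof -
  have o: "fst X \<in> Obj \<T>" "fst Y \<in> Obj \<T>" "fst Z \<in> Obj \<T>" "snd X \<in> Obj \<U>" "snd Y \<in> Obj \<U>" "snd Z \<in> Obj \<U>"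
    using assms by (auto simp: tri_cat_simps)
  have f': "fst f \<in> carrier (Hom \<T> (fst Y) (fst Z))" "fst (snd f) \<in> carrier (Val M (snd Z, fst Y))"
    "snd (snd f) \<in> carrier (Hom \<U> (snd Y) (snd Z))" using assms by (auto simp: tri_cat_simps)
  have 1: "la (snd Y) (snd Z) (fst X) (snd (snd f)) \<zero>\<^bsub>Val M (snd Y, fst X)\<^esub> = \<zero>\<^bsub>Val M (snd Z, fst X)\<^esub>"
    by (rule linear_map_zero[OF M_module M_module bilinear_mapD1[OF la_bilinear]]) (use o f' in auto)
  have 2: "ra (snd Z) (fst X) (fst Y) (fst (snd f)) \<zero>\<^bsub>Hom \<T> (fst X) (fst Y)\<^esub> = \<zero>\<^bsub>Val M (snd Z, fst X)\<^esub>"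
    by (rule linear_map_zero[OF kcat_module[OF T] M_module bilinear_mapD1[OF ra_bilinear]]) (use o f' in auto)
  have 3: "Comp \<T> (fst X) (fst Y) (fst Z) (fst f) \<zero>\<^bsub>Hom \<T> (fst X) (fst Y)\<^esub> = \<zero>\<^bsub>Hom \<T> (fst X) (fst Z)\<^esub>"
    by (rule linear_map_zero[OF kcat_module[OF T] kcat_module[OF T] bilinear_mapD1[OF kcat_bilinear[OF T]]]) (use o f' in auto)
  show ?thesis
    using o by (simp add: tri_cat_simps tri_sec_def 1 2 3 zero_add zero_closed M_module)
qed

text \<open>\<open>t0\<close> supplies an object of \<Lambda> above each object of \<U>; the section
  has zero entry in the \<T> place.\<close>

lemma tri_retract_left:
  assumes t0: "t0 \<in> Obj \<T>"
  shows "retract_left K \<Lambda> \<U> tri_proj_obj tri_proj_mor (\<lambda>u. (t0, u)) tri_sec"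
proof -
  have lin: "tri_sec X Y \<in> linear_map K (Hom \<U> (snd X) (snd Y)) (Hom \<Lambda> X Y)" if "X \<in> Obj \<Lambda>" "Y \<in> Obj \<Lambda>" for X Y
    unfolding tri_sec_def[abs_def] tri_cat_simps using that
    by (intro linear_map_product3 linear_map_id linear_map_const_zero kcat_module[OF T] M_module) (auto simp: tri_cat_simps)
  show ?thesis
  proof unfold_locales
    fix X Y Z u v assume "X \<in> Obj \<Lambda>" "Y \<in> Obj \<Lambda>" "Z \<in> Obj \<Lambda>"
      "u \<in> carrier (Hom \<U> (tri_proj_obj X) (tri_proj_obj Y))" "v \<in> carrier (Hom \<U> (tri_proj_obj Y) (tri_proj_obj Z))"
    then show "Comp \<Lambda> X Y Z (tri_sec Y Z v) (tri_sec X Y u) = tri_sec X Z (Comp \<U> (tri_proj_obj X) (tri_proj_obj Y) (tri_proj_obj Z) v u)"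
      using linear_map_closed[OF lin, of Y Z v] comp_tri_sec[of X Y Z u "tri_sec Y Z v"] by (simp add: tri_sec_def)
  next
    fix X Y assume "X \<in> Obj \<Lambda>" "Y \<in> Obj \<Lambda>"
    show "tri_proj_mor X Y \<in> linear_map K (Hom \<Lambda> X Y) (Hom \<U> (tri_proj_obj X) (tri_proj_obj Y))"
      by (rule linear_mapI) (auto simp: tri_cat_simps)
  next
    fix X Y Z f u assume "X \<in> Obj \<Lambda>" "Y \<in> Obj \<Lambda>" "Z \<in> Obj \<Lambda>"
      "u \<in> carrier (Hom \<U> (tri_proj_obj X) (tri_proj_obj Y))" "f \<in> carrier (Hom \<Lambda> Y Z)"
    then show "Comp \<Lambda> X Y Z f (tri_sec X Y u) =
        tri_sec X Z (Comp \<U> (tri_proj_obj X) (tri_proj_obj Y) (tri_proj_obj Z) (tri_proj_mor Y Z f) u)"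
      by (simp add: comp_tri_sec)
  next
    show "k_category K \<Lambda>" "k_category K \<U>" by (fact k_category_tri, fact U)
    show "tri_sec X Y \<in> linear_map K (Hom \<U> (tri_proj_obj X) (tri_proj_obj Y)) (Hom \<Lambda> X Y)"
      if "X \<in> Obj \<Lambda>" "Y \<in> Obj \<Lambda>" for X Y using lin[OF that] by simp
  qed (use t0 in \<open>auto simp: tri_sec_def tri_cat_simps\<close>)
qed

end

section \<open>Bimodules over \<Lambda> compared with bimodules over \<U>\<close>

locale triangular_pointed = triangular +
  fixes t0
  assumes t0: "t0 \<in> Obj \<T>"
begin

abbreviation "E\<Lambda> \<equiv> env_cat K \<Lambda>"
abbreviation "EB \<equiv> tensor_cat K (op_cat \<U>) \<Lambda>"
abbreviation "EU \<equiv> env_cat K \<U>"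
abbreviation "H\<Lambda> \<equiv> hom_bimodule K \<Lambda>"
abbreviation "HU \<equiv> hom_bimodule K \<U>"

interpretation L: retract_left K \<Lambda> \<U> tri_proj_obj tri_proj_mor "\<lambda>u. (t0, u)" tri_sec
  by (rule tri_retract_left[OF t0])

lemmas op_retract = L.retract_right_op retract_right.axioms(1)[OF L.retract_right_op]
lemmas id_retract = retract_right_id[OF k_category_tri] retract_id[OF k_category_tri]
lemmas id_retract' = retract_left_id[OF k_category_op[OF U]] retract_id[OF k_category_op[OF U]]

text \<open>The stage that restricts the contravariant variable. Passage to opposites has turned
  left absorption into right absorption.\<close>

interpretation R1: retract_right K E\<Lambda> EB "map_prod tri_proj_obj (\<lambda>a. a)"
  "tensor_mor K (op_cat \<U>) \<Lambda> tri_proj_obj (\<lambda>a. a) (\<lambda>X Y. tri_proj_mor Y X) (\<lambda>_ _ f. f)"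
  "map_prod (\<lambda>u. (t0, u)) (\<lambda>a. a)"
  "tensor_mor K (op_cat \<Lambda>) \<Lambda> (\<lambda>a. a) (\<lambda>a. a) (\<lambda>X Y. tri_sec Y X) (\<lambda>_ _ f. f)"
  unfolding env_cat_def
  by (rule retract_right_tensor[OF op_retract(2) id_retract(2) op_retract(1) id_retract(1)])

text \<open>The stage that restricts the covariant variable, with the absorption of the corner as it
  stands.\<close>

interpretation R2: retract_left K EB EU "map_prod (\<lambda>a. a) tri_proj_obj"
  "tensor_mor K (op_cat \<U>) \<U> (\<lambda>a. a) tri_proj_obj (\<lambda>_ _ f. f) tri_proj_mor"
  "map_prod (\<lambda>a. a) (\<lambda>u. (t0, u))"
  "tensor_mor K (op_cat \<U>) \<Lambda> (\<lambda>a. a) (\<lambda>a. a) (\<lambda>_ _ f. f) tri_sec"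
  unfolding env_cat_def
  by (rule retract_left_tensor[OF id_retract'(2) L.retract_axioms id_retract'(1) L.retract_left_axioms])

text \<open>Restriction is applied in two stages, so that each of them meets its own
  adjunction.\<close>

abbreviation "RU \<equiv> R1.res_fun (R2.res_fun HU)"

definition tri_proj_nat where
  "tri_proj_nat = nat_of E\<Lambda> H\<Lambda> (\<lambda>p f. snd (snd f))"

lemmas E\<Lambda>_cat = k_category_env[OF k_category_tri] and EU_cat = k_category_env[OF U]
lemmas H\<Lambda>_fun = k_functor_hom_bimodule[OF k_category_tri] and HU_fun = k_functor_hom_bimodule[OF U]
lemmas RBU_fun = R2.k_functor_res[OF HU_fun]
lemmas RU_fun = R1.k_functor_res[OF RBU_fun]

lemma E\<Lambda>_Obj: "p \<in> Obj E\<Lambda> \<Longrightarrow> fst p \<in> Obj \<Lambda> \<and> snd p \<in> Obj \<Lambda>"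
  by (auto simp: env_cat_def tensor_cat_simps)

lemma Val_RU: "Val RU p = Hom \<U> (snd (fst p)) (snd (snd p))"
  by (simp add: hom_bimodule_simps(1))

text \<open>The projection to the \<U> entry is multiplicative. On pure tensors this is the claim,
  and linearity extends it.\<close>

lemma tri_proj_nat_closed: "tri_proj_nat \<in> nat_trans K E\<Lambda> H\<Lambda> RU"
  unfolding tri_proj_nat_def
proof (rule nat_ofI[OF H\<Lambda>_fun])
  have lin: "(\<lambda>f. snd (snd f)) \<in> linear_map K (Hom \<Lambda> X Y) (Hom \<U> (snd X) (snd Y))" for X Y
    unfolding tri_cat_simps by (rule linear_map_product3_proj(3))
  then show "(\<lambda>f. snd (snd f)) \<in> linear_map K (Val H\<Lambda> p) (Val RU p)" for p
    by (simp only: Val_RU hom_bimodule_simps(1))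
  fix p q X h assume p: "p \<in> Obj E\<Lambda>" and q: "q \<in> Obj E\<Lambda>" and X: "X \<in> carrier (Hom E\<Lambda> p q)" and h: "h \<in> carrier (Val H\<Lambda> p)"
  have o: "fst p \<in> Obj \<Lambda>" "snd p \<in> Obj \<Lambda>" "fst q \<in> Obj \<Lambda>" "snd q \<in> Obj \<Lambda>" using E\<Lambda>_Obj p q by auto
  have oU: "snd (fst p) \<in> Obj \<U>" "snd (snd p) \<in> Obj \<U>" "snd (fst q) \<in> Obj \<U>" "snd (snd q) \<in> Obj \<U>"
    using o by (auto simp: tri_cat_simps)
  have h': "h \<in> carrier (Hom \<Lambda> (fst p) (snd p))" using h by (simp add: hom_bimodule_simps(1))
  have hU: "snd (snd h) \<in> carrier (Hom \<U> (snd (fst p)) (snd (snd p)))" using linear_map_closed[OF lin h'] .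
  show "snd (snd (Act H\<Lambda> p q X h)) = Act RU p q X (snd (snd h))"
  proof (rule env_cat_eqI[OF k_category_tri p q kfun_module[OF RU_fun q], where X = X and f = "\<lambda>X. snd (snd (Act H\<Lambda> p q X h))"])
    show "(\<lambda>X. snd (snd (Act H\<Lambda> p q X h))) \<in> linear_map K (Hom E\<Lambda> p q) (Val RU q)"
      unfolding Val_RU
      by (rule linear_map_comp[OF _ lin]) (use kfun_linear2[OF H\<Lambda>_fun p q h] in \<open>simp add: hom_bimodule_simps(1)\<close>)
    show "(\<lambda>X. Act RU p q X (snd (snd h))) \<in> linear_map K (Hom E\<Lambda> p q) (Val RU q)"
      by (rule kfun_linear2[OF RU_fun p q]) (use hU in \<open>simp only: Val_RU\<close>)
    fix f g assume f: "f \<in> carrier (Hom \<Lambda> (fst q) (fst p))" and g: "g \<in> carrier (Hom \<Lambda> (snd p) (snd q))"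
    have fU: "snd (snd f) \<in> carrier (Hom \<U> (snd (fst q)) (snd (fst p)))" using linear_map_closed[OF lin f] .
    have gU: "snd (snd g) \<in> carrier (Hom \<U> (snd (snd p)) (snd (snd q)))" using linear_map_closed[OF lin g] .
    let ?p1 = "map_prod tri_proj_obj (\<lambda>a. a) p" and ?q1 = "map_prod tri_proj_obj (\<lambda>a. a) q"
    \<comment> \<open>The two stages of \<open>RU\<close> replace the contravariant and then the
      covariant entry of a pure tensor by its \<U> entry.\<close>
    have 1: "tensor_mor K (op_cat \<U>) \<Lambda> tri_proj_obj (\<lambda>a. a) (\<lambda>X Y. tri_proj_mor Y X) (\<lambda>_ _ f. f) p q
        (pure_tensor K (Hom \<Lambda> (fst q) (fst p)) (Hom \<Lambda> (snd p) (snd q)) f g) =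
      pure_tensor K (Hom \<U> (snd (fst q)) (snd (fst p))) (Hom \<Lambda> (snd p) (snd q)) (snd (snd f)) g"
      using tensor_\<Psi>_pure[OF op_retract(2) id_retract(2), of p q f g] p q f g by (simp add: env_cat_def)
    have 2: "tensor_mor K (op_cat \<U>) \<U> (\<lambda>a. a) tri_proj_obj (\<lambda>_ _ f. f) tri_proj_mor ?p1 ?q1
        (pure_tensor K (Hom \<U> (snd (fst q)) (snd (fst p))) (Hom \<Lambda> (snd p) (snd q)) (snd (snd f)) g) =
      pure_tensor K (Hom \<U> (snd (fst q)) (snd (fst p))) (Hom \<U> (snd (snd p)) (snd (snd q))) (snd (snd f)) (snd (snd g))"
      using tensor_\<Psi>_pure[OF id_retract'(2) L.retract_axioms, of ?p1 ?q1 "snd (snd f)" g] o oU fU g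
      by (simp add: tensor_cat_simps mem_Times_iff)
    have oE: "(snd (fst p), snd (snd p)) \<in> Obj EU" "(snd (fst q), snd (snd q)) \<in> Obj EU"
      using oU by (auto simp: env_cat_def tensor_cat_simps)
    have 3: "Act RU p q X v = Act HU (snd (fst p), snd (snd p)) (snd (fst q), snd (snd q))
        (tensor_mor K (op_cat \<U>) \<U> (\<lambda>a. a) tri_proj_obj (\<lambda>_ _ f. f) tri_proj_mor ?p1 ?q1
          (tensor_mor K (op_cat \<U>) \<Lambda> tri_proj_obj (\<lambda>a. a) (\<lambda>X Y. tri_proj_mor Y X) (\<lambda>_ _ f. f) p q X)) v" for X v
      by (cases p; cases q) simp
    have "snd (snd (Comp \<Lambda> (fst q) (snd p) (snd q) g (Comp \<Lambda> (fst q) (fst p) (snd p) h f))) =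
        Comp \<U> (snd (fst q)) (snd (snd p)) (snd (snd q)) (snd (snd g))
          (Comp \<U> (snd (fst q)) (snd (fst p)) (snd (snd p)) (snd (snd h)) (snd (snd f)))"
      by (simp add: tri_cat_simps)
    then show "snd (snd (Act H\<Lambda> p q (pure_tensor K (Hom \<Lambda> (fst q) (fst p)) (Hom \<Lambda> (snd p) (snd q)) f g) h)) =
        Act RU p q (pure_tensor K (Hom \<Lambda> (fst q) (fst p)) (Hom \<Lambda> (snd p) (snd q)) f g) (snd (snd h))"
      using hom_bimodule_pure[OF U oE, of "snd (snd f)" "snd (snd g)" "snd (snd h)"] fU gU hU
      by (simp only: hom_bimodule_pure[OF k_category_tri p q f g h'] 1 2 3 fst_conv snd_conv)
  qed (rule X)
qed

lemma tri_proj_nat_surj: "objectwise_surj E\<Lambda> H\<Lambda> RU tri_proj_nat"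
  unfolding objectwise_surj_def
proof (intro ballI equalityI subsetI)
  fix p v assume p: "p \<in> Obj E\<Lambda>"
  {
    assume v: "v \<in> carrier (Val RU p)"
    have "tri_sec (fst p) (snd p) v \<in> carrier (Hom \<Lambda> (fst p) (snd p))"
      by (rule L.\<sigma>_closed) (use v E\<Lambda>_Obj[OF p] in \<open>auto simp: hom_bimodule_simps(1)\<close>)
    then show "v \<in> tri_proj_nat p ` carrier (Val H\<Lambda> p)"
      using p by (intro image_eqI[of _ _ "tri_sec (fst p) (snd p) v"])
        (simp_all add: tri_proj_nat_def hom_bimodule_simps(1) tri_sec_def)
  }
  assume "v \<in> tri_proj_nat p ` carrier (Val H\<Lambda> p)"
  then show "v \<in> carrier (Val RU p)" using nat_closed[OF tri_proj_nat_closed p] by blast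
qed

text \<open>Right multiplication by the idempotent keeps just the \<U> entry, so the fixed matrices
  are those with vanishing \<open>t\<close> and \<open>m\<close>.\<close>

lemma tri_proj_nat_bij:
  assumes b: "b \<in> Obj EB"
  shows "bij_betw (tri_proj_nat (map_prod (\<lambda>u. (t0, u)) (\<lambda>a. a) b)) (carrier (Val (R1.eig_fun H\<Lambda>) b)) (carrier (Val (R2.res_fun HU) b))"
proof -
  let ?s = "((t0, fst b), snd b)"
  have s: "map_prod (\<lambda>u. (t0, u)) (\<lambda>a. a) b = ?s" by (simp add: map_prod_def split_beta)
  have o: "fst b \<in> Obj \<U>" "snd b \<in> Obj \<Lambda>" "(t0, fst b) \<in> Obj \<Lambda>" using b t0 by (auto simp: tensor_cat_simps tri_cat_simps)
  have oE: "?s \<in> Obj E\<Lambda>" using o by (simp add: env_cat_def tensor_cat_simps)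
  have IdU: "Id \<U> (fst b) \<in> carrier (Hom \<U> (fst b) (fst b))" by (rule kcat_Id[OF U o(1)])
  have Id\<Lambda>: "Id \<Lambda> (snd b) \<in> carrier (Hom \<Lambda> (snd b) (snd b))" by (rule kcat_Id[OF k_category_tri o(2)])
  have secI: "tri_sec (t0, fst b) (t0, fst b) (Id \<U> (fst b)) \<in> carrier (Hom \<Lambda> (t0, fst b) (t0, fst b))"
    using L.\<sigma>_closed[OF o(3,3), of "Id \<U> (fst b)"] IdU by simp
  have e: "tensor_mor K (op_cat \<Lambda>) \<Lambda> (\<lambda>a. a) (\<lambda>a. a) (\<lambda>X Y. tri_sec Y X) (\<lambda>_ _ f. f) ?s ?s (Id EB b) =
      pure_tensor K (Hom \<Lambda> (t0, fst b) (t0, fst b)) (Hom \<Lambda> (snd b) (snd b))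
        (tri_sec (t0, fst b) (t0, fst b) (Id \<U> (fst b))) (Id \<Lambda> (snd b))"
    using tensor_\<sigma>_pure[OF op_retract(2) id_retract(2), of ?s ?s "Id \<U> (fst b)" "Id \<Lambda> (snd b)"] oE IdU Id\<Lambda>
    by (simp add: env_cat_def tensor_cat_simps(4) tensor_cat_simps(3))
  have act: "Act H\<Lambda> ?s ?s (tensor_mor K (op_cat \<Lambda>) \<Lambda> (\<lambda>a. a) (\<lambda>a. a) (\<lambda>X Y. tri_sec Y X) (\<lambda>_ _ f. f) ?s ?s (Id EB b)) x =
      tri_sec (t0, fst b) (snd b) (snd (snd x))" if x: "x \<in> carrier (Hom \<Lambda> (t0, fst b) (snd b))" for x
  proof -
    have xU: "snd (snd x) \<in> carrier (Hom \<U> (fst b) (snd (snd b)))" using x by (auto simp: tri_cat_simps)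
    have "Comp \<Lambda> (t0, fst b) (t0, fst b) (snd b) x (tri_sec (t0, fst b) (t0, fst b) (Id \<U> (fst b))) =
        tri_sec (t0, fst b) (snd b) (snd (snd x))"
      using comp_tri_sec[OF o(3,3,2), of "Id \<U> (fst b)" x] x xU IdU o kcat_Id_right[OF U o(1) _ xU]
      by (simp add: tri_cat_simps(1) mem_Times_iff)
    moreover have "tri_sec (t0, fst b) (snd b) (snd (snd x)) \<in> carrier (Hom \<Lambda> (t0, fst b) (snd b))"
      using L.\<sigma>_closed[OF o(3,2), of "snd (snd x)"] xU by simp
    ultimately show ?thesis
      using hom_bimodule_pure[OF k_category_tri oE oE, of "tri_sec (t0, fst b) (t0, fst b) (Id \<U> (fst b))" "Id \<Lambda> (snd b)" x]
        secI Id\<Lambda> x kcat_Id_left[OF k_category_tri o(3,2)]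
      by (simp add: e)
  qed
  have eig: "carrier (Val (R1.eig_fun H\<Lambda>) b) = {x \<in> carrier (Hom \<Lambda> (t0, fst b) (snd b)). tri_sec (t0, fst b) (snd b) (snd (snd x)) = x}"
    unfolding R1.eig_fun_simps s using act by (auto simp: hom_bimodule_simps(1))
  have res: "carrier (Val (R2.res_fun HU) b) = carrier (Hom \<U> (fst b) (snd (snd b)))"
    by (simp add: hom_bimodule_simps(1))
  have v: "tri_proj_nat ?s x = snd (snd x)" if "x \<in> carrier (Hom \<Lambda> (t0, fst b) (snd b))" for x
    using that oE by (simp add: tri_proj_nat_def hom_bimodule_simps(1))
  have sec: "tri_sec (t0, fst b) (snd b) y \<in> carrier (Hom \<Lambda> (t0, fst b) (snd b))" if "y \<in> carrier (Hom \<U> (fst b) (snd (snd b)))" for y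
    using L.\<sigma>_closed[OF o(3,2), of y] that by simp
  show ?thesis
    unfolding s eig res
    by (rule bij_betw_byWitness[where f' = "tri_sec (t0, fst b) (snd b)"])
      (auto simp: v sec, auto simp: tri_sec_def tri_cat_simps(2))
qed

text \<open>The equation is literal, so the sequence of a subfunctor applies to the ideal without a
  further isomorphism.\<close>

lemma tri_ideal_eq:
  "tri_ideal K \<T> \<U> M = sub_fun H\<Lambda> (\<lambda>p. {f \<in> carrier (Hom \<Lambda> (fst p) (snd p)). snd (snd f) = \<zero>\<^bsub>Hom \<U> (snd (fst p)) (snd (snd p))\<^esub>})"
  by (auto simp: tri_ideal_def kernel_ideal_def sub_fun_def hom_bimodule_simps(1) fun_eq_iff)

text \<open>\<open>P\<close> and \<open>Q\<close> may have different value types. Only over the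
  intermediate category do they yield resolutions of one functor, which can then be
  compared.\<close>

lemma coh_RU_iso:
  assumes P: "split_resolution E\<Lambda> H\<Lambda> P d \<epsilon>" and Q: "split_resolution EU HU Q e \<zeta>"
  obtains \<theta> where
    "\<And>n. \<theta> n \<in> linear_map K (coh (hom_cx E\<Lambda> P RU) (hom_d E\<Lambda> P d) n) (coh (hom_cx EU Q HU) (hom_d EU Q e) n)"
    "\<And>n. bij_betw (\<theta> n) (carrier (coh (hom_cx E\<Lambda> P RU) (hom_d E\<Lambda> P d) n)) (carrier (coh (hom_cx EU Q HU) (hom_d EU Q e) n))"
proof -
  note EP = R1.split_resolution_eig[OF H\<Lambda>_fun P RBU_fun tri_proj_nat_closed tri_proj_nat_bij]
  note RQ = R2.split_resolution_res[OF HU_fun Q]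
  let ?X = "coh (hom_cx E\<Lambda> P RU) (hom_d E\<Lambda> P d)" and ?Y = "coh (hom_cx EU Q HU) (hom_d EU Q e)"
  have "\<exists>\<theta>. \<theta> \<in> linear_map K (?X n) (?Y n) \<and> bij_betw \<theta> (carrier (?X n)) (carrier (?Y n))" for n
  proof -
    let ?XB = "coh (hom_cx EB (\<lambda>n. R1.eig_fun (P n)) (R2.res_fun HU))
        (hom_d EB (\<lambda>n. R1.eig_fun (P n)) (\<lambda>n. R1.eig_nat (P (Suc n)) (d n))) n"
    let ?YB = "coh (hom_cx EB (\<lambda>n. R2.res_fun (Q n)) (R2.res_fun HU))
        (hom_d EB (\<lambda>n. R2.res_fun (Q n)) (\<lambda>n. R2.res_nat (Q (Suc n)) (e n))) n"
    obtain \<theta>1 where 1: "\<theta>1 \<in> linear_map K (?X n) ?XB" "bij_betw \<theta>1 (carrier (?X n)) (carrier ?XB)"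
      using R1.coh_eig_iso[OF H\<Lambda>_fun P RBU_fun RBU_fun EP, of n] by blast
    obtain \<theta>2 where 2: "\<theta>2 \<in> linear_map K ?XB ?YB" "bij_betw \<theta>2 (carrier ?XB) (carrier ?YB)"
      using coh_hom_resolution_iso[OF R2.A RBU_fun RBU_fun EP RQ, of n] by blast
    obtain \<theta>3 where 3: "\<theta>3 \<in> linear_map K ?YB (?Y n)" "bij_betw \<theta>3 (carrier ?YB) (carrier (?Y n))"
      using R2.coh_res_iso[OF Q HU_fun HU_fun RQ, of n] by blast
    show ?thesis
      using linear_map_comp[OF linear_map_comp[OF 1(1) 2(1)] 3(1)] bij_betw_trans[OF bij_betw_trans[OF 1(2) 2(2)] 3(2)]
      by (auto simp: comp_def)
  qed
  then show ?thesis using that by metis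
qed

theorem Ext_long_exact_sequence:
  fixes I defines "I \<equiv> tri_ideal K \<T> \<U> M"
  shows "\<exists>j i p \<delta>.
    j \<in> linear_map K (nat_space K E\<Lambda> H\<Lambda> I) (HM_cohomology K 0 \<Lambda>) \<and>
    (\<forall>n. i n \<in> linear_map K (Ext K E\<Lambda> n H\<Lambda> I) (HM_cohomology K n \<Lambda>)) \<and>
    (\<forall>n. p n \<in> linear_map K (HM_cohomology K n \<Lambda>) (HM_cohomology K n \<U>)) \<and>
    (\<forall>n. \<delta> n \<in> linear_map K (HM_cohomology K n \<U>) (Ext K E\<Lambda> (Suc n) H\<Lambda> I)) \<and>
    inj_on j (carrier (nat_space K E\<Lambda> H\<Lambda> I)) \<and>
    exact_at (nat_space K E\<Lambda> H\<Lambda> I) j (HM_cohomology K 0 \<Lambda>) (p 0) (HM_cohomology K 0 \<U>) \<and>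
    (\<forall>n. exact_at (Ext K E\<Lambda> n H\<Lambda> I) (i n) (HM_cohomology K n \<Lambda>) (p n) (HM_cohomology K n \<U>)) \<and>
    (\<forall>n. exact_at (HM_cohomology K n \<Lambda>) (p n) (HM_cohomology K n \<U>) (\<delta> n) (Ext K E\<Lambda> (Suc n) H\<Lambda> I)) \<and>
    (\<forall>n. exact_at (HM_cohomology K n \<U>) (\<delta> n) (Ext K E\<Lambda> (Suc n) H\<Lambda> I) (i (Suc n)) (HM_cohomology K (Suc n) \<Lambda>))"
proof -
  obtain P d \<epsilon> where P: "chosen_resolution K E\<Lambda> H\<Lambda> = (P, d)" "split_resolution E\<Lambda> H\<Lambda> P d \<epsilon>"
    by (rule chosen_resolution_split[OF E\<Lambda>_cat H\<Lambda>_fun])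
  obtain Q e \<zeta> where Q: "chosen_resolution K EU HU = (Q, e)" "split_resolution EU HU Q e \<zeta>"
    by (rule chosen_resolution_split[OF EU_cat HU_fun])
  have ext\<Lambda>: "Ext K E\<Lambda> n H\<Lambda> G = coh (hom_cx E\<Lambda> P G) (hom_d E\<Lambda> P d) n" for n G
    by (simp add: Ext_def P(1) hom_cohomology_eq_coh)
  have H\<Lambda>: "HM_cohomology K n \<Lambda> = coh (hom_cx E\<Lambda> P H\<Lambda>) (hom_d E\<Lambda> P d) n" for n
    by (simp add: HM_cohomology_def ext\<Lambda>)
  have HU: "HM_cohomology K n \<U> = coh (hom_cx EU Q HU) (hom_d EU Q e) n" for n
    by (simp add: HM_cohomology_def Ext_def Q(1) hom_cohomology_eq_coh)
  let ?N = "\<lambda>p. {f \<in> carrier (Hom \<Lambda> (fst p) (snd p)). snd (snd f) = \<zero>\<^bsub>Hom \<U> (snd (fst p)) (snd (snd p))\<^esub>}"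
  have N: "?N p = {x \<in> carrier (Val H\<Lambda> p). tri_proj_nat p x = \<zero>\<^bsub>Val RU p\<^esub>}" if "p \<in> Obj E\<Lambda>" for p
    unfolding Val_RU hom_bimodule_simps(1) using that by (auto simp: tri_proj_nat_def hom_bimodule_simps(1))
  note I = I_def[unfolded tri_ideal_eq]
  let ?EH = "coh (hom_cx E\<Lambda> P RU) (hom_d E\<Lambda> P d)"
  obtain j i p \<delta> where LES:
    "j \<in> linear_map K (nat_space K E\<Lambda> H\<Lambda> I) (HM_cohomology K 0 \<Lambda>)"
    "\<And>n. i n \<in> linear_map K (Ext K E\<Lambda> n H\<Lambda> I) (HM_cohomology K n \<Lambda>)"
    "\<And>n. p n \<in> linear_map K (HM_cohomology K n \<Lambda>) (?EH n)"
    "\<And>n. \<delta> n \<in> linear_map K (?EH n) (Ext K E\<Lambda> (Suc n) H\<Lambda> I)"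
    "inj_on j (carrier (nat_space K E\<Lambda> H\<Lambda> I))"
    "exact_at (nat_space K E\<Lambda> H\<Lambda> I) j (HM_cohomology K 0 \<Lambda>) (p 0) (?EH 0)"
    "\<And>n. exact_at (Ext K E\<Lambda> n H\<Lambda> I) (i n) (HM_cohomology K n \<Lambda>) (p n) (?EH n)"
    "\<And>n. exact_at (HM_cohomology K n \<Lambda>) (p n) (?EH n) (\<delta> n) (Ext K E\<Lambda> (Suc n) H\<Lambda> I)"
    "\<And>n. exact_at (?EH n) (\<delta> n) (Ext K E\<Lambda> (Suc n) H\<Lambda> I) (i (Suc n)) (HM_cohomology K (Suc n) \<Lambda>)"
    unfolding I ext\<Lambda> H\<Lambda>
    by (rule hom_long_exact_sequence[OF E\<Lambda>_cat H\<Lambda>_fun P(2) H\<Lambda>_fun RU_fun tri_proj_nat_closed tri_proj_nat_surj N], assumption, rule that[unfolded I ext\<Lambda> H\<Lambda>])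
  obtain \<theta> where \<theta>: "\<And>n. \<theta> n \<in> linear_map K (?EH n) (HM_cohomology K n \<U>)"
      "\<And>n. bij_betw (\<theta> n) (carrier (?EH n)) (carrier (HM_cohomology K n \<U>))"
    by (rule coh_RU_iso[OF P(2) Q(2)], rule that[unfolded HU])
  have m: "module K (?EH n)" "module K (HM_cohomology K n \<U>)" for n
    unfolding HU
    by (rule module_coh[OF cocomplex_hom[OF E\<Lambda>_cat H\<Lambda>_fun P(2) RU_fun]],
        rule module_coh[OF cocomplex_hom[OF EU_cat HU_fun Q(2) HU_fun]])
  \<comment> \<open>The cohomology with coefficients \<open>RU\<close> is exchanged for that of \<U>
    in all three positions: \<theta> is composed with \<open>p\<close>, and its inverse with
    \<delta>.\<close>
  note iso = exact_at_iso[OF m \<theta> LES(3) LES(4)]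
  show ?thesis
    using LES(1,2,5) linear_map_comp[OF LES(3) \<theta>(1)] linear_map_comp[OF linear_map_the_inv[OF m(1) \<theta>] LES(4)]
      LES(6)[folded iso(1)] LES(7)[folded iso(1)] LES(8)[folded iso(2)] LES(9)[folded iso(3)]
    by (intro exI[of _ j] exI[of _ i] exI[of _ "\<lambda>n x. \<theta> n (p n x)"]
        exI[of _ "\<lambda>n x. \<delta> n (the_inv_into (carrier (?EH n)) (\<theta> n) x)"]) simp
qed

end

theorem theorem5p4:
  fixes K :: "'k ring"
    and \<T> :: "('k, 'a, 'b) kcat"
    and \<U> :: "('k, 'c, 'd) kcat"
    and M :: "('k, 'c \<times> 'a, ('d \<times> 'b \<Rightarrow> 'k) set, 'e) kfun"
  assumes "field K"
    and "k_category K \<T>" and "Obj \<T> \<noteq> {}"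
    and "k_category K \<U>"
    and "k_functor K (tensor_cat K \<U> (op_cat \<T>)) M"
  defines "\<Lambda> \<equiv> tri_cat K \<T> \<U> M"
    and "\<I> \<equiv> tri_ideal K \<T> \<U> M"
  shows "\<exists>j i p \<delta>.
    j \<in> linear_map K (nat_space K (env_cat K \<Lambda>) (hom_bimodule K \<Lambda>) \<I>) (HM_cohomology K 0 \<Lambda>) \<and>
    (\<forall>n\<ge>1. i n \<in> linear_map K (Ext K (env_cat K \<Lambda>) n (hom_bimodule K \<Lambda>) \<I>) (HM_cohomology K n \<Lambda>)) \<and>
    (\<forall>n. p n \<in> linear_map K (HM_cohomology K n \<Lambda>) (HM_cohomology K n \<U>)) \<and>
    (\<forall>n. \<delta> n \<in> linear_map K (HM_cohomology K n \<U>)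
                 (Ext K (env_cat K \<Lambda>) (Suc n) (hom_bimodule K \<Lambda>) \<I>)) \<and>
    inj_on j (carrier (nat_space K (env_cat K \<Lambda>) (hom_bimodule K \<Lambda>) \<I>)) \<and>
    exact_at (nat_space K (env_cat K \<Lambda>) (hom_bimodule K \<Lambda>) \<I>) j
      (HM_cohomology K 0 \<Lambda>) (p 0) (HM_cohomology K 0 \<U>) \<and>
    (\<forall>n\<ge>1. exact_at (Ext K (env_cat K \<Lambda>) n (hom_bimodule K \<Lambda>) \<I>) (i n)
      (HM_cohomology K n \<Lambda>) (p n) (HM_cohomology K n \<U>)) \<and>
    (\<forall>n. exact_at (HM_cohomology K n \<Lambda>) (p n)
      (HM_cohomology K n \<U>) (\<delta> n) (Ext K (env_cat K \<Lambda>) (Suc n) (hom_bimodule K \<Lambda>) \<I>)) \<and>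
    (\<forall>n. exact_at (HM_cohomology K n \<U>) (\<delta> n)
      (Ext K (env_cat K \<Lambda>) (Suc n) (hom_bimodule K \<Lambda>) \<I>) (i (Suc n)) (HM_cohomology K (Suc n) \<Lambda>))"
proof -
  \<comment> \<open>Any object of \<T> will do; the choice does not enter the statement.\<close>
  obtain t0 where "t0 \<in> Obj \<T>" using assms(3) by blast
  then interpret triangular_pointed K \<T> \<U> M t0
    using assms(2,4,5) domain.axioms(1)[OF field.axioms(1)[OF assms(1)]]
    by (intro triangular_pointed.intro triangular.intro ground.intro triangular_axioms.intro
        triangular_pointed_axioms.intro)
  show ?thesis
    using Ext_long_exact_sequence unfolding \<Lambda>_def \<I>_def by blast
qed

end
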